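(* Let $d\ge 1$, let $\mathcal{O}\subset\mathbb{R}^d$ be a bounded domain and $H=L^2(\mathcal{O})$. Let $A:D(A)\subset H\to H$ be a self-adjoint negative operator, and let $\{e_k\}_{k\ge1}$ be an orthonormal basis of $H$ (of real-valued functions) with $e_k\in D(A)$ and $Ae_k=-\alpha_k e_k$ for all $k\ge 1$, where $0<\alpha_1\le\alpha_2\le\dots$ and $\alpha_k\uparrow\infty$. Assume further that there are a constant $M>0$ and an increasing sequence of positive numbers $\{c_k\}_{k\ge1}$ such that $|e_k(\xi)|\le Mc_k$ and $|\nabla e_k(\xi)|\le M\alpha_k^{1/2}c_k$ for all $\xi\in\mathcal{O}$, $k\ge1$. Let $\{\lambda_k\}_{k\ge1}$ be a sequence of positive constants. Let $K:\mathbb{R}\to[0,\infty)$ be continuous, not identically zero, symmetric, eventually decreasing to zero as $t\to\infty$, and completely monotone on $(0,\infty)$. Then the equation $$\dot u(t,\mathbf{x})=\int_{-\infty}^t K(t-s)\,A u(s,\mathbf{x})\,\mathrm{d}s+\mathbf{F}(t,\mathbf{x}),\qquad \mathbf{F}(t,\mathbf{x})=\sum_{k\ge1}\lambda_kF_k(t)e_k(\mathbf{x}),$$ where $\{F_k\}_{k\ge1}$ are i.i.d. stationary Gaussian processes with $\mathbb{E}[F_k(t)F_k(s)]=K(|t-s|)$, admits stationary solutions $u(t,\mathbf{x})$ (in the sense defined in the context) if and only if $$\sum_{k\ge1}\frac{\lambda_k^2}{\alpha_k}<\infty .$$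
   Context: Complete monotonicity: $K$ is completely monotone on $(0,\infty)$ if $K\in C^\infty(0,\infty)$ and $(-1)^nK^{(n)}(t)\ge0$ for all $n\ge0$, $t>0$. Notation. $\mathcal{S}$ is the Schwartz space on $\mathbb{R}$ and $\mathcal{S}'$ the tempered distributions. For a function $f$, $\widehat f(\omega)=\int_{\mathbb{R}}f(t)e^{-it\omega}\,\mathrm{d}t$; for $f\in\mathcal{S}'$, $\langle\mathcal{F}[f],\varphi\rangle=\langle f,\widehat\varphi\rangle$. $\widetilde f(x)=f(-x)$, $K^+(t)=K(t)1_{\{t\ge0\}}$, and $\delta_t$ is the Dirac distribution at $t$. $L^2(\Omega)$ is the space of complex-valued random variables with finite second moment on a probability space $\Omega$ (assumed rich enough to carry all objects considered). Operators associated with a measure. Let $\nu$ be a non-negative measure on $\mathbb{R}$, absolutely continuous with respect to Lebesgue measure, with $\int_{\mathbb{R}}(1+x^2)^{-m}\nu(\mathrm{d}x)<\infty$ for some integer $m$. An operator associated with $\nu$ is a linear map $V:\mathrm{Dom}(V)\subset\mathcal{S}'\to L^2(\Omega)$, where $\mathrm{Dom}(V)$ consists of those $f\in\mathcal{S}'$ such that $\mathcal{F}[f]$ is a function in $L^2(\nu)$, satisfying $\mathbb{E}\big[\langle V,f_1\rangle\overline{\langle V,f_2\rangle}\big]=\int_{\mathbb{R}}\mathcal{F}[f_1](y)\overline{\mathcal{F}[f_2](y)}\,\nu(\mathrm{d}y)$ for all $f_1,f_2\in\mathrm{Dom}(V)$. By convention all such operators are taken centered Gaussian, with the processes $t\mapsto\langle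 V,\delta_t\rangle$ real-valued. Weak stationary solution of the mode equation. The $k$-th mode equation is, formally, $\dot u_k(t)=-\alpha_k\int_{-\infty}^tK(t-s)u_k(s)\,\mathrm{d}s+\lambda_kF_k(t)$. An operator $V$ associated with a non-negative measure $\nu$ on $\mathbb{R}$ that is absolutely continuous with respect to Lebesgue measure and satisfies $\int_{\mathbb{R}}(1+x^2)^{-m}\nu(\mathrm{d}x)<\infty$ for some integer $m$ (that is, a centered Gaussian linear map $V:\mathrm{Dom}(V)\to L^2(\Omega)$ with $\mathrm{Dom}(V)=\{f\in\mathcal{S}':\mathcal{F}[f]\in L^2(\nu)\}$, with $t\mapsto\langle V,\delta_t\rangle$ real-valued, and with $\mathbb{E}\big[\langle V,f_1\rangle\overline{\langle V,f_2\rangle}\big]=\int_{\mathbb{R}}\mathcal{F}[f_1](y)\overline{\mathcal{F}[f_2](y)}\,\nu(\mathrm{d}y)$ for all $f_1,f_2\in\mathrm{Dom}(V)$) is a weak stationary solution of it if: (a) for all $\varphi\in\mathcal{S}$, $K^+*\varphi\in\mathrm{Dom}(V)$; and (b) for all $\varphi,\psi\in\mathcal{S}$, $$\mathbb{E}\Big[\big\langle V,-\varphi'+\alpha_k\widetilde{K^+*\widetilde\varphi}\big\rangle\overline{\big\langle V,-\psi'+\alpha_k\widetilde{K^+*\widetilde\psi}\big\rangle}\Big]=\lambda_k^2\,\mathbb{E}\big[\langle F_k,\varphi\rangle\overline{\langle F_k,\psi\rangle}\big],$$ where $\mathbb{E}\big[\langle F_k,\varphi\rangle\overline{\langle F_k,\psi\rangle}\big]=\int_{\mathbb{R}}K(t)\,(\varphi*\widetilde{\overline\psi})(t)\,\mathrm{d}t$.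 Stationary solution of the full equation. A random field $u(t,\mathbf{x})=\sum_{k\ge1}u_k(t)e_k(\mathbf{x})$, $(t,\mathbf{x})\in\mathbb{R}\times\mathcal{O}$, is a stationary solution if (a) for all $t\in\mathbb{R}$, $u(t,\cdot)\in L^2(\Omega;H)$, i.e. $\mathbb{E}\|u(t,\cdot)\|_H^2<\infty$; and (b) $u_k(t)=\langle V_k,\delta_t\rangle$, where $\{V_k\}_{k\ge1}$ are mutually independent and, for each $k$, $V_k$ is a weak stationary solution of the $k$-th mode equation.
   Formalization: In Dom(V), "F[f] is a function" allows a principal value at the origin instead of local integrability there; otherwise, for K(t)=1/ln(e+|t|), K^+*φ would leave Dom(V) for every ν and the "if" direction would fail. *)

theory Defs
  imports "HOL-Probability.Probability"
begin

definition vderiv :: "(real \<Rightarrow> 'b::real_normed_vector) \<Rightarrow> real \<Rightarrow> 'b" where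
  "vderiv f = (\<lambda>t. vector_derivative f (at t))"

text \<open>\<open>C\<^sup>\<infinity>\<close> on an open set \<open>S\<close>.\<close>
definition smooth_on :: "real set \<Rightarrow> (real \<Rightarrow> 'b::real_normed_vector) \<Rightarrow> bool" where
  "smooth_on S f \<longleftrightarrow> (\<forall>n. \<forall>t\<in>S. (vderiv ^^ n) f differentiable (at t))"

definition completely_monotone :: "(real \<Rightarrow> real) \<Rightarrow> bool" where
  "completely_monotone K \<longleftrightarrow>
     smooth_on {0<..} K \<and> (\<forall>n. \<forall>t>0. 0 \<le> (-1) ^ n * (vderiv ^^ n) K t)"

definition schwartz_space :: "(real \<Rightarrow> complex) set" where
  "schwartz_space = {\<phi>. smooth_on UNIV \<phi> \<and>
     (\<forall>m n. bdd_above (range (\<lambda>t. \<bar>t\<bar> ^ m * cmod ((vderiv ^^ n) \<phi> t))))}"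

definition schwartz_seminorm :: "nat \<Rightarrow> nat \<Rightarrow> (real \<Rightarrow> complex) \<Rightarrow> real" where
  "schwartz_seminorm m n \<phi> = (SUP t. \<bar>t\<bar> ^ m * cmod ((vderiv ^^ n) \<phi> t))"

definition schwartz_topology :: "(real \<Rightarrow> complex) topology" where
  "schwartz_topology = topology_generated_by
     {{\<psi> \<in> schwartz_space. schwartz_seminorm m n (\<lambda>t. \<psi> t - \<phi> t) < \<epsilon>} | \<phi> m n \<epsilon>.
        \<phi> \<in> schwartz_space \<and> 0 < \<epsilon>}"

definition test_functions :: "(real \<Rightarrow> complex) set" where
  "test_functions = {\<phi>. smooth_on UNIV \<phi> \<and> (\<exists>R. \<forall>t. R < \<bar>t\<bar> \<longrightarrow> \<phi> t = 0)}"

text \<open>A distribution is a functional on all functions that vanishes off the Schwartz space, so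
  that two distributions are equal iff they agree on Schwartz functions.\<close>
type_synonym distribution = "(real \<Rightarrow> complex) \<Rightarrow> complex"

definition tempered_distributions :: "distribution set" where
  "tempered_distributions = {T.
     (\<forall>\<phi>\<in>schwartz_space. \<forall>\<psi>\<in>schwartz_space. \<forall>a b.
        T (\<lambda>t. a * \<phi> t + b * \<psi> t) = a * T \<phi> + b * T \<psi>) \<and>
     continuous_map schwartz_topology euclidean T \<and>
     (\<forall>\<phi>. \<phi> \<notin> schwartz_space \<longrightarrow> T \<phi> = 0)}"

definition function_distribution :: "(real \<Rightarrow> complex) \<Rightarrow> distribution" where
  "function_distribution f =
     (\<lambda>\<phi>. if \<phi> \<in> schwartz_space then \<integral>t. f t * \<phi> t \<partial>lborel else 0)"

definition dirac :: "real \<Rightarrow> distribution" where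
  "dirac t = (\<lambda>\<phi>. if \<phi> \<in> schwartz_space then \<phi> t else 0)"

definition fourier :: "(real \<Rightarrow> complex) \<Rightarrow> real \<Rightarrow> complex" where
  "fourier f \<omega> = (\<integral>t. f t * exp (- (\<i> * complex_of_real (t * \<omega>))) \<partial>lborel)"

definition fourier_distribution :: "distribution \<Rightarrow> distribution" where
  "fourier_distribution T = (\<lambda>\<phi>. if \<phi> \<in> schwartz_space then T (fourier \<phi>) else 0)"

text \<open>\<open>T\<close> is the function \<open>g\<close>. If \<open>g\<close> is locally integrable this is the usual
  identification \<open>T(\<phi>) = \<integral> g \<phi>\<close> on test functions. The integral is read as a principal
  value at the origin because the Fourier transform of \<open>kernel_plus K\<close> has imaginary part of
  size about \<open>K(1/\<omega>) / \<omega>\<close> near \<open>0\<close>, which for slowly decaying \<open>K\<close>, such as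
  \<open>1 / ln (e + \<bar>t\<bar>)\<close>, is not absolutely integrable there. No point mass at the
  origin is hidden: the Dirac distribution is not a function in this sense.\<close>
definition is_function :: "distribution \<Rightarrow> (real \<Rightarrow> complex) \<Rightarrow> bool" where
  "is_function T g \<longleftrightarrow>
     g \<in> borel_measurable borel \<and>
     (\<forall>a b. 0 < a \<longrightarrow> set_integrable lborel {x. a \<le> \<bar>x\<bar> \<and> \<bar>x\<bar> \<le> b} g) \<and>
     (\<forall>\<phi>\<in>test_functions.
        ((\<lambda>\<epsilon>. LINT x:{x. \<epsilon> < \<bar>x\<bar>}|lborel. g x * \<phi> x) \<longlongrightarrow> T \<phi>) (at_right 0))"

definition convolution :: "(real \<Rightarrow> complex) \<Rightarrow> (real \<Rightarrow> complex) \<Rightarrow> real \<Rightarrow> complex" where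
  "convolution f g t = (\<integral>s. f s * g (t - s) \<partial>lborel)"

definition reflect :: "(real \<Rightarrow> complex) \<Rightarrow> real \<Rightarrow> complex" where
  "reflect f t = f (- t)"

definition kernel_plus :: "(real \<Rightarrow> real) \<Rightarrow> real \<Rightarrow> complex" where
  "kernel_plus K t = (if 0 \<le> t then complex_of_real (K t) else 0)"

text \<open>The point mass at \<open>0\<close> counts as a (degenerate) centered normal law.\<close>
definition centered_normal :: "'w measure \<Rightarrow> ('w \<Rightarrow> real) \<Rightarrow> bool" where
  "centered_normal M X \<longleftrightarrow> X \<in> borel_measurable M \<and>
     ((AE w in M. X w = 0) \<or> (\<exists>\<sigma>>0. distributed M lborel X (normal_density 0 \<sigma>)))"

text \<open>Joint Gaussianity of all real and imaginary parts: \<open>Re (c * z)\<close> is an arbitrary real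
  linear combination of \<open>Re z\<close> and \<open>Im z\<close>.\<close>
definition centered_gaussian :: "'w measure \<Rightarrow> 'i set \<Rightarrow> ('i \<Rightarrow> 'w \<Rightarrow> complex) \<Rightarrow> bool" where
  "centered_gaussian M I X \<longleftrightarrow>
     (\<forall>J c. finite J \<longrightarrow> J \<subseteq> I \<longrightarrow> centered_normal M (\<lambda>w. \<Sum>i\<in>J. Re (c i * X i w)))"

definition path_law :: "'w measure \<Rightarrow> (real \<Rightarrow> 'w \<Rightarrow> real) \<Rightarrow> (real \<Rightarrow> real) measure" where
  "path_law M X = distr M (Pi\<^sub>M UNIV (\<lambda>_. borel)) (\<lambda>w t. X t w)"

definition stationary_process :: "'w measure \<Rightarrow> (real \<Rightarrow> 'w \<Rightarrow> real) \<Rightarrow> bool" where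
  "stationary_process M X \<longleftrightarrow> (\<forall>h. path_law M (\<lambda>t. X (t + h)) = path_law M X)"

definition iid_gaussian_noise ::
  "'w measure \<Rightarrow> (real \<Rightarrow> real) \<Rightarrow> (nat \<Rightarrow> real \<Rightarrow> 'w \<Rightarrow> real) \<Rightarrow> bool" where
  "iid_gaussian_noise M K F \<longleftrightarrow>
     prob_space.indep_vars M (\<lambda>_. Pi\<^sub>M UNIV (\<lambda>_. borel)) (\<lambda>k w t. F k t w) UNIV \<and>
     (\<forall>j k. path_law M (F j) = path_law M (F k)) \<and>
     (\<forall>k. stationary_process M (F k)) \<and>
     (\<forall>k. centered_gaussian M UNIV (\<lambda>t w. complex_of_real (F k t w))) \<and>
     (\<forall>k t s. prob_space.expectation M (\<lambda>w. F k t w * F k s w) = K \<bar>t - s\<bar>)"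

definition spectral_measure :: "real measure \<Rightarrow> bool" where
  "spectral_measure \<nu> \<longleftrightarrow> sets \<nu> = sets borel \<and> absolutely_continuous lborel \<nu> \<and>
     (\<exists>m::int. (\<integral>\<^sup>+x. ennreal ((1 + x\<^sup>2) powi (- m)) \<partial>\<nu>) < \<infinity>)"

definition op_dom :: "real measure \<Rightarrow> distribution set" where
  "op_dom \<nu> = {f \<in> tempered_distributions.
     \<exists>g. is_function (fourier_distribution f) g \<and> integrable \<nu> (\<lambda>y. (cmod (g y))\<^sup>2)}"

text \<open>Elements of \<open>L\<^sup>2(\<Omega>)\<close> are represented by random variables, with equality almost
  everywhere; \<open>V f\<close> is irrelevant for \<open>f\<close> outside \<open>op_dom \<nu>\<close>. The function
  representing a distribution is unique Lebesgue-, hence \<open>\<nu>\<close>-, almost everywhere, so the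
  covariance identity may be required for every representative. Point evaluations are required
  to be real only where they are defined, since the total mass of \<open>\<nu>\<close> may be infinite.\<close>
definition associated_operator ::
  "'w measure \<Rightarrow> real measure \<Rightarrow> (distribution \<Rightarrow> 'w \<Rightarrow> complex) \<Rightarrow> bool" where
  "associated_operator M \<nu> V \<longleftrightarrow>
     spectral_measure \<nu> \<and>
     (\<forall>f\<in>op_dom \<nu>. V f \<in> borel_measurable M \<and> integrable M (\<lambda>w. (cmod (V f w))\<^sup>2)) \<and>
     (\<forall>f1\<in>op_dom \<nu>. \<forall>f2\<in>op_dom \<nu>. \<forall>a b.
        AE w in M. V (\<lambda>\<phi>. a * f1 \<phi> + b * f2 \<phi>) w = a * V f1 w + b * V f2 w) \<and>
     (\<forall>f1\<in>op_dom \<nu>. \<forall>f2\<in>op_dom \<nu>. \<forall>g1 g2.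
        is_function (fourier_distribution f1) g1 \<longrightarrow>
        is_function (fourier_distribution f2) g2 \<longrightarrow>
        (\<integral>w. V f1 w * cnj (V f2 w) \<partial>M) = (\<integral>y. g1 y * cnj (g2 y) \<partial>\<nu>)) \<and>
     centered_gaussian M (op_dom \<nu>) V \<and>
     (\<forall>t. dirac t \<in> op_dom \<nu> \<longrightarrow> (AE w in M. Im (V (dirac t) w) = 0))"

text \<open>\<open>E [\<langle>F\<^sub>k, \<phi>\<rangle> * cnj \<langle>F\<^sub>k, \<psi>\<rangle>]\<close> for a stationary noise \<open>F\<^sub>k\<close> with covariance \<open>K\<close>.\<close>
definition noise_covariance ::
  "(real \<Rightarrow> real) \<Rightarrow> (real \<Rightarrow> complex) \<Rightarrow> (real \<Rightarrow> complex) \<Rightarrow> complex" where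
  "noise_covariance K \<phi> \<psi> =
     (\<integral>t. complex_of_real (K t) * convolution \<phi> (reflect (\<lambda>s. cnj (\<psi> s))) t \<partial>lborel)"

text \<open>\<open>\<langle>u, adjoint_drift K a \<phi>\<rangle>\<close> is the pairing of \<open>u'(t) + a * \<integral>\<^sub>-\<^sub>\<infinity>\<^sup>t K(t - s) u(s) ds\<close>
  with \<open>\<phi>\<close> after moving the operations to \<open>\<phi>\<close>.\<close>
definition adjoint_drift ::
  "(real \<Rightarrow> real) \<Rightarrow> real \<Rightarrow> (real \<Rightarrow> complex) \<Rightarrow> distribution" where
  "adjoint_drift K a \<phi> = function_distribution
     (\<lambda>t. - vderiv \<phi> t
           + complex_of_real a * reflect (convolution (kernel_plus K) (reflect \<phi>)) t)"

text \<open>That \<open>adjoint_drift K a \<phi>\<close> lies in the domain is what gives the final identity a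
  meaning.\<close>
definition weak_stationary_solution ::
  "'w measure \<Rightarrow> (real \<Rightarrow> real) \<Rightarrow> real \<Rightarrow> real \<Rightarrow>
   real measure \<Rightarrow> (distribution \<Rightarrow> 'w \<Rightarrow> complex) \<Rightarrow> bool" where
  "weak_stationary_solution M K a l \<nu> V \<longleftrightarrow>
     associated_operator M \<nu> V \<and>
     (\<forall>\<phi>\<in>schwartz_space.
        function_distribution (convolution (kernel_plus K) \<phi>) \<in> op_dom \<nu>) \<and>
     (\<forall>\<phi>\<in>schwartz_space. adjoint_drift K a \<phi> \<in> op_dom \<nu>) \<and>
     (\<forall>\<phi>\<in>schwartz_space. \<forall>\<psi>\<in>schwartz_space.
        (\<integral>w. V (adjoint_drift K a \<phi>) w * cnj (V (adjoint_drift K a \<psi>) w) \<partial>M)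
          = complex_of_real (l\<^sup>2) * noise_covariance K \<phi> \<psi>)"

text \<open>\<open>L\<^sup>2(\<O>)\<close>, complex-valued; its elements are functions up to equality almost everywhere on
  \<open>\<O>\<close>.\<close>
definition L2 :: "'a::euclidean_space set \<Rightarrow> ('a \<Rightarrow> complex) set" where
  "L2 \<O> = {f \<in> borel_measurable (lebesgue_on \<O>).
     integrable (lebesgue_on \<O>) (\<lambda>x. (cmod (f x))\<^sup>2)}"

definition L2_inner ::
  "'a::euclidean_space set \<Rightarrow> ('a \<Rightarrow> complex) \<Rightarrow> ('a \<Rightarrow> complex) \<Rightarrow> complex" where
  "L2_inner \<O> f g = (\<integral>x. f x * cnj (g x) \<partial>lebesgue_on \<O>)"

definition L2_norm :: "'a::euclidean_space set \<Rightarrow> ('a \<Rightarrow> complex) \<Rightarrow> real" where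
  "L2_norm \<O> f = sqrt (\<integral>x. (cmod (f x))\<^sup>2 \<partial>lebesgue_on \<O>)"

definition L2_orthonormal_basis ::
  "'a::euclidean_space set \<Rightarrow> (nat \<Rightarrow> 'a \<Rightarrow> complex) \<Rightarrow> bool" where
  "L2_orthonormal_basis \<O> b \<longleftrightarrow>
     (\<forall>k. b k \<in> L2 \<O>) \<and>
     (\<forall>j k. L2_inner \<O> (b j) (b k) = (if j = k then 1 else 0)) \<and>
     (\<forall>f\<in>L2 \<O>. (\<lambda>n. L2_norm \<O> (\<lambda>x. f x - (\<Sum>k<n. L2_inner \<O> f (b k) * b k x)))
                  \<longlonglongrightarrow> 0)"

text \<open>A linear operator \<open>A\<close> on \<open>L\<^sup>2(\<O>)\<close> with domain \<open>D\<close>, both compatible with equality almost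
  everywhere.\<close>
definition L2_operator ::
  "'a::euclidean_space set \<Rightarrow> ('a \<Rightarrow> complex) set \<Rightarrow>
   (('a \<Rightarrow> complex) \<Rightarrow> 'a \<Rightarrow> complex) \<Rightarrow> bool" where
  "L2_operator \<O> D A \<longleftrightarrow>
     D \<subseteq> L2 \<O> \<and> D \<noteq> {} \<and> (\<forall>f\<in>D. A f \<in> L2 \<O>) \<and>
     (\<forall>f\<in>D. \<forall>g\<in>L2 \<O>. (AE x in lebesgue_on \<O>. f x = g x) \<longrightarrow>
        g \<in> D \<and> (AE x in lebesgue_on \<O>. A f x = A g x)) \<and>
     (\<forall>f\<in>D. \<forall>g\<in>D. \<forall>a b. (\<lambda>x. a * f x + b * g x) \<in> D \<and>
        (AE x in lebesgue_on \<O>. A (\<lambda>x. a * f x + b * g x) x = a * A f x + b * A g x))"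

text \<open>Densely defined and equal to its adjoint, domains included.\<close>
definition L2_self_adjoint ::
  "'a::euclidean_space set \<Rightarrow> ('a \<Rightarrow> complex) set \<Rightarrow>
   (('a \<Rightarrow> complex) \<Rightarrow> 'a \<Rightarrow> complex) \<Rightarrow> bool" where
  "L2_self_adjoint \<O> D A \<longleftrightarrow>
     L2_operator \<O> D A \<and>
     (\<forall>f\<in>L2 \<O>. \<forall>\<epsilon>>0. \<exists>g\<in>D. L2_norm \<O> (\<lambda>x. f x - g x) < \<epsilon>) \<and>
     (\<forall>g\<in>L2 \<O>. \<forall>h\<in>L2 \<O>.
        (\<forall>f\<in>D. L2_inner \<O> (A f) g = L2_inner \<O> f h) \<longleftrightarrow>
        g \<in> D \<and> (AE x in lebesgue_on \<O>. A g x = h x))"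

definition L2_negative ::
  "'a::euclidean_space set \<Rightarrow> ('a \<Rightarrow> complex) set \<Rightarrow>
   (('a \<Rightarrow> complex) \<Rightarrow> 'a \<Rightarrow> complex) \<Rightarrow> bool" where
  "L2_negative \<O> D A \<longleftrightarrow> (\<forall>f\<in>D. Re (L2_inner \<O> (A f) f) \<le> 0)"

text \<open>A random field \<open>u t w x\<close> that is a stationary solution; modes are indexed from \<open>0\<close>. The
  series for \<open>u t\<close> converges in \<open>L\<^sup>2(\<O>)\<close>, almost surely for each \<open>t\<close>. The conditions
  \<open>dirac t \<in> op_dom (\<nu> k)\<close> are what gives \<open>u\<^sub>k(t) = \<langle>V\<^sub>k, \<delta>\<^sub>t\<rangle>\<close> a meaning.\<close>
definition stationary_solution ::
  "'w measure \<Rightarrow> 'a::euclidean_space set \<Rightarrow> (real \<Rightarrow> real) \<Rightarrow> (nat \<Rightarrow> real) \<Rightarrow>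
   (nat \<Rightarrow> real) \<Rightarrow> (nat \<Rightarrow> 'a \<Rightarrow> real) \<Rightarrow> (real \<Rightarrow> 'w \<Rightarrow> 'a \<Rightarrow> complex) \<Rightarrow> bool" where
  "stationary_solution M \<O> K \<alpha> lam e u \<longleftrightarrow>
     (\<exists>\<nu> V.
        (\<forall>k. weak_stationary_solution M K (\<alpha> k) (lam k) (\<nu> k) (V k)) \<and>
        prob_space.indep_vars M (\<lambda>k. Pi\<^sub>M (op_dom (\<nu> k)) (\<lambda>_. borel))
          (\<lambda>k w. \<lambda>f\<in>op_dom (\<nu> k). V k f w) UNIV \<and>
        (\<forall>k t. dirac t \<in> op_dom (\<nu> k)) \<and>
        (\<forall>t. AE w in M. u t w \<in> L2 \<O> \<and>
           (\<lambda>n. L2_norm \<O> (\<lambda>x. u t w x - (\<Sum>k<n. V k (dirac t) w * complex_of_real (e k x))))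
             \<longlonglongrightarrow> 0)) \<and>
     (\<forall>t. (\<lambda>(w, x). u t w x) \<in> borel_measurable (M \<Otimes>\<^sub>M lebesgue_on \<O>) \<and>
        (\<integral>\<^sup>+w. \<integral>\<^sup>+x. ennreal ((cmod (u t w x))\<^sup>2) \<partial>lebesgue_on \<O> \<partial>M) < \<infinity>)"

end

theory Submission imports Defs "HOL-Complex_Analysis.Complex_Analysis" begin

text \<open>A completely monotone kernel is a mixture \<open>K t = \<integral> K'' s * max 0 (s - \<bar>t\<bar>) ds\<close> of triangles,
  so its Laplace transform \<open>k\<close> extends to the imaginary axis, where its real part is \<open>\<pi>\<close> times
  the spectral density \<open>\<kappa>\<close> of the noise. In Fourier space the \<open>k\<close>-th mode equation is
  multiplication by \<open>m \<omega> = \<i> \<omega> + \<alpha>\<^sub>k k (\<i> \<omega>)\<close>, which forces the spectral measure to be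
  \<open>\<lambda>\<^sub>k\<^sup>2 \<kappa> / \<bar>m\<bar>\<^sup>2 d\<omega>\<close>. Since \<open>\<alpha>\<^sub>k \<pi> \<kappa> / \<bar>m\<bar>\<^sup>2 = Re (1 / m)\<close>, and \<open>1 / (z + \<alpha>\<^sub>k k z)\<close> behaves
  like \<open>1 / z\<close> at infinity in the right half plane, Cauchy's theorem gives this measure the total mass
  \<open>\<lambda>\<^sub>k\<^sup>2 / \<alpha>\<^sub>k\<close>, which is the variance of \<open>u\<^sub>k(t)\<close>. The random series \<open>\<Sum> u\<^sub>k(t) e\<^sub>k\<close> with
  orthonormal \<open>e\<^sub>k\<close> has a finite second moment iff the sum of these variances is finite. The modes
  exist as isonormal processes on \<open>L\<^sup>2(\<nu>\<^sub>k)\<close>, driven by independent normal variables that are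
  taken from the noise at time \<open>0\<close>.\<close>

section \<open>Mixtures of triangles\<close>

text \<open>\<open>K\<close> tends to zero but may fail to be integrable, and then the transform of
  \<open>kernel_plus K\<close> may fail to be integrable at the origin. The moment of the weight
  \<open>K''\<close> that is always finite is \<open>\<integral> s * K'' s ds = K 0\<close>, so the
  estimates for \<open>k\<close> are arranged to be linear in the width \<open>s\<close> of a
  triangle. Two places need more. The symbol of the drift is identified as a principal value: the
  symmetric cut-off pairs \<open>x\<close> with \<open>- x\<close>, where the transform takes
  conjugate values; its real part \<open>pi * kappa\<close> is integrable, and its odd imaginary
  part only meets the odd part of the test function. Cauchy's theorem is applied on a line
  \<open>Re z = \<sigma>\<close> with \<open>\<sigma> > 0\<close>, and the limit
  \<open>\<sigma> \<rightarrow> 0\<close> needs a majorant of \<open>1 / (z + a * k z)\<close> up to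
  the axis. That majorant comes from a lower bound of \<open>Re (k z)\<close>, which is why a lower
  bound of \<open>K''\<close> near the origin is among the assumptions on the kernel. For necessity
  of the summability condition it is enough to recover the total mass of each spectral measure from
  the weak equation.\<close>

lemma one_minus_cos_le: "1 - cos x \<le> x\<^sup>2 / 2" for x :: real
proof -
  have "\<bar>sin (x/2)\<bar> \<le> \<bar>x/2\<bar>" by (rule abs_sin_x_le_abs_x)
  then have "(sin (x/2))\<^sup>2 \<le> (x/2)\<^sup>2" by (subst abs_le_square_iff[symmetric])
  moreover have "1 - cos x = 2 * (sin (x/2))\<^sup>2"
    using cos_double_sin[of "x/2"] by simp
  ultimately show ?thesis by (simp add: power_divide)
qed

text \<open>Integration by parts: \<open>Si x - (1 - cos x) / x\<close> is an antiderivative whose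
  second term vanishes at both ends, so the value is the Dirichlet integral. Nonnegativity of the
  integrand yields integrability at the same time.\<close>

lemma has_bochner_integral_one_minus_cos_half:
  "has_bochner_integral lborel (\<lambda>x::real. indicator {0..} x *\<^sub>R ((1 - cos x) / x\<^sup>2)) (pi / 2)"
proof -
  let ?F = "\<lambda>x. Si x - (1 - cos x) / x"
  have d: "DERIV ?F x :> (1 - cos x) / x\<^sup>2" if "0 < x" for x
  proof -
    have "DERIV ?F x :> sinc x - (sin x * x - (1 - cos x) * 1) / (x * x)"
      using that by (intro DERIV_diff DERIV_Si) (auto intro!: derivative_eq_intros)
    moreover have "sinc x - (sin x * x - (1 - cos x) * 1) / (x * x) = (1 - cos x) / x\<^sup>2"
      using that by (simp add: field_simps power2_eq_square)
    ultimately show ?thesis by simp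
  qed
  have bd: "\<bar>(1 - cos x) / x\<bar> \<le> \<bar>x\<bar>" for x :: real
  proof (cases "x = 0")
    case False
    have "\<bar>1 - cos x\<bar> \<le> x\<^sup>2" using one_minus_cos_le[of x] cos_le_one[of x] zero_le_power2[of x] by linarith
    with False show ?thesis by (simp add: abs_divide divide_le_eq power2_eq_square abs_mult)
  qed simp
  have A: "(?F \<longlongrightarrow> 0) (at_right 0)"
  proof -
    have "(Si \<longlongrightarrow> Si 0) (at_right 0)"
      using isCont_Si[of 0] unfolding isCont_def by (rule tendsto_within_subset) simp
    moreover have "Si 0 = 0" by (simp add: Si_def zero_ereal_def[symmetric])
    moreover have "((\<lambda>x. (1 - cos x) / x) \<longlongrightarrow> (0::real)) (at_right 0)"
    proof (rule tendsto_rabs_zero_cancel, rule tendsto_sandwich[of "\<lambda>_. 0" _ _ "\<lambda>x. \<bar>x\<bar>"])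
      show "((\<lambda>x::real. \<bar>x\<bar>) \<longlongrightarrow> 0) (at_right 0)" by (rule tendsto_eq_intros refl | simp)+
    qed (use bd in auto)
    ultimately show ?thesis using tendsto_diff by fastforce
  qed
  have B: "(?F \<longlongrightarrow> pi/2) at_top"
  proof -
    have "((\<lambda>x. (1 - cos x) / x) \<longlongrightarrow> (0::real)) at_top" by real_asymp
    from tendsto_diff[OF Si_at_top this] show ?thesis by simp
  qed
  have int: "set_integrable lborel (einterval 0 \<infinity>) (\<lambda>x. (1 - cos x) / x\<^sup>2)"
       "(LBINT x=0..\<infinity>. (1 - cos x) / x\<^sup>2) = pi/2 - 0"
  proof -
    show "set_integrable lborel (einterval 0 \<infinity>) (\<lambda>x. (1 - cos x) / x\<^sup>2)"
      by (rule interval_integral_FTC_nonneg(1)[where F="?F" and A=0 and B="pi/2"])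
         (use d A B in \<open>auto intro!: continuous_intros simp: zero_ereal_def ereal_tendsto_simps1 ereal_tendsto_simps\<close>)
    show "(LBINT x=0..\<infinity>. (1 - cos x) / x\<^sup>2) = pi/2 - 0"
      by (rule interval_integral_FTC_nonneg(2)[where F="?F" and A=0 and B="pi/2"])
         (use d A B in \<open>auto intro!: continuous_intros simp: zero_ereal_def ereal_tendsto_simps1 ereal_tendsto_simps\<close>)
  qed
  have ei: "einterval 0 \<infinity> = {0::real<..}" by (auto simp: einterval_def zero_ereal_def)
  have "has_bochner_integral lborel (\<lambda>x::real. indicator {0<..} x *\<^sub>R ((1 - cos x) / x\<^sup>2)) (pi / 2)"
    using int by (auto simp: has_bochner_integral_iff ei set_integrable_def interval_lebesgue_integral_def
        set_lebesgue_integral_def zero_ereal_def)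
  moreover have "(\<lambda>x::real. indicator {0<..} x *\<^sub>R ((1 - cos x) / x\<^sup>2)) = (\<lambda>x::real. indicator {0..} x *\<^sub>R ((1 - cos x) / x\<^sup>2))"
    by (auto simp: indicator_def fun_eq_iff)
  ultimately show ?thesis by simp
qed

text \<open>Evenness doubles the half-line value, and the substitution
  \<open>x \<mapsto> a * x\<close> contributes the factor
  \<open>a\<^sup>2 / \<bar>a\<bar>\<close>.\<close>

lemma has_bochner_integral_one_minus_cos:
  "has_bochner_integral lborel (\<lambda>x::real. (1 - cos (a * x)) / x\<^sup>2) (pi * \<bar>a\<bar>)"
proof (cases "a = 0")
  case False
  have "has_bochner_integral lborel (\<lambda>x::real. (1 - cos x) / x\<^sup>2) (2 *\<^sub>R (pi / 2))"
    by (rule has_bochner_integral_even_function[OF has_bochner_integral_one_minus_cos_half]) simp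
  then have "has_bochner_integral lborel (\<lambda>x::real. (1 - cos (0 + a * x)) / (0 + a * x)\<^sup>2) (pi /\<^sub>R \<bar>a\<bar>)"
    using lborel_has_bochner_integral_real_affine_iff[OF False, of "\<lambda>x. (1 - cos x) / x\<^sup>2" pi 0] by simp
  then have "has_bochner_integral lborel (\<lambda>x::real. a\<^sup>2 * ((1 - cos (0 + a * x)) / (0 + a * x)\<^sup>2)) (a\<^sup>2 * (pi /\<^sub>R \<bar>a\<bar>))"
    by (rule has_bochner_integral_mult_right)
  moreover have "a\<^sup>2 * (pi /\<^sub>R \<bar>a\<bar>) = pi * \<bar>a\<bar>"
    using False by (cases "a > 0") (auto simp: power2_eq_square field_simps)
  moreover have "(\<lambda>x. a\<^sup>2 * ((1 - cos (0 + a * x)) / (0 + a * x)\<^sup>2)) = (\<lambda>x. (1 - cos (a * x)) / x\<^sup>2)"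
    using False by (simp add: power_mult_distrib)
  ultimately show ?thesis by (simp only:)
qed (simp add: has_bochner_integral_zero)

text \<open>The integrand is a combination of \<open>1 - cos (c * x)\<close> for
  \<open>c = s + t\<close>, \<open>s - t\<close> and \<open>t\<close>, so its integral is the same
  combination of the absolute values \<open>\<bar>c\<bar>\<close>. That second difference is the
  triangle.\<close>

lemma has_bochner_integral_triangle_transform:
  assumes "0 \<le> s"
  shows "has_bochner_integral lborel (\<lambda>x::real. (1 - cos (s * x)) / x\<^sup>2 * cos (t * x)) (pi * max 0 (s - \<bar>t\<bar>))"
proof -
  let ?g = "\<lambda>a x::real. (1 - cos (a * x)) / x\<^sup>2"
  have "has_bochner_integral lborel (\<lambda>x. ?g (s+t) x / 2 + ?g (s-t) x / 2 - ?g t x)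
      (pi * \<bar>s+t\<bar> / 2 + pi * \<bar>s-t\<bar>/2 - pi * \<bar>t\<bar>)"
    by (intro has_bochner_integral_diff has_bochner_integral_add has_bochner_integral_divide
        has_bochner_integral_one_minus_cos)
  moreover have "?g (s+t) x / 2 + ?g (s-t) x / 2 - ?g t x = (1 - cos (s * x)) / x\<^sup>2 * cos (t * x)" for x
  proof -
    have "cos ((s+t)*x) + cos ((s-t)*x) = 2 * (cos (s*x) * cos (t*x))"
      by (simp add: cos_add cos_diff algebra_simps)
    then have "(1 - cos ((s+t)*x)) / 2 + (1 - cos ((s-t)*x))/2 - (1 - cos (t*x)) = (1 - cos (s * x)) * cos (t*x)"
      by (simp only: left_diff_distrib) (simp add: field_simps)
    then have "((1 - cos ((s+t)*x)) / 2 + (1 - cos ((s-t)*x))/2 - (1 - cos (t*x))) / x\<^sup>2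
        = (1 - cos (s * x)) * cos (t*x) / x\<^sup>2" by simp
    moreover have "?g (s+t) x / 2 + ?g (s-t) x / 2 - ?g t x
        = ((1 - cos ((s+t)*x)) / 2 + (1 - cos ((s-t)*x))/2 - (1 - cos (t*x))) / x\<^sup>2"
      by (simp add: add_divide_distrib diff_divide_distrib mult.commute)
    ultimately show ?thesis by (simp only: times_divide_eq_left)
  qed
  moreover have "pi * \<bar>s+t\<bar> / 2 + pi * \<bar>s-t\<bar>/2 - pi * \<bar>t\<bar> = pi * max 0 (s - \<bar>t\<bar>)"
  proof -
    have "\<bar>s+t\<bar> / 2 + \<bar>s-t\<bar>/2 - \<bar>t\<bar> = max 0 (s - \<bar>t\<bar>)" using assms by (auto simp: max_def abs_if field_simps)
    then have "pi * (\<bar>s+t\<bar> / 2 + \<bar>s-t\<bar>/2 - \<bar>t\<bar>) = pi * max 0 (s - \<bar>t\<bar>)" by simp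
    then show ?thesis by (simp add: algebra_simps)
  qed
  ultimately show ?thesis by simp
qed

section \<open>Exponential estimates and the Laplace transform of one triangle\<close>

lemma norm_exp_diff_le:
  assumes "0 \<le> Re z" "0 \<le> Re w" "0 \<le> s"
  shows "cmod (exp (- (z * of_real s)) - exp (- (w * of_real s))) \<le> s * cmod (z - w)"
proof (rule field_differentiable_bound[of "{z. 0 \<le> Re z}" _ "\<lambda>z. - of_real s * exp (- (z * of_real s))"])
  show "convex {z. 0 \<le> Re z}" by (rule convex_halfspace_Re_ge)
  fix u :: complex assume u: "u \<in> {z. 0 \<le> Re z}"
  show "((\<lambda>z. exp (- (z * complex_of_real s))) has_field_derivative - complex_of_real s * exp (- (u * complex_of_real s))) (at u within {z. 0 \<le> Re z})"
    by (auto intro!: derivative_eq_intros)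
  have "exp (- (Re u * s)) \<le> 1" using u assms by simp
  then show "cmod (- complex_of_real s * exp (- (u * complex_of_real s))) \<le> s"
    using assms by (simp add: norm_mult mult_left_le)
qed (use assms in auto)

text \<open>The Laplace transform at \<open>z\<close> of the triangle \<open>max 0 (s - t)\<close>.\<close>
definition tri :: "real \<Rightarrow> complex \<Rightarrow> complex" where
  "tri s z = of_real s / z - (1 - exp (- (z * of_real s))) / z\<^sup>2"

lemma norm_one_minus_exp_le:
  assumes "0 \<le> Re z" "0 \<le> s"
  shows "cmod (1 - exp (- (z * of_real s))) \<le> s * cmod z"
  using norm_exp_diff_le[of 0 z s] assms by simp

text \<open>Both terms of \<open>tri\<close> are of size \<open>s / \<bar>z\<bar>\<close>. The
  growth in \<open>s\<close> is linear because \<open>s * w s\<close> will be the integrable moment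
  of the mixing weight.\<close>

lemma norm_tri_le:
  assumes "0 \<le> Re z" "0 \<le> s"
  shows "cmod (tri s z) \<le> 2 * s / cmod z"
proof (cases "z = 0")
  case False
  have "cmod (tri s z) \<le> cmod (of_real s / z) + cmod ((1 - exp (- (z * of_real s))) / z\<^sup>2)"
    unfolding tri_def by (rule norm_triangle_ineq4)
  also have "\<dots> \<le> s / cmod z + s * cmod z / (cmod z)\<^sup>2"
    using norm_one_minus_exp_le[OF assms] assms by (auto simp: norm_divide norm_power intro!: divide_right_mono)
  also have "\<dots> = 2 * s / cmod z" using False by (simp add: power2_eq_square)
  finally show ?thesis .
qed (simp add: tri_def)

text \<open>The term \<open>s / z\<close> is purely imaginary on the axis. What remains is the
  kernel whose cosine transform is the symmetric triangle; at \<open>x = 0\<close> both sides are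
  zero by the convention for division.\<close>

lemma Re_tri_axis: "Re (tri s (\<i> * of_real x)) = (1 - cos (s * x)) / x\<^sup>2"
proof (cases "x = 0")
  case False
  have "(\<i> * complex_of_real x)\<^sup>2 = of_real (- x\<^sup>2)" by (simp add: power_mult_distrib)
  then have "tri s (\<i> * of_real x) = of_real s / (\<i> * of_real x) + (1 - exp (- (\<i> * of_real (x * s)))) / of_real (x\<^sup>2)"
    unfolding tri_def by (simp add: mult.assoc)
  moreover have "Re (of_real s / (\<i> * of_real x)) = 0" by (simp add: Re_divide)
  moreover have "Re ((1 - exp (- (\<i> * of_real (x * s)))) / of_real (x\<^sup>2)) = (1 - cos (s * x)) / x\<^sup>2"
    unfolding Re_divide_of_real by (simp add: Re_exp mult.commute)
  ultimately show ?thesis by simp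
qed (simp add: tri_def)

lemma tri_cnj: "tri s (cnj z) = cnj (tri s z)"
  by (simp add: tri_def exp_cnj)

text \<open>Monotonicity in \<open>s\<close> of the difference of the two sides, and of its derivative,
  reduces the estimate to the trivial case \<open>s = 0\<close>.\<close>
lemma Re_tri_ge:
  assumes z: "z = Complex \<sigma> \<omega>" and "\<omega> \<noteq> 0" "0 \<le> \<sigma>" "0 \<le> s"
  shows "exp (- (\<sigma> * s)) * (1 - cos (\<omega> * s)) / \<omega>\<^sup>2 \<le> Re (tri s z)"
proof -
  define B where "B = (\<lambda>s. exp (- (\<sigma> * s)) * (1 - cos (\<omega> * s)) / \<omega>\<^sup>2)"
  define B' where "B' = (\<lambda>s. exp (- (\<sigma> * s)) * sin (\<omega> * s) / \<omega> - \<sigma> * B s)"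
  have B: "(B has_real_derivative B' s) (at s)" for s
    unfolding B_def B'_def using \<open>\<omega> \<noteq> 0\<close>
    by (auto intro!: derivative_eq_intros simp: field_simps power2_eq_square)
  have B0: "0 \<le> B s" for s unfolding B_def by simp
  have z0: "z \<noteq> 0" using assms by (auto simp: complex_eq_iff)
  define P where "P = (\<lambda>s. Re ((1 - exp (- (z * of_real s))) / z))"
  have dT: "((\<lambda>s. tri s z) has_vector_derivative (1 - exp (- (z * of_real s))) / z) (at s)" for s
    unfolding tri_def using z0
    by (auto intro!: derivative_eq_intros has_vector_derivative_real_field
        simp: field_simps power2_eq_square scaleR_conv_of_real)
  have Tri: "((\<lambda>s. Re (tri s z)) has_real_derivative P s) (at s)" for s
    using bounded_linear.has_vector_derivative[OF bounded_linear_Re dT[of s]]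
    by (simp add: P_def has_real_derivative_iff_has_vector_derivative)
  have dP: "((\<lambda>s. (1 - exp (- (z * of_real s))) / z) has_vector_derivative exp (- (z * of_real s))) (at s)" for s
    using z0
    by (auto intro!: derivative_eq_intros has_vector_derivative_real_field
        simp: field_simps power2_eq_square scaleR_conv_of_real)
  have P: "(P has_real_derivative exp (- (\<sigma> * s)) * cos (\<omega> * s)) (at s)" for s
    using bounded_linear.has_vector_derivative[OF bounded_linear_Re dP[of s]]
    by (simp add: P_def has_real_derivative_iff_has_vector_derivative z Re_exp)
  \<comment> \<open>\<open>P - B'\<close> equals \<open>Q + 2 * \<sigma> * B\<close>. Removing this
    multiple of \<open>B\<close> makes the oscillating terms cancel in the derivative of
    \<open>Q\<close>, which is then \<open>\<sigma>\<^sup>2 * B\<close> and so nonnegative.\<close>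
  define Q where "Q = (\<lambda>s. P s - exp (- (\<sigma> * s)) * sin (\<omega> * s) / \<omega> - \<sigma> * B s)"
  have dQ: "(Q has_real_derivative \<sigma>\<^sup>2 * B s) (at s)" for s
  proof -
    have "((\<lambda>s. exp (- (\<sigma> * s)) * sin (\<omega> * s) / \<omega>) has_real_derivative
        exp (- (\<sigma> * s)) * cos (\<omega> * s) - \<sigma> * (exp (- (\<sigma> * s)) * sin (\<omega> * s) / \<omega>)) (at s)"
      using \<open>\<omega> \<noteq> 0\<close> by (auto intro!: derivative_eq_intros simp: field_simps)
    from DERIV_diff[OF DERIV_diff[OF P this] DERIV_cmult[OF B, of \<sigma>]]
    show ?thesis unfolding Q_def
      by (rule DERIV_cong) (simp add: B'_def algebra_simps power2_eq_square)
  qed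
  have Q0: "0 \<le> Q s" if "0 \<le> s" for s
  proof -
    have "Q 0 \<le> Q s" using that by (rule DERIV_nonneg_imp_nondecreasing) (use dQ B0 in force)
    then show ?thesis by (simp add: Q_def P_def B_def)
  qed
  have "Re (tri 0 z) - B 0 \<le> Re (tri s z) - B s" using \<open>0 \<le> s\<close>
  proof (rule DERIV_nonneg_imp_nondecreasing)
    fix x assume x: "0 \<le> x" "x \<le> s"
    have "((\<lambda>s. Re (tri s z) - B s) has_real_derivative P x - B' x) (at x)"
      by (intro DERIV_diff Tri B)
    moreover have "0 \<le> P x - B' x"
      using Q0[OF x(1)] mult_nonneg_nonneg[OF \<open>0 \<le> \<sigma>\<close> B0[of x]] unfolding Q_def B'_def by linarith
    ultimately show "\<exists>y. ((\<lambda>s. Re (tri s z) - B s) has_real_derivative y) (at x) \<and> 0 \<le> y" by blast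
  qed
  then show ?thesis by (simp add: tri_def B_def)
qed

text \<open>The real axis is missing from \<open>Re_tri_ge\<close>, which divides by
  \<open>\<omega>\<^sup>2\<close>. Here the claim reduces to
  \<open>1 - u \<le> exp (- u)\<close>.\<close>

lemma Re_tri_nonneg_real: assumes "0 < \<sigma>" "0 \<le> s" shows "0 \<le> Re (tri s (of_real \<sigma>))"
proof -
  have "1 - \<sigma> * s \<le> exp (- (\<sigma> * s))" using exp_ge_add_one_self[of "- (\<sigma> * s)"] by simp
  then have "0 \<le> (\<sigma> * s - (1 - exp (- (\<sigma> * s)))) / \<sigma>\<^sup>2" using assms by simp
  moreover have "tri s (of_real \<sigma>) = of_real ((\<sigma> * s - (1 - exp (- (\<sigma> * s)))) / \<sigma>\<^sup>2)"
    using assms by (simp add: tri_def exp_of_real[symmetric] field_simps power2_eq_square)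
  ultimately show ?thesis by simp
qed

lemma measurable_tri [measurable]:
  "(\<lambda>(s, z). tri s z) \<in> borel_measurable (borel \<Otimes>\<^sub>M borel)"
  unfolding tri_def case_prod_beta by measurable

text \<open>Collects what is taken over from complete monotonicity: two derivatives with their
  signs, and in \<open>strict\<close> a lower bound of \<open>K2\<close> next to the origin, which
  later keeps the real part of the Laplace transform away from zero.\<close>

locale convex_kernel =
  fixes K K1 K2 :: "real \<Rightarrow> real"
  assumes cont: "continuous_on UNIV K"
    and sym: "K (- t) = K t"
    and nonneg: "0 \<le> K t"
    and d1: "0 < t \<Longrightarrow> (K has_real_derivative K1 t) (at t)"
    and d2: "0 < t \<Longrightarrow> (K1 has_real_derivative K2 t) (at t)"
    and cont2: "continuous_on {0<..} K2"
    and K1: "0 < t \<Longrightarrow> K1 t \<le> 0"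
    and K2: "0 < t \<Longrightarrow> 0 \<le> K2 t"
    and lim: "(K \<longlongrightarrow> 0) at_top"
    and strict: "\<exists>s0>0. \<exists>c>0. \<forall>s\<in>{0<..s0}. c \<le> K2 s"
begin

section \<open>The triangle representation of a convex kernel\<close>

definition w where "w s = indicator {0<..} s * K2 s"

lemma w_nonneg: "0 \<le> w s" by (simp add: w_def K2 indicator_def)
lemma w_0: "s \<le> 0 \<Longrightarrow> w s = 0" by (simp add: w_def)

lemma w_measurable [measurable]: "w \<in> borel_measurable borel"
  unfolding w_def using borel_measurable_continuous_on_indicator[OF _ cont2] by simp

lemma K1_mono: assumes "0 < s" "s \<le> t" shows "K1 s \<le> K1 t"
  using assms(2)
proof (rule DERIV_nonneg_imp_nondecreasing)
  fix x assume "s \<le> x" "x \<le> t"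
  then have "0 < x" using assms by simp
  then show "\<exists>y. (K1 has_real_derivative y) (at x) \<and> 0 \<le> y" using d2 K2 by blast
qed

text \<open>Convexity: the slope on \<open>[t/2, t]\<close> never exceeds
  \<open>K1 t \<le> 0\<close>, so \<open>t * \<bar>K1 t\<bar>\<close> is at most twice the drop of
  \<open>K\<close> over this interval. It removes the boundary term at infinity in the next
  lemma.\<close>

lemma t_K1_lim: "((\<lambda>t. t * K1 t) \<longlongrightarrow> 0) at_top"
proof -
  have b: "\<bar>t * K1 t\<bar> \<le> 2 * (K (t/2) - K t)" if t: "0 < t" for t
  proof -
    obtain x where x: "t/2 < x" "x < t" "K t - K (t/2) = (t - t/2) * K1 x"
      using MVT2[of "t/2" t K K1] t d1 by auto
    have "K1 x \<le> K1 t" using x t by (intro K1_mono) auto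
    then have "t * K1 x \<le> t * K1 t" using t by simp
    moreover have "2 * (K t - K (t/2)) = t * K1 x" using x(3) by simp
    moreover have "t * K1 t \<le> 0" using K1[OF t] t by (simp add: mult_nonneg_nonpos)
    ultimately show ?thesis by simp
  qed
  have "((\<lambda>t. K (t/2)) \<longlongrightarrow> 0) at_top"
    by (rule filterlim_compose[OF lim]) real_asymp
  from tendsto_mult_left[OF tendsto_diff[OF this lim], of 2]
  have "((\<lambda>t. 2 * (K (t/2) - K t)) \<longlongrightarrow> 0) at_top" by simp
  then show ?thesis
    by (rule Lim_null_comparison[rotated]) (use b in \<open>auto intro!: eventually_at_top_linorderI[of 1]\<close>)
qed

text \<open>Taylor's formula expanded from infinity: \<open>(s - t) * K1 s - K s\<close> is an
  antiderivative that starts at \<open>- K t\<close> and tends to zero.\<close>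

lemma nn_integral_triangle_pos:
  assumes "0 < t"
  shows "(\<integral>\<^sup>+s. ennreal (max 0 (s - t) * w s) \<partial>lborel) = ennreal (K t)"
proof -
  have "(\<integral>\<^sup>+s. ennreal ((s - t) * w s) * indicator {t..} s \<partial>lborel) = ennreal (0 - ((t - t) * K1 t - K t))"
  proof (rule nn_integral_FTC_atLeast[where F="\<lambda>s. (s - t) * K1 s - K s" and T=0])
    fix x assume x: "t \<le> x"
    then show "((\<lambda>s. (s - t) * K1 s - K s) has_real_derivative (x - t) * w x) (at x)"
      using assms by (auto intro!: derivative_eq_intros d1 d2 simp: w_def)
    show "0 \<le> (x - t) * w x" using x w_nonneg[of x] by simp
  next
    have "((\<lambda>s. K1 s) \<longlongrightarrow> 0) at_top"
    proof (rule Lim_null_comparison[OF _ tendsto_norm_zero[OF t_K1_lim]])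
      show "\<forall>\<^sub>F x in at_top. norm (K1 x) \<le> norm (x * K1 x)"
        by (rule eventually_at_top_linorderI[of 1]) (auto simp: abs_mult mult_le_cancel_right1)
    qed
    then have "((\<lambda>s. s * K1 s - t * K1 s - K s) \<longlongrightarrow> 0 - t * 0 - 0) at_top"
      by (intro tendsto_intros t_K1_lim lim)
    then show "((\<lambda>s. (s - t) * K1 s - K s) \<longlongrightarrow> 0) at_top" by (simp add: algebra_simps)
  qed simp
  moreover have "ennreal ((s - t) * w s) * indicator {t..} s = ennreal (max 0 (s - t) * w s)" for s
    by (auto simp: indicator_def max_def)
  ultimately show ?thesis by simp
qed

text \<open>The derivatives are only available for positive times. The value at \<open>t = 0\<close>
  follows by monotone convergence along \<open>t = 1 / (n + 1)\<close> and continuity of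
  \<open>K\<close>.\<close>

lemma nn_integral_triangle:
  "(\<integral>\<^sup>+s. ennreal (max 0 (s - \<bar>t\<bar>) * w s) \<partial>lborel) = ennreal (K t)"
proof -
  have Ka: "K \<bar>t\<bar> = K t" using sym[of t] by (simp add: abs_if)
  show ?thesis
  proof (cases "t = 0")
    case False
    then show ?thesis using nn_integral_triangle_pos[of "\<bar>t\<bar>"] Ka by simp
  next
    case True
    let ?e = "\<lambda>n. inverse (real (Suc n))"
    have "(\<lambda>n. \<integral>\<^sup>+s. ennreal (max 0 (s - ?e n) * w s) \<partial>lborel) \<longlonglongrightarrow> (\<integral>\<^sup>+s. ennreal (max 0 s * w s) \<partial>lborel)"
    proof (rule nn_integral_LIMSEQ)
      show "incseq (\<lambda>n s. ennreal (max 0 (s - ?e n) * w s))"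
      proof (intro incseq_SucI le_funI ennreal_leI mult_right_mono w_nonneg max.mono order_refl diff_left_mono)
        fix n show "?e (Suc n) \<le> ?e n" by (intro le_imp_inverse_le) auto
      qed
      fix s
      have "(\<lambda>n. max 0 (s - ?e n) * w s) \<longlonglongrightarrow> max 0 (s - 0) * w s"
        by (intro tendsto_max tendsto_mult tendsto_diff tendsto_const LIMSEQ_inverse_real_of_nat)
      then show "(\<lambda>n. ennreal (max 0 (s - ?e n) * w s)) \<longlonglongrightarrow> ennreal (max 0 s * w s)"
        by (intro tendsto_ennrealI) simp
    qed simp
    moreover have "(\<lambda>n. \<integral>\<^sup>+s. ennreal (max 0 (s - ?e n) * w s) \<partial>lborel) \<longlonglongrightarrow> ennreal (K 0)"
    proof -
      have "(\<lambda>n. K (?e n)) \<longlonglongrightarrow> K 0"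
        using cont LIMSEQ_inverse_real_of_nat by (rule continuous_on_tendsto_compose) auto
      then show ?thesis by (subst nn_integral_triangle_pos) auto
    qed
    ultimately show ?thesis using LIMSEQ_unique True by fastforce
  qed
qed

lemma has_bochner_integral_triangle:
  "has_bochner_integral lborel (\<lambda>s. max 0 (s - \<bar>t\<bar>) * w s) (K t)"
  by (rule has_bochner_integral_nn_integral)
     (use nn_integral_triangle w_nonneg nonneg in \<open>auto intro!: AE_I2\<close>)

text \<open>The mixture at \<open>t = 0\<close>. The function \<open>s * w s\<close> is the
  dominating function for the integrals over \<open>s\<close> that follow.\<close>

lemma has_bochner_integral_s_w: "has_bochner_integral lborel (\<lambda>s. s * w s) (K 0)"
proof -
  have "(\<lambda>s. max 0 (s - \<bar>0\<bar>) * w s) = (\<lambda>s. s * w s)" by (auto simp: max_def w_0 fun_eq_iff)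
  then show ?thesis using has_bochner_integral_triangle[of 0] by (simp only:)
qed

lemma integrable_s_w: "integrable lborel (\<lambda>s. s * w s)"
  and integral_s_w: "(\<integral>s. s * w s \<partial>lborel) = K 0"
  using has_bochner_integral_s_w by (auto simp: has_bochner_integral_iff)

lemma K_le: "K t \<le> K 0"
proof -
  have "(\<integral>s. max 0 (s - \<bar>t\<bar>) * w s \<partial>lborel) \<le> (\<integral>s. s * w s \<partial>lborel)"
  proof (rule integral_mono)
    show "integrable lborel (\<lambda>s. max 0 (s - \<bar>t\<bar>) * w s)"
      using has_bochner_integral_triangle by (simp add: has_bochner_integral_iff)
    fix s show "max 0 (s - \<bar>t\<bar>) * w s \<le> s * w s"
      by (cases "s > 0") (auto simp: w_0 intro!: mult_right_mono w_nonneg)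
  qed (rule integrable_s_w)
  then show ?thesis using has_bochner_integral_triangle[of t] integral_s_w by (simp add: has_bochner_integral_iff)
qed

text \<open>The Laplace transform of \<open>K\<close>. Written as a mixture of \<open>tri\<close> it converges absolutely also on
  the imaginary axis without the origin, although \<open>K\<close> need not be integrable.\<close>
definition k :: "complex \<Rightarrow> complex" where
  "k z = (\<integral>s. of_real (w s) * tri s z \<partial>lborel)"

section \<open>Size and positivity of the Laplace transform\<close>

lemma norm_w_tri_le:
  assumes "0 \<le> Re z" shows "cmod (of_real (w s) * tri s z) \<le> (2 / cmod z) * (s * w s)"
proof (cases "s > 0")
  case True
  have "w s * cmod (tri s z) \<le> w s * (2 * s / cmod z)"
    using norm_tri_le[OF assms, of s] True w_nonneg by (intro mult_left_mono) auto
  then show ?thesis using w_nonneg[of s] by (simp add: norm_mult algebra_simps)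
qed (simp add: w_0)

lemma integrable_w_tri:
  assumes "0 \<le> Re z" shows "integrable lborel (\<lambda>s. of_real (w s) * tri s z)"
proof (rule Bochner_Integration.integrable_bound)
  show "integrable lborel (\<lambda>s. (2 / cmod z) * (s * w s))" by (intro integrable_mult_right integrable_s_w)
  show "(\<lambda>s. of_real (w s) * tri s z) \<in> borel_measurable lborel" by simp
  show "AE s in lborel. cmod (of_real (w s) * tri s z) \<le> norm ((2 / cmod z) * (s * w s))"
    unfolding real_norm_def by (intro AE_I2 order_trans[OF norm_w_tri_le[OF assms] abs_ge_self])
qed

lemma norm_k_le: assumes "0 \<le> Re z" shows "cmod (k z) \<le> 2 * K 0 / cmod z"
proof -
  have "cmod (k z) \<le> (\<integral>s. (2 / cmod z) * (s * w s) \<partial>lborel)"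
    unfolding k_def
    by (rule Bochner_Integration.integral_norm_bound_integral[OF integrable_w_tri[OF assms] _ norm_w_tri_le[OF assms]])
       (intro integrable_mult_right integrable_s_w)
  then show ?thesis by (simp add: integral_s_w)
qed

lemma Re_k: assumes "0 \<le> Re z"
  shows "Re (k z) = (\<integral>s. w s * Re (tri s z) \<partial>lborel)" "integrable lborel (\<lambda>s. w s * Re (tri s z))"
proof -
  show "Re (k z) = (\<integral>s. w s * Re (tri s z) \<partial>lborel)" unfolding k_def
    by (subst integral_Re[OF integrable_w_tri[OF assms], symmetric]) simp
  show "integrable lborel (\<lambda>s. w s * Re (tri s z))"
    using integrable_Re[OF integrable_w_tri[OF assms]] by simp
qed

lemma k_cnj: "k (cnj z) = cnj (k z)"
  unfolding k_def tri_cnj using Bochner_Integration.integral_cnj[of lborel "\<lambda>s. of_real (w s) * tri s z"] by simp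

lemma Re_k_nonneg: assumes "0 \<le> Re z" shows "0 \<le> Re (k z)"
  unfolding Re_k[OF assms]
proof (rule integral_nonneg_AE, rule AE_I2)
  fix s
  show "0 \<le> w s * Re (tri s z)"
  proof (cases "s > 0")
    case True
    have "0 \<le> Re (tri s z)"
    proof (cases "Im z = 0")
      case False
      have "0 \<le> exp (- (Re z * s)) * (1 - cos (Im z * s)) / (Im z)\<^sup>2" by simp
      also have "\<dots> \<le> Re (tri s z)" by (rule Re_tri_ge) (use False True assms in auto)
      finally show ?thesis .
    next
      case im: True
      then have z: "z = of_real (Re z)" by (simp add: complex_eq_iff)
      show ?thesis
      proof (cases "Re z = 0")
        case True
        then have "z = 0" using z by simp
        then show ?thesis by (simp add: tri_def)
      next
        case False
        then show ?thesis using Re_tri_nonneg_real[of "Re z" s] assms True by (subst z) simp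
      qed
    qed
    then show ?thesis using w_nonneg by simp
  qed (simp add: w_0)
qed

text \<open>Fourth order Taylor expansion; the loss from \<open>1 / 2\<close> to
  \<open>1 / 4\<close> absorbs the remainder, which is at most \<open>x\<^sup>2 / 24\<close> for
  \<open>\<bar>x\<bar> \<le> 1\<close>.\<close>

lemma one_minus_cos_ge: assumes "\<bar>x\<bar> \<le> 1" shows "x\<^sup>2 / 4 \<le> 1 - cos (x::real)"
proof -
  obtain t where "cos x = (\<Sum>m<4. cos_coeff m * x ^ m) + (cos (t + 1/2 * real (4::nat) * pi) / fact 4) * x ^ 4"
    using Maclaurin_cos_expansion[of x 4] by blast
  moreover have "(\<Sum>m<4. cos_coeff m * x ^ m) = 1 - x\<^sup>2 / 2"
  proof -
    have "{..<4::nat} = {0, 1, 2, 3}" by auto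
    then show ?thesis by (simp add: cos_coeff_def)
  qed
  ultimately have "cos x = 1 - x\<^sup>2 / 2 + cos (t + 2 * pi) / 24 * x ^ 4"
    by (simp add: fact_numeral)
  moreover have "cos (t + 2 * pi) * x ^ 4 \<le> 1 * x ^ 4" by (intro mult_right_mono) auto
  moreover have "x ^ 4 \<le> x\<^sup>2 * 1"
  proof -
    have "x\<^sup>2 \<le> 1" using assms by (simp add: abs_square_le_1)
    then have "x\<^sup>2 * x\<^sup>2 \<le> x\<^sup>2 * 1" by (intro mult_left_mono) auto
    then show ?thesis by (simp add: power2_eq_square power4_eq_xxxx mult.assoc)
  qed
  ultimately show ?thesis using zero_le_power2[of x] by linarith
qed

text \<open>The bound is uniform up to the imaginary axis and up to the punctured origin, which is
  what dominated convergence needs when the line of integration moves to the axis. Since every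
  \<open>tri\<close> has nonnegative real part, a small interval of widths \<open>s\<close> already
  suffices.\<close>

lemma Re_k_ge:
  assumes "0 < R"
  shows "\<exists>c>0. \<forall>\<sigma> \<omega>. 0 \<le> \<sigma> \<longrightarrow> \<sigma> \<le> 1 \<longrightarrow> \<omega> \<noteq> 0 \<longrightarrow> \<bar>\<omega>\<bar> \<le> R \<longrightarrow> c \<le> Re (k (Complex \<sigma> \<omega>))"
proof -
  obtain s0 c where s0: "s0 > 0" "c > 0" "\<And>s. s \<in> {0<..s0} \<Longrightarrow> c \<le> K2 s" using strict by blast
  \<comment> \<open>\<open>d \<le> s0\<close> gives \<open>c \<le> w s\<close> on the chosen
    interval, and \<open>d * R \<le> 1\<close> keeps \<open>\<omega> * s\<close> in the range of
    \<open>one_minus_cos_ge\<close>.\<close>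
  define d where "d = min s0 (1 / R)"
  have d: "0 < d" "d \<le> s0" "d * R \<le> 1" using s0 assms by (auto simp: d_def field_simps min_def)
  let ?g = "\<lambda>s. c * exp (- d) * ((d/2)\<^sup>2 / 4) * indicator {d/2..d} s :: real"
  have "c * exp (- d) * ((d/2)\<^sup>2 / 4) * (d / 2) \<le> Re (k (Complex \<sigma> \<omega>))"
    if *: "0 \<le> \<sigma>" "\<sigma> \<le> 1" "\<omega> \<noteq> 0" "\<bar>\<omega>\<bar> \<le> R" for \<sigma> \<omega>
  proof -
    have "(\<integral>s. ?g s \<partial>lborel) \<le> (\<integral>s. w s * Re (tri s (Complex \<sigma> \<omega>)) \<partial>lborel)"
    proof (rule integral_mono)
      show "integrable lborel ?g" using d by (intro integrable_mult_right) (auto simp: emeasure_lborel_Icc_eq)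
      show "integrable lborel (\<lambda>s. w s * Re (tri s (Complex \<sigma> \<omega>)))" using * by (intro Re_k) auto
      fix s
      have lb: "exp (- (\<sigma> * s)) * (1 - cos (\<omega> * s)) / \<omega>\<^sup>2 \<le> Re (tri s (Complex \<sigma> \<omega>))" if "0 \<le> s"
        by (rule Re_tri_ge) (use * that in auto)
      show "?g s \<le> w s * Re (tri s (Complex \<sigma> \<omega>))"
      proof (cases "s \<in> {d/2..d}")
        case True
        have s: "0 < s" "s \<le> d" using True d by auto
        have "\<bar>\<omega> * s\<bar> \<le> R * d" unfolding abs_mult using * s assms by (intro mult_mono) auto
        then have "(\<omega> * s)\<^sup>2 / 4 \<le> 1 - cos (\<omega> * s)" using d by (intro one_minus_cos_ge) (simp add: mult.commute)
        then have "s\<^sup>2 / 4 \<le> (1 - cos (\<omega> * s)) / \<omega>\<^sup>2" using *(3) by (simp add: field_simps power_mult_distrib)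
        moreover have "(d/2)\<^sup>2 / 4 \<le> s\<^sup>2 / 4" using True d by (auto intro!: power_mono divide_right_mono)
        ultimately have 1: "(d/2)\<^sup>2 / 4 \<le> (1 - cos (\<omega> * s)) / \<omega>\<^sup>2" by linarith
        have "\<sigma> * s \<le> 1 * d" using * s by (intro mult_mono) auto
        then have 2: "exp (- d) \<le> exp (- (\<sigma> * s))" by simp
        have "exp (- d) * ((d/2)\<^sup>2 / 4) \<le> exp (- (\<sigma> * s)) * ((1 - cos (\<omega> * s)) / \<omega>\<^sup>2)"
          using 1 2 by (intro mult_mono) auto
        also have "\<dots> \<le> Re (tri s (Complex \<sigma> \<omega>))" using lb s by simp
        finally have 3: "exp (- d) * ((d/2)\<^sup>2 / 4) \<le> Re (tri s (Complex \<sigma> \<omega>))" .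
        have "c \<le> w s" using s d s0(3)[of s] by (simp add: w_def)
        then have "c * (exp (- d) * ((d/2)\<^sup>2 / 4)) \<le> w s * Re (tri s (Complex \<sigma> \<omega>))"
          using 3 s0 w_nonneg by (intro mult_mono) auto
        then show ?thesis using True by simp
      next
        case False
        have "0 \<le> exp (- (\<sigma> * s)) * (1 - cos (\<omega> * s)) / \<omega>\<^sup>2" by simp
        with lb have "0 \<le> Re (tri s (Complex \<sigma> \<omega>))" if "0 \<le> s" using that order_trans by blast
        then have "0 \<le> w s * Re (tri s (Complex \<sigma> \<omega>))"
          using w_nonneg by (cases "s > 0") (auto simp: w_0)
        with False show ?thesis by simp
      qed
    qed
    moreover have "(\<integral>s. ?g s \<partial>lborel) = c * exp (- d) * ((d/2)\<^sup>2 / 4) * (d / 2)" using d by simp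
    moreover have "Re (k (Complex \<sigma> \<omega>)) = (\<integral>s. w s * Re (tri s (Complex \<sigma> \<omega>)) \<partial>lborel)"
      using *(1) by (simp add: Re_k(1))
    ultimately show ?thesis by linarith
  qed
  then show ?thesis using s0 d by (intro exI[of _ "c * exp (- d) * ((d/2)\<^sup>2 / 4) * (d / 2)"]) auto
qed

text \<open>The Bernstein function with Levy density \<open>w\<close>. It is what remains of
  \<open>k\<close> after the powers of \<open>z\<close> are pulled out of the integral, and it is
  Lipschitz up to the axis, so regularity of \<open>k\<close> is reduced to that of
  \<open>N\<close>.\<close>

definition N :: "complex \<Rightarrow> complex" where
  "N z = (\<integral>s. of_real (w s) * (1 - exp (- (z * of_real s))) \<partial>lborel)"

lemma integrable_N: assumes "0 \<le> Re z"
  shows "integrable lborel (\<lambda>s. of_real (w s) * (1 - exp (- (z * of_real s))))"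
proof (rule Bochner_Integration.integrable_bound)
  show "integrable lborel (\<lambda>s. cmod z * (s * w s))" by (intro integrable_mult_right integrable_s_w)
  have "w s * cmod (1 - exp (- (z * of_real s))) \<le> cmod z * (s * w s)" for s
    using mult_left_mono[OF norm_one_minus_exp_le[OF assms, of s] w_nonneg[of s]] w_0[of s]
    by (cases "s > 0") (auto simp: mult_ac)
  then show "AE s in lborel. cmod (of_real (w s) * (1 - exp (- (z * of_real s)))) \<le> norm (cmod z * (s * w s))"
    using w_nonneg by (intro AE_I2) (auto simp: norm_mult intro: order_trans[OF _ abs_ge_self])
qed simp

lemma k_eq: assumes "0 \<le> Re z" shows "k z = (of_real (K 0) * z - N z) / z\<^sup>2"
proof (cases "z = 0")
  case False
  have "k z = (\<integral>s. of_real (s * w s) / z - of_real (w s) * (1 - exp (- (z * of_real s))) / z\<^sup>2 \<partial>lborel)"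
    unfolding k_def tri_def by (intro Bochner_Integration.integral_cong refl) (simp add: algebra_simps)
  also have "\<dots> = of_real (K 0) / z - N z / z\<^sup>2"
    unfolding N_def using integrable_N[OF assms] integrable_s_w
    by (subst Bochner_Integration.integral_diff)
       (auto simp: integral_s_w simp del: of_real_mult)
  also have "\<dots> = (of_real (K 0) * z - N z) / z\<^sup>2" using False by (simp add: field_simps power2_eq_square)
  finally show ?thesis .
qed (simp add: k_def tri_def)

lemma N_lipschitz: assumes "0 \<le> Re z" "0 \<le> Re y" shows "cmod (N z - N y) \<le> K 0 * cmod (z - y)"
proof -
  have "N z - N y = (\<integral>s. of_real (w s) * (exp (- (y * of_real s)) - exp (- (z * of_real s))) \<partial>lborel)"
    unfolding N_def using integrable_N assms
    by (subst Bochner_Integration.integral_diff[symmetric]) (auto simp: algebra_simps)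
  also have "cmod \<dots> \<le> (\<integral>s. cmod (z - y) * (s * w s) \<partial>lborel)"
  proof (rule Bochner_Integration.integral_norm_bound_integral)
    have "integrable lborel (\<lambda>s. of_real (w s) * (1 - exp (- (z * of_real s))) - of_real (w s) * (1 - exp (- (y * of_real s))))"
      using integrable_N assms by (intro Bochner_Integration.integrable_diff) auto
    then show "integrable lborel (\<lambda>s. of_real (w s) * (exp (- (y * of_real s)) - exp (- (z * of_real s))))"
      by (simp add: algebra_simps)
    fix s
    show "cmod (of_real (w s) * (exp (- (y * of_real s)) - exp (- (z * of_real s)))) \<le> cmod (z - y) * (s * w s)"
      using mult_left_mono[OF norm_exp_diff_le[of y z s] w_nonneg[of s]] w_0[of s] w_nonneg[of s] assms
      by (cases "s > 0") (auto simp: norm_mult mult_ac norm_minus_commute)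
  qed (intro integrable_mult_right integrable_s_w)
  finally show ?thesis by (simp add: integral_s_w mult.commute)
qed

lemma continuous_on_k: "continuous_on ({z. 0 \<le> Re z} - {0}) k"
proof -
  have "continuous_on {z. 0 \<le> Re z} N"
    by (rule lipschitz_on_continuous_on[of "K 0"], rule lipschitz_onI)
       (use N_lipschitz nonneg in \<open>auto simp: dist_norm\<close>)
  then have "continuous_on ({z. 0 \<le> Re z} - {0}) (\<lambda>z. (of_real (K 0) * z - N z) / z\<^sup>2)"
    by (intro continuous_intros) (auto intro: continuous_on_subset)
  then show ?thesis by (rule continuous_on_eq) (simp add: k_eq)
qed

text \<open>Differentiation under the integral sign. The difference quotients are dominated by
  \<open>s * w s\<close>; they are taken within the half plane because the Lipschitz bound for the
  exponential holds there.\<close>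

lemma N_DERIV: assumes "0 < Re z"
  shows "(N has_field_derivative (\<integral>s. of_real (w s * s) * exp (- (z * of_real s)) \<partial>lborel)) (at z)"
proof -
  let ?S = "{z. 0 < Re z}"
  have op: "open ?S" by (rule open_halfspace_Re_gt)
  let ?d = "\<lambda>y s. of_real (w s) * ((exp (- (z * of_real s)) - exp (- (y * of_real s))) / (y - z))"
  have "((\<lambda>y. \<integral>s. ?d y s \<partial>lborel) \<longlongrightarrow> (\<integral>s. of_real (w s * s) * exp (- (z * of_real s)) \<partial>lborel)) (at z within ?S)"
    unfolding tendsto_at_iff_sequentially comp_def
  proof safe
    fix X assume X: "\<forall>i. X i \<in> ?S - {z}" "X \<longlonglongrightarrow> z"
    show "(\<lambda>n. \<integral>s. ?d (X n) s \<partial>lborel) \<longlonglongrightarrow> (\<integral>s. of_real (w s * s) * exp (- (z * of_real s)) \<partial>lborel)"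
    proof (rule integral_dominated_convergence[where w="\<lambda>s. s * w s"])
      show "AE s in lborel. (\<lambda>n. ?d (X n) s) \<longlonglongrightarrow> of_real (w s * s) * exp (- (z * of_real s))"
      proof (rule AE_I2)
        fix s
        have "((\<lambda>y. - exp (- (y * of_real s))) has_field_derivative of_real s * exp (- (z * of_real s))) (at z)"
          by (auto intro!: derivative_eq_intros)
        then have "((\<lambda>y. (exp (- (z * of_real s)) - exp (- (y * of_real s))) / (y - z)) \<longlongrightarrow> of_real s * exp (- (z * of_real s))) (at z)"
          by (simp add: has_field_derivative_iff)
        then have "(\<lambda>n. (exp (- (z * of_real s)) - exp (- (X n * of_real s))) / (X n - z)) \<longlonglongrightarrow> of_real s * exp (- (z * of_real s))"
          using X unfolding tendsto_at_iff_sequentially comp_def by auto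
        from tendsto_mult_left[OF this, of "of_real (w s)"]
        show "(\<lambda>n. ?d (X n) s) \<longlonglongrightarrow> of_real (w s * s) * exp (- (z * of_real s))" by (simp add: mult.assoc)
      qed
      fix n
      have xn: "0 \<le> Re (X n)" "X n \<noteq> z" using X(1) by (auto dest!: spec[of _ n])
      have "cmod (?d (X n) s) \<le> s * w s" for s
      proof (cases "s > 0")
        case True
        have "cmod (exp (- (z * of_real s)) - exp (- (X n * of_real s))) \<le> s * cmod (z - X n)"
          using assms xn True by (intro norm_exp_diff_le) auto
        then have "cmod ((exp (- (z * of_real s)) - exp (- (X n * of_real s))) / (X n - z)) \<le> s"
          using xn by (simp add: norm_divide divide_le_eq norm_minus_commute)
        then have "w s * cmod ((exp (- (z * of_real s)) - exp (- (X n * of_real s))) / (X n - z)) \<le> w s * s"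
          using w_nonneg[of s] by (intro mult_left_mono) auto
        then show ?thesis by (simp only: norm_mult norm_of_real abs_of_nonneg[OF w_nonneg] mult.commute)
      qed (simp add: w_0)
      then show "AE s in lborel. cmod (?d (X n) s) \<le> s * w s" by simp
    qed (use integrable_s_w in auto)
  qed
  moreover have "\<forall>\<^sub>F y in at z within ?S. (\<integral>s. ?d y s \<partial>lborel) = (N y - N z) / (y - z)"
  proof -
  have "(\<integral>s. ?d y s \<partial>lborel) = (N y - N z) / (y - z)" if "y \<in> ?S" for y
  proof -
    have "N y - N z = (\<integral>s. of_real (w s) * (exp (- (z * of_real s)) - exp (- (y * of_real s))) \<partial>lborel)"
      unfolding N_def using integrable_N[of y] integrable_N[of z] assms that
      by (subst Bochner_Integration.integral_diff[symmetric]) (auto simp: algebra_simps)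
    then show ?thesis by simp
  qed
  then show ?thesis unfolding eventually_at_filter by (intro always_eventually) auto
  qed
  ultimately have "((\<lambda>y. (N y - N z) / (y - z)) \<longlongrightarrow> (\<integral>s. of_real (w s * s) * exp (- (z * of_real s)) \<partial>lborel)) (at z within ?S)"
    by (rule Lim_transform_eventually)
  then show ?thesis
    using op assms by (simp add: has_field_derivative_iff at_within_open[of z ?S])
qed

lemma holomorphic_k: "k holomorphic_on {z. 0 < Re z}"
proof -
  have "N holomorphic_on {z. 0 < Re z}"
    unfolding holomorphic_on_def field_differentiable_def using N_DERIV has_field_derivative_at_within by blast
  then have "(\<lambda>z. (of_real (K 0) * z - N z) / z\<^sup>2) holomorphic_on {z. 0 < Re z}"
    by (intro holomorphic_intros) auto
  then show ?thesis by (rule holomorphic_transform) (simp add: k_eq)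
qed

end

section \<open>The mass of the spectral density\<close>

context convex_kernel
begin

text \<open>The spectral density of the noise, normalised so that its Fourier transform is
  \<open>K\<close> without a factor \<open>2 * pi\<close>.\<close>

definition kappa :: "real \<Rightarrow> real" where
  "kappa \<omega> = Re (k (\<i> * of_real \<omega>)) / pi"

text \<open>The symbol of the mode equation; \<open>hres a\<close> below extends its inverse to the half plane.\<close>
definition msym :: "real \<Rightarrow> real \<Rightarrow> complex" where
  "msym a \<omega> = \<i> * of_real \<omega> + of_real a * k (\<i> * of_real \<omega>)"

lemma measurable_k [measurable]: "k \<in> borel_measurable borel"
  unfolding k_def by measurable

lemma measurable_kappa [measurable]: "kappa \<in> borel_measurable borel"
  unfolding kappa_def by measurable

lemma measurable_msym [measurable]: "msym a \<in> borel_measurable borel"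
  unfolding msym_def by measurable

lemma kappa_nonneg: "0 \<le> kappa \<omega>"
  unfolding kappa_def by (intro divide_nonneg_pos Re_k_nonneg) auto

lemma Re_k_pos: assumes "0 \<le> \<sigma>" "\<sigma> \<le> 1" "\<omega> \<noteq> 0" shows "0 < Re (k (Complex \<sigma> \<omega>))"
proof -
  obtain c where "c > 0" "\<forall>\<sigma> y. 0 \<le> \<sigma> \<longrightarrow> \<sigma> \<le> 1 \<longrightarrow> y \<noteq> 0 \<longrightarrow> \<bar>y\<bar> \<le> \<bar>\<omega>\<bar> \<longrightarrow> c \<le> Re (k (Complex \<sigma> y))"
    using Re_k_ge[of "\<bar>\<omega>\<bar>"] assms(3) by auto
  moreover from this have "c \<le> Re (k (Complex \<sigma> \<omega>))" using assms by blast
  ultimately show ?thesis by linarith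
qed

lemma kappa_pos: "\<omega> \<noteq> 0 \<Longrightarrow> 0 < kappa \<omega>"
  using Re_k_pos[of 0 \<omega>] by (simp add: kappa_def Complex_eq)

lemma kappa_minus: "kappa (- \<omega>) = kappa \<omega>"
  using k_cnj[of "\<i> * of_real \<omega>"] by (simp add: kappa_def)

lemma msym_minus: "msym a (- \<omega>) = cnj (msym a \<omega>)"
  using k_cnj[of "\<i> * of_real \<omega>"] by (simp add: msym_def)

text \<open>Its real part is \<open>a * pi * kappa \<omega>\<close>. At the origin the conventions
  for division give \<open>k 0 = 0\<close>, hence \<open>msym a 0 = 0\<close>; the point is excluded
  here and ignored later as a null set.\<close>

lemma msym_nonzero: assumes "0 < a" "\<omega> \<noteq> 0" shows "msym a \<omega> \<noteq> 0"
proof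
  assume "msym a \<omega> = 0"
  then have "Re (msym a \<omega>) = 0" by simp
  then show False using kappa_pos[OF assms(2)] assms(1) by (simp add: msym_def kappa_def)
qed

section \<open>Fourier inversion for the spectral density of the noise\<close>

lemma has_bochner_integral_w_triangle_transform:
  "has_bochner_integral lborel (\<lambda>\<omega>. w s * ((1 - cos (s * \<omega>)) / \<omega>\<^sup>2 * cos (t * \<omega>))) (w s * (pi * max 0 (s - \<bar>t\<bar>)))"
proof (cases "s > 0")
  case True
  then show ?thesis by (intro has_bochner_integral_mult_right has_bochner_integral_triangle_transform) auto
qed (simp add: w_0 has_bochner_integral_zero)

text \<open>Replacing the cosine \<open>cos (t * \<omega>)\<close> by 1 gives a nonnegative majorant
  whose inner integral over \<open>\<omega>\<close> is \<open>pi * (s * w s)\<close>.\<close>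

lemma integrable_pair_triangle_transform:
  "integrable (lborel \<Otimes>\<^sub>M lborel) (\<lambda>(s, \<omega>). w s * ((1 - cos (s * \<omega>)) / \<omega>\<^sup>2 * cos (t * \<omega>)))"
proof -
  let ?g = "\<lambda>s \<omega>. (1 - cos (s * \<omega>)) / \<omega>\<^sup>2 :: real"
  let ?f = "\<lambda>t s \<omega>. w s * (?g s \<omega> * cos (t * \<omega>))"
  note I = has_bochner_integral_w_triangle_transform
  show ?thesis
  proof (rule lborel_pair.Fubini_integrable)
    have b: "norm (?f t s \<omega>) \<le> ?f 0 s \<omega>" for s \<omega>
    proof -
      have "0 \<le> ?g s \<omega>" by simp
      then have "w s * (?g s \<omega> * \<bar>cos (t * \<omega>)\<bar>) \<le> w s * (?g s \<omega> * 1)"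
        by (intro mult_left_mono w_nonneg) auto
      moreover have "norm (?f t s \<omega>) = w s * (?g s \<omega> * \<bar>cos (t * \<omega>)\<bar>)"
        using \<open>0 \<le> ?g s \<omega>\<close> w_nonneg[of s] by (simp only: real_norm_def abs_mult abs_of_nonneg)
      ultimately show ?thesis by (simp only: mult_zero_left cos_zero)
    qed
    have "integrable lborel (\<lambda>s. \<integral>\<omega>. ?f 0 s \<omega> \<partial>lborel)"
    proof -
      have "(\<lambda>s. \<integral>\<omega>. ?f 0 s \<omega> \<partial>lborel) = (\<lambda>s. pi * (s * w s))"
      proof
        fix s
        have "(\<integral>\<omega>. ?f 0 s \<omega> \<partial>lborel) = w s * (pi * max 0 (s - \<bar>0\<bar>))"
          using I[of s 0] by (rule has_bochner_integral_integral_eq)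
        also have "\<dots> = pi * (s * w s)" by (cases "s > 0") (auto simp: w_0)
        finally show "(\<integral>\<omega>. ?f 0 s \<omega> \<partial>lborel) = pi * (s * w s)" .
      qed
      then show ?thesis using integrable_s_w by simp
    qed
    then have "integrable lborel (\<lambda>s. \<integral>\<omega>. norm (?f t s \<omega>) \<partial>lborel)"
    proof (rule Bochner_Integration.integrable_bound)
      show "AE s in lborel. norm (\<integral>\<omega>. norm (?f t s \<omega>) \<partial>lborel) \<le> norm (\<integral>\<omega>. ?f 0 s \<omega> \<partial>lborel)"
      proof (rule AE_I2)
        fix s
        have "(\<integral>\<omega>. norm (?f t s \<omega>) \<partial>lborel) \<le> (\<integral>\<omega>. ?f 0 s \<omega> \<partial>lborel)"
          by (intro integral_mono integrable_norm b has_bochner_integral_iff[THEN iffD1, OF I, THEN conjunct1])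
        moreover have "0 \<le> (\<integral>\<omega>. norm (?f t s \<omega>) \<partial>lborel)" by (rule integral_nonneg_AE) simp
        ultimately show "norm (\<integral>\<omega>. norm (?f t s \<omega>) \<partial>lborel) \<le> norm (\<integral>\<omega>. ?f 0 s \<omega> \<partial>lborel)" by simp
      qed
    qed simp
    then show "integrable lborel (\<lambda>s. \<integral>\<omega>. norm (case (s, \<omega>) of (s, \<omega>) \<Rightarrow> ?f t s \<omega>) \<partial>lborel)" by simp
    show "AE s in lborel. integrable lborel (\<lambda>\<omega>. case (s, \<omega>) of (s, \<omega>) \<Rightarrow> ?f t s \<omega>)"
      using I by (auto simp: has_bochner_integral_iff)
  qed simp
qed

text \<open>Fubini: integrating over \<open>s\<close> first produces \<open>pi * kappa\<close>,
  integrating over \<open>\<omega>\<close> first returns the triangles, whose mixture is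
  \<open>K\<close>.\<close>

lemma has_bochner_integral_kappa_cos:
  "has_bochner_integral lborel (\<lambda>\<omega>. kappa \<omega> * cos (t * \<omega>)) (K t)"
proof -
  let ?g = "\<lambda>s \<omega>. (1 - cos (s * \<omega>)) / \<omega>\<^sup>2 :: real"
  let ?f = "\<lambda>t s \<omega>. w s * (?g s \<omega> * cos (t * \<omega>))"
  note I = has_bochner_integral_w_triangle_transform and int = integrable_pair_triangle_transform[of t]
  have k: "(\<integral>s. ?f t s \<omega> \<partial>lborel) = pi * (kappa \<omega> * cos (t * \<omega>))" for \<omega>
  proof -
    have "(\<integral>s. ?f t s \<omega> \<partial>lborel) = (\<integral>s. w s * Re (tri s (\<i> * of_real \<omega>)) * cos (t * \<omega>) \<partial>lborel)"
      unfolding Re_tri_axis by (simp add: mult.assoc)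
    then show ?thesis by (simp add: kappa_def Re_k(1))
  qed
  have "integrable lborel (\<lambda>\<omega>. \<integral>s. ?f t s \<omega> \<partial>lborel)"
    using lborel_pair.integrable_snd[OF int] by simp
  then have int2: "integrable lborel (\<lambda>\<omega>. kappa \<omega> * cos (t * \<omega>))"
    unfolding k by (simp add: integrable_mult_right_iff)
  have "(\<integral>\<omega>. \<integral>s. ?f t s \<omega> \<partial>lborel \<partial>lborel) = (\<integral>s. \<integral>\<omega>. ?f t s \<omega> \<partial>lborel \<partial>lborel)"
    by (rule lborel_pair.Fubini_integral[OF int])
  also have "\<dots> = (\<integral>s. pi * (max 0 (s - \<bar>t\<bar>) * w s) \<partial>lborel)"
    by (intro Bochner_Integration.integral_cong refl)
       (simp only: has_bochner_integral_integral_eq[OF I], simp add: mult_ac)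
  also have "\<dots> = pi * K t" using has_bochner_integral_triangle[of t] by (simp add: has_bochner_integral_iff)
  finally have "(\<integral>\<omega>. kappa \<omega> * cos (t * \<omega>) \<partial>lborel) = K t" unfolding k by simp
  with int2 show ?thesis by (simp add: has_bochner_integral_iff)
qed

lemma integrable_kappa: "integrable lborel kappa"
  using has_bochner_integral_kappa_cos[of 0] by (simp add: has_bochner_integral_iff)

definition hres :: "real \<Rightarrow> complex \<Rightarrow> complex" where
  "hres a z = 1 / (z + of_real a * k z)"

section \<open>Contour integration of the inverse symbol\<close>

lemma den_pos: assumes "0 < a" "0 < Re z" shows "z + of_real a * k z \<noteq> 0"
proof -
  have "0 < Re (z + of_real a * k z)" using assms Re_k_nonneg[of z] by (simp add: add_pos_nonneg)
  then show ?thesis by (metis less_irrefl zero_complex.sel(1))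
qed

lemma holomorphic_hres: assumes "0 < a" shows "hres a holomorphic_on {z. 0 < Re z}"
  unfolding hres_def by (intro holomorphic_intros holomorphic_k) (use den_pos assms in auto)

lemma Re_le_norm_inverse: assumes "0 < c" "c \<le> Re z" shows "cmod (1 / z) \<le> 1 / c"
proof -
  have "c \<le> cmod z" using assms complex_Re_le_cmod[of z] by linarith
  then show ?thesis using assms by (simp add: norm_divide divide_left_mono frac_le)
qed

text \<open>On the arc \<open>a * k z\<close> is bounded by \<open>2 * a * K 0\<close>, so the two
  reciprocals differ by \<open>O(1 / R\<^sup>2)\<close>. The condition
  \<open>4 * a * K 0 \<le> R\<close> makes that bound at most \<open>R / 2\<close> and leaves a
  denominator of size at least \<open>R / 2\<close>.\<close>

lemma norm_hres_sub_le:
  assumes a: "0 < a" and R: "1 \<le> R" "4 * a * K 0 \<le> R" and \<sigma>: "0 < \<sigma>" "\<sigma> \<le> 1"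
    and z: "cmod (z - of_real \<sigma>) = R" "\<sigma> \<le> Re z"
  shows "cmod (hres a z - 1 / (z - of_real \<sigma>)) \<le> 2 * (1 + 2 * a * K 0) / R\<^sup>2"
proof -
  have K0: "0 \<le> K 0" by (rule nonneg)
  have "R\<^sup>2 \<le> (cmod z)\<^sup>2"
  proof -
    have "R\<^sup>2 = (Re z - \<sigma>)\<^sup>2 + (Im z)\<^sup>2" unfolding z(1)[symmetric] by (simp add: cmod_power2)
    moreover have "(Re z - \<sigma>)\<^sup>2 \<le> (Re z)\<^sup>2" using z(2) \<sigma> by (intro power_mono) auto
    ultimately show ?thesis unfolding cmod_power2[of z] by linarith
  qed
  then have zR: "R \<le> cmod z" by (rule power2_le_imp_le) simp
  have kb: "cmod (k z) \<le> 2 * K 0 / R"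
  proof -
    have "cmod (k z) \<le> 2 * K 0 / cmod z" using z(2) \<sigma> by (intro norm_k_le) auto
    also have "\<dots> \<le> 2 * K 0 / R" using zR R K0 by (intro divide_left_mono mult_pos_pos) auto
    finally show ?thesis .
  qed
  have K0R: "2 * K 0 / R \<le> 2 * K 0" using R K0 mult_left_mono[of 1 R "2 * K 0"] by (simp add: divide_le_eq)
  have ak: "cmod (of_real a * k z) \<le> 2 * a * K 0"
    using mult_left_mono[OF order_trans[OF kb K0R], of a] a by (simp add: norm_mult)
  have ne: "z + of_real a * k z \<noteq> 0" using den_pos a z(2) \<sigma> by auto
  have ne2: "z - of_real \<sigma> \<noteq> 0" using z(1) R by auto
  have lower: "R / 2 \<le> cmod (z + of_real a * k z)"
  proof -
    have "cmod z - cmod (of_real a * k z) \<le> cmod (z + of_real a * k z)" by (rule norm_diff_ineq)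
    then show ?thesis using ak zR R by (simp add: mult.assoc)
  qed
  have "hres a z - 1 / (z - of_real \<sigma>) = - (of_real \<sigma> + of_real a * k z) / ((z + of_real a * k z) * (z - of_real \<sigma>))"
    unfolding hres_def using ne ne2 by (simp add: field_simps)
  then have "cmod (hres a z - 1 / (z - of_real \<sigma>)) = cmod (of_real \<sigma> + of_real a * k z) / (cmod (z + of_real a * k z) * R)"
    by (simp only: norm_divide norm_mult z(1) norm_minus_cancel)
  also have "\<dots> \<le> (1 + 2 * a * K 0) / (R / 2 * R)"
  proof (rule frac_le)
    show "cmod (of_real \<sigma> + of_real a * k z) \<le> 1 + 2 * a * K 0"
      using norm_triangle_ineq[of "of_real \<sigma>" "of_real a * k z"] ak \<sigma> by simp
    show "R / 2 * R \<le> cmod (z + of_real a * k z) * R" using lower R by (intro mult_right_mono) auto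
  qed (use R a K0 in auto)
  also have "\<dots> = 2 * (1 + 2 * a * K 0) / R\<^sup>2" by (simp add: power2_eq_square)
  finally show ?thesis .
qed

text \<open>Cauchy's theorem on a half disc, where \<open>hres a z\<close> is close to \<open>1 / (z - \<sigma>)\<close> on the arc.\<close>
lemma integral_hres_line:
  assumes a: "0 < a" and R: "1 \<le> R" "4 * a * K 0 \<le> R" and \<sigma>: "0 < \<sigma>" "\<sigma> \<le> 1"
  shows "cmod (integral {-R..R} (\<lambda>\<omega>. hres a (Complex \<sigma> \<omega>)) - pi) \<le> 2 * (1 + 2 * a * K 0) * pi / R"
proof -
  let ?C = "part_circlepath (of_real \<sigma>) R (- (pi/2)) (pi/2)"
  let ?L = "linepath (Complex \<sigma> (-R)) (Complex \<sigma> R)"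
  let ?S = "{z. 0 < Re z}"
  have c: "exp (\<i> * of_real (pi/2)) = \<i>" by (metis cis_conv_exp cis_pi_half)
  have c': "exp (\<i> * of_real (- (pi/2))) = - \<i>" using cis_conv_exp[of "- (pi/2)"] by (simp add: complex_eq_iff)
  have ends: "pathstart ?C = Complex \<sigma> (-R)" "pathfinish ?C = Complex \<sigma> R"
    unfolding pathstart_part_circlepath pathfinish_part_circlepath using c c' by (auto simp: complex_eq_iff)
  have im: "\<sigma> \<le> Re z" if z: "z \<in> path_image ?C" for z
  proof -
    obtain x where x: "x \<in> {- (pi/2)..pi/2}" "z = of_real \<sigma> + of_real R * cis x"
    proof -
      have cs: "closed_segment (- (pi/2)) (pi/2) = {- (pi/2)..pi/2}" using pi_ge_zero by (simp add: closed_segment_eq_real_ivl)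
      have "z \<in> (\<lambda>x. of_real \<sigma> + of_real R * cis x) ` {- (pi/2)..pi/2}"
        using z unfolding path_image_part_circlepath' cs .
      then show ?thesis using that by blast
    qed
    then have "0 \<le> R * cos x" using R by (intro mult_nonneg_nonneg cos_ge_zero) auto
    then show ?thesis by (simp add: x(2))
  qed
  have Cin: "path_image ?C \<subseteq> ?S" using im \<sigma> by fastforce
  have Lin: "path_image ?L \<subseteq> ?S"
    unfolding path_image_linepath by (rule closed_segment_subset) (use \<sigma> in \<open>auto simp: convex_halfspace_Re_gt\<close>)
  have "(hres a has_contour_integral 0) (?C +++ reversepath ?L)"
    by (rule Cauchy_theorem_convex_simple[OF holomorphic_hres[OF a]])
       (use Cin Lin ends in \<open>auto simp: convex_halfspace_Re_gt path_image_join closed_segment_commute intro!: valid_path_join\<close>)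
  moreover have hC: "hres a contour_integrable_on ?C" and hL: "hres a contour_integrable_on ?L"
    using Cin Lin holomorphic_on_imp_continuous_on[OF holomorphic_hres[OF a]] 
    by (auto intro!: contour_integrable_continuous_part_circlepath contour_integrable_continuous_linepath intro: continuous_on_subset)
  moreover have "contour_integral (?C +++ reversepath ?L) (hres a)
      = contour_integral ?C (hres a) + contour_integral (reversepath ?L) (hres a)"
    by (rule contour_integral_join) (use hC hL in \<open>auto simp del: reversepath_linepath intro: contour_integrable_reversepath\<close>)
  moreover have "contour_integral (reversepath ?L) (hres a) = - contour_integral ?L (hres a)"
    by (rule contour_integral_reversepath) simp
  ultimately have eq: "contour_integral ?L (hres a) = contour_integral ?C (hres a)"
    by (auto dest!: contour_integral_unique)
  \<comment> \<open>The arc is centred at \<open>\<sigma>\<close>, so the comparison function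
    integrates exactly over the half turn.\<close>
  have main: "((\<lambda>z. 1 / (z - of_real \<sigma>)) has_contour_integral (\<i> * of_real pi)) ?C"
  proof -
    have "((\<lambda>t. 1 / (complex_of_real \<sigma> + R * cis t - complex_of_real \<sigma>) * R * \<i> * cis t) has_integral (\<i> * of_real pi)) {- (pi/2)..pi/2}"
    proof -
      have "(\<lambda>t. 1 / (complex_of_real \<sigma> + R * cis t - complex_of_real \<sigma>) * R * \<i> * cis t) = (\<lambda>t. \<i>)"
        using R by (auto simp: fun_eq_iff)
      then show ?thesis using has_integral_const_real[of \<i> "- (pi/2)" "pi/2"]
        by (simp add: scaleR_conv_of_real mult.commute)
    qed
    then show ?thesis by (subst has_contour_integral_part_circlepath_iff) auto
  qed
  have "((\<lambda>z. hres a z - 1 / (z - of_real \<sigma>)) has_contour_integral (contour_integral ?C (hres a) - \<i> * of_real pi)) ?C"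
    by (intro has_contour_integral_diff has_contour_integral_integral hC main)
  \<comment> \<open>An integrand of order \<open>1 / R\<^sup>2\<close> on an arc of length
    \<open>pi * R\<close>: the error is of order \<open>1 / R\<close> and does not depend on
    \<open>\<sigma>\<close>.\<close>
  then have "cmod (contour_integral ?C (hres a) - \<i> * of_real pi) \<le> 2 * (1 + 2 * a * K 0) / R\<^sup>2 * R * (pi/2 - - (pi/2))"
  proof (rule has_contour_integral_bound_part_circlepath)
    fix z assume z: "z \<in> path_image ?C"
    show "cmod (hres a z - 1 / (z - of_real \<sigma>)) \<le> 2 * (1 + 2 * a * K 0) / R\<^sup>2"
      by (rule norm_hres_sub_le[OF a R \<sigma> _ im[OF z]])
         (use in_path_image_part_circlepath[OF z] R in auto)
  qed (use R a nonneg[of 0] in auto)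
  also have "\<dots> = 2 * (1 + 2 * a * K 0) * pi / R" using R by (simp add: power2_eq_square)
  finally have b: "cmod (contour_integral ?L (hres a) - \<i> * of_real pi) \<le> 2 * (1 + 2 * a * K 0) * pi / R" by (simp only: eq)
  have "contour_integral ?L (hres a) = \<i> * integral {-R..R} (\<lambda>x. hres a (Complex \<sigma> x))"
    by (rule contour_integral_linepath_same_Re) (use R in auto)
  then have "contour_integral ?L (hres a) - \<i> * of_real pi = \<i> * (integral {-R..R} (\<lambda>x. hres a (Complex \<sigma> x)) - of_real pi)"
    by (simp add: algebra_simps)
  then show ?thesis using b by (simp add: norm_mult)
qed

lemma continuous_on_hres_line:
  assumes "0 < a" "0 < \<sigma>" shows "continuous_on A (\<lambda>\<omega>. hres a (Complex \<sigma> \<omega>))"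
proof -
  have "continuous_on UNIV (\<lambda>\<omega>. hres a (Complex \<sigma> \<omega>))"
    by (rule continuous_on_compose2[OF holomorphic_on_imp_continuous_on[OF holomorphic_hres[OF assms(1)]]])
       (use assms in \<open>auto simp: Complex_eq intro!: continuous_intros\<close>)
  then show ?thesis by (rule continuous_on_subset) simp
qed

lemma measurable_hres [measurable]: "hres a \<in> borel_measurable borel"
  unfolding hres_def by measurable

lemma measurable_hres_line [measurable]:
  "(\<lambda>\<omega>. Re (hres a (Complex \<sigma> \<omega>))) \<in> borel_measurable borel"
  unfolding Complex_eq by measurable

text \<open>The limit \<open>\<sigma> \<rightarrow> 0\<close> of \<open>integral_hres_line\<close>.
  For \<open>\<omega> \<noteq> 0\<close> the integrands converge because \<open>k\<close> is
  continuous up to the punctured axis, and \<open>Re_k_ge\<close> bounds them by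
  \<open>1 / (a * c)\<close> on the bounded interval. The error estimate survives since it is
  uniform in \<open>\<sigma>\<close>.\<close>

lemma Re_hres_axis_integral:
  assumes a: "0 < a" and R: "1 \<le> R" "4 * a * K 0 \<le> R"
  shows "integrable lborel (\<lambda>\<omega>. indicator {-R..R} \<omega> * Re (hres a (Complex 0 \<omega>)))"
    and "\<bar>(\<integral>\<omega>. indicator {-R..R} \<omega> * Re (hres a (Complex 0 \<omega>)) \<partial>lborel) - pi\<bar> \<le> 2 * (1 + 2 * a * K 0) * pi / R"
proof -
  obtain c where c: "c > 0" "\<And>\<sigma> \<omega>. 0 \<le> \<sigma> \<Longrightarrow> \<sigma> \<le> 1 \<Longrightarrow> \<omega> \<noteq> 0 \<Longrightarrow> \<bar>\<omega>\<bar> \<le> R \<Longrightarrow> c \<le> Re (k (Complex \<sigma> \<omega>))"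
    using Re_k_ge[of R] R by auto
  let ?e = "\<lambda>n. inverse (real (Suc n))"
  let ?s = "\<lambda>n \<omega>. indicator {-R..R} \<omega> * Re (hres a (Complex (?e n) \<omega>))"
  let ?f = "\<lambda>\<omega>. indicator {-R..R} \<omega> * Re (hres a (Complex 0 \<omega>))"
  have e: "0 < ?e n" "?e n \<le> 1" for n by (auto simp: field_simps)
  have ne: "AE \<omega> in lborel. \<omega> \<noteq> (0::real)" by (rule AE_lborel_singleton)
  have bd: "AE \<omega> in lborel. norm (?s n \<omega>) \<le> indicator {-R..R} \<omega> * (1 / (a * c))" for n
    using ne
  proof eventually_elim
    case (elim \<omega>)
    show ?case
    proof (cases "\<omega> \<in> {-R..R}")
      case True
      have "a * c \<le> Re (Complex (?e n) \<omega> + of_real a * k (Complex (?e n) \<omega>))"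
        using c(2)[of "?e n" \<omega>] True e[of n] elim a by (auto simp: add_increasing)
      from Re_le_norm_inverse[OF _ this] have "cmod (hres a (Complex (?e n) \<omega>)) \<le> 1 / (a * c)"
        using a c by (simp add: hres_def)
      then show ?thesis using True abs_Re_le_cmod[of "hres a (Complex (?e n) \<omega>)"] by simp
    qed simp
  qed
  have lim: "AE \<omega> in lborel. (\<lambda>n. ?s n \<omega>) \<longlonglongrightarrow> ?f \<omega>"
    using ne
  proof eventually_elim
    case (elim \<omega>)
    have "(\<lambda>n. Complex (?e n) \<omega>) \<longlonglongrightarrow> Complex 0 \<omega>"
      by (intro tendsto_Complex LIMSEQ_inverse_real_of_nat tendsto_const)
    then have kc: "(\<lambda>n. k (Complex (?e n) \<omega>)) \<longlonglongrightarrow> k (Complex 0 \<omega>)"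
      by (rule continuous_on_tendsto_compose[OF continuous_on_k])
         (use elim e in \<open>auto simp: complex_eq_iff intro!: always_eventually less_imp_le\<close>)
    have "msym a \<omega> \<noteq> 0" using msym_nonzero[OF a elim] .
    then have nz: "Complex 0 \<omega> + of_real a * k (Complex 0 \<omega>) \<noteq> 0" by (simp add: msym_def Complex_eq)
    have "(\<lambda>n. hres a (Complex (?e n) \<omega>)) \<longlonglongrightarrow> hres a (Complex 0 \<omega>)"
      unfolding hres_def
      by (intro tendsto_divide tendsto_add tendsto_mult tendsto_const kc nz tendsto_Complex LIMSEQ_inverse_real_of_nat)
    then show ?case by (intro tendsto_mult tendsto_const tendsto_Re)
  qed
  have dom: "integrable lborel (\<lambda>\<omega>. indicator {-R..R} \<omega> * (1 / (a * c)))"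
    by (intro integrable_mult_left) (auto simp: emeasure_lborel_Icc_eq)
  have ms: "?s n \<in> borel_measurable lborel" for n by simp
  have mf: "?f \<in> borel_measurable lborel" by simp
  show "integrable lborel ?f"
    by (rule integrable_dominated_convergence[OF mf ms dom lim bd])
  have conv: "(\<lambda>n. \<integral>\<omega>. ?s n \<omega> \<partial>lborel) \<longlonglongrightarrow> (\<integral>\<omega>. ?f \<omega> \<partial>lborel)"
    by (rule integral_dominated_convergence[OF mf ms dom lim bd])
  have "\<bar>(\<integral>\<omega>. ?s n \<omega> \<partial>lborel) - pi\<bar> \<le> 2 * (1 + 2 * a * K 0) * pi / R" for n
  proof -
    let ?h = "\<lambda>\<omega>. hres a (Complex (?e n) \<omega>)"
    have co: "continuous_on {-R..R} ?h" by (intro continuous_on_hres_line a e)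
    have "set_integrable lborel {-R..R} ?h" unfolding set_integrable_def by (rule borel_integrable_compact[OF _ co]) simp
    then have si: "set_integrable lborel {-R..R} ?h" .
    have hk: "integral {-R..R} ?h = (\<integral>\<omega>. indicator {-R..R} \<omega> *\<^sub>R ?h \<omega> \<partial>lborel)"
      using set_borel_integral_eq_integral(2)[OF si] by (simp add: set_lebesgue_integral_def)
    have "(\<integral>\<omega>. ?s n \<omega> \<partial>lborel) = Re (\<integral>\<omega>. indicator {-R..R} \<omega> *\<^sub>R ?h \<omega> \<partial>lborel)"
      using si by (subst integral_Re[symmetric]) (auto simp: set_integrable_def)
    then have "(\<integral>\<omega>. ?s n \<omega> \<partial>lborel) - pi = Re (integral {-R..R} ?h - of_real pi)" using hk by simp
    then show ?thesis
      using abs_Re_le_cmod[of "integral {-R..R} ?h - of_real pi"] integral_hres_line[OF a R e[of n]] by simp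
  qed
  moreover have "(\<lambda>n. \<bar>(\<integral>\<omega>. ?s n \<omega> \<partial>lborel) - pi\<bar>) \<longlonglongrightarrow> \<bar>(\<integral>\<omega>. ?f \<omega> \<partial>lborel) - pi\<bar>"
    by (intro tendsto_rabs tendsto_diff conv tendsto_const)
  ultimately show "\<bar>(\<integral>\<omega>. ?f \<omega> \<partial>lborel) - pi\<bar> \<le> 2 * (1 + 2 * a * K 0) * pi / R"
    by (intro LIMSEQ_le_const2) auto
qed

lemma Re_hres_axis: "Re (hres a (Complex 0 \<omega>)) = a * pi * (kappa \<omega> / (cmod (msym a \<omega>))\<^sup>2)"
proof -
  have "hres a (Complex 0 \<omega>) = 1 / msym a \<omega>" by (simp add: hres_def msym_def Complex_eq)
  then show ?thesis by (simp add: Re_divide cmod_power2 kappa_def msym_def)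
qed

text \<open>The integrals over \<open>[-R, R]\<close> of the real part of the inverse symbol differ
  from \<open>pi\<close> by \<open>O(1 / R)\<close>; its positivity turns this symmetric limit into
  a Lebesgue integral by monotone convergence. Dividing by \<open>a * pi\<close> leaves a mass that
  does not depend on \<open>K\<close>.\<close>

theorem nn_integral_spectral_density:
  assumes a: "0 < a"
  shows "(\<integral>\<^sup>+\<omega>. ennreal (kappa \<omega> / (cmod (msym a \<omega>))\<^sup>2) \<partial>lborel) = ennreal (1 / a)"
proof -
  let ?f = "\<lambda>\<omega>. Re (hres a (Complex 0 \<omega>))"
  let ?C = "2 * (1 + 2 * a * K 0) * pi"
  have f0: "0 \<le> ?f \<omega>" for \<omega> unfolding Re_hres_axis using a kappa_nonneg by simp
  have "(\<lambda>n. \<integral>\<^sup>+\<omega>. ennreal (indicator {- real n..real n} \<omega> * ?f \<omega>) \<partial>lborel) \<longlonglongrightarrow> (\<integral>\<^sup>+\<omega>. ennreal (?f \<omega>) \<partial>lborel)"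
  proof (rule nn_integral_LIMSEQ)
    show "incseq (\<lambda>n \<omega>. ennreal (indicator {- real n..real n} \<omega> * ?f \<omega>))"
      by (auto simp: incseq_def le_fun_def indicator_def f0)
    fix \<omega> :: real
    have "\<forall>\<^sub>F n in sequentially. ennreal (?f \<omega>) = ennreal (indicator {- real n..real n} \<omega> * ?f \<omega>)"
      using eventually_ge_at_top[of "nat \<lceil>\<bar>\<omega>\<bar>\<rceil>"]
    proof eventually_elim
      case (elim n)
      then have "\<bar>\<omega>\<bar> \<le> real n" by linarith
      then have "\<omega> \<in> {- real n..real n}" by auto
      then show ?case by simp
    qed
    then show "(\<lambda>n. ennreal (indicator {- real n..real n} \<omega> * ?f \<omega>)) \<longlonglongrightarrow> ennreal (?f \<omega>)"
      by (rule Lim_transform_eventually[OF tendsto_const])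
  qed simp
  moreover have "(\<lambda>n. \<integral>\<^sup>+\<omega>. ennreal (indicator {- real n..real n} \<omega> * ?f \<omega>) \<partial>lborel) \<longlonglongrightarrow> ennreal pi"
  proof -
    let ?I = "\<lambda>n. \<integral>\<omega>. indicator {- real n..real n} \<omega> * ?f \<omega> \<partial>lborel"
    have ev: "\<forall>\<^sub>F n in sequentially. 1 \<le> real n \<and> 4 * a * K 0 \<le> real n"
      using eventually_ge_at_top[of "max 1 (nat \<lceil>4 * a * K 0\<rceil>)"]
      by eventually_elim (auto simp: nat_ceiling_le_eq)
    have "?I \<longlonglongrightarrow> pi"
    proof (rule LIM_zero_cancel, rule Lim_null_comparison)
      show "\<forall>\<^sub>F n in sequentially. norm (?I n - pi) \<le> ?C / real n"
        using ev by eventually_elim (use Re_hres_axis_integral(2)[OF a] in auto)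
      show "(\<lambda>n. ?C / real n) \<longlonglongrightarrow> 0" by (rule lim_const_over_n)
    qed
    then have "(\<lambda>n. ennreal (?I n)) \<longlonglongrightarrow> ennreal pi" by (rule tendsto_ennrealI)
    moreover have "\<forall>\<^sub>F n in sequentially. ennreal (?I n) = (\<integral>\<^sup>+\<omega>. ennreal (indicator {- real n..real n} \<omega> * ?f \<omega>) \<partial>lborel)"
      using ev
    proof eventually_elim
      case (elim n)
      show ?case
        by (subst nn_integral_eq_integral) (use Re_hres_axis_integral(1)[OF a] elim f0 in auto)
    qed
    ultimately show ?thesis by (rule Lim_transform_eventually)
  qed
  ultimately have "(\<integral>\<^sup>+\<omega>. ennreal (?f \<omega>) \<partial>lborel) = ennreal pi" by (rule LIMSEQ_unique)
  then have "ennreal (a * pi) * (\<integral>\<^sup>+\<omega>. ennreal (kappa \<omega> / (cmod (msym a \<omega>))\<^sup>2) \<partial>lborel) = ennreal (a * pi) * ennreal (1 / a)"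
    unfolding Re_hres_axis using a kappa_nonneg
    by (subst nn_integral_cmult[symmetric]) (auto simp: ennreal_mult[symmetric])
  then show ?thesis using a by (simp add: ennreal_mult_cancel_left)
qed

lemma has_bochner_integral_spectral_density:
  assumes a: "0 < a"
  shows "has_bochner_integral lborel (\<lambda>\<omega>. kappa \<omega> / (cmod (msym a \<omega>))\<^sup>2) (1 / a)"
  by (rule has_bochner_integral_nn_integral)
     (use nn_integral_spectral_density[OF a] a kappa_nonneg in auto)

end

section \<open>Schwartz functions and test functions\<close>

text \<open>A candidate sequence for all derivatives is checked one differentiation at a time. This
  yields smoothness and the iterated \<open>vderiv\<close> together.\<close>

lemma smooth_derivI:
  assumes "F 0 = f" and d: "\<And>n t. (F n has_vector_derivative F (Suc n) t) (at t)"
  shows "smooth_on UNIV f" and "(vderiv ^^ n) f = F n"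
proof -
  have v: "(vderiv ^^ n) f = F n" for n
  proof (induction n)
    case (Suc n)
    have "vderiv (F n) = F (Suc n)" unfolding vderiv_def using d by (intro ext vector_derivative_at)
    then show ?case using Suc by simp
  qed (use assms in simp)
  then show "(vderiv ^^ n) f = F n" .
  show "smooth_on UNIV f" unfolding smooth_on_def v using d
    by (auto intro: differentiableI_vector)
qed

section \<open>Calculus of iterated derivatives\<close>

lemma smooth_has_deriv:
  assumes "smooth_on UNIV f"
  shows "((vderiv ^^ n) f has_vector_derivative (vderiv ^^ Suc n) f t) (at t)"
  using assms unfolding smooth_on_def by (auto simp: vderiv_def vector_derivative_works[symmetric])

lemma smooth_vderiv: "smooth_on UNIV f \<Longrightarrow> smooth_on UNIV (vderiv f)"
  unfolding smooth_on_def by (metis funpow_Suc_right o_apply)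

lemma smooth_continuous: "smooth_on UNIV f \<Longrightarrow> continuous_on A ((vderiv ^^ n) f)"
  using smooth_has_deriv has_vector_derivative_continuous continuous_at_imp_continuous_on by metis

lemma smooth_lincomb:
  fixes f g :: "real \<Rightarrow> complex"
  assumes "smooth_on UNIV f" "smooth_on UNIV g"
  shows "smooth_on UNIV (\<lambda>t. a * f t + b * g t)"
    and "(vderiv ^^ n) (\<lambda>t. a * f t + b * g t) = (\<lambda>t. a * (vderiv ^^ n) f t + b * (vderiv ^^ n) g t)"
proof -
  let ?F = "\<lambda>n t. a * (vderiv ^^ n) f t + b * (vderiv ^^ n) g t"
  have F0: "?F 0 = (\<lambda>t. a * f t + b * g t)" by simp
  have d: "(?F n has_vector_derivative ?F (Suc n) t) (at t)" for n t
    by (intro has_vector_derivative_add has_vector_derivative_mult_right smooth_has_deriv assms)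
  show "smooth_on UNIV (\<lambda>t. a * f t + b * g t)" using F0 d by (rule smooth_derivI)
  show "(vderiv ^^ n) (\<lambda>t. a * f t + b * g t) = ?F n" using F0 d by (rule smooth_derivI)
qed

lemma smooth_affine:
  fixes f :: "real \<Rightarrow> 'b::real_normed_vector"
  assumes "smooth_on UNIV f"
  shows "smooth_on UNIV (\<lambda>t. f (c * t + d))"
proof -
  let ?F = "\<lambda>n t. (c ^ n) *\<^sub>R (vderiv ^^ n) f (c * t + d)"
  have "(?F n has_vector_derivative ?F (Suc n) t) (at t)" for n t
  proof -
    have "((\<lambda>t. c * t + d) has_vector_derivative c) (at t)" by (auto intro!: derivative_eq_intros)
    from vector_diff_chain_at[OF this smooth_has_deriv[OF assms, of n]]
    have "((\<lambda>t. (vderiv ^^ n) f (c * t + d)) has_vector_derivative c *\<^sub>R (vderiv ^^ Suc n) f (c * t + d)) (at t)"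
      by (simp add: o_def)
    from bounded_linear.has_vector_derivative[OF bounded_linear_scaleR_right[of "c ^ n"] this]
    show ?thesis by (simp add: mult.commute)
  qed
  then show ?thesis by (rule smooth_derivI(1)[rotated]) simp
qed

lemma smooth_of_real:
  fixes f :: "real \<Rightarrow> real"
  assumes "smooth_on UNIV f"
  shows "smooth_on UNIV (\<lambda>t. complex_of_real (f t))"
proof (rule smooth_derivI(1)[where F="\<lambda>n t. of_real ((vderiv ^^ n) f t)"])
  show "((\<lambda>t. complex_of_real ((vderiv ^^ n) f t)) has_vector_derivative of_real ((vderiv ^^ Suc n) f t)) (at t)" for n t
    by (rule has_vector_derivative_of_real)
      (use smooth_has_deriv[OF assms] in \<open>simp add: has_real_derivative_iff_has_vector_derivative\<close>)
qed simp

text \<open>Coinduction for smoothness: membership in a class of differentiable functions that is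
  stable under \<open>vderiv\<close>.\<close>

lemma smooth_closedI:
  assumes S: "\<And>f. f \<in> S \<Longrightarrow> (\<forall>t. f differentiable (at t)) \<and> vderiv f \<in> S" and "f \<in> S"
  shows "smooth_on UNIV f"
proof -
  have "(vderiv ^^ n) f \<in> S" for n by (induction n) (use assms in auto)
  then show ?thesis unfolding smooth_on_def using S by blast
qed

text \<open>Sums of products of smooth functions. By the product rule this class is stable under
  differentiation, which replaces the binomial formula for higher derivatives of a product.\<close>

inductive_set smooth_products :: "(real \<Rightarrow> complex) set" where
  prod: "smooth_on UNIV f \<Longrightarrow> smooth_on UNIV g \<Longrightarrow> (\<lambda>t. f t * g t) \<in> smooth_products"
| add: "f \<in> smooth_products \<Longrightarrow> g \<in> smooth_products \<Longrightarrow> (\<lambda>t. f t + g t) \<in> smooth_products"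

lemma smooth_mult:
  fixes f g :: "real \<Rightarrow> complex"
  assumes "smooth_on UNIV f" "smooth_on UNIV g"
  shows "smooth_on UNIV (\<lambda>t. f t * g t)"
proof (rule smooth_closedI[of smooth_products])
  show "(\<lambda>t. f t * g t) \<in> smooth_products" using assms by (rule smooth_products.prod)
next
  fix h assume "h \<in> smooth_products"
  then show "(\<forall>t. h differentiable (at t)) \<and> vderiv h \<in> smooth_products"
  proof induction
    case (prod f g)
    have d: "((\<lambda>t. f t * g t) has_vector_derivative f t * vderiv g t + vderiv f t * g t) (at t)" for t
      using smooth_has_deriv[OF prod(1), of 0 t] smooth_has_deriv[OF prod(2), of 0 t]
      by (intro has_vector_derivative_mult) auto
    then have "vderiv (\<lambda>t. f t * g t) = (\<lambda>t. f t * vderiv g t + vderiv f t * g t)"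
      unfolding vderiv_def by (intro ext vector_derivative_at) (simp add: vderiv_def)
    moreover have "(\<lambda>t. f t * vderiv g t + vderiv f t * g t) \<in> smooth_products"
      by (intro smooth_products.intros prod smooth_vderiv)
    ultimately show ?case using d differentiableI_vector by metis
  next
    case (add f g)
    have d: "((\<lambda>t. f t + g t) has_vector_derivative vderiv f t + vderiv g t) (at t)" for t
      using add.IH by (intro has_vector_derivative_add) (auto simp: vderiv_def vector_derivative_works[symmetric])
    then have "vderiv (\<lambda>t. f t + g t) = (\<lambda>t. vderiv f t + vderiv g t)"
      unfolding vderiv_def by (intro ext vector_derivative_at) (simp add: vderiv_def)
    then show ?case using d differentiableI_vector smooth_products.add add.IH by metis
  qed
qed

lemma smooth_id: "smooth_on UNIV complex_of_real"
  by (rule smooth_derivI(1)[where F="\<lambda>n t. if n = 0 then of_real t else if n = 1 then 1 else 0"])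
     (auto intro!: derivative_eq_intros has_vector_derivative_of_real simp: fun_eq_iff)

text \<open>The function \<open>exp (- 1 / x)\<close>, extended by zero, with a polynomial factor in
  \<open>1 / x\<close>. Differentiation maps \<open>p\<close> to \<open>y\<^sup>2 * (p - p')\<close>
  in the variable \<open>y = 1 / x\<close>, so the family is closed under derivatives, also at the
  origin.\<close>

definition flat_exp :: "real poly \<Rightarrow> real \<Rightarrow> real" where
  "flat_exp p x = (if 0 < x then poly p (1 / x) * exp (- (1 / x)) else 0)"

lemma poly_exp_at_top: "((\<lambda>y. poly p y * exp (- y)) \<longlongrightarrow> (0::real)) at_top"
proof -
  have "((\<lambda>y. \<Sum>i\<le>degree p. coeff p i * (y ^ i / exp y)) \<longlongrightarrow> (\<Sum>i\<le>degree p. coeff p i * 0)) at_top"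
    by (intro tendsto_sum tendsto_mult tendsto_const tendsto_power_div_exp_0)
  then show ?thesis by (simp add: poly_altdef exp_minus divide_inverse sum_distrib_right mult.assoc)
qed

lemma flat_exp_deriv:
  "(flat_exp p has_real_derivative flat_exp ([:0,0,1:] * (p - pderiv p)) x) (at x)"
proof -
  consider "x < 0" | "x = 0" | "0 < x" by linarith
  then show ?thesis
  proof cases
    case 1
    have "((\<lambda>_. 0) has_real_derivative 0) (at x)" by simp
    then have "(flat_exp p has_real_derivative 0) (at x)"
      by (rule has_field_derivative_transform_within_open[of _ _ _ "{..<0}"])
         (use 1 in \<open>auto simp: flat_exp_def\<close>)
    then show ?thesis using 1 by (simp add: flat_exp_def)
  next
    case 2
    have "((\<lambda>h. flat_exp p h / h) \<longlongrightarrow> 0) (at 0)"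
    proof -
      have "((\<lambda>h. flat_exp p h / h) \<longlongrightarrow> 0) (at_left 0)"
      proof (rule Lim_transform_eventually[OF tendsto_const])
        show "\<forall>\<^sub>F h in at_left 0. 0 = flat_exp p h / h"
          by (auto simp: eventually_at_filter flat_exp_def)
      qed
      moreover have "((\<lambda>h. flat_exp p h / h) \<longlongrightarrow> 0) (at_right 0)"
      proof -
        \<comment> \<open>The difference quotient at the origin is again of the same form: dividing
          by \<open>h\<close> multiplies the polynomial by its variable, which is
          \<open>pCons 0 p\<close>.\<close>
        have "((\<lambda>h. poly (pCons 0 p) (inverse h) * exp (- inverse h)) \<longlongrightarrow> 0) (at_right 0)"
          by (rule filterlim_compose[OF poly_exp_at_top filterlim_inverse_at_top_right])
        then show ?thesis
          by (rule Lim_transform_eventually)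
             (auto simp: eventually_at_filter flat_exp_def field_simps)
      qed
      ultimately show ?thesis by (simp add: filterlim_at_split)
    qed
    then show ?thesis using 2 by (simp add: has_field_derivative_iff flat_exp_def)
  next
    case 3
    have "((\<lambda>x. poly p (1 / x) * exp (- (1 / x))) has_real_derivative
        poly ([:0,0,1:] * (p - pderiv p)) (1 / x) * exp (- (1 / x))) (at x)"
      using 3 by (auto intro!: derivative_eq_intros DERIV_chain2[OF poly_DERIV] simp: field_simps power2_eq_square)
    then have "(flat_exp p has_real_derivative poly ([:0,0,1:] * (p - pderiv p)) (1 / x) * exp (- (1 / x))) (at x)"
      by (rule has_field_derivative_transform_within_open[of _ _ _ "{0<..}"])
         (use 3 in \<open>auto simp: flat_exp_def\<close>)
    then show ?thesis using 3 by (simp add: flat_exp_def)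
  qed
qed

lemma smooth_flat_exp: "smooth_on UNIV (flat_exp p)"
proof (rule smooth_derivI(1)[where F="\<lambda>n. flat_exp (((\<lambda>p. [:0,0,1:] * (p - pderiv p)) ^^ n) p)"])
  show "(flat_exp (((\<lambda>p. [:0,0,1:] * (p - pderiv p)) ^^ n) p) has_vector_derivative
    flat_exp (((\<lambda>p. [:0,0,1:] * (p - pderiv p)) ^^ Suc n) p) t) (at t)" for n t
    using flat_exp_deriv by (simp add: has_real_derivative_iff_has_vector_derivative[symmetric])
qed simp

text \<open>Smooth, supported in \<open>[a, b]\<close>, and increasing to the indicator of \<open>(a, b)\<close> as \<open>n \<rightarrow> \<infinity>\<close>.\<close>
definition bump :: "real \<Rightarrow> real \<Rightarrow> nat \<Rightarrow> real \<Rightarrow> complex" where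
  "bump a b n x = of_real (flat_exp 1 (real n * (x - a))) * of_real (flat_exp 1 (real n * (b - x)))"

lemma smooth_bump: "smooth_on UNIV (bump a b n)"
proof -
  have "smooth_on UNIV (\<lambda>x. complex_of_real (flat_exp 1 (real n * x + - real n * a)) * complex_of_real (flat_exp 1 (- real n * x + real n * b)))"
    by (intro smooth_mult smooth_of_real smooth_affine smooth_flat_exp)
  then show ?thesis unfolding bump_def by (simp add: algebra_simps)
qed

lemma bump_outside: "x \<notin> {a<..<b} \<Longrightarrow> bump a b n x = 0"
proof -
  have "flat_exp 1 (real n * y) = 0" if "y \<le> 0" for y using that
    by (simp add: flat_exp_def zero_less_mult_iff)
  then show "x \<notin> {a<..<b} \<Longrightarrow> bump a b n x = 0" by (auto simp: bump_def not_less)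
qed

lemma test_bump: "bump a b n \<in> test_functions"
proof -
  have "bump a b n t = 0" if "max \<bar>a\<bar> \<bar>b\<bar> < \<bar>t\<bar>" for t
    by (rule bump_outside) (use that in \<open>auto simp: abs_if split: if_splits\<close>)
  then show ?thesis unfolding test_functions_def using smooth_bump by blast
qed

lemma norm_bump_le: "cmod (bump a b n x) \<le> indicator {a<..<b} x"
proof (cases "x \<in> {a<..<b}")
  case True
  have "\<bar>flat_exp 1 y\<bar> \<le> 1" for y by (simp add: flat_exp_def)
  then have "\<bar>flat_exp 1 y\<bar> * \<bar>flat_exp 1 z\<bar> \<le> 1 * 1" for y z by (intro mult_mono) auto
  then show ?thesis using True by (simp add: bump_def norm_mult)
qed (simp add: bump_outside)

lemma bump_limit: "(\<lambda>n. bump a b n x) \<longlonglongrightarrow> indicator {a<..<b} x"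
proof (cases "x \<in> {a<..<b}")
  case True
  have "(\<lambda>n. flat_exp 1 (real n * y)) \<longlonglongrightarrow> 1" if "0 < y" for y
  proof -
    have "(\<lambda>n. exp (- (1 / (real n * y)))) \<longlonglongrightarrow> exp (- 0)"
      using that by (intro tendsto_exp tendsto_minus) real_asymp
    moreover have "\<forall>\<^sub>F n in sequentially. exp (- (1 / (real n * y))) = flat_exp 1 (real n * y)"
      using eventually_gt_at_top[of 0] by eventually_elim (use that in \<open>auto simp: flat_exp_def\<close>)
    ultimately show ?thesis using Lim_transform_eventually by fastforce
  qed
  then have "(\<lambda>n. bump a b n x) \<longlonglongrightarrow> of_real 1 * of_real 1"
    unfolding bump_def using True by (intro tendsto_mult tendsto_of_real) auto
  then show ?thesis using True by simp
qed (simp add: bump_outside)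

lemma test_deriv_outside:
  assumes "smooth_on UNIV \<phi>" "\<And>t. R < \<bar>t\<bar> \<Longrightarrow> \<phi> t = 0" "R < \<bar>t\<bar>"
  shows "(vderiv ^^ n) \<phi> t = 0"
  using assms(3)
proof (induction n arbitrary: t)
  case (Suc n)
  have op: "open {t. R < \<bar>t\<bar>}" by (intro open_Collect_less continuous_intros)
  have "((\<lambda>_. 0) has_vector_derivative 0) (at t)" by simp
  then have "((vderiv ^^ n) \<phi> has_vector_derivative 0) (at t)"
    by (rule has_vector_derivative_transform_within_open[OF _ op]) (use Suc in auto)
  then show ?case unfolding funpow.simps o_apply vderiv_def by (rule vector_derivative_at)
qed (use assms in simp)

lemma test_mult_smooth: "\<phi> \<in> test_functions \<Longrightarrow> smooth_on UNIV f \<Longrightarrow> (\<lambda>t. f t * \<phi> t) \<in> test_functions"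
  unfolding test_functions_def by (auto intro!: smooth_mult)

lemma test_schwartz: assumes "\<phi> \<in> test_functions" shows "\<phi> \<in> schwartz_space"
proof -
  obtain R where s: "smooth_on UNIV \<phi>" and R: "\<And>t. R < \<bar>t\<bar> \<Longrightarrow> \<phi> t = 0"
    using assms by (auto simp: test_functions_def)
  have "bdd_above (range (\<lambda>t. \<bar>t\<bar> ^ m * cmod ((vderiv ^^ n) \<phi> t)))" for m n
  proof -
    let ?f = "\<lambda>t. \<bar>t\<bar> ^ m * cmod ((vderiv ^^ n) \<phi> t)"
    have "continuous_on {-R..R} ?f" by (intro continuous_intros smooth_continuous s)
    then have "compact (?f ` {-R..R})" by (intro compact_continuous_image) auto
    then obtain B where B: "\<And>t. t \<in> {-R..R} \<Longrightarrow> ?f t \<le> B"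
    proof -
      assume *: "\<And>B. (\<And>t. t \<in> {-R..R} \<Longrightarrow> ?f t \<le> B) \<Longrightarrow> thesis"
      have "bdd_above (?f ` {-R..R})"
        using \<open>compact (?f ` {-R..R})\<close> by (intro bounded_imp_bdd_above compact_imp_bounded)
      then show thesis unfolding bdd_above_def using * by blast
    qed
    have "?f t \<le> max B 0" for t
    proof (cases "t \<in> {-R..R}")
      case False
      then have "R < \<bar>t\<bar>" by auto
      then show ?thesis using test_deriv_outside[OF s R] by simp
    qed (use B in \<open>auto simp: le_max_iff_disj\<close>)
    then show ?thesis by (auto intro!: bdd_aboveI)
  qed
  then show ?thesis using s by (simp add: schwartz_space_def)
qed

section \<open>Decay of Schwartz functions, and the Gaussians\<close>

lemma schwartz_smooth: "\<phi> \<in> schwartz_space \<Longrightarrow> smooth_on UNIV \<phi>"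
  by (simp add: schwartz_space_def)

lemma schwartz_le_seminorm:
  "\<phi> \<in> schwartz_space \<Longrightarrow> \<bar>t\<bar> ^ m * cmod ((vderiv ^^ n) \<phi> t) \<le> schwartz_seminorm m n \<phi>"
  unfolding schwartz_seminorm_def schwartz_space_def by (auto intro!: cSUP_upper)

lemma schwartz_bddI:
  assumes "smooth_on UNIV \<phi>" "\<And>m n. \<exists>B. \<forall>t. \<bar>t\<bar> ^ m * cmod ((vderiv ^^ n) \<phi> t) \<le> B"
  shows "\<phi> \<in> schwartz_space"
  unfolding schwartz_space_def using assms by (auto simp: bdd_above_def)

lemma schwartz_lincomb:
  assumes "\<phi> \<in> schwartz_space" "\<psi> \<in> schwartz_space"
  shows "(\<lambda>t. a * \<phi> t + b * \<psi> t) \<in> schwartz_space"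
proof (rule schwartz_bddI)
  show "smooth_on UNIV (\<lambda>t. a * \<phi> t + b * \<psi> t)" by (intro smooth_lincomb schwartz_smooth assms)
  fix m n
  have "\<bar>t\<bar> ^ m * cmod ((vderiv ^^ n) (\<lambda>t. a * \<phi> t + b * \<psi> t) t)
      \<le> cmod a * schwartz_seminorm m n \<phi> + cmod b * schwartz_seminorm m n \<psi>" for t
  proof -
    have "\<bar>t\<bar> ^ m * cmod (a * (vderiv ^^ n) \<phi> t + b * (vderiv ^^ n) \<psi> t)
        \<le> \<bar>t\<bar> ^ m * (cmod a * cmod ((vderiv ^^ n) \<phi> t) + cmod b * cmod ((vderiv ^^ n) \<psi> t))"
      by (intro mult_left_mono) (use norm_triangle_ineq in \<open>auto simp: norm_mult[symmetric]\<close>)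
    also have "\<dots> = cmod a * (\<bar>t\<bar> ^ m * cmod ((vderiv ^^ n) \<phi> t)) + cmod b * (\<bar>t\<bar> ^ m * cmod ((vderiv ^^ n) \<psi> t))"
      by (simp add: algebra_simps)
    also have "\<dots> \<le> cmod a * schwartz_seminorm m n \<phi> + cmod b * schwartz_seminorm m n \<psi>"
      by (intro add_mono mult_left_mono schwartz_le_seminorm assms) auto
    finally show ?thesis by (simp add: smooth_lincomb schwartz_smooth assms)
  qed
  then show "\<exists>B. \<forall>t. \<bar>t\<bar> ^ m * cmod ((vderiv ^^ n) (\<lambda>t. a * \<phi> t + b * \<psi> t) t) \<le> B" by blast
qed

lemma schwartz_vderiv: "\<phi> \<in> schwartz_space \<Longrightarrow> vderiv \<phi> \<in> schwartz_space"
  unfolding schwartz_space_def by (auto simp: smooth_vderiv) (metis funpow_Suc_right o_apply)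

lemma schwartz_deriv:
  "\<phi> \<in> schwartz_space \<Longrightarrow> (\<phi> has_vector_derivative vderiv \<phi> t) (at t)"
  using smooth_has_deriv[of \<phi> 0] schwartz_smooth by simp

lemma schwartz_continuous: "\<phi> \<in> schwartz_space \<Longrightarrow> continuous_on A \<phi>"
  using smooth_continuous[of \<phi> A 0] schwartz_smooth by simp

lemma schwartz_measurable: "\<phi> \<in> schwartz_space \<Longrightarrow> \<phi> \<in> borel_measurable borel"
  by (intro borel_measurable_continuous_onI schwartz_continuous)

text \<open>The majorant \<open>1 / (1 + t\<^sup>2)\<close> is integrable with integral
  \<open>pi\<close>. The two seminorms that appear are the ones that control continuity of the
  distributions below.\<close>

lemma schwartz_norm_le:
  assumes "\<phi> \<in> schwartz_space"
  shows "cmod (\<phi> t) \<le> (schwartz_seminorm 0 0 \<phi> + schwartz_seminorm 2 0 \<phi>) * inverse (1 + t\<^sup>2)"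
proof -
  have "(1 + t\<^sup>2) * cmod (\<phi> t) \<le> schwartz_seminorm 0 0 \<phi> + schwartz_seminorm 2 0 \<phi>"
    using schwartz_le_seminorm[OF assms, of t 0 0] schwartz_le_seminorm[OF assms, of t 2 0]
    by (simp add: algebra_simps)
  moreover have "0 < 1 + t\<^sup>2" by (simp add: add_pos_nonneg)
  ultimately show ?thesis by (simp add: field_simps)
qed

lemma schwartz_mult_t_norm_le:
  assumes "\<phi> \<in> schwartz_space"
  shows "\<bar>t\<bar> * cmod (\<phi> t) \<le> (schwartz_seminorm 1 0 \<phi> + schwartz_seminorm 3 0 \<phi>) * inverse (1 + t\<^sup>2)"
proof -
  have "(1 + t\<^sup>2) * (\<bar>t\<bar> * cmod (\<phi> t)) = \<bar>t\<bar> ^ 1 * cmod (\<phi> t) + \<bar>t\<bar> ^ 3 * cmod (\<phi> t)"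
    unfolding power2_abs[of t, symmetric] by (simp add: distrib_right power3_eq_cube power2_eq_square del: abs_mult_self_eq)
  then have "(1 + t\<^sup>2) * (\<bar>t\<bar> * cmod (\<phi> t)) \<le> schwartz_seminorm 1 0 \<phi> + schwartz_seminorm 3 0 \<phi>"
    using schwartz_le_seminorm[OF assms, of t 1 0] schwartz_le_seminorm[OF assms, of t 3 0] by simp
  moreover have "0 < 1 + t\<^sup>2" by (simp add: add_pos_nonneg)
  ultimately show ?thesis by (simp add: field_simps)
qed

lemma integrable_cauchy: "integrable lborel (\<lambda>t::real. inverse (1 + t\<^sup>2))"
  and integral_cauchy: "(\<integral>t. inverse (1 + (t::real)\<^sup>2) \<partial>lborel) = pi"
  using integrable_inverse_1_plus_square LBINT_inverse_1_plus_square
  by (simp_all add: set_integrable_def interval_lebesgue_integral_def set_lebesgue_integral_def einterval_eq_UNIV)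

lemma schwartz_integrable: assumes "\<phi> \<in> schwartz_space" shows "integrable lborel \<phi>"
proof (rule Bochner_Integration.integrable_bound)
  show "integrable lborel (\<lambda>t. (schwartz_seminorm 0 0 \<phi> + schwartz_seminorm 2 0 \<phi>) * inverse (1 + t\<^sup>2))"
    by (intro integrable_mult_right integrable_cauchy)
  show "AE t in lborel. norm (\<phi> t) \<le> norm ((schwartz_seminorm 0 0 \<phi> + schwartz_seminorm 2 0 \<phi>) * inverse (1 + t\<^sup>2))"
    unfolding real_norm_def by (intro AE_I2 order_trans[OF schwartz_norm_le[OF assms] abs_ge_self])
qed (use schwartz_measurable[OF assms] in simp)

lemma schwartz_mult_t_integrable:
  assumes "\<phi> \<in> schwartz_space" shows "integrable lborel (\<lambda>t. \<bar>t\<bar> * cmod (\<phi> t))"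
proof (rule Bochner_Integration.integrable_bound)
  show "integrable lborel (\<lambda>t. (schwartz_seminorm 1 0 \<phi> + schwartz_seminorm 3 0 \<phi>) * inverse (1 + t\<^sup>2))"
    by (intro integrable_mult_right integrable_cauchy)
  show "AE t in lborel. norm (\<bar>t\<bar> * cmod (\<phi> t)) \<le> norm ((schwartz_seminorm 1 0 \<phi> + schwartz_seminorm 3 0 \<phi>) * inverse (1 + t\<^sup>2))"
  proof (rule AE_I2)
    fix t
    have "norm (\<bar>t\<bar> * cmod (\<phi> t)) = \<bar>t\<bar> * cmod (\<phi> t)" by simp
    also note schwartz_mult_t_norm_le[OF assms]
    finally show "norm (\<bar>t\<bar> * cmod (\<phi> t)) \<le> norm ((schwartz_seminorm 1 0 \<phi> + schwartz_seminorm 3 0 \<phi>) * inverse (1 + t\<^sup>2))"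
      unfolding real_norm_def[of "_ * inverse _"] by (rule order_trans[OF _ abs_ge_self])
  qed
qed (use schwartz_measurable[OF assms] in simp)

lemma schwartz_integral_norm_le:
  assumes "\<phi> \<in> schwartz_space"
  shows "(\<integral>t. cmod (\<phi> t) \<partial>lborel) \<le> pi * (schwartz_seminorm 0 0 \<phi> + schwartz_seminorm 2 0 \<phi>)"
proof -
  have "(\<integral>t. cmod (\<phi> t) \<partial>lborel) \<le> (\<integral>t. (schwartz_seminorm 0 0 \<phi> + schwartz_seminorm 2 0 \<phi>) * inverse (1 + t\<^sup>2) \<partial>lborel)"
    by (intro integral_mono integrable_norm integrable_mult_right integrable_cauchy schwartz_integrable schwartz_norm_le assms)
  then show ?thesis by (simp add: integral_cauchy mult.commute)
qed

lemma poly_gauss_bounded: "\<exists>B. \<forall>u::real. \<bar>poly p u\<bar> * exp (- (u\<^sup>2 / 2)) \<le> B"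
proof -
  have mono: "\<exists>B. \<forall>u::real. \<bar>u\<bar> ^ j * exp (- (u\<^sup>2 / 2)) \<le> B" for j
  proof -
    \<comment> \<open>For \<open>\<bar>u\<bar> \<le> 1\<close> the summand 1 suffices. Otherwise
      \<open>\<bar>u\<bar> ^ j \<le> 2 ^ j * (u\<^sup>2 / 2) ^ j\<close>, and one term of the
      exponential series gives \<open>x ^ j \<le> fact j * exp x\<close>.\<close>
    have "\<bar>u\<bar> ^ j * exp (- (u\<^sup>2 / 2)) \<le> 1 + 2 ^ j * fact j" for u :: real
    proof (cases "\<bar>u\<bar> \<le> 1")
      case True
      then have "\<bar>u\<bar> ^ j * exp (- (u\<^sup>2 / 2)) \<le> 1 * 1" by (intro mult_mono power_le_one) auto
      then show ?thesis by (simp add: add_increasing2)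
    next
      case False
      have "\<bar>u\<bar> ^ j \<le> \<bar>u\<bar> ^ (2 * j)" using False by (intro power_increasing) auto
      also have "\<dots> = 2 ^ j * (u\<^sup>2 / 2) ^ j" by (simp add: power_mult power_divide)
      also have "\<dots> \<le> 2 ^ j * (fact j * exp (u\<^sup>2 / 2))"
      proof -
        have "(u\<^sup>2 / 2) ^ j / fact j \<le> exp (u\<^sup>2 / 2)"
        proof -
          have "(\<Sum>i\<in>{j}. (u\<^sup>2/2) ^ i /\<^sub>R fact i) \<le> (\<Sum>i. (u\<^sup>2/2) ^ i /\<^sub>R fact i)"
            by (intro sum_le_suminf summable_exp_generic) auto
          then have "(u\<^sup>2/2) ^ j /\<^sub>R fact j \<le> exp (u\<^sup>2/2)"
            unfolding sums_unique[OF exp_converges, symmetric] by (simp only: sum.insert sum.empty finite.emptyI empty_iff not_False_eq_True add_0_right)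
          then show ?thesis by (simp only: divide_inverse real_scaleR_def mult.commute)
        qed
        then show ?thesis by (simp add: field_simps)
      qed
      finally have "\<bar>u\<bar> ^ j * exp (- (u\<^sup>2 / 2)) \<le> 2 ^ j * (fact j * exp (u\<^sup>2 / 2)) * exp (- (u\<^sup>2 / 2))"
        by (intro mult_right_mono) auto
      also have "\<dots> = 2 ^ j * fact j" by (simp add: mult.assoc flip: exp_add)
      finally show ?thesis by simp
    qed
    then show ?thesis by blast
  qed
  then obtain B where B: "\<And>j (u::real). \<bar>u\<bar> ^ j * exp (- (u\<^sup>2 / 2)) \<le> B j" by metis
  have "\<bar>poly p u\<bar> * exp (- (u\<^sup>2 / 2)) \<le> (\<Sum>i\<le>degree p. \<bar>coeff p i\<bar> * B i)" for u
  proof -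
    have "\<bar>poly p u\<bar> \<le> (\<Sum>i\<le>degree p. \<bar>coeff p i\<bar> * \<bar>u\<bar> ^ i)"
      unfolding poly_altdef by (rule order_trans[OF sum_abs]) (simp add: abs_mult power_abs)
    then have "\<bar>poly p u\<bar> * exp (- (u\<^sup>2 / 2)) \<le> (\<Sum>i\<le>degree p. \<bar>coeff p i\<bar> * \<bar>u\<bar> ^ i) * exp (- (u\<^sup>2 / 2))"
      by (intro mult_right_mono) auto
    also have "\<dots> = (\<Sum>i\<le>degree p. \<bar>coeff p i\<bar> * (\<bar>u\<bar> ^ i * exp (- (u\<^sup>2 / 2))))"
      by (simp add: sum_distrib_right mult.assoc)
    also have "\<dots> \<le> (\<Sum>i\<le>degree p. \<bar>coeff p i\<bar> * B i)" by (intro sum_mono mult_left_mono B) auto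
    finally show ?thesis .
  qed
  then show ?thesis by blast
qed

text \<open>The derivatives are Hermite polynomials, up to sign, times the Gaussian;
  \<open>q\<close> is their recursion. The centre \<open>\<tau>\<close> is left free because
  translates serve as test functions for the characteristic function of a spectral measure.\<close>

lemma schwartz_gauss: "(\<lambda>t. complex_of_real (exp (- ((t - \<tau>)\<^sup>2 / 2)))) \<in> schwartz_space"
proof -
  define q where "q n = ((\<lambda>p. pderiv p - [:0,1:] * p) ^^ n) (1 :: real poly)" for n
  let ?F = "\<lambda>n t. complex_of_real (poly (q n) (t - \<tau>) * exp (- ((t - \<tau>)\<^sup>2 / 2)))"
  have F0: "?F 0 = (\<lambda>t. complex_of_real (exp (- ((t - \<tau>)\<^sup>2 / 2))))" by (simp add: q_def)
  have d: "(?F n has_vector_derivative ?F (Suc n) t) (at t)" for n t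
  proof (rule has_vector_derivative_of_real)
    have "((\<lambda>t. poly (q n) (t - \<tau>) * exp (- ((t - \<tau>)\<^sup>2 / 2))) has_real_derivative
       (poly (pderiv (q n)) (t - \<tau>) * 1) * exp (- ((t - \<tau>)\<^sup>2 / 2)) + exp (- ((t - \<tau>)\<^sup>2 / 2)) * (- (t - \<tau>)) * poly (q n) (t - \<tau>)) (at t)"
      by (intro DERIV_mult DERIV_chain2[OF poly_DERIV] DERIV_chain2[OF DERIV_exp]) (auto intro!: derivative_eq_intros simp: field_simps)
    then show "((\<lambda>t. poly (q n) (t - \<tau>) * exp (- ((t - \<tau>)\<^sup>2 / 2))) has_real_derivative
       poly (q (Suc n)) (t - \<tau>) * exp (- ((t - \<tau>)\<^sup>2 / 2))) (at t)"
      by (rule DERIV_cong) (simp add: q_def algebra_simps)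
  qed
  show ?thesis
  proof (rule schwartz_bddI)
    show "smooth_on UNIV (\<lambda>t. complex_of_real (exp (- ((t - \<tau>)\<^sup>2 / 2))))" using F0 d by (rule smooth_derivI)
    fix m n
    have v: "(vderiv ^^ n) (\<lambda>t. complex_of_real (exp (- ((t - \<tau>)\<^sup>2 / 2)))) = ?F n" using F0 d by (rule smooth_derivI)
    \<comment> \<open>The polynomial \<open>[:\<tau>, 1:]\<close> takes the value \<open>t\<close>
      at \<open>t - \<tau>\<close>, so its power absorbs the weight
      \<open>\<bar>t\<bar> ^ m\<close>.\<close>
    obtain B where B: "\<And>u. \<bar>poly ([:\<tau>, 1:] ^ m * q n) u\<bar> * exp (- (u\<^sup>2 / 2)) \<le> B"
      using poly_gauss_bounded by blast
    have "\<bar>t\<bar> ^ m * cmod (?F n t) \<le> B" for t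
      using B[of "t - \<tau>"] by (simp add: abs_mult power_abs norm_mult mult.assoc)
    then show "\<exists>B. \<forall>t. \<bar>t\<bar> ^ m * cmod ((vderiv ^^ n) (\<lambda>t. complex_of_real (exp (- ((t - \<tau>)\<^sup>2 / 2)))) t) \<le> B"
      unfolding v by blast
  qed
qed

section \<open>The Schwartz topology and tempered distributions\<close>

lemma schwartz_diff: "\<phi> \<in> schwartz_space \<Longrightarrow> \<psi> \<in> schwartz_space \<Longrightarrow> (\<lambda>t. \<phi> t - \<psi> t) \<in> schwartz_space"
  using schwartz_lincomb[of \<phi> \<psi> 1 "-1"] by simp

lemma schwartz_zero: "(\<lambda>_. 0) \<in> schwartz_space"
  using schwartz_lincomb[OF schwartz_gauss schwartz_gauss, of 0 0 0] by simp

lemma schwartz_seminorm_zero: "schwartz_seminorm m n (\<lambda>_. 0) = 0"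
proof -
  have "(vderiv ^^ n) (\<lambda>_. 0 :: complex) = (\<lambda>_. 0)"
    using smooth_lincomb(2)[of "\<lambda>_. 0" "\<lambda>_. 0" n 0 0] schwartz_smooth[OF schwartz_zero] by simp
  then show ?thesis by (simp add: schwartz_seminorm_def)
qed

lemma topspace_schwartz: "topspace schwartz_topology = schwartz_space"
proof -
  let ?B = "\<lambda>\<phi> m n \<epsilon>. {\<psi> \<in> schwartz_space. schwartz_seminorm m n (\<lambda>t. \<psi> t - \<phi> t) < \<epsilon>}"
  have "\<phi> \<in> \<Union>{?B \<phi> m n \<epsilon> | \<phi> m n \<epsilon>. \<phi> \<in> schwartz_space \<and> 0 < \<epsilon>}" if "\<phi> \<in> schwartz_space" for \<phi>
  proof (rule UnionI)
    show "?B \<phi> 0 0 1 \<in> {?B \<phi> m n \<epsilon> | \<phi> m n \<epsilon>. \<phi> \<in> schwartz_space \<and> 0 < \<epsilon>}"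
      using that zero_less_one by blast
    show "\<phi> \<in> ?B \<phi> 0 0 1" using that schwartz_seminorm_zero by simp
  qed
  then show ?thesis unfolding schwartz_topology_def topology_generated_by_topspace by blast
qed

lemma openin_schwartz_ball:
  assumes "\<phi> \<in> schwartz_space" "0 < \<epsilon>"
  shows "openin schwartz_topology {\<psi> \<in> schwartz_space. schwartz_seminorm m n (\<lambda>t. \<psi> t - \<phi> t) < \<epsilon>}"
  unfolding schwartz_topology_def by (rule topology_generated_by_Basis) (use assms in blast)

text \<open>For a linear functional a bound by finitely many seminorms gives continuity: around each
  function the intersection of a ball for the seminorm \<open>(0, 0)\<close> with one for
  \<open>(2, 0)\<close> is mapped into a prescribed disc.\<close>

lemma tempered_distributionI:
  assumes lin: "\<And>\<phi> \<psi> a b. \<phi> \<in> schwartz_space \<Longrightarrow> \<psi> \<in> schwartz_space \<Longrightarrow>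
      T (\<lambda>t. a * \<phi> t + b * \<psi> t) = a * T \<phi> + b * T \<psi>"
    and bd: "\<And>\<phi>. \<phi> \<in> schwartz_space \<Longrightarrow> cmod (T \<phi>) \<le> B * (schwartz_seminorm 0 0 \<phi> + schwartz_seminorm 2 0 \<phi>)"
    and off: "\<And>\<phi>. \<phi> \<notin> schwartz_space \<Longrightarrow> T \<phi> = 0"
  shows "T \<in> tempered_distributions"
proof -
  \<comment> \<open>The constant is enlarged to \<open>\<bar>B\<bar> + 1\<close> so that it is
    positive and the radius \<open>\<epsilon>\<close> can be obtained by division.\<close>
  have B: "cmod (T \<phi>) \<le> (\<bar>B\<bar> + 1) * (schwartz_seminorm 0 0 \<phi> + schwartz_seminorm 2 0 \<phi>)" if "\<phi> \<in> schwartz_space" for \<phi>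
  proof -
    have "0 \<le> schwartz_seminorm m 0 \<phi>" for m
      using schwartz_le_seminorm[OF that, of 0 m 0] by (rule order_trans[rotated]) simp
    then show ?thesis by (intro order_trans[OF bd[OF that]] mult_right_mono add_nonneg_nonneg) auto
  qed
  have "continuous_map schwartz_topology euclidean T"
    unfolding continuous_map_def
  proof safe
    fix U :: "complex set" assume "openin euclidean U"
    then have U: "open U" by simp
    show "openin schwartz_topology {x \<in> topspace schwartz_topology. T x \<in> U}"
    proof (subst openin_subopen, safe)
      fix \<phi> assume "\<phi> \<in> topspace schwartz_topology" and TU: "T \<phi> \<in> U"
      then have \<phi>: "\<phi> \<in> schwartz_space" by (simp add: topspace_schwartz)
      obtain e where e: "e > 0" "ball (T \<phi>) e \<subseteq> U" using U TU open_contains_ball by blast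
      define \<epsilon> where "\<epsilon> = e / (2 * (\<bar>B\<bar> + 1))"
      have \<epsilon>: "0 < \<epsilon>" using e by (simp add: \<epsilon>_def)
      let ?N = "\<lambda>m. {\<psi> \<in> schwartz_space. schwartz_seminorm m 0 (\<lambda>t. \<psi> t - \<phi> t) < \<epsilon>}"
      have "openin schwartz_topology (?N 0 \<inter> ?N 2)"
        by (intro openin_Int openin_schwartz_ball \<phi> \<epsilon>)
      moreover have "\<phi> \<in> ?N 0 \<inter> ?N 2" using \<phi> \<epsilon> schwartz_seminorm_zero by simp
      moreover have "?N 0 \<inter> ?N 2 \<subseteq> {x \<in> topspace schwartz_topology. T x \<in> U}"
      proof
        fix \<psi> assume \<psi>: "\<psi> \<in> ?N 0 \<inter> ?N 2"
        then have "T \<psi> - T \<phi> = T (\<lambda>t. \<psi> t - \<phi> t)" using lin[of \<psi> \<phi> 1 "-1"] \<phi> by simp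
        then have "cmod (T \<psi> - T \<phi>) \<le> (\<bar>B\<bar> + 1) * (schwartz_seminorm 0 0 (\<lambda>t. \<psi> t - \<phi> t) + schwartz_seminorm 2 0 (\<lambda>t. \<psi> t - \<phi> t))"
          using B[OF schwartz_diff] \<psi> \<phi> by simp
        also have "\<dots> < (\<bar>B\<bar> + 1) * (\<epsilon> + \<epsilon>)" using \<psi> by (intro mult_strict_left_mono add_strict_mono) auto
        also have "\<dots> = e"
        proof -
          have "\<bar>B\<bar> + 1 \<noteq> 0" by linarith
          then show ?thesis unfolding \<epsilon>_def by (simp add: divide_simps)
        qed
        finally have "T \<psi> \<in> ball (T \<phi>) e" by (simp add: dist_norm norm_minus_commute)
        then show "\<psi> \<in> {x \<in> topspace schwartz_topology. T x \<in> U}" using e \<psi> by (auto simp: topspace_schwartz)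
      qed
      ultimately show "\<exists>V. openin schwartz_topology V \<and> \<phi> \<in> V \<and> V \<subseteq> {x \<in> topspace schwartz_topology. T x \<in> U}"
        by blast
    qed
  qed simp
  then show ?thesis using lin off by (auto simp: tempered_distributions_def)
qed

lemma tempered_dirac: "dirac t \<in> tempered_distributions"
proof (rule tempered_distributionI[where B=1])
  fix \<phi> assume \<phi>: "\<phi> \<in> schwartz_space"
  have "0 \<le> schwartz_seminorm 2 0 \<phi>"
    using schwartz_le_seminorm[OF \<phi>, of 0 2 0] by (rule order_trans[rotated]) simp
  then show "cmod (dirac t \<phi>) \<le> 1 * (schwartz_seminorm 0 0 \<phi> + schwartz_seminorm 2 0 \<phi>)"
    using schwartz_le_seminorm[OF \<phi>, of t 0 0] \<phi> by (simp add: dirac_def)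
qed (auto simp: dirac_def schwartz_lincomb)

lemma tempered_function:
  assumes f: "f \<in> borel_measurable borel" "\<And>t. cmod (f t) \<le> B"
  shows "function_distribution f \<in> tempered_distributions"
proof (rule tempered_distributionI[where B="B * pi"])
  have int: "integrable lborel (\<lambda>t. f t * \<phi> t)" if "\<phi> \<in> schwartz_space" for \<phi>
  proof (rule Bochner_Integration.integrable_bound)
    show "integrable lborel (\<lambda>t. B * cmod (\<phi> t))" by (intro integrable_mult_right integrable_norm schwartz_integrable that)
    show "(\<lambda>t. f t * \<phi> t) \<in> borel_measurable lborel" using f(1) schwartz_measurable[OF that] by measurable
    show "AE t in lborel. norm (f t * \<phi> t) \<le> norm (B * cmod (\<phi> t))"
      using f(2) by (intro AE_I2) (auto simp: norm_mult abs_mult intro!: mult_mono order_trans[OF f(2) abs_ge_self])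
  qed
  fix \<phi> \<psi> :: "real \<Rightarrow> complex" and a b assume \<phi>: "\<phi> \<in> schwartz_space" and \<psi>: "\<psi> \<in> schwartz_space"
  have "(\<integral>t. f t * (a * \<phi> t + b * \<psi> t) \<partial>lborel) = (\<integral>t. a * (f t * \<phi> t) + b * (f t * \<psi> t) \<partial>lborel)"
    by (simp add: algebra_simps)
  also have "\<dots> = a * (\<integral>t. f t * \<phi> t \<partial>lborel) + b * (\<integral>t. f t * \<psi> t \<partial>lborel)"
    using int[OF \<phi>] int[OF \<psi>] by simp
  finally show "function_distribution f (\<lambda>t. a * \<phi> t + b * \<psi> t) = a * function_distribution f \<phi> + b * function_distribution f \<psi>"
    using \<phi> \<psi> by (simp add: function_distribution_def schwartz_lincomb)
next
  fix \<phi> assume \<phi>: "\<phi> \<in> schwartz_space"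
  have B0: "0 \<le> B" using f(2)[of 0] norm_ge_zero order_trans by blast
  have "cmod (\<integral>t. f t * \<phi> t \<partial>lborel) \<le> (\<integral>t. cmod (f t * \<phi> t) \<partial>lborel)" by (rule integral_norm_bound)
  also have "\<dots> \<le> (\<integral>t. B * cmod (\<phi> t) \<partial>lborel)"
    by (rule integral_mono_AE', intro integrable_mult_right integrable_norm schwartz_integrable \<phi>)
       (use f(2) B0 in \<open>auto simp: norm_mult intro!: mult_right_mono AE_I2\<close>)
  also have "\<dots> \<le> B * (pi * (schwartz_seminorm 0 0 \<phi> + schwartz_seminorm 2 0 \<phi>))"
    using schwartz_integral_norm_le[OF \<phi>] B0 by (simp add: mult_left_mono)
  finally show "cmod (function_distribution f \<phi>) \<le> B * pi * (schwartz_seminorm 0 0 \<phi> + schwartz_seminorm 2 0 \<phi>)"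
    using \<phi> by (simp add: function_distribution_def mult.assoc)
qed (simp add: function_distribution_def)

section \<open>Fourier transforms of distributions\<close>

abbreviation four_exp :: "real \<Rightarrow> complex" where
  "four_exp y \<equiv> exp (- (\<i> * complex_of_real y))"

lemma norm_four_exp [simp]: "cmod (four_exp y) = 1"
  by (simp add: norm_exp_eq_Re)

lemma four_exp_add: "four_exp (x + y) = four_exp x * four_exp y"
  by (simp add: exp_add[symmetric] algebra_simps)

lemma fourier_integrable:
  assumes "integrable lborel f" shows "integrable lborel (\<lambda>t. f t * four_exp (t * \<omega>))"
  by (rule Bochner_Integration.integrable_bound[OF assms])
     (use borel_measurable_integrable[OF assms] in \<open>auto simp: norm_mult\<close>)

lemma norm_fourier_le: "cmod (fourier f \<omega>) \<le> (\<integral>t. cmod (f t) \<partial>lborel)"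
proof -
  have "cmod (fourier f \<omega>) \<le> (\<integral>t. cmod (f t * four_exp (t * \<omega>)) \<partial>lborel)"
    unfolding fourier_def by (rule integral_norm_bound)
  then show ?thesis by (simp add: norm_mult)
qed

lemma fourier_measurable:
  assumes [measurable]: "f \<in> borel_measurable borel" shows "fourier f \<in> borel_measurable borel"
  unfolding fourier_def by measurable

lemma fourier_reflect: "fourier (reflect f) \<omega> = fourier f (- \<omega>)"
  unfolding fourier_def reflect_def
  by (subst lborel_integral_real_affine[where c="-1" and t=0]) auto

lemma integrable_reflect: "integrable lborel f \<Longrightarrow> integrable lborel (reflect f)"
  unfolding reflect_def using lborel_integrable_real_affine[of f "-1" 0] by simp

lemma integral_reflect: "(\<integral>t. f (- t) \<partial>lborel) = (\<integral>t. f t \<partial>lborel)" for f :: "real \<Rightarrow> 'b::{banach, second_countable_topology}"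
  by (subst (2) lborel_integral_real_affine[where c="-1" and t=0]) auto

lemma fourier_translate: "fourier (\<lambda>t. f (t - \<tau>)) \<omega> = four_exp (\<tau> * \<omega>) * fourier f \<omega>"
proof -
  have "fourier (\<lambda>t. f (t - \<tau>)) \<omega> = (\<integral>t. f t * four_exp ((\<tau> + t) * \<omega>) \<partial>lborel)"
    unfolding fourier_def by (subst lborel_integral_real_affine[where c=1 and t=\<tau>]) auto
  also have "\<dots> = (\<integral>t. four_exp (\<tau> * \<omega>) * (f t * four_exp (t * \<omega>)) \<partial>lborel)"
    by (intro Bochner_Integration.integral_cong refl) (subst distrib_right, subst four_exp_add, simp only: mult_ac)
  finally show ?thesis by (simp add: fourier_def)
qed

lemma integrable_tensor:
  fixes f g :: "real \<Rightarrow> complex"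
  assumes f: "integrable lborel f" and g: "integrable lborel g"
    and h: "(\<lambda>(t, x). h t x) \<in> borel_measurable (borel \<Otimes>\<^sub>M borel)" "\<And>t x. cmod (h t x) \<le> 1"
  shows "integrable (lborel \<Otimes>\<^sub>M lborel) (\<lambda>(t, x). f t * g x * h t x)"
proof -
  have fm [measurable]: "f \<in> borel_measurable borel" and gm [measurable]: "g \<in> borel_measurable borel"
    using borel_measurable_integrable[OF f] borel_measurable_integrable[OF g] by auto
  have "integrable (lborel \<Otimes>\<^sub>M lborel) (\<lambda>(t, x). f t * g x)"
  proof (rule lborel_pair.Fubini_integrable)
    show "integrable lborel (\<lambda>t. \<integral>x. norm (case (t, x) of (t, x) \<Rightarrow> f t * g x) \<partial>lborel)"
      using f by (simp add: norm_mult)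
    show "AE t in lborel. integrable lborel (\<lambda>x. case (t, x) of (t, x) \<Rightarrow> f t * g x)" using g by simp
  qed measurable
  then show ?thesis
  proof (rule Bochner_Integration.integrable_bound)
    show "(\<lambda>(t, x). f t * g x * h t x) \<in> borel_measurable (lborel \<Otimes>\<^sub>M lborel)"
      using h(1) by (simp add: case_prod_beta')
    show "AE z in lborel \<Otimes>\<^sub>M lborel. norm (case z of (t, x) \<Rightarrow> f t * g x * h t x) \<le> norm (case z of (t, x) \<Rightarrow> f t * g x)"
      by (auto intro!: AE_I2 simp: norm_mult h(2) mult_left_le)
  qed
qed

text \<open>The multiplication formula, by Fubini for \<open>f t * g x * exp (- \<i> t x)\<close>.
  It identifies the distributional transform of an integrable function with the classical
  one.\<close>

lemma integral_fourier_swap: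
  assumes f: "integrable lborel f" and g: "integrable lborel g"
  shows "(\<integral>t. f t * fourier g t \<partial>lborel) = (\<integral>x. fourier f x * g x \<partial>lborel)"
    and "integrable lborel (\<lambda>x. fourier f x * g x)"
proof -
  let ?F = "\<lambda>(t, x). f t * g x * four_exp (t * x)"
  have int: "integrable (lborel \<Otimes>\<^sub>M lborel) ?F"
    by (rule integrable_tensor[OF f g]) auto
  have 1: "(\<integral>x. ?F (t, x) \<partial>lborel) = f t * fourier g t" for t
  proof -
    have "(\<integral>x. ?F (t, x) \<partial>lborel) = (\<integral>x. f t * (g x * four_exp (x * t)) \<partial>lborel)"
      by (intro Bochner_Integration.integral_cong refl) (simp add: mult_ac)
    then show ?thesis by (simp add: fourier_def)
  qed
  have 2: "(\<integral>t. ?F (t, x) \<partial>lborel) = fourier f x * g x" for x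
  proof -
    have "(\<integral>t. ?F (t, x) \<partial>lborel) = (\<integral>t. (f t * four_exp (t * x)) * g x \<partial>lborel)"
      by (intro Bochner_Integration.integral_cong refl) (simp add: mult_ac)
    then show ?thesis by (simp add: fourier_def)
  qed
  show "(\<integral>t. f t * fourier g t \<partial>lborel) = (\<integral>x. fourier f x * g x \<partial>lborel)"
    using lborel_pair.Fubini_integral[of "\<lambda>t x. ?F (t, x)"] int unfolding 1 2 by simp
  show "integrable lborel (\<lambda>x. fourier f x * g x)"
    using lborel_pair.integrable_snd[of "\<lambda>t x. ?F (t, x)"] int unfolding 2 by simp
qed

lemma schwartz_lim: assumes "\<phi> \<in> schwartz_space"
  shows "(\<phi> \<longlongrightarrow> 0) at_top" "(\<phi> \<longlongrightarrow> 0) at_bot"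
proof -
  let ?C = "schwartz_seminorm 0 0 \<phi> + schwartz_seminorm 2 0 \<phi>"
  have 1: "((\<lambda>t::real. ?C * inverse (1 + t\<^sup>2)) \<longlongrightarrow> ?C * 0) at_top"
    by (intro tendsto_mult tendsto_const) real_asymp
  have 2: "((\<lambda>t::real. ?C * inverse (1 + t\<^sup>2)) \<longlongrightarrow> ?C * 0) at_bot"
    by (intro tendsto_mult tendsto_const) real_asymp
  show "(\<phi> \<longlongrightarrow> 0) at_top" "(\<phi> \<longlongrightarrow> 0) at_bot"
    by (rule Lim_null_comparison[OF always_eventually], use schwartz_norm_le[OF assms] 1 2 in auto)+
qed

text \<open>The derivative of \<open>\<phi> t * exp (- \<i> t \<omega>)\<close> integrates to zero
  because \<open>\<phi>\<close> vanishes at both ends.\<close>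

lemma fourier_vderiv:
  assumes "\<phi> \<in> schwartz_space" shows "fourier (vderiv \<phi>) \<omega> = \<i> * of_real \<omega> * fourier \<phi> \<omega>"
proof -
  let ?F = "\<lambda>t. \<phi> t * four_exp (t * \<omega>)"
  let ?f = "\<lambda>t. vderiv \<phi> t * four_exp (t * \<omega>) + (- (\<i> * of_real \<omega>)) * (\<phi> t * four_exp (t * \<omega>))"
  have i1: "integrable lborel (\<lambda>t. vderiv \<phi> t * four_exp (t * \<omega>))"
    and i2: "integrable lborel (\<lambda>t. \<phi> t * four_exp (t * \<omega>))"
    by (intro fourier_integrable schwartz_integrable schwartz_vderiv assms)+
  have "(LBINT t=-\<infinity>..\<infinity>. ?f t) = 0 - 0"
  proof (rule interval_integral_FTC_integrable[where F="?F"])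
    fix t :: real
    have "((\<lambda>t. four_exp (t * \<omega>)) has_vector_derivative (- (\<i> * of_real \<omega>)) * four_exp (t * \<omega>)) (at t)"
    proof -
      have "((\<lambda>z. exp (- (\<i> * (z * of_real \<omega>)))) has_field_derivative (- (\<i> * of_real \<omega>)) * four_exp (t * \<omega>)) (at (of_real t))"
        by (auto intro!: derivative_eq_intros)
      from has_vector_derivative_real_field[OF this] show ?thesis by simp
    qed
    from has_vector_derivative_mult[OF schwartz_deriv[OF assms] this]
    show "(?F has_vector_derivative ?f t) (at t)" by (simp add: algebra_simps)
    show "isCont ?f t"
      using continuous_on_eq_continuous_at[of UNIV \<phi>] continuous_on_eq_continuous_at[of UNIV "vderiv \<phi>"]
        schwartz_continuous[OF assms] schwartz_continuous[OF schwartz_vderiv[OF assms]]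
      by (intro continuous_intros) auto
  next
    show "set_integrable lborel (einterval (-\<infinity>) \<infinity>) ?f"
      unfolding set_integrable_def einterval_eq_UNIV using i1 i2 by simp
    have 0: "(?F \<longlongrightarrow> 0) at_top" "(?F \<longlongrightarrow> 0) at_bot"
      by (rule Lim_null_comparison[OF always_eventually tendsto_norm_zero[OF schwartz_lim(1)[OF assms]]], simp add: norm_mult)
         (rule Lim_null_comparison[OF always_eventually tendsto_norm_zero[OF schwartz_lim(2)[OF assms]]], simp add: norm_mult)
    show "((?F \<circ> real_of_ereal) \<longlongrightarrow> 0) (at_right (-\<infinity>))" "((?F \<circ> real_of_ereal) \<longlongrightarrow> 0) (at_left \<infinity>)"
      unfolding ereal_tendsto_simps by (fact 0)+
  qed simp
  then have "(\<integral>t. ?f t \<partial>lborel) = 0"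
    by (simp add: interval_lebesgue_integral_def set_lebesgue_integral_def einterval_eq_UNIV)
  moreover have "(\<integral>t. ?f t \<partial>lborel) = fourier (vderiv \<phi>) \<omega> + (- (\<i> * of_real \<omega>)) * fourier \<phi> \<omega>"
    unfolding fourier_def by (subst Bochner_Integration.integral_add[OF i1]) (use i2 in auto)
  ultimately show ?thesis by simp
qed

text \<open>The second order estimate of the exponential bounds the remainder by
  \<open>h\<^sup>2 / 2\<close> times the second absolute moment of \<open>f\<close>. Test functions
  have all moments and stay test functions after multiplication by \<open>t\<close>.\<close>

lemma fourier_has_deriv:
  assumes f: "f \<in> test_functions"
  shows "(fourier f has_vector_derivative fourier (\<lambda>t. (- \<i> * of_real t) * f t) \<omega>) (at \<omega>)"
proof -
  have mulid: "smooth_on UNIV (\<lambda>t. - \<i> * complex_of_real t)"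
    using smooth_lincomb(1)[OF smooth_id smooth_id, of "- \<i>" 0] by simp
  have t1: "(\<lambda>t. (- \<i> * of_real t) * f t) \<in> test_functions" by (intro test_mult_smooth f mulid)
  have t2: "(\<lambda>t. (- \<i> * of_real t) * ((- \<i> * of_real t) * f t)) \<in> test_functions" by (intro test_mult_smooth t1 mulid)
  have i0: "integrable lborel f" and i1: "integrable lborel (\<lambda>t. (- \<i> * of_real t) * f t)"
    and i2: "integrable lborel (\<lambda>t. (- \<i> * of_real t) * ((- \<i> * of_real t) * f t))"
    by (intro schwartz_integrable test_schwartz f t1 t2)+
  let ?I = "\<integral>t. cmod ((- \<i> * of_real t) * ((- \<i> * of_real t) * f t)) \<partial>lborel"
  have e: "cmod (four_exp y - 1 - (- \<i> * of_real y)) \<le> y\<^sup>2 / 2" for y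
  proof -
    have "four_exp y - 1 - (- \<i> * of_real y) = four_exp y - (1 - \<i> * of_real y)" by simp
    then show ?thesis using iexp_approx1[of "- y" 1] unfolding \<open>four_exp y - 1 - _ = _\<close> by (simp add: power2_eq_square)
  qed
  have b: "cmod (fourier f (\<omega> + h) - fourier f \<omega> - of_real h * fourier (\<lambda>t. (- \<i> * of_real t) * f t) \<omega>) \<le> h\<^sup>2 / 2 * ?I" for h
  proof -
    have eq: "fourier f (\<omega> + h) - fourier f \<omega> - of_real h * fourier (\<lambda>t. (- \<i> * of_real t) * f t) \<omega>
      = (\<integral>t. f t * four_exp (t * (\<omega> + h)) - f t * four_exp (t * \<omega>) - of_real h * ((- \<i> * of_real t) * f t * four_exp (t * \<omega>)) \<partial>lborel)"
      unfolding fourier_def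
      by (subst Bochner_Integration.integral_diff, intro Bochner_Integration.integrable_diff fourier_integrable i0,
          intro integrable_mult_right fourier_integrable i1,
          subst Bochner_Integration.integral_diff, intro fourier_integrable i0, intro fourier_integrable i0) simp
    have "cmod (\<integral>t. f t * four_exp (t * (\<omega> + h)) - f t * four_exp (t * \<omega>) - of_real h * ((- \<i> * of_real t) * f t * four_exp (t * \<omega>)) \<partial>lborel)
      \<le> (\<integral>t. h\<^sup>2 / 2 * cmod ((- \<i> * of_real t) * ((- \<i> * of_real t) * f t)) \<partial>lborel)"
    proof (rule Bochner_Integration.integral_norm_bound_integral)
      show "integrable lborel (\<lambda>t. f t * four_exp (t * (\<omega> + h)) - f t * four_exp (t * \<omega>) - of_real h * ((- \<i> * of_real t) * f t * four_exp (t * \<omega>)))"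
        by (intro Bochner_Integration.integrable_diff fourier_integrable i0 integrable_mult_right i1)
      show "integrable lborel (\<lambda>t. h\<^sup>2 / 2 * cmod ((- \<i> * of_real t) * ((- \<i> * of_real t) * f t)))"
        by (intro integrable_mult_right integrable_norm i2)
      fix t
      have "four_exp (t * (\<omega> + h)) = four_exp (t * \<omega>) * four_exp (t * h)"
        by (simp add: distrib_left four_exp_add flip: of_real_add of_real_mult)
      then have "f t * four_exp (t * (\<omega> + h)) - f t * four_exp (t * \<omega>) - of_real h * ((- \<i> * of_real t) * f t * four_exp (t * \<omega>))
        = f t * four_exp (t * \<omega>) * (four_exp (t * h) - 1 - (- \<i> * of_real (t * h)))"
        by (simp add: algebra_simps)
      then have "cmod (f t * four_exp (t * (\<omega> + h)) - f t * four_exp (t * \<omega>) - of_real h * ((- \<i> * of_real t) * f t * four_exp (t * \<omega>)))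
        = cmod (f t) * cmod (four_exp (t * h) - 1 - (- \<i> * of_real (t * h)))" by (simp add: norm_mult del: of_real_mult)
      also have "\<dots> \<le> cmod (f t) * ((t * h)\<^sup>2 / 2)" by (intro mult_left_mono e) auto
      also have "\<dots> = h\<^sup>2 / 2 * cmod ((- \<i> * of_real t) * ((- \<i> * of_real t) * f t))"
        by (simp add: norm_mult power_mult_distrib power2_eq_square)
      finally show "cmod (f t * four_exp (t * (\<omega> + h)) - f t * four_exp (t * \<omega>) - of_real h * ((- \<i> * of_real t) * f t * four_exp (t * \<omega>)))
          \<le> h\<^sup>2 / 2 * cmod ((- \<i> * of_real t) * ((- \<i> * of_real t) * f t))" .
    qed
    then show ?thesis unfolding eq by (simp only: integral_mult_right_zero)
  qed
  show ?thesis
    unfolding has_vector_derivative_def has_derivative_at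
  proof (intro conjI)
    show "bounded_linear (\<lambda>x. x *\<^sub>R fourier (\<lambda>t. (- \<i> * of_real t) * f t) \<omega>)" by (rule bounded_linear_scaleR_left)
    let ?Q = "\<lambda>h. norm (fourier f (\<omega> + h) - fourier f \<omega> - h *\<^sub>R fourier (\<lambda>t. (- \<i> * of_real t) * f t) \<omega>) / norm h"
    have Q: "norm (?Q h) \<le> \<bar>h\<bar> * (?I / 2)" for h
    proof (cases "h = 0")
      case False
      have "?Q h \<le> (h\<^sup>2 / 2 * ?I) / norm h" using b[of h] by (intro divide_right_mono) (auto simp: scaleR_conv_of_real)
      also have "\<dots> = \<bar>h\<bar> * (?I / 2)" using False by (simp add: power2_eq_square field_simps abs_if)
      finally show ?thesis by simp
    qed simp
    have "((\<lambda>h. \<bar>h\<bar> * (?I / 2)) \<longlongrightarrow> \<bar>0\<bar> * (?I / 2)) (at 0)" by (intro tendsto_intros)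
    then have lim: "((\<lambda>h. \<bar>h\<bar> * (?I / 2)) \<longlongrightarrow> 0) (at 0)" by (simp only: abs_zero mult_zero_left)
    show "(?Q \<longlongrightarrow> 0) (at 0)" by (rule Lim_null_comparison[OF always_eventually lim]) (intro allI Q)
  qed
qed

lemma norm_fourier_iterated_vderiv:
  assumes "\<phi> \<in> schwartz_space"
  shows "cmod (fourier ((vderiv ^^ m) \<phi>) \<omega>) = \<bar>\<omega>\<bar> ^ m * cmod (fourier \<phi> \<omega>)"
proof (induction m)
  case (Suc m)
  have "(vderiv ^^ m) \<phi> \<in> schwartz_space" by (induction m) (auto simp: assms schwartz_vderiv)
  from fourier_vderiv[OF this] Suc show ?case by (simp add: norm_mult)
qed simp

text \<open>Derivatives of the transform are transforms of \<open>(- \<i> t) ^ n * f\<close>, and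
  powers of the frequency come from derivatives of these. The result matters because a distribution
  takes the default value zero off the Schwartz space, so \<open>T (fourier \<phi>)\<close> must not
  fall outside it.\<close>

lemma fourier_test_schwartz: assumes "f \<in> test_functions" shows "fourier f \<in> schwartz_space"
proof -
  define g where "g n = ((\<lambda>f t. (- \<i> * complex_of_real t) * f t) ^^ n) f" for n
  have mulid: "smooth_on UNIV (\<lambda>t. - \<i> * complex_of_real t)"
    using smooth_lincomb(1)[OF smooth_id smooth_id, of "- \<i>" 0] by simp
  have g: "g n \<in> test_functions" for n
    by (induction n) (use assms test_mult_smooth[OF _ mulid] in \<open>auto simp: g_def\<close>)
  have d: "(fourier (g n) has_vector_derivative fourier (g (Suc n)) \<omega>) (at \<omega>)" for n \<omega>
    using fourier_has_deriv[OF g, of n \<omega>] by (simp add: g_def)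
  have F0: "fourier (g 0) = fourier f" by (simp add: g_def)
  show ?thesis
  proof (rule schwartz_bddI)
    show "smooth_on UNIV (fourier f)" by (rule smooth_derivI(1)[where F="\<lambda>n. fourier (g n)", OF F0 d])
    fix m n
    have v: "(vderiv ^^ n) (fourier f) = fourier (g n)" by (rule smooth_derivI(2)[where F="\<lambda>n. fourier (g n)", OF F0 d])
    have "\<bar>t\<bar> ^ m * cmod (fourier (g n) t) \<le> (\<integral>x. cmod ((vderiv ^^ m) (g n) x) \<partial>lborel)" for t
      using norm_fourier_le[of "(vderiv ^^ m) (g n)" t] norm_fourier_iterated_vderiv[OF test_schwartz[OF g]] by simp
    then show "\<exists>B. \<forall>t. \<bar>t\<bar> ^ m * cmod ((vderiv ^^ n) (fourier f) t) \<le> B" unfolding v by blast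
  qed
qed

text \<open>The factor \<open>\<bar>x\<bar>\<close> compensates the size
  \<open>1 / \<bar>x\<bar>\<close> of the imaginary part of the kernel transform near the
  origin.\<close>

lemma fourier_odd_part_le:
  assumes "\<phi> \<in> schwartz_space"
  shows "cmod (fourier \<phi> x - fourier \<phi> (- x)) \<le> 2 * \<bar>x\<bar> * (\<integral>t. \<bar>t\<bar> * cmod (\<phi> t) \<partial>lborel)"
proof -
  have i: "integrable lborel (\<lambda>t. \<phi> t * four_exp (t * y))" for y
    by (intro fourier_integrable schwartz_integrable assms)
  have "fourier \<phi> x - fourier \<phi> (- x) = (\<integral>t. \<phi> t * four_exp (t * x) - \<phi> t * four_exp (t * (- x)) \<partial>lborel)"
    unfolding fourier_def by (rule Bochner_Integration.integral_diff[symmetric, OF i i])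
  also have "cmod \<dots> \<le> (\<integral>t. 2 * \<bar>x\<bar> * (\<bar>t\<bar> * cmod (\<phi> t)) \<partial>lborel)"
  proof (rule Bochner_Integration.integral_norm_bound_integral[OF Bochner_Integration.integrable_diff[OF i i]])
    show "integrable lborel (\<lambda>t. 2 * \<bar>x\<bar> * (\<bar>t\<bar> * cmod (\<phi> t)))"
      by (intro integrable_mult_right schwartz_mult_t_integrable assms)
    fix t
    have e: "cmod (four_exp y - 1) \<le> \<bar>y\<bar>" for y using iexp_approx1[of "- y" 0] by simp
    have "cmod (four_exp (t * x) - four_exp (t * (- x))) \<le> cmod (four_exp (t * x) - 1) + cmod (four_exp (t * (- x)) - 1)"
      using norm_triangle_ineq4[of "four_exp (t * x) - 1" "four_exp (t * (- x)) - 1"] by simp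
    also have "\<dots> \<le> \<bar>t * x\<bar> + \<bar>t * (- x)\<bar>" by (intro add_mono e)
    finally have "cmod (four_exp (t * x) - four_exp (t * (- x))) \<le> 2 * \<bar>x\<bar> * \<bar>t\<bar>" by (simp add: abs_mult mult_ac)
    then have "cmod (\<phi> t) * cmod (four_exp (t * x) - four_exp (t * (- x))) \<le> cmod (\<phi> t) * (2 * \<bar>x\<bar> * \<bar>t\<bar>)"
      by (rule mult_left_mono) simp
    then show "cmod (\<phi> t * four_exp (t * x) - \<phi> t * four_exp (t * (- x))) \<le> 2 * \<bar>x\<bar> * (\<bar>t\<bar> * cmod (\<phi> t))"
      by (simp add: norm_mult mult_ac flip: right_diff_distrib)
  qed
  finally show ?thesis by simp
qed

text \<open>Dominated convergence, as the removed set shrinks to a point. Thus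
  \<open>is_function\<close> extends the usual identification of a distribution with an integrable
  function.\<close>

lemma principal_value_integrable:
  fixes f :: "real \<Rightarrow> 'b::{banach, second_countable_topology}"
  assumes "integrable lborel f"
  shows "((\<lambda>\<epsilon>. LINT x:{x. \<epsilon> < \<bar>x\<bar>}|lborel. f x) \<longlongrightarrow> (\<integral>x. f x \<partial>lborel)) (at_right 0)"
proof (rule tendsto_at_right_sequentially[of 0 1])
  fix S :: "nat \<Rightarrow> real" assume S: "\<And>n. 0 < S n" "S \<longlonglongrightarrow> 0"
  have fm [measurable]: "f \<in> borel_measurable borel" using borel_measurable_integrable[OF assms] by simp
  show "(\<lambda>n. LINT x:{x. S n < \<bar>x\<bar>}|lborel. f x) \<longlonglongrightarrow> (\<integral>x. f x \<partial>lborel)"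
    unfolding set_lebesgue_integral_def
  proof (rule integral_dominated_convergence[where w="\<lambda>x. norm (f x)"])
    have "AE x in lborel. x \<noteq> (0::real)" by (rule AE_lborel_singleton)
    then show "AE x in lborel. (\<lambda>n. indicator {x. S n < \<bar>x\<bar>} x *\<^sub>R f x) \<longlonglongrightarrow> f x"
    proof eventually_elim
      case (elim x)
      then have "\<forall>\<^sub>F n in sequentially. S n < \<bar>x\<bar>" using order_tendstoD(2)[OF S(2), of "\<bar>x\<bar>"] by simp
      then have "\<forall>\<^sub>F n in sequentially. f x = indicator {x. S n < \<bar>x\<bar>} x *\<^sub>R f x" by eventually_elim simp
      then show ?case by (rule Lim_transform_eventually[OF tendsto_const])
    qed
  qed (use assms in \<open>auto intro!: AE_I2 simp: indicator_def\<close>)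
qed simp

lemma is_function_lincomb:
  assumes "is_function S g" "is_function T h"
  shows "is_function (\<lambda>\<phi>. a * S \<phi> + b * T \<phi>) (\<lambda>x. a * g x + b * h x)"
proof -
  have gm [measurable]: "g \<in> borel_measurable borel" and hm [measurable]: "h \<in> borel_measurable borel"
    using assms by (auto simp: is_function_def)
  have gi: "set_integrable lborel {x. c \<le> \<bar>x\<bar> \<and> \<bar>x\<bar> \<le> d} g"
    and hi: "set_integrable lborel {x. c \<le> \<bar>x\<bar> \<and> \<bar>x\<bar> \<le> d} h" if "0 < c" for c d
    using assms that by (auto simp: is_function_def)
  \<comment> \<open>Cut off at \<open>\<epsilon>\<close> and at the support of the test function,
    each summand is integrable, so the truncated integrals are additive. At the origin itself only
    the limits may be added.\<close>
  have *: "set_integrable lborel {x. \<epsilon> < \<bar>x\<bar>} (\<lambda>x. g x * \<phi> x)"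
    if i: "\<And>c d. 0 < c \<Longrightarrow> set_integrable lborel {x. c \<le> \<bar>x\<bar> \<and> \<bar>x\<bar> \<le> d} g"
      and [measurable]: "g \<in> borel_measurable borel" and \<phi>: "\<phi> \<in> test_functions" and "0 < \<epsilon>" for g \<phi> and \<epsilon> :: real
  proof -
    obtain R where R: "\<And>t. R < \<bar>t\<bar> \<Longrightarrow> \<phi> t = 0" using \<phi> by (auto simp: test_functions_def)
    have \<phi>s: "\<phi> \<in> schwartz_space" by (rule test_schwartz[OF \<phi>])
    note schwartz_measurable[OF \<phi>s, measurable]
    have "integrable lborel (\<lambda>x. schwartz_seminorm 0 0 \<phi> *\<^sub>R (indicator {x. \<epsilon> \<le> \<bar>x\<bar> \<and> \<bar>x\<bar> \<le> R} x *\<^sub>R g x))"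
      using i[OF \<open>0 < \<epsilon>\<close>, of R] unfolding set_integrable_def by (rule integrable_scaleR_right)
    then show ?thesis unfolding set_integrable_def
    proof (rule Bochner_Integration.integrable_bound)
      show "AE x in lborel. norm (indicator {x. \<epsilon> < \<bar>x\<bar>} x *\<^sub>R (g x * \<phi> x)) \<le> norm (schwartz_seminorm 0 0 \<phi> *\<^sub>R (indicator {x. \<epsilon> \<le> \<bar>x\<bar> \<and> \<bar>x\<bar> \<le> R} x *\<^sub>R g x))"
      proof (rule AE_I2)
        fix x
        have "cmod (g x) * cmod (\<phi> x) \<le> \<bar>schwartz_seminorm 0 0 \<phi>\<bar> * cmod (g x)"
          using schwartz_le_seminorm[OF \<phi>s, of x 0 0] by (subst mult.commute) (intro mult_right_mono, auto)
        then show "norm (indicator {x. \<epsilon> < \<bar>x\<bar>} x *\<^sub>R (g x * \<phi> x)) \<le> norm (schwartz_seminorm 0 0 \<phi> *\<^sub>R (indicator {x. \<epsilon> \<le> \<bar>x\<bar> \<and> \<bar>x\<bar> \<le> R} x *\<^sub>R g x))"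
          using R[of x] by (auto simp: indicator_def norm_mult not_le)
      qed
    qed simp
  qed
  show ?thesis unfolding is_function_def
  proof (intro conjI allI impI ballI)
    fix c d :: real assume "0 < c"
    from gi[OF this, of d] hi[OF this, of d]
    show "set_integrable lborel {x. c \<le> \<bar>x\<bar> \<and> \<bar>x\<bar> \<le> d} (\<lambda>x. a * g x + b * h x)"
      by (intro set_integral_add set_integrable_mult_right)
  next
    fix \<phi> assume \<phi>: "\<phi> \<in> test_functions"
    let ?I = "\<lambda>g \<epsilon>. LINT x:{x. \<epsilon> < \<bar>x\<bar>}|lborel. g x * \<phi> x"
    have "((\<lambda>\<epsilon>. a * ?I g \<epsilon> + b * ?I h \<epsilon>) \<longlongrightarrow> a * S \<phi> + b * T \<phi>) (at_right 0)"
      using assms \<phi> by (intro tendsto_add tendsto_mult tendsto_const) (auto simp: is_function_def)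
    moreover have "\<forall>\<^sub>F \<epsilon> in at_right 0. a * ?I g \<epsilon> + b * ?I h \<epsilon> = ?I (\<lambda>x. a * g x + b * h x) \<epsilon>"
      using eventually_at_right_less[of "0::real"]
    proof eventually_elim
      case (elim \<epsilon>)
      have "?I (\<lambda>x. a * g x + b * h x) \<epsilon> = (LINT x:{x. \<epsilon> < \<bar>x\<bar>}|lborel. a * (g x * \<phi> x) + b * (h x * \<phi> x))"
        by (simp add: algebra_simps)
      also have "\<dots> = a * ?I g \<epsilon> + b * ?I h \<epsilon>"
        using *[OF gi gm \<phi> elim] *[OF hi hm \<phi> elim]
        by (subst set_integral_add) (auto intro!: set_integrable_mult_right)
      finally show ?case by simp
    qed
    ultimately show "((\<lambda>\<epsilon>. ?I (\<lambda>x. a * g x + b * h x) \<epsilon>) \<longlongrightarrow> a * S \<phi> + b * T \<phi>) (at_right 0)"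
      by (rule Lim_transform_eventually)
  qed simp
qed

text \<open>A pi-lambda argument: half-open intervals generate the Borel sets, and the sets over
  which \<open>d\<close> integrates to zero are closed under complements and disjoint
  unions.\<close>

lemma AE_zero_of_interval_integrals:
  fixes d :: "real \<Rightarrow> complex"
  assumes int: "integrable lborel d" and z: "\<And>a b. a < b \<Longrightarrow> (\<integral>x. indicator {a<..<b} x *\<^sub>R d x \<partial>lborel) = 0"
  shows "AE x in lborel. d x = 0"
proof (rule sigma_finite_measure.density_zero[OF sigma_finite_lborel int])
  fix A assume "A \<in> sets (lborel :: real measure)"
  then have A: "A \<in> sigma_sets UNIV (range (\<lambda>(a, b). {a<..b::real}))"
    by (simp add: borel_sigma_sets_Ioc)
  have meas: "B \<in> sets lborel" if "B \<in> sigma_sets UNIV (range (\<lambda>(a, b). {a<..b::real}))" for B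
    using that by (simp add: borel_sigma_sets_Ioc)
  have si: "set_integrable lborel B d" if "B \<in> sets lborel" for B
    using integrable_mult_indicator[OF that int] by (simp add: set_integrable_def)
  \<comment> \<open>The vanishing total integral is what makes the argument stable under
    complements.\<close>
  have U: "(\<integral>x. d x \<partial>lborel) = 0"
  proof -
    have "(\<lambda>n. \<integral>x. indicator {- real n<..<real n} x *\<^sub>R d x \<partial>lborel) \<longlonglongrightarrow> (\<integral>x. d x \<partial>lborel)"
    proof (rule integral_dominated_convergence[where w="\<lambda>x. norm (d x)"])
      show "AE x in lborel. (\<lambda>n. indicator {- real n<..<real n} x *\<^sub>R d x) \<longlonglongrightarrow> d x"
      proof (rule AE_I2)
        fix x
        have "\<forall>\<^sub>F n in sequentially. d x = indicator {- real n<..<real n} x *\<^sub>R d x"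
          using eventually_gt_at_top[of "nat \<lceil>\<bar>x\<bar>\<rceil>"]
        proof eventually_elim
          case (elim n)
          then have "\<bar>x\<bar> < real n" by linarith
          then have "x \<in> {- real n<..<real n}" by auto
          then show ?case by simp
        qed
        then show "(\<lambda>n. indicator {- real n<..<real n} x *\<^sub>R d x) \<longlonglongrightarrow> d x"
          by (rule Lim_transform_eventually[OF tendsto_const])
      qed
    qed (use int in \<open>auto intro!: AE_I2 simp: indicator_def\<close>)
    moreover have "(\<integral>x. indicator {- real n<..<real n} x *\<^sub>R d x \<partial>lborel) = 0" for n
      using z[of "- real n" "real n"] by (cases "n = 0") auto
    ultimately show ?thesis by (simp only: LIMSEQ_const_iff)
  qed
  show "(LINT x:A|lborel. d x) = 0"
  proof (rule sigma_sets_induct_disjoint[OF _ _ A])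
    show "Int_stable (range (\<lambda>(a, b). {a<..b::real}))"
      by (auto simp: Int_stable_def intro!: image_eqI[where x="(max _ _, min _ _)"])
  next
    fix B :: "real set" assume "B \<in> range (\<lambda>(a, b). {a<..b})"
    then obtain a b where B: "B = {a<..b}" by auto
    show "(LINT x:B|lborel. d x) = 0"
    proof (cases "a < b")
      case False
      then have "B = {}" using B by auto
      then show ?thesis by (simp add: set_lebesgue_integral_def)
    next
      case True
      have [measurable]: "d \<in> borel_measurable borel" using borel_measurable_integrable[OF int] by simp
      have "(LINT x:B|lborel. d x) = (\<integral>x. indicator {a<..<b} x *\<^sub>R d x \<partial>lborel)"
        unfolding set_lebesgue_integral_def B
      proof (rule integral_cong_AE)
        have "AE x in lborel. x \<noteq> b" by (rule AE_lborel_singleton)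
        then show "AE x in lborel. indicator {a<..b} x *\<^sub>R d x = indicator {a<..<b} x *\<^sub>R d x"
          by eventually_elim (auto simp: indicator_def)
      qed auto
      then show ?thesis using z[OF True] by simp
    qed
  next
    fix B assume B: "B \<in> sigma_sets UNIV (range (\<lambda>(a, b). {a<..b::real}))" "(LINT x:B|lborel. d x) = 0"
    have "(LINT x:UNIV|lborel. d x) = (LINT x:B|lborel. d x) + (LINT x:UNIV - B|lborel. d x)"
      using meas[OF B(1)] si by (subst set_integral_Un[symmetric]) (auto simp: Un_Diff_cancel)
    then show "(LINT x:UNIV - B|lborel. d x) = 0" using B(2) U by (simp add: set_lebesgue_integral_def)
  next
    fix B :: "nat \<Rightarrow> real set"
    assume B: "disjoint_family B" "range B \<subseteq> sigma_sets UNIV (range (\<lambda>(a, b). {a<..b::real}))" "\<And>i. (LINT x:B i|lborel. d x) = 0"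
    have m: "B i \<in> sets lborel" for i using meas B(2) by blast
    have "(LINT x:(\<Union>i. B i)|lborel. d x) = (\<Sum>i. LINT x:B i|lborel. d x)"
      by (rule lebesgue_integral_countable_add) (use m si B(1) in \<open>auto simp: disjoint_family_on_def\<close>)
    then show "(LINT x:(\<Union>i. B i)|lborel. d x) = 0" unfolding B(3) by simp
  qed (auto simp: set_lebesgue_integral_def)
qed

text \<open>The difference of two representatives represents zero. Bump functions supported away
  from the origin turn the principal value into an ordinary integral and converge to indicators, so
  the difference vanishes almost everywhere on such intervals. Countably many of them exhaust the
  punctured line.\<close>

lemma is_function_unique:
  assumes "is_function T g" "is_function T h"
  shows "AE x in lborel. g x = h x"
proof -
  let ?d = "\<lambda>x. 1 * g x + (-1) * h x"
  have F: "is_function (\<lambda>\<phi>. 1 * T \<phi> + (-1) * T \<phi>) ?d" by (rule is_function_lincomb[OF assms])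
  have dm [measurable]: "?d \<in> borel_measurable borel" using F by (simp only: is_function_def)
  have di: "\<And>c d. 0 < c \<Longrightarrow> set_integrable lborel {x. c \<le> \<bar>x\<bar> \<and> \<bar>x\<bar> \<le> d} ?d" using F by (simp only: is_function_def)
  have bump0: "(\<integral>x. ?d x * bump a b n x \<partial>lborel) = 0" if ab: "0 < c" "{a<..<b} \<subseteq> {x. c < \<bar>x\<bar>}" for a b c n
  proof -
    have "((\<lambda>\<epsilon>. LINT x:{x. \<epsilon> < \<bar>x\<bar>}|lborel. ?d x * bump a b n x) \<longlongrightarrow> 0) (at_right 0)"
      using F test_bump[of a b n] unfolding is_function_def by simp
    \<comment> \<open>Once \<open>\<epsilon> < c\<close> the cut-off no longer touches the support
      of the bump, so the truncated integral is constant in \<open>\<epsilon>\<close>.\<close>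
    moreover have "\<forall>\<^sub>F \<epsilon> in at_right 0. (LINT x:{x. \<epsilon> < \<bar>x\<bar>}|lborel. ?d x * bump a b n x) = (\<integral>x. ?d x * bump a b n x \<partial>lborel)"
      using eventually_at_right_field[of _ 0] ab(1) 
    proof -
      have "\<forall>\<^sub>F \<epsilon> in at_right 0. \<epsilon> < c" using ab(1) by (simp add: eventually_at_right_field) blast
      then show ?thesis
      proof eventually_elim
        case (elim \<epsilon>)
        have "indicator {x. \<epsilon> < \<bar>x\<bar>} x *\<^sub>R (?d x * bump a b n x) = ?d x * bump a b n x" for x
          using bump_outside[of x a b n] ab(2) elim by (cases "x \<in> {a<..<b}") (auto simp: indicator_def)
        then show ?case unfolding set_lebesgue_integral_def by simp
      qed
    qed
    ultimately have "((\<lambda>\<epsilon>::real. \<integral>x. ?d x * bump a b n x \<partial>lborel) \<longlongrightarrow> 0) (at_right 0)"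
      by (rule Lim_transform_eventually)
    then show ?thesis using tendsto_const_iff trivial_limit_at_right_real by blast
  qed
  have int0: "(\<integral>x. indicator {a<..<b} x *\<^sub>R ?d x \<partial>lborel) = 0" if ab: "0 < c" "{a<..<b} \<subseteq> {x. c < \<bar>x\<bar>}" for a b c
  proof -
    have "(\<lambda>n. \<integral>x. ?d x * bump a b n x \<partial>lborel) \<longlonglongrightarrow> (\<integral>x. indicator {a<..<b} x *\<^sub>R ?d x \<partial>lborel)"
    proof (rule integral_dominated_convergence[where w="\<lambda>x. norm (indicator {x. c \<le> \<bar>x\<bar> \<and> \<bar>x\<bar> \<le> max \<bar>a\<bar> \<bar>b\<bar>} x *\<^sub>R ?d x)"])
      show "integrable lborel (\<lambda>x. norm (indicator {x. c \<le> \<bar>x\<bar> \<and> \<bar>x\<bar> \<le> max \<bar>a\<bar> \<bar>b\<bar>} x *\<^sub>R ?d x))"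
        using di[OF ab(1), of "max \<bar>a\<bar> \<bar>b\<bar>"] unfolding set_integrable_def by (rule integrable_norm)
      show "AE x in lborel. (\<lambda>n. ?d x * bump a b n x) \<longlonglongrightarrow> indicator {a<..<b} x *\<^sub>R ?d x"
      proof (rule AE_I2)
        fix x
        from tendsto_mult[OF tendsto_const bump_limit, of "?d x" a b x]
        show "(\<lambda>n. ?d x * bump a b n x) \<longlonglongrightarrow> indicator {a<..<b} x *\<^sub>R ?d x"
          by (auto simp: indicator_def)
      qed
      fix n
      show "AE x in lborel. norm (?d x * bump a b n x) \<le> norm (indicator {x. c \<le> \<bar>x\<bar> \<and> \<bar>x\<bar> \<le> max \<bar>a\<bar> \<bar>b\<bar>} x *\<^sub>R ?d x)"
      proof (rule AE_I2)
        fix x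
        show "norm (?d x * bump a b n x) \<le> norm (indicator {x. c \<le> \<bar>x\<bar> \<and> \<bar>x\<bar> \<le> max \<bar>a\<bar> \<bar>b\<bar>} x *\<^sub>R ?d x)"
        proof (cases "x \<in> {a<..<b}")
          case True
          then have "c < \<bar>x\<bar>" "\<bar>x\<bar> \<le> max \<bar>a\<bar> \<bar>b\<bar>" using ab by auto
          moreover have "cmod (bump a b n x) \<le> 1" using norm_bump_le[of a b n x] True by simp
          then have "cmod (?d x) * cmod (bump a b n x) \<le> cmod (?d x)" by (intro mult_left_le) auto
          ultimately show ?thesis by (simp add: norm_mult)
        qed (use bump_outside in simp)
      qed
    next
      show "(\<lambda>x. ?d x * bump a b n x) \<in> borel_measurable lborel" for n
        using schwartz_measurable[OF test_schwartz[OF test_bump[of a b n]]] dm by measurable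
    qed (use dm in measurable)
    then show ?thesis unfolding bump0[OF ab] using LIMSEQ_const_iff by metis
  qed
  have zero: "AE x in lborel. indicator {l<..<u} x *\<^sub>R ?d x = 0" if lu: "0 < c" "{l<..<u} \<subseteq> {x. c < \<bar>x\<bar>}" for l u c
  proof (rule AE_zero_of_interval_integrals)
    show "integrable lborel (\<lambda>x. indicator {l<..<u} x *\<^sub>R ?d x)"
    proof -
      have "set_integrable lborel {l<..<u} ?d"
      proof (rule set_integrable_subset[OF di[OF lu(1), of "max \<bar>l\<bar> \<bar>u\<bar>"]])
        show "{l<..<u} \<subseteq> {x. c \<le> \<bar>x\<bar> \<and> \<bar>x\<bar> \<le> max \<bar>l\<bar> \<bar>u\<bar>}"
        proof
          fix x assume x: "x \<in> {l<..<u}"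
          then have "c < \<bar>x\<bar>" using lu(2) by blast
          moreover have "\<bar>x\<bar> \<le> max \<bar>l\<bar> \<bar>u\<bar>" using x by auto
          ultimately show "x \<in> {x. c \<le> \<bar>x\<bar> \<and> \<bar>x\<bar> \<le> max \<bar>l\<bar> \<bar>u\<bar>}" by simp
        qed
      qed simp
      then show ?thesis by (simp only: set_integrable_def)
    qed
    fix a b :: real
    have "(\<integral>x. indicator {max a l<..<min b u} x *\<^sub>R ?d x \<partial>lborel) = 0"
      by (rule int0[OF lu(1)]) (use lu(2) in auto)
    moreover have "(\<lambda>x. indicator {a<..<b} x *\<^sub>R (indicator {l<..<u} x *\<^sub>R ?d x)) = (\<lambda>x. indicator {max a l<..<min b u} x *\<^sub>R ?d x)"
      by (auto simp: indicator_def fun_eq_iff)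
    ultimately show "(\<integral>x. indicator {a<..<b} x *\<^sub>R (indicator {l<..<u} x *\<^sub>R ?d x) \<partial>lborel) = 0" by (simp only:)
  qed
  let ?e = "\<lambda>n. inverse (real (Suc n))"
  have "AE x in lborel. \<forall>n. indicator {?e n<..<real n} x *\<^sub>R ?d x = 0"
    unfolding AE_all_countable
  proof
    show "AE x in lborel. indicator {?e n<..<real n} x *\<^sub>R ?d x = 0" for n by (rule zero[of "?e n"]) auto
  qed
  moreover have "AE x in lborel. \<forall>n. indicator {- real n<..<- ?e n} x *\<^sub>R ?d x = 0"
    unfolding AE_all_countable
  proof
    show "AE x in lborel. indicator {- real n<..<- ?e n} x *\<^sub>R ?d x = 0" for n by (rule zero[of "?e n"]) auto
  qed
  moreover have "AE x in lborel. x \<noteq> (0::real)" by (rule AE_lborel_singleton)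
  ultimately show ?thesis
  proof eventually_elim
    case (elim x)
    then have "0 < \<bar>x\<bar>" by simp
    from reals_Archimedean[OF this] obtain n where n: "?e n < \<bar>x\<bar>" by blast
    obtain m where m: "\<bar>x\<bar> < real m" using reals_Archimedean2 by blast
    have "?e (max n m) \<le> ?e n" by (intro le_imp_inverse_le) auto
    moreover have "real m \<le> real (max n m)" by simp
    ultimately have *: "?e (max n m) < \<bar>x\<bar>" "\<bar>x\<bar> < real (max n m)" using n m by linarith+
    have "x \<in> {?e (max n m)<..<real (max n m)} \<or> x \<in> {- real (max n m)<..<- ?e (max n m)}"
      using * by (cases "x > 0") auto
    then have "?d x = 0" using elim(1)[rule_format, of "max n m"] elim(2)[rule_format, of "max n m"] by auto
    then show ?case by simp
  qed
qed

lemma is_function_integrable: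
  assumes "g \<in> borel_measurable borel" "\<And>\<phi>. \<phi> \<in> test_functions \<Longrightarrow> integrable lborel (\<lambda>x. g x * \<phi> x)"
    "\<And>x. cmod (g x) \<le> B" "\<And>\<phi>. \<phi> \<in> test_functions \<Longrightarrow> T \<phi> = (\<integral>x. g x * \<phi> x \<partial>lborel)"
  shows "is_function T g"
  unfolding is_function_def
proof (intro conjI allI impI ballI)
  fix a b :: real assume "0 < a"
  have "integrable lborel (\<lambda>x. B * indicator {-b..b} x)"
    by (intro integrable_mult_right) (auto simp: emeasure_lborel_Icc_eq)
  then show "set_integrable lborel {x. a \<le> \<bar>x\<bar> \<and> \<bar>x\<bar> \<le> b} g"
    unfolding set_integrable_def
  proof (rule Bochner_Integration.integrable_bound)
    show "AE x in lborel. norm (indicator {x. a \<le> \<bar>x\<bar> \<and> \<bar>x\<bar> \<le> b} x *\<^sub>R g x) \<le> norm (B * indicator {- b..b} x)"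
      using assms(3) by (intro AE_I2) (auto simp: indicator_def abs_le_iff intro: order_trans[OF _ abs_ge_self])
  qed (use assms(1) in measurable)
next
  fix \<phi> assume "\<phi> \<in> test_functions"
  then show "((\<lambda>\<epsilon>. LINT x:{x. \<epsilon> < \<bar>x\<bar>}|lborel. g x * \<phi> x) \<longlongrightarrow> T \<phi>) (at_right 0)"
    using principal_value_integrable[OF assms(2)] assms(4) by simp
qed (rule assms)

lemma is_function_fourier:
  assumes f: "integrable lborel f"
  shows "is_function (fourier_distribution (function_distribution f)) (fourier f)"
proof (rule is_function_integrable)
  show "fourier f \<in> borel_measurable borel" using borel_measurable_integrable[OF f] by (intro fourier_measurable) simp
  show "cmod (fourier f x) \<le> (\<integral>t. cmod (f t) \<partial>lborel)" for x by (rule norm_fourier_le)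
  fix \<phi> assume \<phi>: "\<phi> \<in> test_functions"
  have i: "integrable lborel \<phi>" by (intro schwartz_integrable test_schwartz \<phi>)
  show "integrable lborel (\<lambda>x. fourier f x * \<phi> x)" by (rule integral_fourier_swap(2)[OF f i])
  show "fourier_distribution (function_distribution f) \<phi> = (\<integral>x. fourier f x * \<phi> x \<partial>lborel)"
    using test_schwartz[OF \<phi>] fourier_test_schwartz[OF \<phi>] integral_fourier_swap(1)[OF f i]
    by (simp add: fourier_distribution_def function_distribution_def)
qed

lemma is_function_dirac: "is_function (fourier_distribution (dirac t)) (\<lambda>\<omega>. four_exp (t * \<omega>))"
proof (rule is_function_integrable)
  show "cmod (four_exp (t * \<omega>)) \<le> 1" for \<omega> by simp
  fix \<phi> assume \<phi>: "\<phi> \<in> test_functions"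
  have i: "integrable lborel \<phi>" by (intro schwartz_integrable test_schwartz \<phi>)
  show "integrable lborel (\<lambda>x. four_exp (t * x) * \<phi> x)" using fourier_integrable[OF i, of t] by (simp add: mult.commute)
  show "fourier_distribution (dirac t) \<phi> = (\<integral>x. four_exp (t * x) * \<phi> x \<partial>lborel)"
    using test_schwartz[OF \<phi>] fourier_test_schwartz[OF \<phi>]
    by (simp add: fourier_distribution_def dirac_def fourier_def mult.commute)
qed measurable

section \<open>Reflection, convolution and the ramp\<close>

lemma test_reflect: assumes "\<phi> \<in> test_functions" shows "reflect \<phi> \<in> test_functions"
proof -
  obtain R where "smooth_on UNIV \<phi>" and R: "\<And>t. R < \<bar>t\<bar> \<Longrightarrow> \<phi> t = 0"
    using assms by (auto simp: test_functions_def)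
  then have "smooth_on UNIV (reflect \<phi>)" using smooth_affine[of \<phi> "-1" 0] by (simp add: reflect_def[abs_def])
  moreover have "reflect \<phi> t = 0" if "R < \<bar>t\<bar>" for t using R[of "- t"] that by (simp add: reflect_def)
  ultimately show ?thesis by (auto simp: test_functions_def)
qed

lemma schwartz_reflect: assumes "\<phi> \<in> schwartz_space" shows "reflect \<phi> \<in> schwartz_space"
proof -
  let ?F = "\<lambda>n t. ((-1) ^ n) *\<^sub>R (vderiv ^^ n) \<phi> (- t)"
  have F0: "?F 0 = reflect \<phi>" by (simp add: reflect_def fun_eq_iff)
  have d: "(?F n has_vector_derivative ?F (Suc n) t) (at t)" for n t
  proof -
    have "((\<lambda>t::real. - t) has_vector_derivative -1) (at t)" by (auto intro!: derivative_eq_intros)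
    from vector_diff_chain_at[OF this smooth_has_deriv[OF schwartz_smooth[OF assms], of n]]
    have "((\<lambda>t. (vderiv ^^ n) \<phi> (- t)) has_vector_derivative (-1) *\<^sub>R (vderiv ^^ Suc n) \<phi> (- t)) (at t)"
      by (simp add: o_def)
    from bounded_linear.has_vector_derivative[OF bounded_linear_scaleR_right[of "(-1) ^ n"] this]
    show ?thesis by simp
  qed
  show ?thesis
  proof (rule schwartz_bddI)
    show "smooth_on UNIV (reflect \<phi>)" using F0 d by (rule smooth_derivI)
    fix m n
    have v: "(vderiv ^^ n) (reflect \<phi>) = ?F n" using F0 d by (rule smooth_derivI)
    have "\<bar>t\<bar> ^ m * cmod (?F n t) \<le> schwartz_seminorm m n \<phi>" for t
      using schwartz_le_seminorm[OF assms, of "- t" m n] by (simp add: power_abs)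
    then show "\<exists>B. \<forall>t. \<bar>t\<bar> ^ m * cmod ((vderiv ^^ n) (reflect \<phi>) t) \<le> B" unfolding v by blast
  qed
qed

lemma is_function_reflect:
  assumes "is_function (fourier_distribution (function_distribution f)) g"
  shows "is_function (fourier_distribution (function_distribution (reflect f))) (reflect g)"
proof -
  have gm [measurable]: "g \<in> borel_measurable borel" using assms by (simp add: is_function_def)
  show ?thesis unfolding is_function_def
  proof (intro conjI allI impI ballI)
    show "reflect g \<in> borel_measurable borel" unfolding reflect_def by measurable
    fix a b :: real assume "0 < a"
    then have "integrable lborel (\<lambda>x. indicator {x. a \<le> \<bar>x\<bar> \<and> \<bar>x\<bar> \<le> b} x *\<^sub>R g x)"
      using assms by (simp add: is_function_def set_integrable_def)
    from integrable_reflect[OF this]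
    have "integrable lborel (\<lambda>x. indicator {x. a \<le> \<bar>x\<bar> \<and> \<bar>x\<bar> \<le> b} (- x) *\<^sub>R g (- x))"
      unfolding reflect_def[abs_def] .
    then show "set_integrable lborel {x. a \<le> \<bar>x\<bar> \<and> \<bar>x\<bar> \<le> b} (reflect g)"
      by (simp add: reflect_def set_integrable_def indicator_def)
  next
    fix \<phi> assume \<phi>: "\<phi> \<in> test_functions"
    have "((\<lambda>\<epsilon>. LINT x:{x. \<epsilon> < \<bar>x\<bar>}|lborel. g x * reflect \<phi> x) \<longlongrightarrow> fourier_distribution (function_distribution f) (reflect \<phi>)) (at_right 0)"
      using assms test_reflect[OF \<phi>] by (simp add: is_function_def)
    moreover have "(LINT x:{x. \<epsilon> < \<bar>x\<bar>}|lborel. g x * reflect \<phi> x) = (LINT x:{x. \<epsilon> < \<bar>x\<bar>}|lborel. reflect g x * \<phi> x)" for \<epsilon> :: real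
      unfolding set_lebesgue_integral_def
      by (subst integral_reflect[symmetric]) (simp add: reflect_def indicator_def)
    moreover have "fourier_distribution (function_distribution f) (reflect \<phi>) = fourier_distribution (function_distribution (reflect f)) \<phi>"
    proof -
      have "(\<integral>t. f t * fourier (reflect \<phi>) t \<partial>lborel) = (\<integral>t. reflect f t * fourier \<phi> t \<partial>lborel)"
        by (subst integral_reflect[symmetric]) (simp add: fourier_reflect reflect_def)
      then show ?thesis
        using test_schwartz[OF \<phi>] test_schwartz[OF test_reflect[OF \<phi>]] fourier_test_schwartz[OF \<phi>] fourier_test_schwartz[OF test_reflect[OF \<phi>]]
        by (simp add: fourier_distribution_def function_distribution_def)
    qed
    ultimately show "((\<lambda>\<epsilon>. LINT x:{x. \<epsilon> < \<bar>x\<bar>}|lborel. reflect g x * \<phi> x) \<longlongrightarrow> fourier_distribution (function_distribution (reflect f)) \<phi>) (at_right 0)"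
      by simp
  qed
qed

lemma is_function_cong:
  assumes "\<And>\<phi>. \<phi> \<in> test_functions \<Longrightarrow> S \<phi> = T \<phi>" "is_function S g" shows "is_function T g"
  using assms by (simp add: is_function_def)

lemma integrable_convolution_pair:
  fixes f g :: "real \<Rightarrow> complex"
  assumes f: "integrable lborel f" and g: "integrable lborel g"
  shows "integrable (lborel \<Otimes>\<^sub>M lborel) (\<lambda>(s, t). f s * g (t - s))"
proof (rule lborel_pair.Fubini_integrable)
  have fm [measurable]: "f \<in> borel_measurable borel" and gm [measurable]: "g \<in> borel_measurable borel"
    using borel_measurable_integrable[OF f] borel_measurable_integrable[OF g] by auto
  show "(\<lambda>(s, t). f s * g (t - s)) \<in> borel_measurable (lborel \<Otimes>\<^sub>M lborel)" by measurable
  have sh: "integrable lborel (\<lambda>t. g (t - s))" for s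
    using lborel_integrable_real_affine[OF g, of 1 "- s"] by simp
  have "(\<integral>t. cmod (g (t - s)) \<partial>lborel) = (\<integral>t. cmod (g t) \<partial>lborel)" for s
    by (subst (2) lborel_integral_real_affine[where c=1 and t="- s"]) auto
  then have "(\<lambda>s. \<integral>t. norm (case (s, t) of (s, t) \<Rightarrow> f s * g (t - s)) \<partial>lborel) = (\<lambda>s. cmod (f s) * (\<integral>t. cmod (g t) \<partial>lborel))"
    by (simp add: norm_mult)
  then show "integrable lborel (\<lambda>s. \<integral>t. norm (case (s, t) of (s, t) \<Rightarrow> f s * g (t - s)) \<partial>lborel)"
    using f by simp
  show "AE s in lborel. integrable lborel (\<lambda>t. case (s, t) of (s, t) \<Rightarrow> f s * g (t - s))" using sh by simp
qed

lemma integrable_convolution: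
  assumes f: "integrable lborel f" and g: "integrable lborel g"
  shows "integrable lborel (convolution f g)"
  using lborel_pair.integrable_snd[of "\<lambda>s t. f s * g (t - s)"] integrable_convolution_pair[OF f g]
  by (simp add: convolution_def[abs_def])

lemma fourier_convolution:
  assumes f: "integrable lborel f" and g: "integrable lborel g"
  shows "fourier (convolution f g) \<omega> = fourier f \<omega> * fourier g \<omega>"
proof -
  let ?F = "\<lambda>s t. f s * g (t - s) * four_exp (t * \<omega>)"
  have fm [measurable]: "f \<in> borel_measurable borel" and gm [measurable]: "g \<in> borel_measurable borel"
    using borel_measurable_integrable[OF f] borel_measurable_integrable[OF g] by auto
  have int: "integrable (lborel \<Otimes>\<^sub>M lborel) (\<lambda>(s, t). ?F s t)"
    by (rule Bochner_Integration.integrable_bound[OF integrable_convolution_pair[OF f g]])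
       (auto intro!: AE_I2 simp: norm_mult)
  have "fourier (convolution f g) \<omega> = (\<integral>t. \<integral>s. ?F s t \<partial>lborel \<partial>lborel)"
    unfolding fourier_def convolution_def by simp
  also have "\<dots> = (\<integral>s. \<integral>t. ?F s t \<partial>lborel \<partial>lborel)" by (rule lborel_pair.Fubini_integral[OF int])
  also have "\<dots> = (\<integral>s. f s * four_exp (s * \<omega>) * fourier g \<omega> \<partial>lborel)"
  proof (intro Bochner_Integration.integral_cong refl)
    fix s
    have "(\<integral>t. ?F s t \<partial>lborel) = f s * fourier (\<lambda>t. g (t - s)) \<omega>"
      unfolding fourier_def by (simp add: mult.assoc)
    then show "(\<integral>t. ?F s t \<partial>lborel) = f s * four_exp (s * \<omega>) * fourier g \<omega>"
      by (simp only: fourier_translate mult.assoc)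
  qed
  also have "\<dots> = fourier f \<omega> * fourier g \<omega>" by (simp add: fourier_def)
  finally show ?thesis .
qed

lemma fourier_cnj: "fourier (\<lambda>t. cnj (f t)) \<omega> = cnj (fourier f (- \<omega>))"
  unfolding fourier_def by (simp add: exp_cnj flip: Bochner_Integration.integral_cnj)

text \<open>The triangle of half-width \<open>s\<close> restricted to \<open>t \<ge> 0\<close>. The
  one-sided kernel is the same mixture of ramps as \<open>K\<close> is of triangles, and the Fourier
  transform of a ramp is \<open>tri\<close> on the axis.\<close>

definition ramp :: "real \<Rightarrow> real \<Rightarrow> complex" where
  "ramp s t = of_real (indicator {0..s} t * (s - t))"

lemma ramp_measurable [measurable]: "(\<lambda>(s, t). ramp s t) \<in> borel_measurable (borel \<Otimes>\<^sub>M borel)"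
proof -
  have "(\<lambda>(s, t). ramp s t) = (\<lambda>(s, t). if 0 \<le> t \<and> t \<le> s then of_real (s - t) else 0)"
    by (auto simp: ramp_def fun_eq_iff)
  then show ?thesis by simp
qed

lemma norm_ramp: "0 \<le> t \<Longrightarrow> cmod (ramp s t) = max 0 (s - \<bar>t\<bar>)"
  by (auto simp: ramp_def indicator_def simp del: of_real_diff)

lemma integrable_ramp: "integrable lborel (ramp s)"
proof -
  have "integrable lborel (\<lambda>t. indicator {0..s} t *\<^sub>R (complex_of_real (s - t)))"
    by (rule borel_integrable_compact) (auto intro!: continuous_intros)
  then show ?thesis by (simp add: ramp_def[abs_def] scaleR_conv_of_real)
qed

lemma fourier_ramp:
  assumes "x \<noteq> 0" "0 \<le> s" shows "fourier (ramp s) x = tri s (\<i> * of_real x)"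
proof -
  let ?z = "\<i> * complex_of_real x"
  let ?G = "\<lambda>u. - ((of_real s - u) * exp (- (?z * u)) / ?z) + exp (- (?z * u)) / ?z\<^sup>2"
  let ?g = "\<lambda>t. complex_of_real (s - t) * exp (- (?z * of_real t))"
  have z: "?z \<noteq> 0" using assms by simp
  have "(\<integral>t. indicator {0..s} t *\<^sub>R ?g t \<partial>lborel) = ?G (of_real s) - ?G (of_real 0)"
  proof (rule integral_FTC_atLeastAtMost[where F="\<lambda>t. ?G (of_real t)"])
    fix t
    have "(?G has_field_derivative ?g t) (at (of_real t))"
      using z by (auto intro!: derivative_eq_intros simp: field_simps power2_eq_square)
    from has_vector_derivative_real_field[OF this]
    show "((\<lambda>t. ?G (of_real t)) has_vector_derivative ?g t) (at t within {0..s})"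
      by (rule has_vector_derivative_at_within)
  qed (use assms in \<open>auto intro!: continuous_intros\<close>)
  also have "\<dots> = tri s ?z" using z unfolding tri_def by (simp add: diff_divide_distrib)
  finally show ?thesis unfolding fourier_def ramp_def
    by (simp add: scaleR_conv_of_real mult_ac)
qed

section \<open>The one-sided kernel\<close>

context convex_kernel
begin

section \<open>The transform of the one-sided kernel as a principal value\<close>

lemma measurable_K [measurable]: "K \<in> borel_measurable borel"
  using cont by (rule borel_measurable_continuous_onI)

lemma measurable_kernel_plus [measurable]: "kernel_plus K \<in> borel_measurable borel"
  unfolding kernel_plus_def[abs_def] by measurable

lemma norm_kernel_plus_le: "cmod (kernel_plus K t) \<le> K 0"
  using K_le[of t] nonneg[of t] nonneg[of 0] by (simp add: kernel_plus_def)

lemma has_bochner_integral_w_ramp: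
  "has_bochner_integral lborel (\<lambda>s. of_real (w s) * ramp s t) (kernel_plus K t)"
proof (cases "0 \<le> t")
  case True
  have "(\<lambda>s. of_real (w s) * ramp s t) = (\<lambda>s. complex_of_real (max 0 (s - \<bar>t\<bar>) * w s))"
    using True by (auto simp: ramp_def indicator_def fun_eq_iff)
  moreover have "kernel_plus K t = complex_of_real (K t)" using True by (simp add: kernel_plus_def)
  ultimately show ?thesis
    using has_bochner_integral_of_real[OF has_bochner_integral_triangle[of t], where 'a=complex] by (simp only:)
next
  case False
  then have "ramp s t = 0" for s by (simp add: ramp_def)
  then show ?thesis using False by (simp add: kernel_plus_def has_bochner_integral_zero)
qed

text \<open>Fubini is justified because the absolute integrals over \<open>s\<close> add up to
  \<open>kernel_plus K t\<close>, which is bounded by \<open>K 0\<close>; integrability of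
  \<open>h\<close> then suffices.\<close>

lemma kernel_plus_ramp_pairing:
  assumes h: "integrable lborel h"
  shows "(\<integral>t. kernel_plus K t * h t \<partial>lborel) = (\<integral>s. of_real (w s) * (\<integral>t. ramp s t * h t \<partial>lborel) \<partial>lborel)"
    and "integrable lborel (\<lambda>s. of_real (w s) * (\<integral>t. ramp s t * h t \<partial>lborel))"
proof -
  let ?F = "\<lambda>t s. of_real (w s) * ramp s t * h t"
  have hm [measurable]: "h \<in> borel_measurable borel" using borel_measurable_integrable[OF h] by simp
  have i: "has_bochner_integral lborel (\<lambda>s. ?F t s) (kernel_plus K t * h t)" for t
    by (rule has_bochner_integral_mult_left) (rule has_bochner_integral_w_ramp)
  have n: "(\<integral>s. norm (?F t s) \<partial>lborel) = cmod (kernel_plus K t) * cmod (h t)" for t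
  proof (cases "0 \<le> t")
    case True
    have "norm (?F t s) = max 0 (s - \<bar>t\<bar>) * w s * cmod (h t)" for s
      using norm_ramp[OF True] w_nonneg[of s] by (simp add: norm_mult mult_ac)
    then have "(\<integral>s. norm (?F t s) \<partial>lborel) = K t * cmod (h t)"
      using has_bochner_integral_triangle[of t] by (simp add: has_bochner_integral_iff)
    then show ?thesis using True nonneg[of t] by (simp add: kernel_plus_def)
  qed (simp add: ramp_def kernel_plus_def)
  have int: "integrable (lborel \<Otimes>\<^sub>M lborel) (\<lambda>(t, s). ?F t s)"
  proof (rule lborel_pair.Fubini_integrable)
    have "integrable lborel (\<lambda>t. cmod (kernel_plus K t) * cmod (h t))"
    proof (rule Bochner_Integration.integrable_bound)
      show "integrable lborel (\<lambda>t. K 0 * cmod (h t))" using h by simp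
      show "AE t in lborel. norm (cmod (kernel_plus K t) * cmod (h t)) \<le> norm (K 0 * cmod (h t))"
        using norm_kernel_plus_le nonneg[of 0] by (intro AE_I2) (auto simp: abs_mult intro!: mult_right_mono)
    qed measurable
    then show "integrable lborel (\<lambda>t. \<integral>s. norm (case (t, s) of (t, s) \<Rightarrow> ?F t s) \<partial>lborel)" by (simp add: n)
    show "AE t in lborel. integrable lborel (\<lambda>s. case (t, s) of (t, s) \<Rightarrow> ?F t s)"
      using i by (simp add: has_bochner_integral_iff)
  qed measurable
  have e: "(\<integral>t. ?F t s \<partial>lborel) = of_real (w s) * (\<integral>t. ramp s t * h t \<partial>lborel)" for s
    by (simp add: mult.assoc)
  have "(\<integral>t. kernel_plus K t * h t \<partial>lborel) = (\<integral>t. \<integral>s. ?F t s \<partial>lborel \<partial>lborel)"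
    using i by (simp only: has_bochner_integral_iff)
  also have "\<dots> = (\<integral>s. \<integral>t. ?F t s \<partial>lborel \<partial>lborel)"
    by (rule lborel_pair.Fubini_integral[OF int, symmetric])
  finally show "(\<integral>t. kernel_plus K t * h t \<partial>lborel) = (\<integral>s. of_real (w s) * (\<integral>t. ramp s t * h t \<partial>lborel) \<partial>lborel)"
    unfolding e .
  show "integrable lborel (\<lambda>s. of_real (w s) * (\<integral>t. ramp s t * h t \<partial>lborel))"
    using lborel_pair.integrable_snd[OF int] unfolding e .
qed

text \<open>Outside the cut-off \<open>tri\<close> is at most \<open>2 * s / \<epsilon>\<close>, so
  the double integral has the majorant
  \<open>2 / \<epsilon> * (s * w s) * cmod (\<eta> x)\<close>.\<close>

lemma k_outside_pairing:
  assumes \<epsilon>: "0 < \<epsilon>" and \<eta>: "integrable lborel \<eta>"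
  shows "(\<integral>x. indicator {x. \<epsilon> < \<bar>x\<bar>} x *\<^sub>R (k (\<i> * of_real x) * \<eta> x) \<partial>lborel)
      = (\<integral>s. of_real (w s) * (\<integral>x. indicator {x. \<epsilon> < \<bar>x\<bar>} x *\<^sub>R (tri s (\<i> * of_real x) * \<eta> x) \<partial>lborel) \<partial>lborel)"
    and "integrable lborel (\<lambda>s. of_real (w s) * (\<integral>x. indicator {x. \<epsilon> < \<bar>x\<bar>} x *\<^sub>R (tri s (\<i> * of_real x) * \<eta> x) \<partial>lborel))"
proof -
  let ?A = "{x. \<epsilon> < \<bar>x\<bar>} :: real set"
  let ?F = "\<lambda>x s. indicator ?A x *\<^sub>R (of_real (w s) * tri s (\<i> * of_real x) * \<eta> x)"
  have cm [measurable]: "\<eta> \<in> borel_measurable borel" using borel_measurable_integrable[OF \<eta>] by simp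
  have it: "integrable lborel (\<lambda>s. of_real (w s) * tri s (\<i> * of_real x))" for x by (rule integrable_w_tri) simp
  have ints: "integrable lborel (\<lambda>s. ?F x s)" for x
    by (intro integrable_scaleR_right integrable_mult_left it)
  have K0: "0 \<le> K 0" by (rule nonneg)
  have int: "integrable (lborel \<Otimes>\<^sub>M lborel) (\<lambda>(x, s). ?F x s)"
  proof (rule lborel_pair.Fubini_integrable)
    have "integrable lborel (\<lambda>x. \<integral>s. norm (?F x s) \<partial>lborel)"
    proof (rule Bochner_Integration.integrable_bound)
      show "integrable lborel (\<lambda>x. 2 / \<epsilon> * K 0 * cmod (\<eta> x))" using \<eta> by simp
      show "AE x in lborel. norm (\<integral>s. norm (?F x s) \<partial>lborel) \<le> norm (2 / \<epsilon> * K 0 * cmod (\<eta> x))"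
      proof (rule AE_I2)
        fix x
        have "(\<integral>s. norm (?F x s) \<partial>lborel) \<le> (\<integral>s. 2 / \<epsilon> * cmod (\<eta> x) * (s * w s) \<partial>lborel)"
        proof (rule integral_mono)
          show "integrable lborel (\<lambda>s. norm (?F x s))" by (rule integrable_norm[OF ints])
          show "integrable lborel (\<lambda>s. 2 / \<epsilon> * cmod (\<eta> x) * (s * w s))" by (intro integrable_mult_right integrable_s_w)
          fix s
          show "norm (?F x s) \<le> 2 / \<epsilon> * cmod (\<eta> x) * (s * w s)"
          proof (cases "x \<in> ?A")
            case True
            have sw: "0 \<le> s * w s" using w_nonneg[of s] w_0[of s] by (cases "s > 0") auto
            have "cmod (of_real (w s) * tri s (\<i> * of_real x)) \<le> (2 / cmod (\<i> * of_real x)) * (s * w s)"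
              by (rule norm_w_tri_le) simp
            also have "\<dots> \<le> (2 / \<epsilon>) * (s * w s)"
              using True \<epsilon> sw by (intro mult_right_mono divide_left_mono) (auto simp: norm_mult)
            finally have "cmod (of_real (w s) * tri s (\<i> * of_real x)) * cmod (\<eta> x) \<le> (2 / \<epsilon>) * (s * w s) * cmod (\<eta> x)"
              by (rule mult_right_mono) simp
            then show ?thesis using True by (simp add: norm_mult mult_ac)
          next
            case False
            have sw: "0 \<le> s * w s" using w_nonneg[of s] w_0[of s] by (cases "s > 0") auto
            have "0 \<le> 2 / \<epsilon> * cmod (\<eta> x) * (s * w s)" using \<epsilon> by (intro mult_nonneg_nonneg sw) auto
            with False show ?thesis by simp
          qed
        qed
        also have "\<dots> = 2 / \<epsilon> * K 0 * cmod (\<eta> x)" by (simp add: integral_s_w)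
        finally have "(\<integral>s. norm (?F x s) \<partial>lborel) \<le> 2 / \<epsilon> * K 0 * cmod (\<eta> x)" .
        moreover have "0 \<le> (\<integral>s. norm (?F x s) \<partial>lborel)" by (rule integral_nonneg_AE) simp
        ultimately show "norm (\<integral>s. norm (?F x s) \<partial>lborel) \<le> norm (2 / \<epsilon> * K 0 * cmod (\<eta> x))"
          unfolding real_norm_def[of "integral\<^sup>L _ _"] real_norm_def[of "2 / \<epsilon> * K 0 * cmod (\<eta> x)"]
          by (simp only: abs_of_nonneg)
      qed
    qed measurable
    then show "integrable lborel (\<lambda>x. \<integral>s. norm (case (x, s) of (x, s) \<Rightarrow> ?F x s) \<partial>lborel)" by simp
    show "AE x in lborel. integrable lborel (\<lambda>s. case (x, s) of (x, s) \<Rightarrow> ?F x s)" using ints by simp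
  qed measurable
  have e1: "(\<integral>x. ?F x s \<partial>lborel) = of_real (w s) * (\<integral>x. indicator ?A x *\<^sub>R (tri s (\<i> * of_real x) * \<eta> x) \<partial>lborel)" for s
  proof -
    have "(\<integral>x. ?F x s \<partial>lborel) = (\<integral>x. of_real (w s) * (indicator ?A x *\<^sub>R (tri s (\<i> * of_real x) * \<eta> x)) \<partial>lborel)"
      by (intro Bochner_Integration.integral_cong refl) (simp add: indicator_def)
    then show ?thesis by (simp only: integral_mult_right_zero)
  qed
  have e2: "(\<integral>s. ?F x s \<partial>lborel) = indicator ?A x *\<^sub>R (k (\<i> * of_real x) * \<eta> x)" for x
    by (simp add: k_def)
  show "(\<integral>x. indicator {x. \<epsilon> < \<bar>x\<bar>} x *\<^sub>R (k (\<i> * of_real x) * \<eta> x) \<partial>lborel)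
      = (\<integral>s. of_real (w s) * (\<integral>x. indicator {x. \<epsilon> < \<bar>x\<bar>} x *\<^sub>R (tri s (\<i> * of_real x) * \<eta> x) \<partial>lborel) \<partial>lborel)"
    using lborel_pair.Fubini_integral[OF int] unfolding e1 e2 by (rule HOL.sym)
  show "integrable lborel (\<lambda>s. of_real (w s) * (\<integral>x. indicator {x. \<epsilon> < \<bar>x\<bar>} x *\<^sub>R (tri s (\<i> * of_real x) * \<eta> x) \<partial>lborel))"
    using lborel_pair.integrable_snd[OF int] unfolding e1 .
qed

text \<open>Near the origin the real part of the transform is integrable, while the odd imaginary part is
  of size \<open>1 / \<bar>x\<bar>\<close> and only sees the odd part of \<open>\<eta>\<close>.\<close>
lemma inside_pairing_bound:
  assumes \<epsilon>: "0 < \<epsilon>" and s: "0 < s" and \<eta>: "integrable lborel \<eta>"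
    and B: "\<And>x. cmod (\<eta> x) \<le> B" and L: "\<And>x. cmod (\<eta> x - \<eta> (- x)) \<le> L * \<bar>x\<bar>"
  shows "cmod ((\<integral>t. ramp s t * fourier \<eta> t \<partial>lborel)
      - (\<integral>x. indicator {x. \<epsilon> < \<bar>x\<bar>} x *\<^sub>R (tri s (\<i> * of_real x) * \<eta> x) \<partial>lborel))
    \<le> B * (\<integral>x. indicator {-\<epsilon>..\<epsilon>} x * ((1 - cos (s * x)) / x\<^sup>2) \<partial>lborel) + 2 * \<epsilon> * L * s"
proof -
  let ?A = "{x. \<epsilon> < \<bar>x\<bar>} :: real set"
  let ?T = "\<lambda>x. fourier (ramp s) x"
  let ?R = "\<lambda>x. (1 - cos (s * x)) / x\<^sup>2"
  have cm [measurable]: "\<eta> \<in> borel_measurable borel" using borel_measurable_integrable[OF \<eta>] by simp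
  have fm [measurable]: "?T \<in> borel_measurable borel" by (intro fourier_measurable) simp
  have iT: "integrable lborel (\<lambda>x. ?T x * \<eta> x)"
    by (rule integral_fourier_swap(2)[OF integrable_ramp \<eta>])
  have iA: "integrable lborel (\<lambda>x. indicator ?A x *\<^sub>R (?T x * \<eta> x))"
    by (rule integrable_mult_indicator[OF _ iT]) simp
  have e1: "(\<integral>t. ramp s t * fourier \<eta> t \<partial>lborel) = (\<integral>x. ?T x * \<eta> x \<partial>lborel)"
    by (rule integral_fourier_swap(1)[OF integrable_ramp \<eta>])
  have e2: "(\<integral>x. indicator ?A x *\<^sub>R (tri s (\<i> * of_real x) * \<eta> x) \<partial>lborel) = (\<integral>x. indicator ?A x *\<^sub>R (?T x * \<eta> x) \<partial>lborel)"
    by (intro Bochner_Integration.integral_cong refl) (use \<epsilon> s in \<open>auto simp: indicator_def fourier_ramp\<close>)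
  let ?G = "\<lambda>x. indicator {-\<epsilon>..\<epsilon>} x *\<^sub>R (?T x * \<eta> x)"
  have iG: "integrable lborel ?G" by (rule integrable_mult_indicator[OF _ iT]) simp
  have iG': "integrable lborel (\<lambda>x. ?G (- x))" using integrable_reflect[OF iG] by (simp only: reflect_def[abs_def])
  have "(\<integral>x. ?T x * \<eta> x \<partial>lborel) - (\<integral>x. indicator ?A x *\<^sub>R (?T x * \<eta> x) \<partial>lborel) = (\<integral>x. ?T x * \<eta> x - indicator ?A x *\<^sub>R (?T x * \<eta> x) \<partial>lborel)"
    by (rule Bochner_Integration.integral_diff[symmetric, OF iT iA])
  also have "\<dots> = (\<integral>x. ?G x \<partial>lborel)"
    by (intro Bochner_Integration.integral_cong refl) (auto simp: indicator_def)
  finally have d: "(\<integral>x. ?T x * \<eta> x \<partial>lborel) - (\<integral>x. indicator ?A x *\<^sub>R (?T x * \<eta> x) \<partial>lborel) = (\<integral>x. ?G x \<partial>lborel)" .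
  \<comment> \<open>Averaging over \<open>x\<close> and \<open>- x\<close>: since the transform
    takes conjugate values there, its real part meets \<open>\<eta> x + \<eta> (- x)\<close> and its
    imaginary part meets \<open>\<eta> x - \<eta> (- x)\<close>.\<close>
  have "2 * (\<integral>x. ?G x \<partial>lborel) = (\<integral>x. ?G x \<partial>lborel) + (\<integral>x. ?G (- x) \<partial>lborel)"
    unfolding integral_reflect[of ?G] by simp
  also have "\<dots> = (\<integral>x. ?G x + ?G (- x) \<partial>lborel)"
    by (rule Bochner_Integration.integral_add[symmetric, OF iG iG'])
  finally have sy: "2 * (\<integral>x. ?G x \<partial>lborel) = (\<integral>x. ?G x + ?G (- x) \<partial>lborel)" .
  let ?H = "\<lambda>x. 2 * B * (indicator {-\<epsilon>..\<epsilon>} x * ?R x) + 2 * s * L * indicator {-\<epsilon>..\<epsilon>} x"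
  have iR: "integrable lborel (\<lambda>x. indicator {-\<epsilon>..\<epsilon>} x * ?R x)"
    using integrable_mult_indicator[of "{-\<epsilon>..\<epsilon>}" lborel ?R] has_bochner_integral_one_minus_cos[of s]
    by (simp add: has_bochner_integral_iff)
  have i1: "integrable lborel (\<lambda>x. indicator {-\<epsilon>..\<epsilon>} x :: real)" by (auto simp: emeasure_lborel_Icc_eq)
  have "cmod (\<integral>x. ?G x + ?G (- x) \<partial>lborel) \<le> (\<integral>x. cmod (?G x + ?G (- x)) \<partial>lborel)"
    by (rule integral_norm_bound)
  also have "\<dots> \<le> (\<integral>x. ?H x \<partial>lborel)"
  proof (rule integral_mono_AE)
    show "integrable lborel (\<lambda>x. cmod (?G x + ?G (- x)))" by (intro integrable_norm Bochner_Integration.integrable_add iG iG')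
    show "integrable lborel ?H" by (intro Bochner_Integration.integrable_add integrable_mult_right iR i1)
    have "AE x in lborel. x \<noteq> (0::real)" by (rule AE_lborel_singleton)
    then show "AE x in lborel. norm (?G x + ?G (- x)) \<le> ?H x"
    proof eventually_elim
      case (elim x)
      let ?t = "tri s (\<i> * of_real x)"
      show ?case
      proof (cases "x \<in> {-\<epsilon>..\<epsilon>}")
        case True
        have T: "?T x = ?t" "?T (- x) = cnj ?t"
          using fourier_ramp[of x s] fourier_ramp[of "- x" s] tri_cnj[of s "\<i> * of_real x"] elim s by auto
        have "?t * \<eta> x + cnj ?t * \<eta> (- x) = of_real (Re ?t) * (\<eta> x + \<eta> (- x)) + \<i> * of_real (Im ?t) * (\<eta> x - \<eta> (- x))"
          by (simp add: complex_eq_iff algebra_simps)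
        then have "norm (?G x + ?G (- x)) = cmod (of_real (Re ?t) * (\<eta> x + \<eta> (- x)) + \<i> * of_real (Im ?t) * (\<eta> x - \<eta> (- x)))"
          using True T by simp
        also have "\<dots> \<le> \<bar>Re ?t\<bar> * cmod (\<eta> x + \<eta> (- x)) + \<bar>Im ?t\<bar> * cmod (\<eta> x - \<eta> (- x))"
          by (rule order_trans[OF norm_triangle_ineq]) (simp add: norm_mult)
        also have "\<dots> \<le> ?R x * (2 * B) + (2 * s / \<bar>x\<bar>) * (L * \<bar>x\<bar>)"
        proof (intro add_mono mult_mono L)
          show "\<bar>Re ?t\<bar> \<le> ?R x" unfolding Re_tri_axis by simp
          show "cmod (\<eta> x + \<eta> (- x)) \<le> 2 * B" using norm_triangle_ineq[of "\<eta> x" "\<eta> (- x)"] B[of x] B[of "- x"] by simp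
          show "\<bar>Im ?t\<bar> \<le> 2 * s / \<bar>x\<bar>"
            using abs_Im_le_cmod[of ?t] norm_tri_le[of "\<i> * of_real x" s] s by (simp add: norm_mult)
        qed (use s in auto)
        also have "\<dots> = ?H x" using True elim by simp
        finally show ?thesis .
      next
        case False
        then have "- x \<notin> {-\<epsilon>..\<epsilon>}" by auto
        with False show ?thesis by simp
      qed
    qed
  qed
  also have "(\<integral>x. ?H x \<partial>lborel) = 2 * B * (\<integral>x. indicator {-\<epsilon>..\<epsilon>} x * ?R x \<partial>lborel) + 2 * s * L * (\<integral>x. indicator {-\<epsilon>..\<epsilon>} x \<partial>lborel)"
    by (simp only: Bochner_Integration.integral_add[OF integrable_mult_right[OF iR] integrable_mult_right[OF i1]] integral_mult_right_zero)
  also have "(\<integral>x. indicator {-\<epsilon>..\<epsilon>} x \<partial>lborel) = 2 * \<epsilon>" using \<epsilon> by simp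
  finally have "cmod (2 * (\<integral>x. ?G x \<partial>lborel)) \<le> 2 * B * (\<integral>x. indicator {-\<epsilon>..\<epsilon>} x * ?R x \<partial>lborel) + 2 * s * L * (2 * \<epsilon>)"
    unfolding sy .
  then have "cmod (\<integral>x. ?G x \<partial>lborel) \<le> B * (\<integral>x. indicator {-\<epsilon>..\<epsilon>} x * ?R x \<partial>lborel) + 2 * \<epsilon> * L * s"
    by (simp only: norm_mult norm_numeral) (simp add: algebra_simps)
  then show ?thesis unfolding e1 e2 d .
qed

text \<open>Mixing the real part of the error near the origin over \<open>s\<close> gives, up to
  \<open>pi\<close>, the mass of \<open>kappa\<close> on \<open>[-\<epsilon>, \<epsilon>]\<close>.
  This mass tends to zero because \<open>kappa\<close> is integrable.\<close>

lemma integral_w_inside: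
  shows "(\<integral>s. w s * (\<integral>x. indicator {-\<epsilon>..\<epsilon>} x * ((1 - cos (s * x)) / x\<^sup>2) \<partial>lborel) \<partial>lborel) = pi * (\<integral>x. indicator {-\<epsilon>..\<epsilon>} x * kappa x \<partial>lborel)"
    and "integrable lborel (\<lambda>s. w s * (\<integral>x. indicator {-\<epsilon>..\<epsilon>} x * ((1 - cos (s * x)) / x\<^sup>2) \<partial>lborel))"
proof -
  let ?F = "\<lambda>s x. indicator {-\<epsilon>..\<epsilon>} x * (w s * ((1 - cos (s * x)) / x\<^sup>2))"
  have int: "integrable (lborel \<Otimes>\<^sub>M lborel) (\<lambda>(s, x). ?F s x)"
  proof (rule Bochner_Integration.integrable_bound[OF integrable_pair_triangle_transform[of 0]])
    show "AE z in lborel \<Otimes>\<^sub>M lborel. norm (case z of (s, x) \<Rightarrow> ?F s x) \<le> norm (case z of (s, x) \<Rightarrow> w s * ((1 - cos (s * x)) / x\<^sup>2 * cos (0 * x)))"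
    proof (rule AE_I2)
      fix z :: "real \<times> real"
      obtain s x where z: "z = (s, x)" by (cases z)
      have "norm (?F s x) \<le> norm (w s * ((1 - cos (s * x)) / x\<^sup>2))" by (cases "x \<in> {-\<epsilon>..\<epsilon>}") simp_all
      then show "norm (case z of (s, x) \<Rightarrow> ?F s x) \<le> norm (case z of (s, x) \<Rightarrow> w s * ((1 - cos (s * x)) / x\<^sup>2 * cos (0 * x)))"
        unfolding z by (simp only: prod.case mult_zero_left cos_zero mult_1_right)
    qed
  qed measurable
  have e1: "(\<integral>x. ?F s x \<partial>lborel) = w s * (\<integral>x. indicator {-\<epsilon>..\<epsilon>} x * ((1 - cos (s * x)) / x\<^sup>2) \<partial>lborel)" for s
  proof -
    have "(\<integral>x. ?F s x \<partial>lborel) = (\<integral>x. w s * (indicator {-\<epsilon>..\<epsilon>} x * ((1 - cos (s * x)) / x\<^sup>2)) \<partial>lborel)"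
      by (intro Bochner_Integration.integral_cong refl) (simp add: indicator_def)
    then show ?thesis by (simp only: integral_mult_right_zero)
  qed
  have e2: "(\<integral>s. ?F s x \<partial>lborel) = pi * (indicator {-\<epsilon>..\<epsilon>} x * kappa x)" for x
  proof -
    have "(\<integral>s. ?F s x \<partial>lborel) = indicator {-\<epsilon>..\<epsilon>} x * (\<integral>s. w s * Re (tri s (\<i> * of_real x)) \<partial>lborel)"
      by (simp only: integral_mult_right_zero Re_tri_axis)
    also have "(\<integral>s. w s * Re (tri s (\<i> * of_real x)) \<partial>lborel) = pi * kappa x" by (simp add: kappa_def Re_k(1))
    finally show ?thesis by simp
  qed
  have "(\<integral>s. \<integral>x. ?F s x \<partial>lborel \<partial>lborel) = (\<integral>x. \<integral>s. ?F s x \<partial>lborel \<partial>lborel)"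
    by (rule lborel_pair.Fubini_integral[OF int, symmetric])
  then show "(\<integral>s. w s * (\<integral>x. indicator {-\<epsilon>..\<epsilon>} x * ((1 - cos (s * x)) / x\<^sup>2) \<partial>lborel) \<partial>lborel) = pi * (\<integral>x. indicator {-\<epsilon>..\<epsilon>} x * kappa x \<partial>lborel)"
    unfolding e1 e2 by (simp only: integral_mult_right_zero)
  show "integrable lborel (\<lambda>s. w s * (\<integral>x. indicator {-\<epsilon>..\<epsilon>} x * ((1 - cos (s * x)) / x\<^sup>2) \<partial>lborel))"
    using lborel_pair.integrable_fst[OF int] unfolding e1 .
qed

text \<open>Both sides are mixtures over \<open>s\<close> and differ triangle by triangle only in
  the contribution of \<open>\<bar>x\<bar> \<le> \<epsilon>\<close>. After mixing, the bound of
  \<open>inside_pairing_bound\<close> becomes \<open>B * pi\<close> times the mass of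
  \<open>kappa\<close> on \<open>[-\<epsilon>, \<epsilon>]\<close>, plus
  \<open>2 * \<epsilon> * L * K 0\<close>.\<close>

theorem principal_value_k:
  assumes \<eta>: "integrable lborel \<eta>" and f\<eta>: "integrable lborel (fourier \<eta>)"
    and B: "\<And>x. cmod (\<eta> x) \<le> B" and L: "\<And>x. cmod (\<eta> x - \<eta> (- x)) \<le> L * \<bar>x\<bar>"
  shows "((\<lambda>\<epsilon>. LINT x:{x. \<epsilon> < \<bar>x\<bar>}|lborel. k (\<i> * of_real x) * \<eta> x) \<longlongrightarrow>
      (\<integral>t. kernel_plus K t * fourier \<eta> t \<partial>lborel)) (at_right 0)"
proof (rule LIM_zero_cancel, rule Lim_null_comparison)
  let ?P = "\<lambda>\<epsilon>. LINT x:{x. \<epsilon> < \<bar>x\<bar>}|lborel. k (\<i> * of_real x) * \<eta> x"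
  let ?Q = "\<integral>t. kernel_plus K t * fourier \<eta> t \<partial>lborel"
  let ?b = "\<lambda>\<epsilon>. B * (pi * ((\<integral>x. kappa x \<partial>lborel) - (LINT x:{x. \<epsilon> < \<bar>x\<bar>}|lborel. kappa x))) + 2 * \<epsilon> * L * K 0"
  show "\<forall>\<^sub>F \<epsilon> in at_right 0. norm (?P \<epsilon> - ?Q) \<le> ?b \<epsilon>"
    using eventually_at_right_less[of "0::real"]
  proof eventually_elim
    case (elim \<epsilon>)
    let ?r = "\<lambda>s. \<integral>x. indicator {-\<epsilon>..\<epsilon>} x * ((1 - cos (s * x)) / x\<^sup>2) \<partial>lborel"
    note k1 = kernel_plus_ramp_pairing[OF f\<eta>] and k2 = k_outside_pairing[OF elim \<eta>]
    have "norm (?P \<epsilon> - ?Q) = norm (?Q - ?P \<epsilon>)" by (rule norm_minus_commute)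
    also have "?Q - ?P \<epsilon> = (\<integral>s. of_real (w s) * (\<integral>t. ramp s t * fourier \<eta> t \<partial>lborel)
       - of_real (w s) * (\<integral>x. indicator {x. \<epsilon> < \<bar>x\<bar>} x *\<^sub>R (tri s (\<i> * of_real x) * \<eta> x) \<partial>lborel) \<partial>lborel)"
      unfolding set_lebesgue_integral_def k1(1) k2(1)
      by (rule Bochner_Integration.integral_diff[symmetric, OF k1(2) k2(2)])
    finally have e: "norm (?P \<epsilon> - ?Q) = norm (\<integral>s. of_real (w s) * (\<integral>t. ramp s t * fourier \<eta> t \<partial>lborel)
       - of_real (w s) * (\<integral>x. indicator {x. \<epsilon> < \<bar>x\<bar>} x *\<^sub>R (tri s (\<i> * of_real x) * \<eta> x) \<partial>lborel) \<partial>lborel)" .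
    have "norm (\<integral>s. of_real (w s) * (\<integral>t. ramp s t * fourier \<eta> t \<partial>lborel)
       - of_real (w s) * (\<integral>x. indicator {x. \<epsilon> < \<bar>x\<bar>} x *\<^sub>R (tri s (\<i> * of_real x) * \<eta> x) \<partial>lborel) \<partial>lborel)
       \<le> (\<integral>s. B * (w s * ?r s) + 2 * \<epsilon> * L * (s * w s) \<partial>lborel)"
    proof (rule Bochner_Integration.integral_norm_bound_integral[OF Bochner_Integration.integrable_diff[OF k1(2) k2(2)]])
      show "integrable lborel (\<lambda>s. B * (w s * ?r s) + 2 * \<epsilon> * L * (s * w s))"
        by (intro Bochner_Integration.integrable_add integrable_mult_right integrable_s_w integral_w_inside)
      fix s
      let ?X = "\<integral>t. ramp s t * fourier \<eta> t \<partial>lborel"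
      let ?Y = "\<integral>x. indicator {x. \<epsilon> < \<bar>x\<bar>} x *\<^sub>R (tri s (\<i> * of_real x) * \<eta> x) \<partial>lborel"
      show "norm (of_real (w s) * ?X - of_real (w s) * ?Y) \<le> B * (w s * ?r s) + 2 * \<epsilon> * L * (s * w s)"
      proof (cases "s > 0")
        case True
        have "norm (of_real (w s) * ?X - of_real (w s) * ?Y) = w s * cmod (?X - ?Y)"
          using w_nonneg[of s] by (simp add: norm_mult flip: right_diff_distrib)
        also have "\<dots> \<le> w s * (B * ?r s + 2 * \<epsilon> * L * s)"
          by (intro mult_left_mono w_nonneg inside_pairing_bound[OF elim True \<eta> B L])
        also have "\<dots> = B * (w s * ?r s) + 2 * \<epsilon> * L * (s * w s)" by (simp only: distrib_left mult_ac)
        finally show ?thesis .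
      qed (simp add: w_0)
    qed
    also have "\<dots> = B * (\<integral>s. w s * ?r s \<partial>lborel) + 2 * \<epsilon> * L * K 0"
      using integral_w_inside(2)[of \<epsilon>] integrable_s_w by (subst Bochner_Integration.integral_add) (auto simp: integral_s_w)
    also have "\<dots> = ?b \<epsilon>"
    proof -
      have "(\<integral>x. kappa x \<partial>lborel) - (\<integral>x. indicator {x. \<epsilon> < \<bar>x\<bar>} x *\<^sub>R kappa x \<partial>lborel)
        = (\<integral>x. kappa x - indicator {x. \<epsilon> < \<bar>x\<bar>} x *\<^sub>R kappa x \<partial>lborel)"
        by (rule Bochner_Integration.integral_diff[symmetric, OF integrable_kappa])
           (rule integrable_mult_indicator[OF _ integrable_kappa], simp)
      also have "\<dots> = (\<integral>x. indicator {-\<epsilon>..\<epsilon>} x * kappa x \<partial>lborel)"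
        by (intro Bochner_Integration.integral_cong refl) (auto simp: indicator_def)
      finally show ?thesis unfolding integral_w_inside(1) set_lebesgue_integral_def by simp
    qed
    finally show ?case unfolding e .
  qed
  have "(?b \<longlongrightarrow> B * (pi * ((\<integral>x. kappa x \<partial>lborel) - (\<integral>x. kappa x \<partial>lborel))) + 2 * 0 * L * K 0) (at_right 0)"
    by (intro tendsto_intros principal_value_integrable integrable_kappa)
  then show "(?b \<longlongrightarrow> 0) (at_right 0)" by simp
qed

lemma fourier_kappa: "fourier (\<lambda>\<omega>. of_real (kappa \<omega>)) t = of_real (K t)"
proof -
  have ik: "integrable lborel (\<lambda>\<omega>. complex_of_real (kappa \<omega>))" using integrable_kappa by simp
  note int = fourier_integrable[OF ik, of t]
  have "Re (fourier (\<lambda>\<omega>. of_real (kappa \<omega>)) t) = (\<integral>\<omega>. kappa \<omega> * cos (t * \<omega>) \<partial>lborel)"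
    unfolding fourier_def by (subst integral_Re[symmetric, OF int]) (simp add: Re_exp mult.commute)
  moreover have "Im (fourier (\<lambda>\<omega>. of_real (kappa \<omega>)) t) = 0"
  proof -
    have "Im (fourier (\<lambda>\<omega>. of_real (kappa \<omega>)) t) = (\<integral>\<omega>. - (kappa \<omega> * sin (t * \<omega>)) \<partial>lborel)"
      unfolding fourier_def by (subst integral_Im[symmetric, OF int]) (simp add: Im_exp mult.commute)
    moreover have "(\<integral>\<omega>. - (kappa \<omega> * sin (t * \<omega>)) \<partial>lborel) = - (\<integral>\<omega>. - (kappa \<omega> * sin (t * \<omega>)) \<partial>lborel)"
      by (subst integral_reflect[symmetric]) (simp add: kappa_minus)
    ultimately show ?thesis by simp
  qed
  ultimately show ?thesis using has_bochner_integral_kappa_cos[of t] by (simp add: has_bochner_integral_iff complex_eq_iff)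
qed

text \<open>\<open>K\<close> is written as the transform of \<open>kappa\<close>, and the
  multiplication formula moves the transform onto the convolution, where it factorises.\<close>

lemma noise_covariance_eq:
  assumes \<phi>: "\<phi> \<in> schwartz_space" and \<psi>: "\<psi> \<in> schwartz_space"
  shows "noise_covariance K \<phi> \<psi> = (\<integral>\<omega>. of_real (kappa \<omega>) * (fourier \<phi> \<omega> * cnj (fourier \<psi> \<omega>)) \<partial>lborel)"
proof -
  let ?p = "reflect (\<lambda>s. cnj (\<psi> s))"
  let ?c = "convolution \<phi> ?p"
  have i\<phi>: "integrable lborel \<phi>" by (rule schwartz_integrable[OF \<phi>])
  have ip: "integrable lborel ?p" using schwartz_integrable[OF \<psi>] by (intro integrable_reflect) simp
  have ic: "integrable lborel ?c" by (rule integrable_convolution[OF i\<phi> ip])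
  have ik: "integrable lborel (\<lambda>\<omega>. complex_of_real (kappa \<omega>))" using integrable_kappa by simp
  have "noise_covariance K \<phi> \<psi> = (\<integral>t. ?c t * fourier (\<lambda>\<omega>. of_real (kappa \<omega>)) t \<partial>lborel)"
    unfolding noise_covariance_def fourier_kappa by (simp add: mult.commute)
  also have "\<dots> = (\<integral>x. fourier ?c x * of_real (kappa x) \<partial>lborel)" by (rule integral_fourier_swap(1)[OF ic ik])
  also have "\<dots> = (\<integral>\<omega>. of_real (kappa \<omega>) * (fourier \<phi> \<omega> * cnj (fourier \<psi> \<omega>)) \<partial>lborel)"
    by (simp add: fourier_convolution[OF i\<phi> ip] fourier_reflect fourier_cnj mult.commute)
  finally show ?thesis .
qed

lemma integrable_bounded_shift_pair:
  fixes b f g :: "real \<Rightarrow> complex"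
  assumes bm [measurable]: "b \<in> borel_measurable borel" and b: "\<And>s. cmod (b s) \<le> C"
    and f: "integrable lborel f" and g: "integrable lborel g"
  shows "integrable (lborel \<Otimes>\<^sub>M lborel) (\<lambda>(t, s). b s * f (t - s) * g t)"
proof -
  have fm [measurable]: "f \<in> borel_measurable borel" and gm [measurable]: "g \<in> borel_measurable borel"
    using borel_measurable_integrable[OF f] borel_measurable_integrable[OF g] by auto
  show ?thesis
proof (rule lborel_pair.Fubini_integrable)
  have sh: "integrable lborel (\<lambda>s. f (t - s))" for t
    using lborel_integrable_real_affine[OF f, of "-1" t] by simp
  have I: "(\<integral>s. cmod (f (t - s)) \<partial>lborel) = (\<integral>s. cmod (f s) \<partial>lborel)" for t
    by (subst (2) lborel_integral_real_affine[where c="-1" and t=t]) auto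
  have bs: "integrable lborel (\<lambda>s. b s * f (t - s))" for t
  proof (rule Bochner_Integration.integrable_bound)
    show "integrable lborel (\<lambda>s. C * cmod (f (t - s)))" using sh by simp
    show "AE s in lborel. norm (b s * f (t - s)) \<le> norm (C * cmod (f (t - s)))"
      using b by (intro AE_I2) (auto simp: norm_mult abs_mult intro!: mult_right_mono order_trans[OF b abs_ge_self])
  qed measurable
  show "AE t in lborel. integrable lborel (\<lambda>s. case (t, s) of (t, s) \<Rightarrow> b s * f (t - s) * g t)"
    using bs by simp
  have C: "0 \<le> C" using b[of 0] norm_ge_zero order_trans by blast
  show "integrable lborel (\<lambda>t. \<integral>s. norm (case (t, s) of (t, s) \<Rightarrow> b s * f (t - s) * g t) \<partial>lborel)"
  proof (rule Bochner_Integration.integrable_bound)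
    show "integrable lborel (\<lambda>t. C * (\<integral>s. cmod (f s) \<partial>lborel) * cmod (g t))" using g by simp
    show "AE t in lborel. norm (\<integral>s. norm (case (t, s) of (t, s) \<Rightarrow> b s * f (t - s) * g t) \<partial>lborel) \<le> norm (C * (\<integral>s. cmod (f s) \<partial>lborel) * cmod (g t))"
    proof (rule AE_I2)
      fix t
      have "(\<integral>s. cmod (b s * f (t - s)) \<partial>lborel) \<le> (\<integral>s. C * cmod (f (t - s)) \<partial>lborel)"
        by (intro integral_mono integrable_norm bs integrable_mult_right sh) (auto simp: norm_mult intro!: mult_right_mono b)
      then have "(\<integral>s. cmod (b s * f (t - s)) \<partial>lborel) \<le> C * (\<integral>s. cmod (f s) \<partial>lborel)" by (simp add: I)
      then have "(\<integral>s. cmod (b s * f (t - s)) \<partial>lborel) * cmod (g t) \<le> C * (\<integral>s. cmod (f s) \<partial>lborel) * cmod (g t)"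
        by (rule mult_right_mono) simp
      moreover have "0 \<le> (\<integral>s. cmod (b s * f (t - s)) \<partial>lborel)" by (rule integral_nonneg_AE) simp
      ultimately show "norm (\<integral>s. norm (case (t, s) of (t, s) \<Rightarrow> b s * f (t - s) * g t) \<partial>lborel) \<le> norm (C * (\<integral>s. cmod (f s) \<partial>lborel) * cmod (g t))"
        by (simp add: norm_mult[of "_ * _"] flip: norm_mult[of "b _"])
    qed
  qed measurable
qed measurable
qed

text \<open>By Fubini the pairing with a test function \<open>\<phi>0\<close> is that of
  \<open>kernel_plus K\<close> with the transform of
  \<open>\<eta> = fourier \<phi> * \<phi>0\<close>. Then \<open>principal_value_k\<close> applies to
  \<open>\<eta>\<close>, whose odd part is controlled by those of the two factors.\<close>

lemma is_function_kernel_convolution: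
  assumes \<phi>: "\<phi> \<in> schwartz_space"
  shows "is_function (fourier_distribution (function_distribution (convolution (kernel_plus K) \<phi>)))
    (\<lambda>\<omega>. k (\<i> * of_real \<omega>) * fourier \<phi> \<omega>)"
  unfolding is_function_def
proof (intro conjI allI impI ballI)
  have i\<phi>: "integrable lborel \<phi>" by (rule schwartz_integrable[OF \<phi>])
  note schwartz_measurable[OF \<phi>, measurable]
  have fm [measurable]: "fourier \<phi> \<in> borel_measurable borel" by (intro fourier_measurable) simp
  show "(\<lambda>\<omega>. k (\<i> * of_real \<omega>) * fourier \<phi> \<omega>) \<in> borel_measurable borel" by measurable
  let ?N = "\<integral>t. cmod (\<phi> t) \<partial>lborel"
  {
    fix a b :: real assume a: "0 < a"
    have "integrable lborel (\<lambda>x. 2 * K 0 / a * ?N * indicator {-b..b} x)"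
      by (intro integrable_mult_right) (auto simp: emeasure_lborel_Icc_eq)
    then show "set_integrable lborel {x. a \<le> \<bar>x\<bar> \<and> \<bar>x\<bar> \<le> b} (\<lambda>\<omega>. k (\<i> * of_real \<omega>) * fourier \<phi> \<omega>)"
      unfolding set_integrable_def
    proof (rule Bochner_Integration.integrable_bound)
      show "AE x in lborel. norm (indicator {x. a \<le> \<bar>x\<bar> \<and> \<bar>x\<bar> \<le> b} x *\<^sub>R (k (\<i> * of_real x) * fourier \<phi> x)) \<le> norm (2 * K 0 / a * ?N * indicator {-b..b} x)"
      proof (rule AE_I2)
        fix x
        show "norm (indicator {x. a \<le> \<bar>x\<bar> \<and> \<bar>x\<bar> \<le> b} x *\<^sub>R (k (\<i> * of_real x) * fourier \<phi> x)) \<le> norm (2 * K 0 / a * ?N * indicator {-b..b} x)"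
        proof (cases "a \<le> \<bar>x\<bar> \<and> \<bar>x\<bar> \<le> b")
          case True
          have "cmod (k (\<i> * of_real x)) \<le> 2 * K 0 / cmod (\<i> * of_real x)" by (rule norm_k_le) simp
          also have "\<dots> \<le> 2 * K 0 / a" using True a nonneg[of 0] by (intro divide_left_mono) (auto simp: norm_mult)
          finally have "cmod (k (\<i> * of_real x)) * cmod (fourier \<phi> x) \<le> 2 * K 0 / a * ?N"
            using a nonneg[of 0] by (intro mult_mono norm_fourier_le) auto
          moreover have "x \<in> {-b..b}" using True by auto
          ultimately show ?thesis using True unfolding real_norm_def by (intro order_trans[OF _ abs_ge_self]) (simp add: norm_mult)
        qed simp
      qed
    qed measurable
  }
  fix \<phi>0 assume \<phi>0: "\<phi>0 \<in> test_functions"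
  have s0: "\<phi>0 \<in> schwartz_space" by (rule test_schwartz[OF \<phi>0])
  have i0: "integrable lborel \<phi>0" by (rule schwartz_integrable[OF s0])
  have if0: "integrable lborel (fourier \<phi>0)" by (rule schwartz_integrable[OF fourier_test_schwartz[OF \<phi>0]])
  let ?\<eta> = "\<lambda>x. fourier \<phi> x * \<phi>0 x"
  have i\<eta>: "integrable lborel ?\<eta>" by (rule integral_fourier_swap(2)[OF i\<phi> i0])
  have G: "(\<integral>t. \<phi> (t - s) * fourier \<phi>0 t \<partial>lborel) = fourier ?\<eta> s" for s
  proof -
    have "integrable lborel (\<lambda>t. \<phi> (t - s))" using lborel_integrable_real_affine[OF i\<phi>, of 1 "- s"] by simp
    from integral_fourier_swap(1)[OF this i0]
    have "(\<integral>t. \<phi> (t - s) * fourier \<phi>0 t \<partial>lborel) = (\<integral>x. four_exp (s * x) * fourier \<phi> x * \<phi>0 x \<partial>lborel)"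
      unfolding fourier_translate .
    then show ?thesis unfolding fourier_def[of ?\<eta>] by (simp add: mult_ac)
  qed
  \<comment> \<open>By \<open>G\<close> this transform is a correlation of the integrable functions
    \<open>\<phi>\<close> and \<open>fourier \<phi>0\<close>.\<close>
  have f\<eta>: "integrable lborel (fourier ?\<eta>)"
    using lborel_pair.integrable_snd[OF integrable_bounded_shift_pair[of "\<lambda>_. 1" 1, OF _ _ i\<phi> if0]] by (simp add: G)
  let ?F = "\<lambda>t s. kernel_plus K s * \<phi> (t - s) * fourier \<phi>0 t"
  have "fourier_distribution (function_distribution (convolution (kernel_plus K) \<phi>)) \<phi>0 = (\<integral>t. \<integral>s. ?F t s \<partial>lborel \<partial>lborel)"
    using s0 fourier_test_schwartz[OF \<phi>0] by (simp add: fourier_distribution_def function_distribution_def convolution_def)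
  also have "\<dots> = (\<integral>s. \<integral>t. ?F t s \<partial>lborel \<partial>lborel)"
    by (rule lborel_pair.Fubini_integral[symmetric])
       (rule integrable_bounded_shift_pair[OF measurable_kernel_plus norm_kernel_plus_le i\<phi> if0])
  also have "\<dots> = (\<integral>s. kernel_plus K s * fourier ?\<eta> s \<partial>lborel)"
    by (simp add: mult.assoc G)
  finally have T: "fourier_distribution (function_distribution (convolution (kernel_plus K) \<phi>)) \<phi>0 = (\<integral>s. kernel_plus K s * fourier ?\<eta> s \<partial>lborel)" .
  let ?p = "schwartz_seminorm 0 0 \<phi>0" and ?M = "\<integral>t. \<bar>t\<bar> * cmod (\<phi> t) \<partial>lborel"
  have p: "cmod (\<phi>0 x) \<le> ?p" for x using schwartz_le_seminorm[OF s0, of x 0 0] by simp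
    obtain D where D: "\<And>x. cmod (\<phi>0 x - \<phi>0 (- x)) \<le> D * \<bar>x\<bar>"
    proof
      let ?D = "2 * schwartz_seminorm 0 1 \<phi>0"
      fix x
      have "norm (\<phi>0 x - \<phi>0 (- x)) \<le> schwartz_seminorm 0 1 \<phi>0 * norm (x - (- x))"
      proof (rule differentiable_bound[of UNIV \<phi>0 "\<lambda>x h. h *\<^sub>R vderiv \<phi>0 x"])
        show "(\<phi>0 has_derivative (\<lambda>h. h *\<^sub>R vderiv \<phi>0 x)) (at x within UNIV)" for x
          using schwartz_deriv[OF s0, of x] by (simp add: has_vector_derivative_def)
        show "onorm (\<lambda>h. h *\<^sub>R vderiv \<phi>0 x) \<le> schwartz_seminorm 0 1 \<phi>0" for x
          using schwartz_le_seminorm[OF s0, of x 0 1]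
          by (intro onorm_le) (auto simp: mult.commute intro!: mult_left_mono)
      qed auto
      then show "cmod (\<phi>0 x - \<phi>0 (- x)) \<le> ?D * \<bar>x\<bar>" by (simp add: abs_mult mult_ac)
    qed
  have "((\<lambda>\<epsilon>. LINT x:{x. \<epsilon> < \<bar>x\<bar>}|lborel. k (\<i> * of_real x) * ?\<eta> x) \<longlongrightarrow>
      (\<integral>t. kernel_plus K t * fourier ?\<eta> t \<partial>lborel)) (at_right 0)"
  proof (rule principal_value_k[OF i\<eta> f\<eta>])
    show "cmod (?\<eta> x) \<le> ?N * ?p" for x
      unfolding norm_mult by (intro mult_mono norm_fourier_le p) (auto intro: integral_nonneg_AE)
    show "cmod (?\<eta> x - ?\<eta> (- x)) \<le> (2 * ?M * ?p + ?N * D) * \<bar>x\<bar>" for x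
    proof -
      have "?\<eta> x - ?\<eta> (- x) = (fourier \<phi> x - fourier \<phi> (- x)) * \<phi>0 x + fourier \<phi> (- x) * (\<phi>0 x - \<phi>0 (- x))"
        by (simp add: algebra_simps)
      then have "cmod (?\<eta> x - ?\<eta> (- x)) \<le> cmod (fourier \<phi> x - fourier \<phi> (- x)) * cmod (\<phi>0 x) + cmod (fourier \<phi> (- x)) * cmod (\<phi>0 x - \<phi>0 (- x))"
        by (metis norm_mult norm_triangle_ineq)
      also have "\<dots> \<le> (2 * \<bar>x\<bar> * ?M) * ?p + ?N * (D * \<bar>x\<bar>)"
        by (intro add_mono mult_mono fourier_odd_part_le[OF \<phi>] p norm_fourier_le D)
           (auto intro!: integral_nonneg_AE mult_nonneg_nonneg)
      finally show ?thesis by (simp add: algebra_simps)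
    qed
  qed
  then show "((\<lambda>\<epsilon>. LINT x:{x. \<epsilon> < \<bar>x\<bar>}|lborel. k (\<i> * of_real x) * fourier \<phi> x * \<phi>0 x) \<longlongrightarrow>
     fourier_distribution (function_distribution (convolution (kernel_plus K) \<phi>)) \<phi>0) (at_right 0)"
    unfolding T by (simp only: mult.assoc)
qed

section \<open>The adjoint drift and its symbol\<close>

lemma kernel_convolution_bounded:
  assumes \<phi>: "\<phi> \<in> schwartz_space"
  shows "convolution (kernel_plus K) \<phi> \<in> borel_measurable borel"
    and "cmod (convolution (kernel_plus K) \<phi> t) \<le> K 0 * (\<integral>s. cmod (\<phi> s) \<partial>lborel)"
proof -
  have [measurable]: "\<phi> \<in> borel_measurable borel" by (rule schwartz_measurable[OF \<phi>])
  have "(\<lambda>t. \<integral>s. kernel_plus K s * \<phi> (t - s) \<partial>lborel) \<in> borel_measurable borel"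
    by (rule sigma_finite_measure.borel_measurable_lebesgue_integral[OF sigma_finite_lborel]) simp
  then show "convolution (kernel_plus K) \<phi> \<in> borel_measurable borel"
    by (simp only: convolution_def[abs_def])
  have sh: "integrable lborel (\<lambda>s. \<phi> (t - s))"
    using lborel_integrable_real_affine[OF schwartz_integrable[OF \<phi>], of "-1" t] by simp
  have "cmod (convolution (kernel_plus K) \<phi> t) \<le> (\<integral>s. cmod (kernel_plus K s * \<phi> (t - s)) \<partial>lborel)"
    unfolding convolution_def by (rule integral_norm_bound)
  also have "\<dots> \<le> (\<integral>s. K 0 * cmod (\<phi> (t - s)) \<partial>lborel)"
    by (rule integral_mono_AE')
       (use sh nonneg[of 0] norm_kernel_plus_le in \<open>auto intro!: AE_I2 mult_right_mono simp: norm_mult\<close>)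
  also have "\<dots> = K 0 * (\<integral>s. cmod (\<phi> s) \<partial>lborel)"
    by (subst (2) lborel_integral_real_affine[where c="-1" and t=t]) auto
  finally show "cmod (convolution (kernel_plus K) \<phi> t) \<le> K 0 * (\<integral>s. cmod (\<phi> s) \<partial>lborel)" .
qed

lemma tempered_kernel_convolution:
  "\<phi> \<in> schwartz_space \<Longrightarrow> function_distribution (convolution (kernel_plus K) \<phi>) \<in> tempered_distributions"
  by (rule tempered_function[OF kernel_convolution_bounded])

lemma adjoint_drift_bounded:
  assumes \<phi>: "\<phi> \<in> schwartz_space"
  defines "h \<equiv> reflect (convolution (kernel_plus K) (reflect \<phi>))"
  shows "h \<in> borel_measurable borel" and "\<exists>B. \<forall>t. cmod (h t) \<le> B"
proof -
  note b = kernel_convolution_bounded[OF schwartz_reflect[OF \<phi>]]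
  show "h \<in> borel_measurable borel" using b(1) unfolding h_def reflect_def[of "convolution _ _", abs_def] by measurable
  show "\<exists>B. \<forall>t. cmod (h t) \<le> B" using b(2) unfolding h_def reflect_def[of "convolution _ _"] by blast
qed

lemma tempered_adjoint_drift: assumes \<phi>: "\<phi> \<in> schwartz_space" shows "adjoint_drift K a \<phi> \<in> tempered_distributions"
proof -
  let ?h = "reflect (convolution (kernel_plus K) (reflect \<phi>))"
  note [measurable] = adjoint_drift_bounded(1)[OF \<phi>] schwartz_measurable[OF schwartz_vderiv[OF \<phi>]]
  obtain B where B: "\<And>t. cmod (?h t) \<le> B" using adjoint_drift_bounded(2)[OF \<phi>] by blast
  show ?thesis unfolding adjoint_drift_def
  proof (rule tempered_function)
    fix t
    have "cmod (- vderiv \<phi> t + of_real a * ?h t) \<le> cmod (- vderiv \<phi> t) + cmod (of_real a * ?h t)"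
      by (rule norm_triangle_ineq)
    also have "\<dots> \<le> schwartz_seminorm 0 1 \<phi> + \<bar>a\<bar> * B"
      using schwartz_le_seminorm[OF \<phi>, of t 0 1] by (intro add_mono) (auto simp: norm_mult intro!: mult_left_mono B)
    finally show "cmod (- vderiv \<phi> t + of_real a * ?h t) \<le> schwartz_seminorm 0 1 \<phi> + \<bar>a\<bar> * B" .
  qed measurable
qed

text \<open>The derivative contributes \<open>- \<i> \<omega>\<close>. The two reflections replace
  \<open>k (\<i> \<omega>)\<close> by \<open>k (- \<i> \<omega>)\<close>, its conjugate. Hence the
  symbol of the adjoint is the conjugate of \<open>msym\<close>.\<close>

lemma is_function_adjoint_drift:
  assumes \<phi>: "\<phi> \<in> schwartz_space"
  shows "is_function (fourier_distribution (adjoint_drift K a \<phi>)) (\<lambda>\<omega>. cnj (msym a \<omega>) * fourier \<phi> \<omega>)"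
proof -
  let ?h = "reflect (convolution (kernel_plus K) (reflect \<phi>))"
  let ?S = "fourier_distribution (function_distribution (vderiv \<phi>))"
  let ?T = "fourier_distribution (function_distribution ?h)"
  note [measurable] = adjoint_drift_bounded(1)[OF \<phi>]
  obtain B where B: "\<And>t. cmod (?h t) \<le> B" using adjoint_drift_bounded(2)[OF \<phi>] by blast
  have i': "integrable lborel (vderiv \<phi>)" by (intro schwartz_integrable schwartz_vderiv \<phi>)
  have "is_function (\<lambda>\<phi>. (-1) * ?S \<phi> + of_real a * ?T \<phi>)
     (\<lambda>x. (-1) * fourier (vderiv \<phi>) x + of_real a * reflect (\<lambda>\<omega>. k (\<i> * of_real \<omega>) * fourier (reflect \<phi>) \<omega>) x)"
    by (intro is_function_lincomb is_function_fourier is_function_reflect is_function_kernel_convolution schwartz_reflect i' \<phi>)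
  moreover have "(-1) * ?S \<phi>0 + of_real a * ?T \<phi>0 = fourier_distribution (adjoint_drift K a \<phi>) \<phi>0" if "\<phi>0 \<in> test_functions" for \<phi>0
  proof -
    have s0: "\<phi>0 \<in> schwartz_space" "fourier \<phi>0 \<in> schwartz_space" using that by (auto intro: test_schwartz fourier_test_schwartz)
    note [measurable] = schwartz_measurable[OF s0(2)] schwartz_measurable[OF schwartz_vderiv[OF \<phi>]]
    have i1: "integrable lborel (\<lambda>t. ?h t * fourier \<phi>0 t)"
    proof (rule Bochner_Integration.integrable_bound)
      show "integrable lborel (\<lambda>t. B * cmod (fourier \<phi>0 t))" using schwartz_integrable[OF s0(2)] by simp
      show "AE t in lborel. norm (?h t * fourier \<phi>0 t) \<le> norm (B * cmod (fourier \<phi>0 t))"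
        by (intro AE_I2) (auto simp: norm_mult abs_mult intro!: mult_right_mono order_trans[OF B abs_ge_self])
    qed measurable
    have i2: "integrable lborel (\<lambda>t. vderiv \<phi> t * fourier \<phi>0 t)"
    proof (rule Bochner_Integration.integrable_bound)
      show "integrable lborel (\<lambda>t. schwartz_seminorm 0 1 \<phi> * cmod (fourier \<phi>0 t))" using schwartz_integrable[OF s0(2)] by simp
      show "AE t in lborel. norm (vderiv \<phi> t * fourier \<phi>0 t) \<le> norm (schwartz_seminorm 0 1 \<phi> * cmod (fourier \<phi>0 t))"
      proof (rule AE_I2)
        fix t
        have "cmod (vderiv \<phi> t) \<le> \<bar>schwartz_seminorm 0 1 \<phi>\<bar>" using schwartz_le_seminorm[OF \<phi>, of t 0 1] by simp
        then show "norm (vderiv \<phi> t * fourier \<phi>0 t) \<le> norm (schwartz_seminorm 0 1 \<phi> * cmod (fourier \<phi>0 t))"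
          by (simp add: norm_mult abs_mult mult_right_mono)
      qed
    qed measurable
    have "(\<integral>t. (- vderiv \<phi> t + of_real a * ?h t) * fourier \<phi>0 t \<partial>lborel)
       = (\<integral>t. (-1) * (vderiv \<phi> t * fourier \<phi>0 t) + of_real a * (?h t * fourier \<phi>0 t) \<partial>lborel)"
      by (intro Bochner_Integration.integral_cong refl) (simp add: algebra_simps)
    also have "\<dots> = (-1) * (\<integral>t. vderiv \<phi> t * fourier \<phi>0 t \<partial>lborel) + of_real a * (\<integral>t. ?h t * fourier \<phi>0 t \<partial>lborel)"
      by (subst Bochner_Integration.integral_add) (use i1 i2 in auto)
    finally show ?thesis using s0
      by (simp add: fourier_distribution_def adjoint_drift_def function_distribution_def)
  qed
  ultimately have "is_function (fourier_distribution (adjoint_drift K a \<phi>))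
     (\<lambda>x. (-1) * fourier (vderiv \<phi>) x + of_real a * reflect (\<lambda>\<omega>. k (\<i> * of_real \<omega>) * fourier (reflect \<phi>) \<omega>) x)"
    by (rule is_function_cong[rotated])
  moreover have "(-1) * fourier (vderiv \<phi>) x + of_real a * reflect (\<lambda>\<omega>. k (\<i> * of_real \<omega>) * fourier (reflect \<phi>) \<omega>) x
     = cnj (msym a x) * fourier \<phi> x" for x
    using k_cnj[of "\<i> * of_real x"]
    by (simp add: fourier_vderiv[OF \<phi>] fourier_reflect msym_def reflect_def algebra_simps)
  ultimately show ?thesis by simp
qed

end

section \<open>A complete orthonormal family\<close>

locale finite_line_measure = finite_measure \<nu> for \<nu> :: "real measure" +
  assumes sets_nu: "sets \<nu> = sets borel"
begin

lemma measurable_nu_iff [simp]: "borel_measurable \<nu> = borel_measurable borel"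
  by (rule measurable_cong_sets) (auto simp: sets_nu)

definition sqi :: "(real \<Rightarrow> real) \<Rightarrow> bool" where
  "sqi f \<longleftrightarrow> f \<in> borel_measurable borel \<and> integrable \<nu> (\<lambda>x. (f x)\<^sup>2)"

definition ip :: "(real \<Rightarrow> real) \<Rightarrow> (real \<Rightarrow> real) \<Rightarrow> real" where
  "ip f g = (\<integral>x. f x * g x \<partial>\<nu>)"

section \<open>Square-integrable real functions and their inner product\<close>

lemma sqi_measurable: "sqi f \<Longrightarrow> f \<in> borel_measurable borel" by (simp add: sqi_def)

lemma sqi_integrable_mult: assumes "sqi f" "sqi g" shows "integrable \<nu> (\<lambda>x. f x * g x)"
proof (rule Bochner_Integration.integrable_bound)
  show "integrable \<nu> (\<lambda>x. (f x)\<^sup>2 + (g x)\<^sup>2)" using assms by (simp add: sqi_def)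
  have "\<bar>a * b\<bar> \<le> a\<^sup>2 + b\<^sup>2" for a b :: real
  proof -
    have "0 \<le> (\<bar>a\<bar> - \<bar>b\<bar>)\<^sup>2" by simp
    then have "2 * \<bar>a * b\<bar> \<le> a\<^sup>2 + b\<^sup>2" by (simp add: power2_diff abs_mult)
    moreover have "0 \<le> a\<^sup>2 + b\<^sup>2" by simp
    ultimately show ?thesis by linarith
  qed
  then show "AE x in \<nu>. norm (f x * g x) \<le> norm ((f x)\<^sup>2 + (g x)\<^sup>2)" by (auto intro!: AE_I2)
  show "(\<lambda>x. f x * g x) \<in> borel_measurable \<nu>" using assms by (auto simp: sqi_def)
qed

lemma sqi_lincomb: assumes "sqi f" "sqi g" shows "sqi (\<lambda>x. a * f x + b * g x)"
proof -
  have "integrable \<nu> (\<lambda>x. a\<^sup>2 * (f x)\<^sup>2 + 2 * a * b * (f x * g x) + b\<^sup>2 * (g x)\<^sup>2)"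
    using assms sqi_integrable_mult[OF assms] by (intro Bochner_Integration.integrable_add integrable_mult_right) (auto simp: sqi_def)
  moreover have "a\<^sup>2 * (f x)\<^sup>2 + 2 * a * b * (f x * g x) + b\<^sup>2 * (g x)\<^sup>2 = (a * f x + b * g x)\<^sup>2" for x
    by (simp add: power2_eq_square algebra_simps)
  ultimately have "integrable \<nu> (\<lambda>x. (a * f x + b * g x)\<^sup>2)" by simp
  moreover have "(\<lambda>x. a * f x + b * g x) \<in> borel_measurable borel"
    using sqi_measurable[OF assms(1)] sqi_measurable[OF assms(2)] by measurable
  ultimately show ?thesis by (simp add: sqi_def)
qed

lemma sqi_zero: "sqi (\<lambda>_. 0)" by (simp add: sqi_def)
lemma sqi_scale: "sqi f \<Longrightarrow> sqi (\<lambda>x. a * f x)" using sqi_lincomb[OF _ sqi_zero, of f a 0] by simp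
lemma sqi_diff: "sqi f \<Longrightarrow> sqi g \<Longrightarrow> sqi (\<lambda>x. f x - g x)" using sqi_lincomb[of f g 1 "-1"] by simp
lemma sqi_add: "sqi f \<Longrightarrow> sqi g \<Longrightarrow> sqi (\<lambda>x. f x + g x)" using sqi_lincomb[of f g 1 1] by simp

lemma sqi_sum: "finite A \<Longrightarrow> (\<And>i. i \<in> A \<Longrightarrow> sqi (f i)) \<Longrightarrow> sqi (\<lambda>x. \<Sum>i\<in>A. f i x)"
  by (induction A rule: finite_induct) (auto intro: sqi_zero sqi_add)

lemma ip_commute: "ip f g = ip g f" by (simp add: ip_def mult.commute)

lemma ip_lincomb: assumes "sqi f" "sqi g" "sqi h" shows "ip (\<lambda>x. a * f x + b * g x) h = a * ip f h + b * ip g h"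
proof -
  have "ip (\<lambda>x. a * f x + b * g x) h = (\<integral>x. a * (f x * h x) + b * (g x * h x) \<partial>\<nu>)"
    unfolding ip_def by (simp add: algebra_simps)
  also have "\<dots> = a * ip f h + b * ip g h"
    using sqi_integrable_mult assms by (simp add: ip_def)
  finally show ?thesis .
qed

lemma ip_zero: "ip (\<lambda>_. 0) h = 0" by (simp add: ip_def)
lemma ip_scale: "ip (\<lambda>x. a * f x) h = a * ip f h" by (simp add: ip_def mult.assoc)
lemma ip_diff: "sqi f \<Longrightarrow> sqi g \<Longrightarrow> sqi h \<Longrightarrow> ip (\<lambda>x. f x - g x) h = ip f h - ip g h"
  using ip_lincomb[of f g h 1 "-1"] by simp
lemma ip_add: "sqi f \<Longrightarrow> sqi g \<Longrightarrow> sqi h \<Longrightarrow> ip (\<lambda>x. f x + g x) h = ip f h + ip g h"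
  using ip_lincomb[of f g h 1 1] by simp

lemma ip_sum: "finite A \<Longrightarrow> (\<And>i. i \<in> A \<Longrightarrow> sqi (f i)) \<Longrightarrow> sqi h \<Longrightarrow> ip (\<lambda>x. \<Sum>i\<in>A. f i x) h = (\<Sum>i\<in>A. ip (f i) h)"
  by (induction A rule: finite_induct) (auto simp: ip_zero ip_add sqi_sum)

lemma ip_nonneg: "0 \<le> ip f f" unfolding ip_def by (rule integral_nonneg_AE) auto

lemma ip_cong_AE:
  assumes "AE x in \<nu>. f x = g x" "sqi f" "sqi g" "sqi h" shows "ip f h = ip g h"
  unfolding ip_def by (rule integral_cong_AE) (use assms in \<open>auto simp: sqi_def\<close>)

text \<open>Indicators of half lines with rational end points: a countable family with dense span,
  the input of the orthonormalisation.\<close>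

definition sset :: "nat \<Rightarrow> real \<Rightarrow> real" where
  "sset n = indicator {..of_rat (from_nat n)}"

lemma sqi_indicator: "A \<in> sets borel \<Longrightarrow> sqi (indicator A)"
  unfolding sqi_def using sets_nu finite_measure_axioms
  by (auto simp: power2_eq_square indicator_inter_arith[symmetric] less_top[symmetric] intro!: integrable_real_indicator)

lemma sqi_sset: "sqi (sset n)" unfolding sset_def by (rule sqi_indicator) simp

text \<open>Gram--Schmidt; division by zero turns a vanishing residue into the zero function.\<close>
definition gs_step :: "(nat \<Rightarrow> real \<Rightarrow> real) \<Rightarrow> nat \<Rightarrow> real \<Rightarrow> real" where
  "gs_step b n x = sset n x - (\<Sum>i<n. ip (sset n) (b i) * b i x)"

text \<open>Well-founded recursion: the function at stage \<open>n\<close> refers only to the stages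
  below \<open>n\<close>, which is the congruence condition of the choice principle.\<close>

lemma gs_exists: "\<exists>b. \<forall>n. b n = (\<lambda>x. gs_step b n x / sqrt (ip (gs_step b n) (gs_step b n)))"
proof (rule dependent_wellorder_choice)
  fix r and f g :: "nat \<Rightarrow> real \<Rightarrow> real" and n :: nat
  assume fg: "\<And>y. y < n \<Longrightarrow> f y = g y"
  have "gs_step f n = gs_step g n" unfolding gs_step_def by (intro ext) (simp add: fg)
  then show "(r = (\<lambda>x. gs_step f n x / sqrt (ip (gs_step f n) (gs_step f n)))) = (r = (\<lambda>x. gs_step g n x / sqrt (ip (gs_step g n) (gs_step g n))))"
    by simp
qed blast

definition gs :: "nat \<Rightarrow> real \<Rightarrow> real" where
  "gs = (SOME b. \<forall>n. b n = (\<lambda>x. gs_step b n x / sqrt (ip (gs_step b n) (gs_step b n))))"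

lemma gs_eq: "gs n = (\<lambda>x. inverse (sqrt (ip (gs_step gs n) (gs_step gs n))) * gs_step gs n x)"
  using someI_ex[OF gs_exists, folded gs_def] by (simp add: divide_inverse mult.commute)

lemma sqi_gs: "sqi (gs n)"
proof (induction n rule: less_induct)
  case (less n)
  have "sqi (gs_step gs n)" unfolding gs_step_def[abs_def]
    by (intro sqi_diff sqi_sset sqi_sum sqi_scale less) auto
  then show ?case by (subst gs_eq) (rule sqi_scale)
qed

lemma gs_norm: "gs n = (\<lambda>_. 0) \<or> ip (gs n) (gs n) = 1"
proof (cases "ip (gs_step gs n) (gs_step gs n) = 0")
  case True
  then show ?thesis using gs_eq[of n] by simp
next
  case False
  let ?p = "gs_step gs n" and ?r = "inverse (sqrt (ip (gs_step gs n) (gs_step gs n)))"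
  have "ip (gs n) (gs n) = ?r * ip ?p (gs n)" by (subst (1) gs_eq) (rule ip_scale)
  also have "ip ?p (gs n) = ip (gs n) ?p" by (rule ip_commute)
  also have "\<dots> = ?r * ip ?p ?p" by (subst gs_eq) (rule ip_scale)
  finally have "ip (gs n) (gs n) = ?r * (?r * ip ?p ?p)" .
  also have "\<dots> = 1" using False ip_nonneg[of ?p] by (simp add: field_simps)
  finally show ?thesis by simp
qed

lemma gs_step_orth: assumes "\<And>i. i < n \<Longrightarrow> \<forall>j<i. ip (gs i) (gs j) = 0" "j < n"
  shows "ip (gs_step gs n) (gs j) = 0"
proof -
  let ?c = "\<lambda>i. ip (sset n) (gs i)"
  have "ip (gs_step gs n) (gs j) = ?c j - (\<Sum>i<n. ?c i * ip (gs i) (gs j))"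
    unfolding gs_step_def[abs_def]
    by (subst ip_diff) (auto intro!: sqi_sset sqi_sum sqi_scale sqi_gs simp: ip_sum ip_scale sqi_scale sqi_gs)
  also have "(\<Sum>i<n. ?c i * ip (gs i) (gs j)) = (\<Sum>i<n. if i = j then ?c j * ip (gs j) (gs j) else 0)"
  proof (rule sum.cong)
    fix i assume "i \<in> {..<n}"
    then show "?c i * ip (gs i) (gs j) = (if i = j then ?c j * ip (gs j) (gs j) else 0)"
      using assms(1)[of i] assms(1)[of j] assms(2) ip_commute[of "gs i" "gs j"] by (cases i j rule: linorder_cases) auto
  qed simp
  also have "\<dots> = ?c j * ip (gs j) (gs j)" using assms(2) by simp
  also have "\<dots> = ?c j" using gs_norm[of j] by (auto simp: ip_commute[of "sset n"] ip_zero)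
  finally show ?thesis by simp
qed

lemma gs_orth_less: "j < n \<Longrightarrow> ip (gs n) (gs j) = 0"
proof (induction n arbitrary: j rule: less_induct)
  case (less n)
  have "ip (gs_step gs n) (gs j) = 0" by (rule gs_step_orth) (use less in auto)
  then show ?case by (subst gs_eq) (simp add: ip_scale)
qed

lemma gs_orth: "i \<noteq> j \<Longrightarrow> ip (gs i) (gs j) = 0"
  using gs_orth_less[of i j] gs_orth_less[of j i] ip_commute[of "gs i" "gs j"] by (cases i j rule: linorder_cases) auto

text \<open>Covers both alternatives of \<open>gs_norm\<close>: a unit vector has factor 1, and for
  a vanished member the coefficient itself is zero. This lets Bessel's identity be written without a
  case distinction.\<close>

lemma gs_coeff_mult: "ip f (gs i) * ip (gs i) (gs i) = ip f (gs i)"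
  using gs_norm[of i] by (auto simp: ip_commute[of f] ip_zero)

lemma ip_gs_sum: assumes "sqi f" shows "ip (\<lambda>x. \<Sum>i<n. d i * gs i x) (gs j) = (if j < n then d j * ip (gs j) (gs j) else 0)"
proof -
  have "ip (\<lambda>x. \<Sum>i<n. d i * gs i x) (gs j) = (\<Sum>i<n. d i * ip (gs i) (gs j))"
    by (subst ip_sum) (auto intro: sqi_scale sqi_gs simp: ip_scale)
  also have "\<dots> = (\<Sum>i<n. if i = j then d j * ip (gs j) (gs j) else 0)"
    by (intro sum.cong) (auto simp: gs_orth)
  also have "\<dots> = (if j < n then d j * ip (gs j) (gs j) else 0)" by simp
  finally show ?thesis .
qed

definition gres :: "nat \<Rightarrow> (real \<Rightarrow> real) \<Rightarrow> real \<Rightarrow> real" where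
  "gres n f x = f x - (\<Sum>i<n. ip f (gs i) * gs i x)"

lemma sqi_gres: "sqi f \<Longrightarrow> sqi (gres n f)"
  unfolding gres_def[abs_def] by (intro sqi_diff sqi_sum sqi_scale sqi_gs) auto

text \<open>Pythagoras: the residue is orthogonal to the projection, and both mixed terms equal the
  sum of squared coefficients.\<close>

lemma ip_gres: assumes f: "sqi f" shows "ip (gres n f) (gres n f) = ip f f - (\<Sum>i<n. (ip f (gs i))\<^sup>2)"
proof -
  let ?p = "\<lambda>x. \<Sum>i<n. ip f (gs i) * gs i x"
  have p: "sqi ?p" by (intro sqi_sum sqi_scale sqi_gs) auto
  have pf: "ip ?p f = (\<Sum>i<n. (ip f (gs i))\<^sup>2)"
    by (subst ip_sum) (auto intro: sqi_scale sqi_gs f simp: ip_scale power2_eq_square ip_commute[of "gs _" f])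
  have pp: "ip ?p ?p = (\<Sum>i<n. (ip f (gs i))\<^sup>2)"
  proof -
    have "ip ?p ?p = (\<Sum>i<n. ip f (gs i) * ip (gs i) ?p)"
      by (subst ip_sum) (auto intro: sqi_scale sqi_gs p simp: ip_scale)
    also have "\<dots> = (\<Sum>i<n. (ip f (gs i))\<^sup>2)"
      by (intro sum.cong refl) (auto simp: ip_commute[of "gs _" ?p] ip_gs_sum[OF f] gs_coeff_mult power2_eq_square)
    finally show ?thesis .
  qed
  have e: "gres n f = (\<lambda>x. f x - ?p x)" by (simp add: gres_def fun_eq_iff)
  have G: "ip (gres n f) h = ip f h - ip ?p h" if "sqi h" for h unfolding e by (rule ip_diff[OF f p that])
  have r: "sqi (gres n f)" unfolding e by (rule sqi_diff[OF f p])
  have "ip (gres n f) (gres n f) = ip (gres n f) f - ip (gres n f) ?p"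
    using G[OF r] by (simp only: ip_commute[of f "gres n f"] ip_commute[of ?p "gres n f"])
  then show ?thesis using pf pp ip_commute[of f ?p] by (simp only: G[OF f] G[OF p])
qed

lemma gres_le: "sqi f \<Longrightarrow> ip (gres n f) (gres n f) \<le> ip f f"
  by (simp add: ip_gres sum_nonneg)

lemma ip_add_le: assumes "sqi f" "sqi g"
  shows "ip (\<lambda>x. f x + g x) (\<lambda>x. f x + g x) \<le> 2 * ip f f + 2 * ip g g"
proof -
  have "ip (\<lambda>x. f x + g x) (\<lambda>x. f x + g x) \<le> (\<integral>x. 2 * (f x * f x) + 2 * (g x * g x) \<partial>\<nu>)"
    unfolding ip_def
  proof (rule integral_mono)
    show "integrable \<nu> (\<lambda>x. (f x + g x) * (f x + g x))" by (intro sqi_integrable_mult sqi_add assms)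
    show "integrable \<nu> (\<lambda>x. 2 * (f x * f x) + 2 * (g x * g x))"
      by (intro Bochner_Integration.integrable_add integrable_mult_right sqi_integrable_mult assms)
    fix x
    have "0 \<le> (f x - g x)\<^sup>2" by simp
    then show "(f x + g x) * (f x + g x) \<le> 2 * (f x * f x) + 2 * (g x * g x)"
      by (simp add: power2_eq_square algebra_simps)
  qed
  also have "\<dots> = 2 * ip f f + 2 * ip g g"
    unfolding ip_def using sqi_integrable_mult assms by simp
  finally show ?thesis .
qed

text \<open>Membership in the closed span of \<open>gs\<close>.\<close>
definition reached :: "(real \<Rightarrow> real) \<Rightarrow> bool" where
  "reached f \<longleftrightarrow> sqi f \<and> (\<lambda>n. ip (gres n f) (gres n f)) \<longlonglongrightarrow> 0"

section \<open>Completeness of the Gram-Schmidt family\<close>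

lemma reached_lincomb: assumes "reached f" "reached g" shows "reached (\<lambda>x. a * f x + b * g x)"
proof -
  have f: "sqi f" and g: "sqi g" using assms by (auto simp: reached_def)
  have le: "ip (gres n (\<lambda>x. a * f x + b * g x)) (gres n (\<lambda>x. a * f x + b * g x))
      \<le> 2 * (a * (a * ip (gres n f) (gres n f))) + 2 * (b * (b * ip (gres n g) (gres n g)))" for n
  proof -
    have "gres n (\<lambda>x. a * f x + b * g x) = (\<lambda>x. a * gres n f x + b * gres n g x)"
      unfolding gres_def[abs_def] using f g
      by (auto simp: ip_lincomb sqi_gs sum.distrib sum_distrib_left algebra_simps fun_eq_iff)
    then show ?thesis
      using ip_add_le[OF sqi_scale[OF sqi_gres[OF f, of n], of a] sqi_scale[OF sqi_gres[OF g, of n], of b]]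
      by (simp add: ip_scale ip_commute[of _ "\<lambda>x. _ * gres n _ x"])
  qed
  have "(\<lambda>n. 2 * (a * (a * ip (gres n f) (gres n f))) + 2 * (b * (b * ip (gres n g) (gres n g)))) \<longlonglongrightarrow> 2 * (a * (a * 0)) + 2 * (b * (b * 0))"
    using assms unfolding reached_def by (intro tendsto_intros) auto
  then have l: "(\<lambda>n. 2 * (a * (a * ip (gres n f) (gres n f))) + 2 * (b * (b * ip (gres n g) (gres n g)))) \<longlonglongrightarrow> 0" by simp
  have "(\<lambda>n. ip (gres n (\<lambda>x. a * f x + b * g x)) (gres n (\<lambda>x. a * f x + b * g x))) \<longlonglongrightarrow> 0"
    by (rule tendsto_sandwich[OF always_eventually always_eventually tendsto_const l]) (intro allI ip_nonneg le)+
  then show ?thesis using sqi_lincomb[OF f g] by (simp add: reached_def)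
qed

text \<open>The residue does not increase the norm, so replacing \<open>g\<close> by a close
  \<open>h k\<close> costs little for every \<open>n\<close> at once.\<close>

lemma reached_limit:
  assumes h: "\<And>k. reached (h k)" and g: "sqi g" and l: "(\<lambda>k. ip (\<lambda>x. g x - h k x) (\<lambda>x. g x - h k x)) \<longlonglongrightarrow> 0"
  shows "reached g"
  unfolding reached_def
proof (intro conjI g LIMSEQ_I)
  fix e :: real assume e: "0 < e"
  \<comment> \<open>A quarter for each part, since \<open>ip_add_le\<close> carries a factor 2 on
    both summands.\<close>
  obtain k where k: "ip (\<lambda>x. g x - h k x) (\<lambda>x. g x - h k x) < e / 4"
    using order_tendstoD(2)[OF l, of "e/4"] e by (auto simp: eventually_sequentially)
  have hk: "sqi (h k)" using h by (simp add: reached_def)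
  obtain N where N: "\<And>n. N \<le> n \<Longrightarrow> ip (gres n (h k)) (gres n (h k)) < e / 4"
    using h[of k] e order_tendstoD(2)[of "\<lambda>n. ip (gres n (h k)) (gres n (h k))" 0 sequentially "e/4"]
    unfolding reached_def eventually_sequentially by auto
  show "\<exists>N. \<forall>n\<ge>N. norm (ip (gres n g) (gres n g) - 0) < e"
  proof (intro exI allI impI)
    fix n assume n: "N \<le> n"
    have "gres n g = (\<lambda>x. gres n (\<lambda>x. g x - h k x) x + gres n (h k) x)"
      unfolding gres_def[abs_def] using g hk
      by (auto simp: ip_diff sqi_gs left_diff_distrib sum_subtractf fun_eq_iff)
    then have "ip (gres n g) (gres n g) \<le> 2 * ip (gres n (\<lambda>x. g x - h k x)) (gres n (\<lambda>x. g x - h k x)) + 2 * ip (gres n (h k)) (gres n (h k))"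
      using ip_add_le[OF sqi_gres[OF sqi_diff[OF g hk], of n] sqi_gres[OF hk, of n]] by simp
    also have "\<dots> < e" using gres_le[OF sqi_diff[OF g hk], of n] k N[OF n] by linarith
    finally show "norm (ip (gres n g) (gres n g) - 0) < e" using ip_nonneg by simp
  qed
qed

text \<open>By construction \<open>sset m\<close> lies in the span of the members up to index
  \<open>m\<close>, so its residue vanishes as soon as \<open>m < n\<close>.\<close>

lemma reached_sset: "reached (sset m)"
proof -
  have "gs_step gs m = gres m (sset m)" by (simp add: gs_step_def gres_def fun_eq_iff)
  have Z: "ip (gres n (sset m)) (gres n (sset m)) = 0" if "m < n" for n
  proof -
    let ?p = "gres m (sset m)"
    have le: "(\<Sum>i<Suc m. (ip (sset m) (gs i))\<^sup>2) \<le> (\<Sum>i<n. (ip (sset m) (gs i))\<^sup>2)"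
      using that by (intro sum_mono2) auto
    \<comment> \<open>The last member is the normalised residue, so the coefficient along it is the
      length of the residue. Bessel's sum up to \<open>m\<close> is therefore the full square norm.
      The case of a vanished residue is consistent with division by zero.\<close>
    have "ip ?p ?p = (ip (sset m) (gs m))\<^sup>2"
    proof -
      have "ip (sset m) (gs m) = ip ?p (gs m)"
        unfolding gres_def[abs_def]
      proof (subst ip_diff)
        show "sqi (\<lambda>x. \<Sum>i<m. ip (sset m) (gs i) * gs i x)" by (intro sqi_sum sqi_scale sqi_gs) auto
      qed (auto intro: sqi_sset sqi_gs simp: ip_gs_sum[OF sqi_sset])
      also have "\<dots> = ip (gs m) ?p" by (rule ip_commute)
      also have "\<dots> = inverse (sqrt (ip ?p ?p)) * ip ?p ?p"
        by (subst gs_eq) (simp add: \<open>gs_step gs m = gres m (sset m)\<close> ip_scale)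
      finally have "ip (sset m) (gs m) = sqrt (ip ?p ?p)"
        using ip_nonneg[of ?p] by (cases "ip ?p ?p = 0") (auto simp: field_simps real_div_sqrt)
      then show ?thesis using ip_nonneg[of ?p] by simp
    qed
    then have "ip (sset m) (sset m) = (\<Sum>i<Suc m. (ip (sset m) (gs i))\<^sup>2)"
      using ip_gres[OF sqi_sset, of m m] by simp
    then have "ip (gres n (sset m)) (gres n (sset m)) \<le> 0" using ip_gres[OF sqi_sset, of n m] le by linarith
    then show ?thesis using ip_nonneg by (intro antisym) auto
  qed
  have "\<forall>\<^sub>F n in sequentially. 0 = ip (gres n (sset m)) (gres n (sset m))"
    using eventually_gt_at_top[of m] by eventually_elim (simp only: Z)
  from Lim_transform_eventually[OF tendsto_const this]
  show ?thesis unfolding reached_def by (intro conjI sqi_sset)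
qed

lemma reached_dominated:
  assumes h: "\<And>k. reached (h k)" and gm: "g \<in> borel_measurable borel" and f: "sqi f"
    and lim: "\<And>x. (\<lambda>k. h k x) \<longlonglongrightarrow> g x" and b: "\<And>k x. \<bar>h k x\<bar> \<le> \<bar>f x\<bar>"
  shows "reached g"
proof (rule reached_limit[OF h])
  have hm: "h k \<in> borel_measurable borel" for k using h by (simp add: reached_def sqi_def)
  have gb: "\<bar>g x\<bar> \<le> \<bar>f x\<bar>" for x
    by (rule LIMSEQ_le_const2[OF tendsto_rabs[OF lim]]) (use b in auto)
  have if2: "integrable \<nu> (\<lambda>x. (f x)\<^sup>2)" using f by (simp add: sqi_def)
  show "sqi g" unfolding sqi_def
  proof (intro conjI gm)
    show "integrable \<nu> (\<lambda>x. (g x)\<^sup>2)"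
      by (rule Bochner_Integration.integrable_bound[OF if2]) (use gm gb in \<open>auto intro!: AE_I2 simp: abs_le_square_iff\<close>)
  qed
  have "(\<lambda>k. \<integral>x. (g x - h k x) * (g x - h k x) \<partial>\<nu>) \<longlonglongrightarrow> (\<integral>x. 0 \<partial>\<nu>)"
  proof (rule integral_dominated_convergence[where w="\<lambda>x. 4 * (f x)\<^sup>2"])
    show "integrable \<nu> (\<lambda>x. 4 * (f x)\<^sup>2)" using if2 by simp
    show "AE x in \<nu>. (\<lambda>k. (g x - h k x) * (g x - h k x)) \<longlonglongrightarrow> 0"
    proof (rule AE_I2)
      fix x
      have "(\<lambda>k. (g x - h k x) * (g x - h k x)) \<longlonglongrightarrow> (g x - g x) * (g x - g x)" by (intro tendsto_intros lim)
      then show "(\<lambda>k. (g x - h k x) * (g x - h k x)) \<longlonglongrightarrow> 0" by simp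
    qed
    fix k
    show "AE x in \<nu>. norm ((g x - h k x) * (g x - h k x)) \<le> 4 * (f x)\<^sup>2"
    proof (rule AE_I2)
      fix x
      have "\<bar>g x - h k x\<bar> \<le> 2 * \<bar>f x\<bar>" using gb[of x] b[of k x] by linarith
      then have "\<bar>g x - h k x\<bar> * \<bar>g x - h k x\<bar> \<le> (2 * \<bar>f x\<bar>) * (2 * \<bar>f x\<bar>)" by (intro mult_mono) auto
      then show "norm ((g x - h k x) * (g x - h k x)) \<le> 4 * (f x)\<^sup>2" by (simp add: abs_mult power2_eq_square)
    qed
  qed (use gm hm in auto)
  then show "(\<lambda>k. ip (\<lambda>x. g x - h k x) (\<lambda>x. g x - h k x)) \<longlonglongrightarrow> 0" by (simp add: ip_def)
qed

lemma sqi_one: "sqi (\<lambda>_. 1)" by (simp add: sqi_def)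

text \<open>Rational end points approach \<open>a\<close> strictly from above because the half lines
  contain their end point; from below the limit would miss \<open>a\<close>.\<close>

lemma reached_atMost: "reached (indicator {..a})"
proof -
  have "\<exists>q :: rat. a < of_rat q \<and> of_rat q < a + inverse (real (Suc n))" for n
    by (rule of_rat_dense) simp
  then obtain q :: "nat \<Rightarrow> rat" where q: "\<And>n. a < of_rat (q n)" "\<And>n. of_rat (q n) < a + inverse (real (Suc n))" by metis
  show ?thesis
  proof (rule reached_dominated[where h="\<lambda>k. sset (to_nat (q k))" and f="\<lambda>_. 1"])
    show "reached (sset (to_nat (q k)))" for k by (rule reached_sset)
    show "sqi (\<lambda>_. 1)" by (rule sqi_one)
    fix x
    show "(\<lambda>k. sset (to_nat (q k)) x) \<longlonglongrightarrow> indicator {..a} x"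
    proof (cases "x \<le> a")
      case True
      then have "sset (to_nat (q k)) x = indicator {..a} x" for k using q(1)[of k] by (auto simp: sset_def indicator_def)
      then show ?thesis by simp
    next
      case False
      then have "0 < x - a" by simp
      from reals_Archimedean[OF this] obtain n where n: "inverse (real (Suc n)) < x - a" by blast
      have "\<forall>\<^sub>F k in sequentially. indicator {..a} x = sset (to_nat (q k)) x"
        using eventually_ge_at_top[of n]
      proof eventually_elim
        case (elim k)
        have "inverse (real (Suc k)) \<le> inverse (real (Suc n))" using elim by (intro le_imp_inverse_le) auto
        then have "of_rat (q k) < x" using q(2)[of k] n by linarith
        then show ?case using False by (auto simp: sset_def indicator_def)
      qed
      then show ?thesis by (rule Lim_transform_eventually[OF tendsto_const])
    qed
    show "\<bar>sset (to_nat (q k)) x\<bar> \<le> \<bar>1\<bar>" for k by (simp add: sset_def indicator_def)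
  qed simp
qed

lemma reached_one: "reached (\<lambda>_. 1)"
proof (rule reached_dominated[where h="\<lambda>k. indicator {..real k}" and f="\<lambda>_. 1"])
  fix x :: real
  have "\<forall>\<^sub>F k in sequentially. 1 = (indicator {..real k} x :: real)"
    using eventually_ge_at_top[of "nat \<lceil>x\<rceil>"]
  proof eventually_elim
    case (elim k)
    then have "x \<le> real k" by linarith
    then show ?case by simp
  qed
  then show "(\<lambda>k. indicator {..real k} x :: real) \<longlonglongrightarrow> 1" by (rule Lim_transform_eventually[OF tendsto_const])
qed (auto intro: reached_atMost sqi_one simp: indicator_def)

lemma reached_zero: "reached (\<lambda>_. 0)"
  using reached_lincomb[OF reached_one reached_one, of 0 0] by simp

lemma reached_sum: "finite A \<Longrightarrow> (\<And>i. i \<in> A \<Longrightarrow> reached (f i)) \<Longrightarrow> reached (\<lambda>x. \<Sum>i\<in>A. c i * f i x)"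
proof (induction A rule: finite_induct)
  case (insert i A)
  have "reached (\<lambda>x. c i * f i x + 1 * (\<Sum>i\<in>A. c i * f i x))"
    by (rule reached_lincomb) (use insert in auto)
  then show ?case using insert by simp
qed (simp add: reached_zero)

text \<open>Half lines are a generating family stable under intersection, and \<open>reached\<close>
  passes to complements, by subtraction from 1, and to disjoint unions, by dominated
  convergence.\<close>

lemma reached_indicator: assumes "A \<in> sets borel" shows "reached (indicator A)"
proof -
  have A: "A \<in> sigma_sets UNIV (range (\<lambda>a::real. {..a}))"
    using assms by (simp add: borel_eq_atMost)
  have m: "B \<in> sets borel" if "B \<in> sigma_sets UNIV (range (\<lambda>a::real. {..a}))" for B
    using that by (simp add: borel_eq_atMost)
  show ?thesis
  proof (rule sigma_sets_induct_disjoint[OF _ _ A])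
    show "Int_stable (range (\<lambda>a::real. {..a}))" by (auto simp: Int_stable_def)
    show "reached (indicator B)" if "B \<in> range (\<lambda>a. {..a})" for B using that reached_atMost by auto
    show "reached (indicator {})" using reached_zero by (simp add: indicator_def[abs_def])
  next
    fix B assume B: "reached (indicator B)"
    have "reached (\<lambda>x. 1 * 1 + (-1) * indicator B x)" by (rule reached_lincomb[OF reached_one B])
    moreover have "(\<lambda>x. 1 * 1 + (-1) * indicator B x) = (indicator (UNIV - B) :: real \<Rightarrow> real)"
      by (auto simp: indicator_def fun_eq_iff)
    ultimately show "reached (indicator (UNIV - B))" by simp
  next
    fix B :: "nat \<Rightarrow> real set"
    assume B: "disjoint_family B" "range B \<subseteq> sigma_sets UNIV (range (\<lambda>a. {..a}))" "\<And>i. reached (indicator (B i))"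
    have eq: "(\<Sum>i<n. 1 * indicator (B i) x) = (indicator (\<Union>i<n. B i) x :: real)" for n x
    proof -
      have "(indicator (\<Union>i<n. B i) x :: real) = (\<Sum>i<n. indicator (B i) x)"
        by (rule indicator_UN_disjoint) (use B(1) in \<open>auto simp: disjoint_family_on_def\<close>)
      then show ?thesis by simp
    qed
    show "reached (indicator (\<Union>i. B i))"
    proof (rule reached_dominated[where h="\<lambda>n x. \<Sum>i<n. 1 * indicator (B i) x" and f="\<lambda>_. 1"])
      show "reached (\<lambda>x. \<Sum>i<n. 1 * indicator (B i) x)" for n by (rule reached_sum) (auto intro: B(3))
      have "B i \<in> sets borel" for i using m B(2) by blast
      then show "indicator (\<Union>i. B i) \<in> borel_measurable borel" by auto
      fix x
      show "(\<lambda>n. \<Sum>i<n. 1 * indicator (B i) x) \<longlonglongrightarrow> (indicator (\<Union>i. B i) x :: real)"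
        unfolding eq by (rule LIMSEQ_indicator_UN)
      show "\<bar>\<Sum>i<n. 1 * indicator (B i) x\<bar> \<le> \<bar>1::real\<bar>" for n unfolding eq by (simp add: indicator_def)
    qed (rule sqi_one)
  qed auto
qed

lemma reached_simple: assumes "simple_function borel f" shows "reached (f :: real \<Rightarrow> real)"
proof -
  have fin: "finite (range f)" and m: "\<And>y. y \<in> range f \<Longrightarrow> f -` {y} \<in> sets borel"
    using assms by (auto simp: simple_function_def)
  have "f = (\<lambda>x. \<Sum>y\<in>range f. y * indicator (f -` {y}) x)"
  proof
    fix x
    have "(\<Sum>y\<in>range f. y * indicator (f -` {y}) x) = (\<Sum>y\<in>range f. if y = f x then f x else 0)"
      by (intro sum.cong) (auto simp: indicator_def)
    then show "f x = (\<Sum>y\<in>range f. y * indicator (f -` {y}) x)" using fin by simp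
  qed
  moreover have "reached (\<lambda>x. \<Sum>y\<in>range f. y * indicator (f -` {y}) x)"
    by (rule reached_sum[OF fin]) (intro reached_indicator m)
  ultimately show ?thesis by simp
qed

lemma reached_all: assumes "sqi f" shows "reached f"
proof -
  have fm: "f \<in> borel_measurable borel" using assms by (simp add: sqi_def)
  obtain F where F: "\<And>i. simple_function borel (F i)" "\<And>x. (\<lambda>i. F i x) \<longlonglongrightarrow> f x" "\<And>i x. dist (F i x) 0 \<le> 2 * dist (f x) 0"
    using borel_measurable_implies_sequence_metric[OF fm, of 0] by auto
  show ?thesis
    by (rule reached_dominated[where h=F and f="\<lambda>x. 2 * f x"])
       (use F fm assms in \<open>auto intro: reached_simple sqi_scale simp: abs_mult\<close>)
qed

theorem gs_parseval: assumes "sqi f" shows "(\<lambda>i. (ip f (gs i))\<^sup>2) sums ip f f"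
proof -
  have "(\<lambda>n. ip f f - ip (gres n f) (gres n f)) \<longlonglongrightarrow> ip f f - 0"
    using reached_all[OF assms] unfolding reached_def by (intro tendsto_intros) auto
  then show ?thesis unfolding sums_def by (simp add: ip_gres[OF assms])
qed

end

section \<open>Complex functions over a symmetric measure\<close>

locale symmetric_borel_measure = finite_line_measure +
  assumes symm: "distr \<nu> borel uminus = \<nu>"
begin

lemma integral_minus: "f \<in> borel_measurable borel \<Longrightarrow> (\<integral>x. f (- x) \<partial>\<nu>) = (\<integral>x. f x \<partial>\<nu>)"
  for f :: "real \<Rightarrow> 'b::{banach, second_countable_topology}"
  using integral_distr[of uminus \<nu> borel f] symm by simp

lemma integrable_minus: "f \<in> borel_measurable borel \<Longrightarrow> integrable \<nu> f \<Longrightarrow> integrable \<nu> (\<lambda>x. f (- x))"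
  for f :: "real \<Rightarrow> 'b::{banach, second_countable_topology}"
  using integrable_distr[of uminus \<nu> borel f] symm by simp

text \<open>A unitary map on \<open>L\<^sup>2(\<nu>)\<close> that sends Hermitian functions to real ones.\<close>
definition hart :: "(real \<Rightarrow> complex) \<Rightarrow> real \<Rightarrow> complex" where
  "hart g y = Complex (1/2) (-1/2) * g y + Complex (1/2) (1/2) * g (- y)"

definition csqi :: "(real \<Rightarrow> complex) \<Rightarrow> bool" where
  "csqi g \<longleftrightarrow> g \<in> borel_measurable borel \<and> integrable \<nu> (\<lambda>y. (cmod (g y))\<^sup>2)"

text \<open>Coefficients of \<open>hart g\<close> along the real functions \<open>gs\<close>,
  extended complex linearly. Passing through \<open>hart\<close> makes the coefficients of a
  Hermitian \<open>g\<close> real, as is needed for real point evaluations.\<close>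

definition coef :: "(real \<Rightarrow> complex) \<Rightarrow> nat \<Rightarrow> complex" where
  "coef g j = Complex (ip (\<lambda>y. Re (hart g y)) (gs j)) (ip (\<lambda>y. Im (hart g y)) (gs j))"

lemma hart_measurable:
  assumes [measurable]: "g \<in> borel_measurable borel" shows "hart g \<in> borel_measurable borel"
  unfolding hart_def[abs_def] by measurable

text \<open>\<open>hart\<close> acts on the pair \<open>(g y, g (- y))\<close> by a unitary matrix
  of size two. Integrated against the symmetric measure, this becomes preservation of the
  norm.\<close>

lemma hart_parallelogram: "(cmod (hart g y))\<^sup>2 + (cmod (hart g (- y)))\<^sup>2 = (cmod (g y))\<^sup>2 + (cmod (g (- y)))\<^sup>2"
  by (simp add: hart_def cmod_power2) (simp add: power2_eq_square field_simps)

lemma hart_csqi: assumes "csqi g" shows "csqi (hart g)" "(\<integral>y. (cmod (hart g y))\<^sup>2 \<partial>\<nu>) = (\<integral>y. (cmod (g y))\<^sup>2 \<partial>\<nu>)"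
proof -
  have [measurable]: "g \<in> borel_measurable borel" and ig: "integrable \<nu> (\<lambda>y. (cmod (g y))\<^sup>2)" using assms by (auto simp: csqi_def)
  note [measurable] = hart_measurable[of g]
  have ig': "integrable \<nu> (\<lambda>y. (cmod (g (- y)))\<^sup>2)" using integrable_minus[OF _ ig] by simp
  have ih: "integrable \<nu> (\<lambda>y. (cmod (hart g y))\<^sup>2)"
  proof (rule Bochner_Integration.integrable_bound)
    show "integrable \<nu> (\<lambda>y. (cmod (g y))\<^sup>2 + (cmod (g (- y)))\<^sup>2)" using ig ig' by simp
    show "AE y in \<nu>. norm ((cmod (hart g y))\<^sup>2) \<le> norm ((cmod (g y))\<^sup>2 + (cmod (g (- y)))\<^sup>2)"
      using hart_parallelogram[of g] by (auto intro!: AE_I2) (metis le_add_same_cancel1 zero_le_power2)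
  qed (simp add: hart_measurable)
  then show "csqi (hart g)" by (simp add: csqi_def hart_measurable)
  have ih': "integrable \<nu> (\<lambda>y. (cmod (hart g (- y)))\<^sup>2)" using integrable_minus[OF _ ih] by (simp add: hart_measurable)
  have m1: "(\<integral>y. (cmod (hart g (- y)))\<^sup>2 \<partial>\<nu>) = (\<integral>y. (cmod (hart g y))\<^sup>2 \<partial>\<nu>)"
    using integral_minus[of "\<lambda>y. (cmod (hart g y))\<^sup>2"] by (simp add: hart_measurable)
  have m2: "(\<integral>y. (cmod (g (- y)))\<^sup>2 \<partial>\<nu>) = (\<integral>y. (cmod (g y))\<^sup>2 \<partial>\<nu>)"
    using integral_minus[of "\<lambda>y. (cmod (g y))\<^sup>2"] by simp
  have "(\<integral>y. (cmod (hart g y))\<^sup>2 + (cmod (hart g (- y)))\<^sup>2 \<partial>\<nu>) = (\<integral>y. (cmod (g y))\<^sup>2 + (cmod (g (- y)))\<^sup>2 \<partial>\<nu>)"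
    by (simp only: hart_parallelogram)
  then show "(\<integral>y. (cmod (hart g y))\<^sup>2 \<partial>\<nu>) = (\<integral>y. (cmod (g y))\<^sup>2 \<partial>\<nu>)"
    using ig ig' ih ih' m1 m2 by simp
qed

lemma csqi_Re_Im: assumes "csqi g" shows "sqi (\<lambda>y. Re (g y))" "sqi (\<lambda>y. Im (g y))"
proof -
  have [measurable]: "g \<in> borel_measurable borel" and ig: "integrable \<nu> (\<lambda>y. (cmod (g y))\<^sup>2)" using assms by (auto simp: csqi_def)
  have "integrable \<nu> (\<lambda>y. (Re (g y))\<^sup>2)" "integrable \<nu> (\<lambda>y. (Im (g y))\<^sup>2)"
    by (rule Bochner_Integration.integrable_bound[OF ig]; simp add: cmod_power2)+
  then show "sqi (\<lambda>y. Re (g y))" "sqi (\<lambda>y. Im (g y))" by (auto simp: sqi_def)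
qed

theorem coef_parseval: assumes "csqi g" shows "(\<lambda>j. (cmod (coef g j))\<^sup>2) sums (\<integral>y. (cmod (g y))\<^sup>2 \<partial>\<nu>)"
proof -
  note h = csqi_Re_Im[OF hart_csqi(1)[OF assms]]
  have "(\<lambda>j. (ip (\<lambda>y. Re (hart g y)) (gs j))\<^sup>2 + (ip (\<lambda>y. Im (hart g y)) (gs j))\<^sup>2) sums
     (ip (\<lambda>y. Re (hart g y)) (\<lambda>y. Re (hart g y)) + ip (\<lambda>y. Im (hart g y)) (\<lambda>y. Im (hart g y)))"
    by (intro sums_add gs_parseval h)
  moreover have "ip (\<lambda>y. Re (hart g y)) (\<lambda>y. Re (hart g y)) + ip (\<lambda>y. Im (hart g y)) (\<lambda>y. Im (hart g y))
     = (\<integral>y. (cmod (hart g y))\<^sup>2 \<partial>\<nu>)"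
  proof -
    have "(cmod (hart g y))\<^sup>2 = Re (hart g y) * Re (hart g y) + Im (hart g y) * Im (hart g y)" for y
      unfolding cmod_power2 by (simp add: power2_eq_square)
    then show ?thesis
      unfolding ip_def using sqi_integrable_mult[OF h(1) h(1)] sqi_integrable_mult[OF h(2) h(2)] by simp
  qed
  moreover have "(cmod (coef g j))\<^sup>2 = (ip (\<lambda>y. Re (hart g y)) (gs j))\<^sup>2 + (ip (\<lambda>y. Im (hart g y)) (gs j))\<^sup>2" for j
    by (simp add: coef_def cmod_power2)
  ultimately show ?thesis by (simp only: hart_csqi(2)[OF assms])
qed

lemma csqi_lincomb: assumes "csqi f" "csqi g" shows "csqi (\<lambda>y. a * f y + b * g y)"
proof -
  have [measurable]: "f \<in> borel_measurable borel" "g \<in> borel_measurable borel"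
    and i: "integrable \<nu> (\<lambda>y. (cmod (f y))\<^sup>2)" "integrable \<nu> (\<lambda>y. (cmod (g y))\<^sup>2)" using assms by (auto simp: csqi_def)
  have "integrable \<nu> (\<lambda>y. (cmod (a * f y + b * g y))\<^sup>2)"
  proof (rule Bochner_Integration.integrable_bound)
    show "integrable \<nu> (\<lambda>y. 2 * (cmod a)\<^sup>2 * (cmod (f y))\<^sup>2 + 2 * (cmod b)\<^sup>2 * (cmod (g y))\<^sup>2)" using i by simp
    show "AE y in \<nu>. norm ((cmod (a * f y + b * g y))\<^sup>2) \<le> norm (2 * (cmod a)\<^sup>2 * (cmod (f y))\<^sup>2 + 2 * (cmod b)\<^sup>2 * (cmod (g y))\<^sup>2)"
    proof (rule AE_I2)
      fix y
      have "(cmod (a * f y + b * g y))\<^sup>2 \<le> (cmod (a * f y) + cmod (b * g y))\<^sup>2"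
        by (intro power_mono norm_triangle_ineq) auto
      also have "\<dots> \<le> 2 * (cmod (a * f y))\<^sup>2 + 2 * (cmod (b * g y))\<^sup>2"
        using zero_le_power2[of "cmod (a * f y) - cmod (b * g y)"] by (simp add: power2_sum power2_diff)
      finally show "norm ((cmod (a * f y + b * g y))\<^sup>2) \<le> norm (2 * (cmod a)\<^sup>2 * (cmod (f y))\<^sup>2 + 2 * (cmod b)\<^sup>2 * (cmod (g y))\<^sup>2)"
        by (simp add: norm_mult power_mult_distrib)
    qed
  qed simp
  then show ?thesis by (simp add: csqi_def)
qed

lemma coef_lincomb: assumes "csqi f" "csqi g"
  shows "coef (\<lambda>y. a * f y + b * g y) j = a * coef f j + b * coef g j"
proof -
  note F = csqi_Re_Im[OF hart_csqi(1)[OF assms(1)]] and G = csqi_Re_Im[OF hart_csqi(1)[OF assms(2)]]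
  have e: "hart (\<lambda>y. a * f y + b * g y) y = a * hart f y + b * hart g y" for y
    by (simp add: hart_def algebra_simps)
  have re: "(\<lambda>y. Re (hart (\<lambda>y. a * f y + b * g y) y))
     = (\<lambda>y. 1 * (Re a * Re (hart f y) + (- Im a) * Im (hart f y)) + 1 * (Re b * Re (hart g y) + (- Im b) * Im (hart g y)))"
    unfolding e by (simp add: algebra_simps)
  have im: "(\<lambda>y. Im (hart (\<lambda>y. a * f y + b * g y) y))
     = (\<lambda>y. 1 * (Re a * Im (hart f y) + Im a * Re (hart f y)) + 1 * (Re b * Im (hart g y) + Im b * Re (hart g y)))"
    unfolding e by (simp add: algebra_simps)
  show ?thesis unfolding coef_def re im
    by (simp only: ip_lincomb[OF sqi_lincomb[OF F(1) F(2)] sqi_lincomb[OF G(1) G(2)] sqi_gs]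
          ip_lincomb[OF sqi_lincomb[OF F(2) F(1)] sqi_lincomb[OF G(2) G(1)] sqi_gs]
          ip_lincomb[OF F(1) F(2) sqi_gs] ip_lincomb[OF G(1) G(2) sqi_gs]
          ip_lincomb[OF F(2) F(1) sqi_gs] ip_lincomb[OF G(2) G(1) sqi_gs])
       (simp add: complex_eq_iff algebra_simps)
qed

lemma coef_hermitian: assumes "\<And>y. g (- y) = cnj (g y)" shows "Im (coef g j) = 0"
proof -
  have "Im (hart g y) = 0" for y by (simp add: hart_def assms)
  then show ?thesis by (simp add: coef_def ip_zero)
qed

lemma coef_cong_AE: assumes "AE y in \<nu>. f y = g y" "csqi f" "csqi g" shows "coef f = coef g"
proof
  fix j
  have [measurable]: "f \<in> borel_measurable borel" "g \<in> borel_measurable borel" using assms by (auto simp: csqi_def)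
  have "AE y in distr \<nu> borel uminus. f y = g y" unfolding symm by (rule assms(1))
  then have "AE y in \<nu>. f (- y) = g (- y)" by (subst (asm) AE_distr_iff) auto
  then have e: "AE y in \<nu>. hart f y = hart g y" using assms(1) by eventually_elim (simp add: hart_def)
  note F = csqi_Re_Im[OF hart_csqi(1)[OF assms(2)]] and G = csqi_Re_Im[OF hart_csqi(1)[OF assms(3)]]
  have "ip (\<lambda>y. Re (hart f y)) (gs j) = ip (\<lambda>y. Re (hart g y)) (gs j)"
    by (rule ip_cong_AE) (use e F G sqi_gs in auto)
  moreover have "ip (\<lambda>y. Im (hart f y)) (gs j) = ip (\<lambda>y. Im (hart g y)) (gs j)"
    by (rule ip_cong_AE) (use e F G sqi_gs in auto)
  ultimately show "coef f j = coef g j" by (simp add: coef_def)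
qed

end

section \<open>Isonormal processes\<close>

lemma integral_le_of_nn_integral_le:
  fixes f :: "'a \<Rightarrow> real"
  assumes "f \<in> borel_measurable N" "\<And>x. 0 \<le> f x" "(\<integral>\<^sup>+x. ennreal (f x) \<partial>N) \<le> ennreal c" "0 \<le> c"
  shows "integrable N f" "(\<integral>x. f x \<partial>N) \<le> c"
proof -
  show i: "integrable N f"
    by (rule integrableI_nonneg) (use assms in \<open>auto intro: order_le_less_trans\<close>)
  have "ennreal (\<integral>x. f x \<partial>N) = (\<integral>\<^sup>+x. ennreal (f x) \<partial>N)"
    by (rule nn_integral_eq_integral[symmetric, OF i]) (use assms in auto)
  then have "ennreal (\<integral>x. f x \<partial>N) \<le> ennreal c" using assms(3) by simp
  then show "(\<integral>x. f x \<partial>N) \<le> c" by (simp only: ennreal_le_iff[OF assms(4)])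
qed

text \<open>The rate \<open>1/8\<close> leaves room for a weight \<open>2 ^ k\<close>: in
  \<open>L2_limit\<close> their product \<open>(1/4) ^ k\<close> is still summable.\<close>

lemma fast_subsequence:
  fixes \<rho> :: "nat \<Rightarrow> real"
  assumes "\<rho> \<longlonglongrightarrow> 0"
  shows "\<exists>r. strict_mono r \<and> (\<forall>k. \<rho> (r k) \<le> (1/8) ^ k)"
proof -
  have ex: "\<exists>y>x. \<rho> y \<le> (1/8) ^ n" for n x
  proof -
    have "\<forall>\<^sub>F y in sequentially. \<rho> y < (1/8) ^ n" by (rule order_tendstoD(2)[OF assms]) simp
    then obtain N where "\<And>y. N \<le> y \<Longrightarrow> \<rho> y < (1/8) ^ n" by (auto simp: eventually_sequentially)
    then show ?thesis by (intro exI[of _ "max N (Suc x)"]) (auto intro: less_imp_le)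
  qed
  have "\<exists>f. \<forall>n. \<rho> (f n) \<le> (1/8) ^ n \<and> f n < f (Suc n)"
  proof (rule dependent_nat_choice)
    show "\<exists>x. \<rho> x \<le> (1/8) ^ 0" using ex[of 0 0] by auto
    show "\<exists>y. \<rho> y \<le> (1/8) ^ Suc n \<and> x < y" for x n using ex[of x "Suc n"] by auto
  qed
  then show ?thesis by (auto simp: strict_mono_Suc_iff)
qed

text \<open>Riesz-Fischer with a limit given by a formula. The increments along the subsequence are
  summable in mean, hence almost everywhere, and Fatou's lemma carries the mean-square bound over to
  the limit.\<close>

lemma (in finite_measure) L2_limit:
  fixes X :: "nat \<Rightarrow> 'a \<Rightarrow> complex"
  assumes X [measurable]: "\<And>n. X n \<in> borel_measurable M"
    and r: "strict_mono r" "\<And>k. \<rho> (r k) \<le> (1/8) ^ k"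
    and b: "\<And>m n. m \<le> n \<Longrightarrow> (\<integral>\<^sup>+w. ennreal ((cmod (X n w - X m w))\<^sup>2) \<partial>M) \<le> ennreal (\<rho> m)"
  shows "AE w in M. convergent (\<lambda>k. X (r k) w)"
    and "(\<integral>\<^sup>+w. ennreal ((cmod (lim (\<lambda>k. X (r k) w) - X n w))\<^sup>2) \<partial>M) \<le> ennreal (\<rho> n)"
proof -
  let ?D = "\<lambda>k w. X (r (Suc k)) w - X (r k) w"
  have Dk: "(\<integral>\<^sup>+w. ennreal (cmod (?D k w)) \<partial>M) \<le> ennreal ((1/2) ^ k * (measure M (space M) + 1))" for k
  proof -
    \<comment> \<open>Trades the first moment for the second: the constant part is integrable on a
      finite measure and summable in \<open>k\<close>, and the quadratic part is controlled by the
      rate of the subsequence.\<close>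
    have le: "t \<le> (1/2) ^ k + 2 ^ k * t\<^sup>2" if "0 \<le> t" for t :: real
    proof (cases "t \<le> (1/2) ^ k")
      case False
      have "(1/2) ^ k * 2 ^ k = (1::real)" by (simp add: power_one_over)
      have "1 \<le> 2 ^ k * t" using False mult_left_mono[of "(1/2) ^ k" t "2 ^ k"] by (simp add: power_one_over)
      then have "1 * t \<le> 2 ^ k * t * t" using that by (intro mult_right_mono) auto
      then have "t \<le> 2 ^ k * t\<^sup>2" by (simp add: power2_eq_square mult.assoc)
      moreover have "0 \<le> (1/2::real) ^ k" by simp
      ultimately show ?thesis by linarith
    qed (simp add: add_increasing2)
    have "(\<integral>\<^sup>+w. ennreal (cmod (?D k w)) \<partial>M) \<le> (\<integral>\<^sup>+w. ennreal ((1/2) ^ k) + ennreal (2 ^ k) * ennreal ((cmod (?D k w))\<^sup>2) \<partial>M)"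
    proof (rule nn_integral_mono)
      fix w
      have "ennreal (cmod (?D k w)) \<le> ennreal ((1/2) ^ k + 2 ^ k * (cmod (?D k w))\<^sup>2)" by (intro ennreal_leI le) simp
      then show "ennreal (cmod (?D k w)) \<le> ennreal ((1/2) ^ k) + ennreal (2 ^ k) * ennreal ((cmod (?D k w))\<^sup>2)"
        by (simp add: ennreal_plus ennreal_mult del: ennreal_power)
    qed
    also have "\<dots> = ennreal ((1/2) ^ k) * emeasure M (space M) + ennreal (2 ^ k) * (\<integral>\<^sup>+w. ennreal ((cmod (?D k w))\<^sup>2) \<partial>M)"
      by (subst nn_integral_add) (auto simp: nn_integral_cmult)
    also have "\<dots> \<le> ennreal ((1/2) ^ k) * emeasure M (space M) + ennreal (2 ^ k) * ennreal ((1/8) ^ k)"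
    proof (intro add_left_mono mult_left_mono)
      have "(\<integral>\<^sup>+w. ennreal ((cmod (?D k w))\<^sup>2) \<partial>M) \<le> ennreal (\<rho> (r k))"
        by (rule b) (use r(1) in \<open>simp add: strict_mono_less_eq\<close>)
      also have "\<dots> \<le> ennreal ((1/8) ^ k)" by (rule ennreal_leI) (rule r(2))
      finally show "(\<integral>\<^sup>+w. ennreal ((cmod (?D k w))\<^sup>2) \<partial>M) \<le> ennreal ((1/8) ^ k)" .
    qed auto
    also have "\<dots> = ennreal ((1/2) ^ k * measure M (space M) + 2 ^ k * (1/8) ^ k)"
      by (simp add: emeasure_eq_measure ennreal_plus ennreal_mult del: ennreal_power)
    also have "\<dots> \<le> ennreal ((1/2) ^ k * (measure M (space M) + 1))"
    proof (rule ennreal_leI)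
      have "(2::real) ^ k * (1/8) ^ k = (1/4) ^ k" by (simp flip: power_mult_distrib)
      also have "\<dots> \<le> (1/2) ^ k" by (intro power_mono) auto
      finally show "(1/2) ^ k * measure M (space M) + 2 ^ k * (1/8) ^ k \<le> (1/2) ^ k * (measure M (space M) + 1)"
        by (simp add: distrib_left)
    qed
    finally show ?thesis .
  qed
  have "(\<integral>\<^sup>+w. (\<Sum>k. ennreal (cmod (?D k w))) \<partial>M) = (\<Sum>k. \<integral>\<^sup>+w. ennreal (cmod (?D k w)) \<partial>M)"
    by (rule nn_integral_suminf) simp
  also have "\<dots> \<le> (\<Sum>k. ennreal ((1/2) ^ k * (measure M (space M) + 1)))"
    by (intro suminf_le Dk) auto
  also have "\<dots> = ennreal (\<Sum>k. (1/2) ^ k * (measure M (space M) + 1))"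
    by (intro suminf_ennreal2) (auto intro!: summable_mult2 summable_geometric)
  finally have "(\<integral>\<^sup>+w. (\<Sum>k. ennreal (cmod (?D k w))) \<partial>M) \<noteq> \<infinity>"
    by (auto simp: top_unique)
  then have "AE w in M. (\<Sum>k. ennreal (cmod (?D k w))) \<noteq> \<infinity>"
    by (intro nn_integral_PInf_AE) auto
  then show conv: "AE w in M. convergent (\<lambda>k. X (r k) w)"
  proof eventually_elim
    case (elim w)
    then have "summable (\<lambda>k. cmod (?D k w))" by (intro summable_suminf_not_top) auto
    then have "summable (\<lambda>k. ?D k w)" by (rule summable_norm_cancel)
    then have "convergent (\<lambda>n. \<Sum>k<n. ?D k w)" by (simp add: summable_iff_convergent)
    then have "convergent (\<lambda>n. X (r n) w - X (r 0) w)" by (simp add: sum_lessThan_telescope[of "\<lambda>k. X (r k) w"])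
    then show ?case by (rule convergent_diff_const_right_iff[THEN iffD1])
  qed
  have "(\<integral>\<^sup>+w. ennreal ((cmod (lim (\<lambda>k. X (r k) w) - X n w))\<^sup>2) \<partial>M) = (\<integral>\<^sup>+w. liminf (\<lambda>k. ennreal ((cmod (X (r k) w - X n w))\<^sup>2)) \<partial>M)"
  proof (rule nn_integral_cong_AE)
    show "AE w in M. ennreal ((cmod (lim (\<lambda>k. X (r k) w) - X n w))\<^sup>2) = liminf (\<lambda>k. ennreal ((cmod (X (r k) w - X n w))\<^sup>2))"
      using conv
    proof eventually_elim
      case (elim w)
      then have "(\<lambda>k. X (r k) w) \<longlonglongrightarrow> lim (\<lambda>k. X (r k) w)" by (simp add: convergent_LIMSEQ_iff)
      then have "(\<lambda>k. ennreal ((cmod (X (r k) w - X n w))\<^sup>2)) \<longlonglongrightarrow> ennreal ((cmod (lim (\<lambda>k. X (r k) w) - X n w))\<^sup>2)"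
        by (intro tendsto_ennrealI tendsto_power tendsto_norm tendsto_diff tendsto_const)
      then show ?case by (intro lim_imp_Liminf[symmetric]) auto
    qed
  qed
  also have "\<dots> \<le> liminf (\<lambda>k. \<integral>\<^sup>+w. ennreal ((cmod (X (r k) w - X n w))\<^sup>2) \<partial>M)"
    by (rule nn_integral_liminf) simp
  also have "\<dots> \<le> liminf (\<lambda>k. ennreal (\<rho> n))"
  proof (rule Liminf_mono)
    show "\<forall>\<^sub>F k in sequentially. (\<integral>\<^sup>+w. ennreal ((cmod (X (r k) w - X n w))\<^sup>2) \<partial>M) \<le> ennreal (\<rho> n)"
      using eventually_ge_at_top[of n]
    proof eventually_elim
      case (elim k)
      then have "n \<le> r k" using seq_suble[OF r(1), of k] by linarith
      then show ?case by (rule b)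
    qed
  qed
  also have "\<dots> = ennreal (\<rho> n)" by (simp add: Liminf_const)
  finally show "(\<integral>\<^sup>+w. ennreal ((cmod (lim (\<lambda>k. X (r k) w) - X n w))\<^sup>2) \<partial>M) \<le> ennreal (\<rho> n)" .
qed

definition tail :: "(nat \<Rightarrow> complex) \<Rightarrow> nat \<Rightarrow> real" where
  "tail a n = (\<Sum>j. (cmod (a j))\<^sup>2) - (\<Sum>j<n. (cmod (a j))\<^sup>2)"

definition ell2 :: "(nat \<Rightarrow> complex) \<Rightarrow> bool" where
  "ell2 a \<longleftrightarrow> summable (\<lambda>j. (cmod (a j))\<^sup>2)"

lemma tail_lim: "ell2 a \<Longrightarrow> tail a \<longlonglongrightarrow> 0"
proof -
  assume "ell2 a"
  then have "(\<lambda>n. (\<Sum>j. (cmod (a j))\<^sup>2) - (\<Sum>j<n. (cmod (a j))\<^sup>2)) \<longlonglongrightarrow> (\<Sum>j. (cmod (a j))\<^sup>2) - (\<Sum>j. (cmod (a j))\<^sup>2)"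
    unfolding ell2_def by (intro tendsto_diff tendsto_const summable_LIMSEQ)
  then show ?thesis by (simp add: tail_def[abs_def])
qed

lemma tail_nonneg: "ell2 a \<Longrightarrow> 0 \<le> tail a n"
  unfolding tail_def ell2_def using sum_le_suminf[of "\<lambda>j. (cmod (a j))\<^sup>2" "{..<n}"] by simp

lemma sum_le_tail: "ell2 a \<Longrightarrow> m \<le> n \<Longrightarrow> (\<Sum>j=m..<n. (cmod (a j))\<^sup>2) \<le> tail a m"
proof -
  assume a: "ell2 a" and mn: "m \<le> n"
  have "(\<Sum>j<n. (cmod (a j))\<^sup>2) = (\<Sum>j<m. (cmod (a j))\<^sup>2) + (\<Sum>j=m..<n. (cmod (a j))\<^sup>2)"
    using sum.atLeastLessThan_concat[of 0 m n "\<lambda>j. (cmod (a j))\<^sup>2"] mn by (simp add: lessThan_atLeast0)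
  then show ?thesis using tail_nonneg[OF a, of n] by (simp add: tail_def)
qed

lemma cmod_add_sq_le: "(cmod (x + y))\<^sup>2 \<le> 2 * (cmod x)\<^sup>2 + 2 * (cmod y)\<^sup>2"
proof -
  have "(cmod (x + y))\<^sup>2 \<le> (cmod x + cmod y)\<^sup>2" by (intro power_mono norm_triangle_ineq) auto
  also have "\<dots> \<le> 2 * (cmod x)\<^sup>2 + 2 * (cmod y)\<^sup>2"
    using zero_le_power2[of "cmod x - cmod y"] by (simp add: power2_sum power2_diff)
  finally show ?thesis .
qed

lemma ell2_lincomb: assumes "ell2 a" "ell2 b" shows "ell2 (\<lambda>j. c * a j + d * b j)"
  unfolding ell2_def
proof (rule summable_comparison_test')
  show "summable (\<lambda>j. 2 * (cmod c)\<^sup>2 * (cmod (a j))\<^sup>2 + 2 * (cmod d)\<^sup>2 * (cmod (b j))\<^sup>2)"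
    using assms unfolding ell2_def by (intro summable_add summable_mult)
  show "norm ((cmod (c * a j + d * b j))\<^sup>2) \<le> 2 * (cmod c)\<^sup>2 * (cmod (a j))\<^sup>2 + 2 * (cmod d)\<^sup>2 * (cmod (b j))\<^sup>2" for j
    using cmod_add_sq_le[of "c * a j" "d * b j"] by (simp add: norm_mult power_mult_distrib)
qed

definition rsub :: "(nat \<Rightarrow> complex) \<Rightarrow> nat \<Rightarrow> nat" where
  "rsub a = (SOME r. strict_mono r \<and> (\<forall>k. tail a (r k) \<le> (1/8) ^ k))"

lemma rsub: assumes "ell2 a" shows "strict_mono (rsub a)" "tail a (rsub a k) \<le> (1/8) ^ k"
  using someI_ex[OF fast_subsequence[OF tail_lim[OF assms]]] unfolding rsub_def by auto

text \<open>Summing along a subsequence that depends on \<open>a\<close> only gives almost sure convergence and makes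
  the limit a measurable function of \<open>x\<close>, so that independence of the variables passes to it.\<close>
definition phi :: "(nat \<Rightarrow> complex) \<Rightarrow> (nat \<Rightarrow> real) \<Rightarrow> complex" where
  "phi a x = lim (\<lambda>k. \<Sum>j<rsub a k. a j * of_real (x j))"

lemma phi_measurable [measurable]: "phi a \<in> borel_measurable (Pi\<^sub>M UNIV (\<lambda>_. borel))"
  unfolding phi_def[abs_def] by (rule borel_measurable_lim_metric) simp

section \<open>Gaussian series with square-summable coefficients\<close>

locale iid_normals = prob_space +
  fixes \<xi> :: "nat \<Rightarrow> 'a \<Rightarrow> real"
  assumes indep: "indep_vars (\<lambda>_. borel) \<xi> UNIV"
    and normal: "\<And>j. distributed M lborel (\<xi> j) std_normal_density"
begin

lemma xi_measurable [measurable]: "\<xi> j \<in> borel_measurable M"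
  using distributed_measurable[OF normal, of j] by simp

lemma xi_expectation: "integrable M (\<xi> j)" "expectation (\<xi> j) = 0"
proof -
  show "expectation (\<xi> j) = 0" by (rule standard_normal_distributed_expectation[OF normal])
  show "integrable M (\<xi> j)"
    using distributed_integrable[OF normal, of "\<lambda>x. x" j] integrable_std_normal_moment[of 1] by simp
qed

lemma xi_square: "integrable M (\<lambda>w. (\<xi> j w)\<^sup>2)" "expectation (\<lambda>w. (\<xi> j w)\<^sup>2) = 1"
proof -
  have "has_bochner_integral lborel (\<lambda>x. std_normal_density x * x\<^sup>2) 1"
    using std_normal_moment_even[of 1] by (simp add: fact_2)
  then show "integrable M (\<lambda>w. (\<xi> j w)\<^sup>2)" "expectation (\<lambda>w. (\<xi> j w)\<^sup>2) = 1"
    using distributed_integrable[OF normal, of "\<lambda>x. x\<^sup>2" j] distributed_integral[OF normal, of "\<lambda>x. x\<^sup>2" j]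
    by (auto simp: has_bochner_integral_iff)
qed

lemma xi_mult: "integrable M (\<lambda>w. \<xi> i w * \<xi> j w)" "expectation (\<lambda>w. \<xi> i w * \<xi> j w) = (if i = j then 1 else 0)"
proof -
  have "integrable M (\<lambda>w. \<xi> i w * \<xi> j w) \<and> expectation (\<lambda>w. \<xi> i w * \<xi> j w) = (if i = j then 1 else 0)"
  proof (cases "i = j")
    case True
    then show ?thesis using xi_square[of j] by (simp add: power2_eq_square)
  next
    case False
    have iv: "indep_vars (\<lambda>_. borel) \<xi> {i, j}" by (rule indep_vars_subset[OF indep]) simp
    show ?thesis
      using indep_vars_integrable[OF _ iv] indep_vars_lebesgue_integral[OF _ iv] xi_expectation False by simp
  qed
  then show "integrable M (\<lambda>w. \<xi> i w * \<xi> j w)" "expectation (\<lambda>w. \<xi> i w * \<xi> j w) = (if i = j then 1 else 0)" by auto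
qed

lemma real_sum_square:
  assumes "finite J"
  shows "integrable M (\<lambda>w. (\<Sum>j\<in>J. d j * \<xi> j w)\<^sup>2)" "expectation (\<lambda>w. (\<Sum>j\<in>J. d j * \<xi> j w)\<^sup>2) = (\<Sum>j\<in>J. (d j)\<^sup>2)"
proof -
  have e: "(\<lambda>w. (\<Sum>j\<in>J. d j * \<xi> j w)\<^sup>2) = (\<lambda>w. \<Sum>i\<in>J. \<Sum>j\<in>J. d i * d j * (\<xi> i w * \<xi> j w))"
    by (auto simp: power2_eq_square sum_product mult_ac fun_eq_iff intro!: sum.cong)
  show "integrable M (\<lambda>w. (\<Sum>j\<in>J. d j * \<xi> j w)\<^sup>2)"
    unfolding e by (intro Bochner_Integration.integrable_sum integrable_mult_right xi_mult)
  have "expectation (\<lambda>w. (\<Sum>j\<in>J. d j * \<xi> j w)\<^sup>2) = (\<Sum>i\<in>J. \<Sum>j\<in>J. d i * d j * (if i = j then 1 else 0))"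
    unfolding e by (subst Bochner_Integration.integral_sum, intro Bochner_Integration.integrable_sum integrable_mult_right xi_mult,
        subst Bochner_Integration.integral_sum, intro integrable_mult_right xi_mult) (simp add: xi_mult)
  also have "\<dots> = (\<Sum>j\<in>J. (d j)\<^sup>2)" using assms by (simp add: power2_eq_square if_distrib[of "\<lambda>x. _ * x"] cong: if_cong)
  finally show "expectation (\<lambda>w. (\<Sum>j\<in>J. d j * \<xi> j w)\<^sup>2) = (\<Sum>j\<in>J. (d j)\<^sup>2)" .
qed

lemma complex_sum_square:
  assumes "finite J"
  shows "integrable M (\<lambda>w. (cmod (\<Sum>j\<in>J. a j * of_real (\<xi> j w)))\<^sup>2)"
    "expectation (\<lambda>w. (cmod (\<Sum>j\<in>J. a j * of_real (\<xi> j w)))\<^sup>2) = (\<Sum>j\<in>J. (cmod (a j))\<^sup>2)"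
proof -
  have e: "(\<lambda>w. (cmod (\<Sum>j\<in>J. a j * of_real (\<xi> j w)))\<^sup>2) = (\<lambda>w. (\<Sum>j\<in>J. Re (a j) * \<xi> j w)\<^sup>2 + (\<Sum>j\<in>J. Im (a j) * \<xi> j w)\<^sup>2)"
    by (simp add: cmod_power2)
  note r = real_sum_square[OF assms]
  show "integrable M (\<lambda>w. (cmod (\<Sum>j\<in>J. a j * of_real (\<xi> j w)))\<^sup>2)"
    unfolding e by (intro Bochner_Integration.integrable_add r)
  show "expectation (\<lambda>w. (cmod (\<Sum>j\<in>J. a j * of_real (\<xi> j w)))\<^sup>2) = (\<Sum>j\<in>J. (cmod (a j))\<^sup>2)"
    unfolding e by (subst Bochner_Integration.integral_add[OF r(1) r(1)]) (simp add: r(2) cmod_power2 sum.distrib)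
qed

definition psum :: "(nat \<Rightarrow> complex) \<Rightarrow> nat \<Rightarrow> 'a \<Rightarrow> complex" where
  "psum a n w = (\<Sum>j<n. a j * of_real (\<xi> j w))"

definition W :: "(nat \<Rightarrow> complex) \<Rightarrow> 'a \<Rightarrow> complex" where
  "W a w = phi a (\<lambda>j. \<xi> j w)"

lemma psum_measurable [measurable]: "psum a n \<in> borel_measurable M"
  unfolding psum_def[abs_def] by measurable

lemma W_eq: "W a w = lim (\<lambda>k. psum a (rsub a k) w)"
  by (simp add: W_def phi_def psum_def)

lemma W_measurable [measurable]: "W a \<in> borel_measurable M"
  unfolding W_eq[abs_def] by (rule borel_measurable_lim_metric) simp

lemma psum_diff_bound:
  assumes "ell2 a" "m \<le> n"
  shows "(\<integral>\<^sup>+w. ennreal ((cmod (psum a n w - psum a m w))\<^sup>2) \<partial>M) \<le> ennreal (tail a m)"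
proof -
  have e: "psum a n w - psum a m w = (\<Sum>j=m..<n. a j * of_real (\<xi> j w))" for w
    using sum.atLeastLessThan_concat[of 0 m n "\<lambda>j. a j * of_real (\<xi> j w)"] assms(2) by (simp add: psum_def lessThan_atLeast0 algebra_simps)
  have "(\<integral>\<^sup>+w. ennreal ((cmod (psum a n w - psum a m w))\<^sup>2) \<partial>M) = ennreal (\<Sum>j=m..<n. (cmod (a j))\<^sup>2)"
    unfolding e using complex_sum_square[of "{m..<n}" a] by (subst nn_integral_eq_integral) auto
  also have "\<dots> \<le> ennreal (tail a m)" by (intro ennreal_leI sum_le_tail assms)
  finally show ?thesis .
qed

lemma W_limit:
  assumes a: "ell2 a"
  shows "AE w in M. (\<lambda>k. psum a (rsub a k) w) \<longlonglongrightarrow> W a w"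
    and "integrable M (\<lambda>w. (cmod (W a w - psum a n w))\<^sup>2)"
    and "expectation (\<lambda>w. (cmod (W a w - psum a n w))\<^sup>2) \<le> tail a n"
proof -
  have L: "AE w in M. convergent (\<lambda>k. psum a (rsub a k) w)"
    "(\<integral>\<^sup>+w. ennreal ((cmod (lim (\<lambda>k. psum a (rsub a k) w) - psum a n w))\<^sup>2) \<partial>M) \<le> ennreal (tail a n)"
    by (rule L2_limit[where X="psum a" and r="rsub a" and \<rho>="tail a"]; use rsub[OF a] psum_diff_bound[OF a] in simp)+
  show "AE w in M. (\<lambda>k. psum a (rsub a k) w) \<longlonglongrightarrow> W a w"
    using L(1) by eventually_elim (simp add: W_eq convergent_LIMSEQ_iff)
  have "(\<integral>\<^sup>+w. ennreal ((cmod (W a w - psum a n w))\<^sup>2) \<partial>M) \<le> ennreal (tail a n)"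
    unfolding W_eq by (rule L(2))
  from integral_le_of_nn_integral_le[OF _ _ this tail_nonneg[OF a]]
  show "integrable M (\<lambda>w. (cmod (W a w - psum a n w))\<^sup>2)" "expectation (\<lambda>w. (cmod (W a w - psum a n w))\<^sup>2) \<le> tail a n"
    by auto
qed

lemma W_square_integrable: assumes "ell2 a" shows "integrable M (\<lambda>w. (cmod (W a w))\<^sup>2)"
  using W_limit(2)[OF assms, of 0] by (simp add: psum_def)

lemma AE_zero_of_small:
  fixes Z :: "'a \<Rightarrow> complex"
  assumes [measurable]: "Z \<in> borel_measurable M" and i: "\<And>n. integrable M (Y n)" and le: "\<And>n w. (cmod (Z w))\<^sup>2 \<le> Y n w"
    and b: "\<And>n. expectation (Y n) \<le> c n" and c: "c \<longlonglongrightarrow> 0"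
  shows "AE w in M. Z w = 0"
proof -
  have iz: "integrable M (\<lambda>w. (cmod (Z w))\<^sup>2)"
    by (rule Bochner_Integration.integrable_bound[OF i[of 0]]) (use le[of _ 0] in \<open>auto intro!: AE_I2 order_trans[OF le[of _ 0] abs_ge_self]\<close>)
  have "expectation (\<lambda>w. (cmod (Z w))\<^sup>2) \<le> c n" for n
    by (rule order_trans[OF integral_mono[OF iz i le] b])
  then have "expectation (\<lambda>w. (cmod (Z w))\<^sup>2) \<le> 0" by (intro LIMSEQ_le_const[OF c]) auto
  moreover have "0 \<le> expectation (\<lambda>w. (cmod (Z w))\<^sup>2)" by (rule integral_nonneg_AE) auto
  ultimately have "expectation (\<lambda>w. (cmod (Z w))\<^sup>2) = 0" by simp
  then have "AE w in M. (cmod (Z w))\<^sup>2 = 0" using integral_nonneg_eq_0_iff_AE[OF iz] by simp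
  then show ?thesis by simp
qed

text \<open>The three limits run along different subsequences, as \<open>rsub\<close> depends on the
  coefficients, so they cannot be added path by path. They are compared in mean square through
  partial sums of the same length, for which the identity is exact.\<close>

lemma W_lincomb:
  assumes a: "ell2 a" and b: "ell2 b"
  shows "AE w in M. W (\<lambda>j. c * a j + d * b j) w = c * W a w + d * W b w"
proof -
  let ?e = "\<lambda>j. c * a j + d * b j"
  have e: "ell2 ?e" by (rule ell2_lincomb[OF a b])
  have p: "psum ?e n w = c * psum a n w + d * psum b n w" for n w
    by (simp add: psum_def sum.distrib sum_distrib_left algebra_simps)
  let ?Y = "\<lambda>n w. 2 * (cmod (W ?e w - psum ?e n w))\<^sup>2 + 2 * (2 * (cmod c)\<^sup>2 * (cmod (W a w - psum a n w))\<^sup>2 + 2 * (cmod d)\<^sup>2 * (cmod (W b w - psum b n w))\<^sup>2)"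
  have "AE w in M. W ?e w - (c * W a w + d * W b w) = 0"
  proof (rule AE_zero_of_small[where Y="?Y"])
    show "integrable M (?Y n)" for n
      by (intro Bochner_Integration.integrable_add integrable_mult_right W_limit a b e)
    show "(cmod (W ?e w - (c * W a w + d * W b w)))\<^sup>2 \<le> ?Y n w" for n w
    proof -
      have "W ?e w - (c * W a w + d * W b w) = (W ?e w - psum ?e n w) + (c * (- (W a w - psum a n w)) + d * (- (W b w - psum b n w)))"
        by (simp add: p algebra_simps)
      then have "(cmod (W ?e w - (c * W a w + d * W b w)))\<^sup>2 \<le> 2 * (cmod (W ?e w - psum ?e n w))\<^sup>2 + 2 * (cmod (c * (- (W a w - psum a n w)) + d * (- (W b w - psum b n w))))\<^sup>2"
        by (simp only: cmod_add_sq_le)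
      also have "\<dots> \<le> 2 * (cmod (W ?e w - psum ?e n w))\<^sup>2 + 2 * (2 * (cmod (c * (- (W a w - psum a n w))))\<^sup>2 + 2 * (cmod (d * (- (W b w - psum b n w))))\<^sup>2)"
        by (intro add_left_mono mult_left_mono cmod_add_sq_le) auto
      also have "\<dots> = ?Y n w" by (simp only: norm_mult norm_minus_cancel power_mult_distrib mult.assoc)
      finally show ?thesis .
    qed
    show "expectation (?Y n) \<le> 2 * tail ?e n + 2 * (2 * (cmod c)\<^sup>2 * tail a n + 2 * (cmod d)\<^sup>2 * tail b n)" for n
    proof -
      have "expectation (?Y n) = 2 * expectation (\<lambda>w. (cmod (W ?e w - psum ?e n w))\<^sup>2)
        + 2 * (2 * (cmod c)\<^sup>2 * expectation (\<lambda>w. (cmod (W a w - psum a n w))\<^sup>2) + 2 * (cmod d)\<^sup>2 * expectation (\<lambda>w. (cmod (W b w - psum b n w))\<^sup>2))"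
        using W_limit(2)[OF a, of n] W_limit(2)[OF b, of n] W_limit(2)[OF e, of n] by simp
      also have "\<dots> \<le> 2 * tail ?e n + 2 * (2 * (cmod c)\<^sup>2 * tail a n + 2 * (cmod d)\<^sup>2 * tail b n)"
        by (intro add_mono mult_left_mono W_limit a b e) auto
      finally show ?thesis .
    qed
    have "(\<lambda>n. 2 * tail ?e n + 2 * (2 * (cmod c)\<^sup>2 * tail a n + 2 * (cmod d)\<^sup>2 * tail b n)) \<longlonglongrightarrow> 2 * 0 + 2 * (2 * (cmod c)\<^sup>2 * 0 + 2 * (cmod d)\<^sup>2 * 0)"
      by (intro tendsto_intros tail_lim a b e)
    then show "(\<lambda>n. 2 * tail ?e n + 2 * (2 * (cmod c)\<^sup>2 * tail a n + 2 * (cmod d)\<^sup>2 * tail b n)) \<longlonglongrightarrow> 0" by simp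
  qed simp
  then show ?thesis by simp
qed

lemma W_real: assumes a: "ell2 a" and r: "\<And>j. Im (a j) = 0" shows "AE w in M. Im (W a w) = 0"
  using W_limit(1)[OF a]
proof eventually_elim
  case (elim w)
  have "Im (psum a n w) = 0" for n by (simp add: psum_def r)
  then have "(\<lambda>k. 0) \<longlonglongrightarrow> Im (W a w)" using tendsto_Im[OF elim] by simp
  then show ?case by (simp add: LIMSEQ_const_iff)
qed

text \<open>The partial sums have the right second moment, and they approximate \<open>W a\<close>
  in mean square. A weighted Young inequality turns this into convergence of second moments.\<close>

lemma W_norm: assumes a: "ell2 a" shows "expectation (\<lambda>w. (cmod (W a w))\<^sup>2) = (\<Sum>j. (cmod (a j))\<^sup>2)"
proof -
  let ?E = "expectation (\<lambda>w. (cmod (W a w))\<^sup>2)"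
  let ?S = "\<lambda>n. \<Sum>j<n. (cmod (a j))\<^sup>2"
  let ?\<delta> = "\<lambda>n. tail a n"
  \<comment> \<open>The weight must tend to zero, while the tail divided by it must tend to zero
    too: the square root achieves both, and \<open>1 / (n + 1)\<close> keeps it positive when the
    tail vanishes.\<close>
  let ?h = "\<lambda>n. sqrt (tail a n) + inverse (real (Suc n))"
  have iW: "integrable M (\<lambda>w. (cmod (W a w))\<^sup>2)" by (rule W_square_integrable[OF a])
  have iS: "integrable M (\<lambda>w. (cmod (psum a n w))\<^sup>2)" "expectation (\<lambda>w. (cmod (psum a n w))\<^sup>2) = ?S n" for n
    unfolding psum_def using complex_sum_square[of "{..<n}" a] by auto
  have bd: "\<bar>?E - ?S n\<bar> \<le> tail a n + sqrt (tail a n) + ?h n * ?E" for n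
  proof -
    have h: "0 < ?h n" using tail_nonneg[OF a, of n] by (simp add: add_nonneg_pos)
    have pt: "\<bar>x\<^sup>2 - y\<^sup>2\<bar> \<le> d\<^sup>2 + d\<^sup>2 / ?h n + ?h n * x\<^sup>2" if "\<bar>x - y\<bar> \<le> d" "0 \<le> x" for x y d :: real
    proof -
      have d: "0 \<le> d" using that by linarith
      have "\<bar>x\<^sup>2 - y\<^sup>2\<bar> = \<bar>x - y\<bar> * \<bar>x + y\<bar>" by (simp add: power2_eq_square abs_mult[symmetric] algebra_simps)
      also have "\<dots> \<le> d * (2 * x + d)"
        using that d by (intro mult_mono) auto
      also have "\<dots> = d\<^sup>2 + 2 * d * x" by (simp add: power2_eq_square algebra_simps)
      also have "2 * d * x \<le> d\<^sup>2 / ?h n + ?h n * x\<^sup>2"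
      proof -
        have "0 \<le> (d - ?h n * x)\<^sup>2 / ?h n" using h by (intro divide_nonneg_pos) auto
        also have "\<dots> = d\<^sup>2 / ?h n + ?h n * x\<^sup>2 - 2 * d * x"
        proof -
          have gen: "(d - q * x)\<^sup>2 / q = d\<^sup>2 / q + q * x\<^sup>2 - 2 * d * x" if "q \<noteq> 0" for q :: real
            using that by (simp add: power2_diff field_simps power2_eq_square)
          show ?thesis by (rule gen) (use h in simp)
        qed
        finally show ?thesis by simp
      qed
      finally show ?thesis by simp
    qed
    have "\<bar>?E - ?S n\<bar> = \<bar>expectation (\<lambda>w. (cmod (W a w))\<^sup>2 - (cmod (psum a n w))\<^sup>2)\<bar>"
      using iW iS[of n] by simp
    also have "\<dots> \<le> expectation (\<lambda>w. \<bar>(cmod (W a w))\<^sup>2 - (cmod (psum a n w))\<^sup>2\<bar>)"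
      by (rule integral_abs_bound)
    also have "\<dots> \<le> expectation (\<lambda>w. (cmod (W a w - psum a n w))\<^sup>2 + (cmod (W a w - psum a n w))\<^sup>2 / ?h n + ?h n * (cmod (W a w))\<^sup>2)"
    proof (rule integral_mono)
      show "integrable M (\<lambda>w. \<bar>(cmod (W a w))\<^sup>2 - (cmod (psum a n w))\<^sup>2\<bar>)" using iW iS by simp
      show "integrable M (\<lambda>w. (cmod (W a w - psum a n w))\<^sup>2 + (cmod (W a w - psum a n w))\<^sup>2 / ?h n + ?h n * (cmod (W a w))\<^sup>2)"
        by (intro Bochner_Integration.integrable_add integrable_divide integrable_mult_right W_limit a iW)
      show "\<bar>(cmod (W a w))\<^sup>2 - (cmod (psum a n w))\<^sup>2\<bar> \<le> (cmod (W a w - psum a n w))\<^sup>2 + (cmod (W a w - psum a n w))\<^sup>2 / ?h n + ?h n * (cmod (W a w))\<^sup>2" for w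
        by (rule pt) (auto intro: norm_triangle_ineq3)
    qed
    also have "\<dots> = expectation (\<lambda>w. (cmod (W a w - psum a n w))\<^sup>2) + expectation (\<lambda>w. (cmod (W a w - psum a n w))\<^sup>2) / ?h n + ?h n * ?E"
      using W_limit(2)[OF a, of n] iW by simp
    also have "\<dots> \<le> tail a n + tail a n / ?h n + ?h n * ?E"
      using h W_limit(3)[OF a, of n] by (intro add_mono divide_right_mono) auto
    also have "tail a n / ?h n \<le> sqrt (tail a n)"
    proof -
      have "tail a n = sqrt (tail a n) * sqrt (tail a n)" using tail_nonneg[OF a, of n] by simp
      also have "\<dots> \<le> sqrt (tail a n) * ?h n" using tail_nonneg[OF a, of n] by (intro mult_left_mono) auto
      finally show ?thesis using h by (simp add: divide_le_eq)
    qed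
    finally show ?thesis by simp
  qed
  have "(\<lambda>n. tail a n + sqrt (tail a n) + ?h n * ?E) \<longlonglongrightarrow> 0 + sqrt 0 + (sqrt 0 + 0) * ?E"
    by (intro tendsto_intros tail_lim a LIMSEQ_inverse_real_of_nat)
  then have l: "(\<lambda>n. tail a n + sqrt (tail a n) + ?h n * ?E) \<longlonglongrightarrow> 0" by simp
  have "(\<lambda>n. ?E - ?S n) \<longlonglongrightarrow> 0"
    by (rule Lim_null_comparison[OF always_eventually l]) (intro allI, simp only: real_norm_def, rule bd)
  then have "(\<lambda>n. ?E - (?E - ?S n)) \<longlonglongrightarrow> ?E - 0" by (intro tendsto_diff tendsto_const)
  then have "(\<lambda>j. (cmod (a j))\<^sup>2) sums ?E" by (simp add: sums_def)
  then show ?thesis by (rule sums_unique)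
qed

lemma char_real_sum: "char (distr M borel (\<lambda>w. \<Sum>j<n. d j * \<xi> j w)) t = of_real (exp (- (t\<^sup>2 * (\<Sum>j<n. (d j)\<^sup>2) / 2)))"
proof -
  have "indep_vars (\<lambda>_. borel) (\<lambda>j w. d j * \<xi> j w) {..<n}"
    by (rule indep_vars_compose2[OF indep_vars_subset[OF indep]]) auto
  from char_distr_sum[OF this, of t]
  have "char (distr M borel (\<lambda>w. \<Sum>j<n. d j * \<xi> j w)) t = (\<Prod>j<n. char (distr M borel (\<lambda>w. d j * \<xi> j w)) t)" .
  also have "\<dots> = (\<Prod>j<n. of_real (exp (- ((t * d j)\<^sup>2 / 2))))"
  proof (rule prod.cong[OF refl])
    fix j
    have "distr M borel (\<xi> j) = std_normal_distribution"
      using distributed_distr_eq_density[OF normal, of j] by (simp cong: distr_cong)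
    then have "char (distr M borel (\<xi> j)) (t * d j) = of_real (exp (- ((t * d j)\<^sup>2 / 2)))"
      by (simp add: char_std_normal_distribution)
    then show "char (distr M borel (\<lambda>w. d j * \<xi> j w)) t = of_real (exp (- ((t * d j)\<^sup>2 / 2)))"
      unfolding char_def by (simp add: integral_distr mult.assoc)
  qed
  also have "\<dots> = of_real (exp (\<Sum>j<n. - ((t * d j)\<^sup>2 / 2)))" by (simp add: exp_sum)
  also have "(\<Sum>j<n. - ((t * d j)\<^sup>2 / 2)) = - (t\<^sup>2 * (\<Sum>j<n. (d j)\<^sup>2) / 2)"
    by (simp add: sum_negf sum_distrib_left sum_divide_distrib power_mult_distrib)
  finally show ?thesis .
qed

text \<open>As the variables are real, the real part of \<open>W a\<close> is the series with
  coefficients \<open>Re (a j)\<close>. The characteristic functions of its partial sums converge to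
  a Gaussian one, and Levy's uniqueness theorem identifies the law after scaling to unit variance.
  Zero variance is the degenerate case of \<open>centered_normal\<close>.\<close>

theorem W_gaussian: assumes a: "ell2 a" shows "centered_normal M (\<lambda>w. Re (W a w))"
proof -
  define d where "d j = Re (a j)" for j
  let ?X = "\<lambda>w. Re (W a w)"
  have sd: "summable (\<lambda>j. (d j)\<^sup>2)"
    by (rule summable_comparison_test'[OF a[unfolded ell2_def]]) (simp add: d_def cmod_power2)
  define v where "v = (\<Sum>j. (d j)\<^sup>2)"
  have v0: "0 \<le> v" unfolding v_def by (rule suminf_nonneg[OF sd]) simp
  have ch: "char (distr M borel ?X) t = of_real (exp (- (t\<^sup>2 * v / 2)))" for t
  proof -
    have "(\<lambda>k. char (distr M borel (\<lambda>w. \<Sum>j<rsub a k. d j * \<xi> j w)) t) \<longlonglongrightarrow> char (distr M borel ?X) t"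
    proof -
      have "(\<lambda>k. expectation (\<lambda>w. iexp (t * (\<Sum>j<rsub a k. d j * \<xi> j w)))) \<longlonglongrightarrow> expectation (\<lambda>w. iexp (t * ?X w))"
      proof (rule integral_dominated_convergence[where w="\<lambda>_. 1"])
        show "AE w in M. (\<lambda>k. iexp (t * (\<Sum>j<rsub a k. d j * \<xi> j w))) \<longlonglongrightarrow> iexp (t * ?X w)"
          using W_limit(1)[OF a]
        proof eventually_elim
          case (elim w)
          have "Re (psum a n w) = (\<Sum>j<n. d j * \<xi> j w)" for n by (simp add: psum_def d_def)
          then have "(\<lambda>k. \<Sum>j<rsub a k. d j * \<xi> j w) \<longlonglongrightarrow> ?X w" using tendsto_Re[OF elim] by simp
          then show ?case by (intro tendsto_intros)
        qed
      qed auto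
      then show ?thesis unfolding char_def by (simp add: integral_distr)
    qed
    moreover have "(\<lambda>k. char (distr M borel (\<lambda>w. \<Sum>j<rsub a k. d j * \<xi> j w)) t) \<longlonglongrightarrow> of_real (exp (- (t\<^sup>2 * v / 2)))"
    proof -
      have "(\<lambda>k. \<Sum>j<rsub a k. (d j)\<^sup>2) \<longlonglongrightarrow> v"
        using LIMSEQ_subseq_LIMSEQ[OF summable_LIMSEQ[OF sd] rsub(1)[OF a]] by (simp add: v_def comp_def)
      then show ?thesis unfolding char_real_sum by (intro tendsto_intros) auto
    qed
    ultimately show ?thesis by (rule LIMSEQ_unique)
  qed
  show ?thesis
  proof (cases "v = 0")
    case True
    then have d0: "d j = 0" for j using suminf_eq_zero_iff[OF sd] by (simp add: v_def)
    have "AE w in M. ?X w = 0" using W_limit(1)[OF a]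
    proof eventually_elim
      case (elim w)
      have "Re (psum a n w) = 0" for n using d0 by (simp add: psum_def d_def)
      then have "(\<lambda>k. 0) \<longlonglongrightarrow> ?X w" using tendsto_Re[OF elim] by simp
      then show ?case by (simp add: LIMSEQ_const_iff)
    qed
    then show ?thesis by (simp add: centered_normal_def)
  next
    case False
    define s where "s = sqrt v"
    have s: "0 < s" "s\<^sup>2 = v" using False v0 by (auto simp: s_def)
    have "distr M borel (\<lambda>w. ?X w / s) = std_normal_distribution"
    proof (rule Levy_uniqueness)
      show "real_distribution (distr M borel (\<lambda>w. ?X w / s))" by simp
      show "real_distribution std_normal_distribution" by (rule real_dist_normal_dist)
      have "char (distr M borel (\<lambda>w. ?X w / s)) t = char std_normal_distribution t" for t
      proof -
        have "char (distr M borel (\<lambda>w. ?X w / s)) t = char (distr M borel ?X) (t / s)"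
          unfolding char_def by (simp add: integral_distr)
        also have "\<dots> = of_real (exp (- (t\<^sup>2 / 2)))" using s False by (simp add: ch power_divide)
        finally show ?thesis by (simp add: char_std_normal_distribution)
      qed
      then show "char (distr M borel (\<lambda>w. ?X w / s)) = char std_normal_distribution" by blast
    qed
    then have "distributed M lborel (\<lambda>w. (?X w - 0) / s) std_normal_density"
      unfolding distributed_def by (auto cong: distr_cong)
    then have "distributed M lborel ?X (normal_density 0 s)"
      using normal_standard_normal_convert[OF s(1), of ?X 0] by simp
    then show ?thesis using s by (auto simp: centered_normal_def)
  qed
qed

end

section \<open>Weak solutions of the mode equation\<close>

lemma integrable_cmod_lincomb_sq:
  fixes X Y :: "'a \<Rightarrow> complex"
  assumes [measurable]: "X \<in> borel_measurable N" "Y \<in> borel_measurable N"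
    and i: "integrable N (\<lambda>w. (cmod (X w))\<^sup>2)" "integrable N (\<lambda>w. (cmod (Y w))\<^sup>2)"
  shows "integrable N (\<lambda>w. (cmod (1 * X w + c * Y w))\<^sup>2)"
proof (rule Bochner_Integration.integrable_bound)
  show "integrable N (\<lambda>w. 2 * (cmod (X w))\<^sup>2 + 2 * ((cmod c)\<^sup>2 * (cmod (Y w))\<^sup>2))" using i by simp
  show "AE w in N. norm ((cmod (1 * X w + c * Y w))\<^sup>2) \<le> norm (2 * (cmod (X w))\<^sup>2 + 2 * ((cmod c)\<^sup>2 * (cmod (Y w))\<^sup>2))"
  proof (rule AE_I2)
    fix w
    have "(cmod (1 * X w + c * Y w))\<^sup>2 \<le> 2 * (cmod (X w))\<^sup>2 + 2 * ((cmod c)\<^sup>2 * (cmod (Y w))\<^sup>2)"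
      using cmod_add_sq_le[of "1 * X w" "c * Y w"] by (simp add: norm_mult power_mult_distrib)
    then show "norm ((cmod (1 * X w + c * Y w))\<^sup>2) \<le> norm (2 * (cmod (X w))\<^sup>2 + 2 * ((cmod c)\<^sup>2 * (cmod (Y w))\<^sup>2))" by simp
  qed
qed measurable

text \<open>Reduces inner products to norms of linear combinations. Applied on both sides of an
  isometry, it makes linearity and norm preservation enough for the covariance identity.\<close>

lemma integral_polarization:
  fixes X Y :: "'a \<Rightarrow> complex"
  assumes "X \<in> borel_measurable N" "Y \<in> borel_measurable N"
    and "integrable N (\<lambda>w. (cmod (X w))\<^sup>2)" "integrable N (\<lambda>w. (cmod (Y w))\<^sup>2)"
  defines "I \<equiv> \<lambda>c. complex_of_real (\<integral>w. (cmod (1 * X w + c * Y w))\<^sup>2 \<partial>N)"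
  shows "(\<integral>w. X w * cnj (Y w) \<partial>N) = (I 1 - I (-1) + \<i> * I \<i> - \<i> * I (- \<i>)) / 4"
proof -
  note ii = integrable_cmod_lincomb_sq[OF assms(1-4)]
  let ?q = "\<lambda>c w. complex_of_real ((cmod (1 * X w + c * Y w))\<^sup>2)"
  have iq: "integrable N (?q c)" for c by (rule integrable_of_real[OF ii])
  have Iq: "(\<integral>w. ?q c w \<partial>N) = I c" for c unfolding I_def by (rule integral_of_real[OF ii])
  have p: "X w * cnj (Y w) = (?q 1 w - ?q (-1) w + \<i> * ?q \<i> w - \<i> * ?q (- \<i>) w) / 4" for w
    unfolding cmod_power2 by (simp add: complex_eq_iff) (simp add: power2_eq_square algebra_simps)
  have "(\<integral>w. X w * cnj (Y w) \<partial>N) = (\<integral>w. ?q 1 w - ?q (-1) w + \<i> * ?q \<i> w - \<i> * ?q (- \<i>) w \<partial>N) / 4"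
    unfolding p by (simp only: integral_divide_zero)
  also have "(\<integral>w. ?q 1 w - ?q (-1) w + \<i> * ?q \<i> w - \<i> * ?q (- \<i>) w \<partial>N) = I 1 - I (-1) + \<i> * I \<i> - \<i> * I (- \<i>)"
    by (simp only: Bochner_Integration.integral_diff Bochner_Integration.integral_add Bochner_Integration.integrable_add
        Bochner_Integration.integrable_diff integrable_mult_right integral_mult_right_zero iq Iq)
  finally show ?thesis .
qed

lemma (in prob_space) centered_normal_cong_AE:
  assumes "centered_normal M X" "AE w in M. X w = Y w" and [measurable]: "Y \<in> borel_measurable M"
  shows "centered_normal M Y"
proof -
  have [measurable]: "X \<in> borel_measurable M" using assms(1) by (simp add: centered_normal_def)
  have d: "distr M lborel X = distr M lborel Y"
    by (rule distr_cong_AE) (use assms(2) in auto)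
  consider "AE w in M. X w = 0" | s where "s > 0" "distributed M lborel X (normal_density 0 s)"
    using assms(1) by (auto simp: centered_normal_def)
  then show ?thesis
  proof cases
    case 1
    then have "AE w in M. Y w = 0" using assms(2) by eventually_elim simp
    then show ?thesis by (simp add: centered_normal_def)
  next
    case 2
    then have "distributed M lborel Y (normal_density 0 s)"
      unfolding distributed_def d by simp
    then show ?thesis using 2 by (auto simp: centered_normal_def)
  qed
qed

definition rep :: "real measure \<Rightarrow> distribution \<Rightarrow> real \<Rightarrow> complex" where
  "rep \<nu> f = (SOME g. is_function (fourier_distribution f) g \<and> integrable \<nu> (\<lambda>y. (cmod (g y))\<^sup>2))"

lemma rep: assumes "f \<in> op_dom \<nu>"
  shows "is_function (fourier_distribution f) (rep \<nu> f)" "integrable \<nu> (\<lambda>y. (cmod (rep \<nu> f y))\<^sup>2)"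
  using someI_ex[of "\<lambda>g. is_function (fourier_distribution f) g \<and> integrable \<nu> (\<lambda>y. (cmod (g y))\<^sup>2)"] assms
  by (auto simp: op_dom_def rep_def)

lemma fourier_distribution_lincomb:
  "fourier_distribution (\<lambda>\<phi>. a * f1 \<phi> + b * f2 \<phi>) = (\<lambda>\<phi>. a * fourier_distribution f1 \<phi> + b * fourier_distribution f2 \<phi>)"
  by (auto simp: fourier_distribution_def fun_eq_iff)

lemma is_function_unique_nu:
  assumes "is_function T g" "is_function T h" "absolutely_continuous lborel \<nu>" "sets \<nu> = sets borel"
  shows "AE x in \<nu>. g x = h x"
  using absolutely_continuous_AE[OF _ assms(3) is_function_unique[OF assms(1,2)]] assms(4) by simp

section \<open>The isonormal operator of a symmetric spectral measure\<close>

locale gaussian_model = S?: symmetric_borel_measure \<nu> + N?: iid_normals M \<xi>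
  for \<nu> :: "real measure" and M :: "'w measure" and \<xi> :: "nat \<Rightarrow> 'w \<Rightarrow> real" +
  assumes ac: "absolutely_continuous lborel \<nu>"
begin

definition V :: "distribution \<Rightarrow> 'w \<Rightarrow> complex" where
  "V f w = W (coef (rep \<nu> f)) w"

lemma csqi_rep: "f \<in> op_dom \<nu> \<Longrightarrow> csqi (rep \<nu> f)"
  using rep[of f \<nu>] by (simp add: csqi_def is_function_def)

lemma ell2_coef: "csqi g \<Longrightarrow> ell2 (coef g)"
  unfolding ell2_def using coef_parseval by (rule sums_summable)

lemma V_eq:
  assumes "f \<in> op_dom \<nu>" "is_function (fourier_distribution f) g"
  shows "csqi g" "coef (rep \<nu> f) = coef g"
proof -
  have e: "AE y in \<nu>. rep \<nu> f y = g y"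
    by (rule is_function_unique_nu[OF rep(1)[OF assms(1)] assms(2) ac sets_nu])
  have gm: "g \<in> borel_measurable borel" using assms(2) by (simp add: is_function_def)
  have rm: "rep \<nu> f \<in> borel_measurable borel" using csqi_rep[OF assms(1)] by (simp add: csqi_def)
  have "integrable \<nu> (\<lambda>y. (cmod (g y))\<^sup>2) \<longleftrightarrow> integrable \<nu> (\<lambda>y. (cmod (rep \<nu> f y))\<^sup>2)"
    by (rule integrable_cong_AE) (use e gm rm in auto)
  then show g: "csqi g" using gm rep(2)[OF assms(1)] by (simp add: csqi_def)
  show "coef (rep \<nu> f) = coef g" by (rule coef_cong_AE[OF e csqi_rep[OF assms(1)] g])
qed

lemma W_coef_norm: assumes "csqi g" shows "expectation (\<lambda>w. (cmod (W (coef g) w))\<^sup>2) = (\<integral>y. (cmod (g y))\<^sup>2 \<partial>\<nu>)"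
  using W_norm[OF ell2_coef[OF assms]] sums_unique[OF coef_parseval[OF assms]] by simp

lemma W_coef_lincomb: assumes "csqi f" "csqi g"
  shows "AE w in M. W (coef (\<lambda>y. a * f y + b * g y)) w = a * W (coef f) w + b * W (coef g) w"
proof -
  have "coef (\<lambda>y. a * f y + b * g y) = (\<lambda>j. a * coef f j + b * coef g j)"
    using coef_lincomb[OF assms] by blast
  then show ?thesis using W_lincomb[OF ell2_coef[OF assms(1)] ell2_coef[OF assms(2)], of a b] by simp
qed

lemma W_coef_inner: assumes f: "csqi f" and g: "csqi g"
  shows "(\<integral>w. W (coef f) w * cnj (W (coef g) w) \<partial>M) = (\<integral>y. f y * cnj (g y) \<partial>\<nu>)"
proof -
  have fm: "f \<in> borel_measurable \<nu>" "g \<in> borel_measurable \<nu>" "integrable \<nu> (\<lambda>y. (cmod (f y))\<^sup>2)" "integrable \<nu> (\<lambda>y. (cmod (g y))\<^sup>2)"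
    using f g by (auto simp: csqi_def)
  have n: "(\<integral>w. (cmod (1 * W (coef f) w + c * W (coef g) w))\<^sup>2 \<partial>M) = (\<integral>y. (cmod (1 * f y + c * g y))\<^sup>2 \<partial>\<nu>)" for c
  proof -
    have "(\<integral>w. (cmod (1 * W (coef f) w + c * W (coef g) w))\<^sup>2 \<partial>M) = (\<integral>w. (cmod (W (coef (\<lambda>y. 1 * f y + c * g y)) w))\<^sup>2 \<partial>M)"
    proof (rule integral_cong_AE)
      show "AE w in M. (cmod (1 * W (coef f) w + c * W (coef g) w))\<^sup>2 = (cmod (W (coef (\<lambda>y. 1 * f y + c * g y)) w))\<^sup>2"
        using W_coef_lincomb[OF f g, of 1 c] by eventually_elim simp
    qed measurable
    also have "\<dots> = (\<integral>y. (cmod (1 * f y + c * g y))\<^sup>2 \<partial>\<nu>)" by (rule W_coef_norm[OF csqi_lincomb[OF f g]])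
    finally show ?thesis .
  qed
  have "W (coef f) \<in> borel_measurable M" "W (coef g) \<in> borel_measurable M" by measurable
  from integral_polarization[OF this W_square_integrable[OF ell2_coef[OF f]] W_square_integrable[OF ell2_coef[OF g]]]
  show ?thesis unfolding n integral_polarization[OF fm] .
qed

text \<open>By induction every finite complex combination agrees almost surely with one
  \<open>W b\<close>, whose real part is normal.\<close>

lemma V_gaussian: "centered_gaussian M (op_dom \<nu>) V"
  unfolding centered_gaussian_def
proof (intro allI impI)
  fix J and c :: "distribution \<Rightarrow> complex" assume J: "finite J" "J \<subseteq> op_dom \<nu>"
  have "\<exists>b. ell2 b \<and> (AE w in M. (\<Sum>i\<in>J. c i * V i w) = W b w)"
    using J
  proof (induction J rule: finite_induct)
    case empty
    have z: "ell2 (\<lambda>_. 0)" by (simp add: ell2_def)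
    have "AE w in M. W (\<lambda>j. 0 * 0 + 0 * 0) w = 0 * W (\<lambda>_. 0) w + 0 * W (\<lambda>_. 0) w" by (rule W_lincomb[OF z z])
    then have "AE w in M. (\<Sum>i\<in>{}. c i * V i w) = W (\<lambda>_. 0) w" by eventually_elim simp
    then show ?case using z by blast
  next
    case (insert f J)
    then obtain b where b: "ell2 b" "AE w in M. (\<Sum>i\<in>J. c i * V i w) = W b w" by auto
    have f: "ell2 (coef (rep \<nu> f))" using insert.prems by (intro ell2_coef csqi_rep) auto
    have "AE w in M. W (\<lambda>j. c f * coef (rep \<nu> f) j + 1 * b j) w = c f * W (coef (rep \<nu> f)) w + 1 * W b w"
      by (rule W_lincomb[OF f b(1)])
    then have "AE w in M. (\<Sum>i\<in>insert f J. c i * V i w) = W (\<lambda>j. c f * coef (rep \<nu> f) j + 1 * b j) w"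
      using b(2) by eventually_elim (use insert.hyps in \<open>simp add: V_def\<close>)
    then show ?case using ell2_lincomb[OF f b(1)] by blast
  qed
  then obtain b where b: "ell2 b" "AE w in M. (\<Sum>i\<in>J. c i * V i w) = W b w" by blast
  show "centered_normal M (\<lambda>w. \<Sum>i\<in>J. Re (c i * V i w))"
  proof (rule centered_normal_cong_AE[OF W_gaussian[OF b(1)]])
    show "AE w in M. Re (W b w) = (\<Sum>i\<in>J. Re (c i * V i w))"
      using b(2) by eventually_elim (metis Re_sum)
    have "(\<lambda>w. Re (c i * V i w)) \<in> borel_measurable M" for i
      unfolding V_def by measurable
    then show "(\<lambda>w. \<Sum>i\<in>J. Re (c i * V i w)) \<in> borel_measurable M" by simp
  qed
qed

theorem associated_operator_V: "associated_operator M \<nu> V"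
  unfolding associated_operator_def
proof (intro conjI ballI allI impI)
  \<comment> \<open>The measure is finite, so the exponent zero already witnesses moderate
    growth.\<close>
  have "(\<integral>\<^sup>+x. ennreal ((1 + x\<^sup>2) powi (- 0)) \<partial>\<nu>) < \<infinity>"
    using S.emeasure_finite[of "space \<nu>"] by (simp add: less_top[symmetric])
  then show "spectral_measure \<nu>" using sets_nu ac unfolding spectral_measure_def by blast
next
  fix f assume f: "f \<in> op_dom \<nu>"
  show "V f \<in> borel_measurable M" unfolding V_def[abs_def] by measurable
  show "integrable M (\<lambda>w. (cmod (V f w))\<^sup>2)"
    unfolding V_def by (intro W_square_integrable ell2_coef csqi_rep f)
next
  fix f1 f2 and a b :: complex assume f1: "f1 \<in> op_dom \<nu>" and f2: "f2 \<in> op_dom \<nu>"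
  let ?f = "\<lambda>\<phi>. a * f1 \<phi> + b * f2 \<phi>"
  let ?g = "\<lambda>y. a * rep \<nu> f1 y + b * rep \<nu> f2 y"
  have isf: "is_function (fourier_distribution ?f) ?g"
    unfolding fourier_distribution_lincomb by (intro is_function_lincomb rep f1 f2)
  have cg: "csqi ?g" by (intro csqi_lincomb csqi_rep f1 f2)
  \<comment> \<open>The representative chosen for the combination agrees with \<open>?g\<close> only
    almost everywhere. The coefficients cannot see the difference, by
    \<open>coef_cong_AE\<close>.\<close>
  have ex: "is_function (fourier_distribution ?f) (rep \<nu> ?f) \<and> integrable \<nu> (\<lambda>y. (cmod (rep \<nu> ?f y))\<^sup>2)"
    unfolding rep_def by (rule someI[where x="?g"]) (use isf cg in \<open>auto simp: csqi_def\<close>)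
  have "coef (rep \<nu> ?f) = coef ?g"
  proof (rule coef_cong_AE)
    show "AE y in \<nu>. rep \<nu> ?f y = ?g y" by (rule is_function_unique_nu[OF _ isf ac sets_nu]) (use ex in blast)
    show "csqi (rep \<nu> ?f)" using ex by (simp add: csqi_def is_function_def)
  qed (rule cg)
  then show "AE w in M. V ?f w = a * V f1 w + b * V f2 w"
    unfolding V_def using W_coef_lincomb[OF csqi_rep[OF f1] csqi_rep[OF f2], of a b] by simp
next
  fix f1 f2 g1 g2 assume f1: "f1 \<in> op_dom \<nu>" and f2: "f2 \<in> op_dom \<nu>"
    and g1: "is_function (fourier_distribution f1) g1" and g2: "is_function (fourier_distribution f2) g2"
  show "(\<integral>w. V f1 w * cnj (V f2 w) \<partial>M) = (\<integral>y. g1 y * cnj (g2 y) \<partial>\<nu>)"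
    unfolding V_def V_eq(2)[OF f1 g1] V_eq(2)[OF f2 g2] by (rule W_coef_inner[OF V_eq(1)[OF f1 g1] V_eq(1)[OF f2 g2]])
next
  show "centered_gaussian M (op_dom \<nu>) V" by (rule V_gaussian)
next
  fix t assume t: "dirac t \<in> op_dom \<nu>"
  note e = V_eq[OF t is_function_dirac]
  show "AE w in M. Im (V (dirac t) w) = 0"
    unfolding V_def e(2) by (rule W_real[OF ell2_coef[OF e(1)]], rule coef_hermitian) (simp add: exp_cnj)
qed

end

lemma measurable_cnj [measurable]: "cnj \<in> borel_measurable borel"
  by (intro borel_measurable_continuous_onI continuous_intros)

context convex_kernel
begin

section \<open>The spectral measure of the mode equation and existence of a weak solution\<close>

definition nuK :: "real \<Rightarrow> real \<Rightarrow> real measure" where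
  "nuK a l = density lborel (\<lambda>\<omega>. ennreal (l\<^sup>2 * (kappa \<omega> / (cmod (msym a \<omega>))\<^sup>2)))"

lemma sets_nuK: "sets (nuK a l) = sets borel" by (simp add: nuK_def)

lemma emeasure_nuK: assumes "0 < a" shows "emeasure (nuK a l) UNIV = ennreal (l\<^sup>2 / a)"
proof -
  have "emeasure (nuK a l) UNIV = (\<integral>\<^sup>+\<omega>. ennreal (l\<^sup>2) * ennreal (kappa \<omega> / (cmod (msym a \<omega>))\<^sup>2) \<partial>lborel)"
    unfolding nuK_def by (subst emeasure_density) (auto simp: ennreal_mult[symmetric] kappa_nonneg simp del: times_divide_eq_right)
  also have "\<dots> = ennreal (l\<^sup>2) * ennreal (1 / a)"
    by (subst nn_integral_cmult) (auto simp: nn_integral_spectral_density[OF assms])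
  finally show ?thesis using assms by (simp add: ennreal_mult[symmetric])
qed

lemma symmetric_nuK: assumes "0 < a" shows "symmetric_borel_measure (nuK a l)"
proof (intro symmetric_borel_measure.intro finite_line_measure.intro finite_line_measure_axioms.intro
    symmetric_borel_measure_axioms.intro)
  show "finite_measure (nuK a l)"
    by (rule finite_measureI) (use emeasure_nuK[OF assms, of l] in \<open>simp add: nuK_def\<close>)
  show "sets (nuK a l) = sets borel" by (rule sets_nuK)
  show "distr (nuK a l) borel uminus = nuK a l"
  proof (rule measure_eqI)
    show "sets (distr (nuK a l) borel uminus) = sets (nuK a l)" by (simp add: sets_nuK)
    fix A assume "A \<in> sets (distr (nuK a l) borel uminus)"
    then have A [measurable]: "A \<in> sets borel" by simp
    let ?r = "\<lambda>\<omega>. l\<^sup>2 * (kappa \<omega> / (cmod (msym a \<omega>))\<^sup>2)"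
    have r: "?r (- \<omega>) = ?r \<omega>" for \<omega> by (simp add: kappa_minus msym_minus)
    have mu: "uminus \<in> measurable (nuK a l) borel" by (simp add: nuK_def)
    have mA: "uminus -` A \<in> sets (borel :: real measure)"
      using measurable_sets[of "uminus :: real \<Rightarrow> real" borel borel A] by simp
    have "emeasure (distr (nuK a l) borel uminus) A = emeasure (nuK a l) (uminus -` A)"
      by (subst emeasure_distr[OF mu A]) (simp add: nuK_def)
    also have "\<dots> = (\<integral>\<^sup>+\<omega>. ennreal (?r \<omega>) * indicator (uminus -` A) \<omega> \<partial>lborel)"
      unfolding nuK_def by (subst emeasure_density) (use mA in auto)
    also have "\<dots> = (\<integral>\<^sup>+\<omega>. ennreal (?r (- \<omega>)) * indicator (uminus -` A) (- \<omega>) \<partial>lborel)"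
      by (subst nn_integral_real_affine[where c="-1" and t=0]) (use mA in auto)
    also have "\<dots> = (\<integral>\<^sup>+\<omega>. ennreal (?r \<omega>) * indicator A \<omega> \<partial>lborel)"
      unfolding r by (intro nn_integral_cong) (simp add: indicator_def)
    also have "\<dots> = emeasure (nuK a l) A" unfolding nuK_def by (subst emeasure_density) auto
    finally show "emeasure (distr (nuK a l) borel uminus) A = emeasure (nuK a l) A" .
  qed
qed

lemma ac_nuK: "absolutely_continuous lborel (nuK a l)"
  unfolding nuK_def by (rule absolutely_continuousI_density) simp

lemma integrable_nuK:
  fixes f :: "real \<Rightarrow> 'b::{banach, second_countable_topology}"
  assumes "f \<in> borel_measurable borel"
  shows "integrable (nuK a l) f \<longleftrightarrow> integrable lborel (\<lambda>\<omega>. (l\<^sup>2 * (kappa \<omega> / (cmod (msym a \<omega>))\<^sup>2)) *\<^sub>R f \<omega>)"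
    and "(\<integral>\<omega>. f \<omega> \<partial>nuK a l) = (\<integral>\<omega>. (l\<^sup>2 * (kappa \<omega> / (cmod (msym a \<omega>))\<^sup>2)) *\<^sub>R f \<omega> \<partial>lborel)"
proof -
  have n: "AE \<omega> in lborel. 0 \<le> l\<^sup>2 * (kappa \<omega> / (cmod (msym a \<omega>))\<^sup>2)" using kappa_nonneg by (intro AE_I2) simp
  have f: "f \<in> borel_measurable lborel" using assms by simp
  show "integrable (nuK a l) f \<longleftrightarrow> integrable lborel (\<lambda>\<omega>. (l\<^sup>2 * (kappa \<omega> / (cmod (msym a \<omega>))\<^sup>2)) *\<^sub>R f \<omega>)"
    unfolding nuK_def by (rule integrable_density[OF f _ n]) measurable
  show "(\<integral>\<omega>. f \<omega> \<partial>nuK a l) = (\<integral>\<omega>. (l\<^sup>2 * (kappa \<omega> / (cmod (msym a \<omega>))\<^sup>2)) *\<^sub>R f \<omega> \<partial>lborel)"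
    unfolding nuK_def by (rule integral_density[OF f _ n]) measurable
qed

lemma dirac_dom: assumes "0 < a" shows "dirac t \<in> op_dom (nuK a l)"
proof -
  interpret symmetric_borel_measure "nuK a l" by (rule symmetric_nuK[OF assms])
  have "integrable (nuK a l) (\<lambda>y. (cmod (four_exp (t * y)))\<^sup>2)" by simp
  then show ?thesis using tempered_dirac is_function_dirac unfolding op_dom_def by blast
qed

lemma integrable_kappa_fourier:
  assumes "integrable lborel \<phi>"
  shows "integrable lborel (\<lambda>\<omega>. kappa \<omega> * (cmod (fourier \<phi> \<omega>))\<^sup>2)"
proof (rule Bochner_Integration.integrable_bound)
  have [measurable]: "fourier \<phi> \<in> borel_measurable borel"
    using borel_measurable_integrable[OF assms] by (intro fourier_measurable) simp
  let ?N = "\<integral>t. cmod (\<phi> t) \<partial>lborel"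
  show "integrable lborel (\<lambda>\<omega>. kappa \<omega> * ?N\<^sup>2)" using integrable_kappa by simp
  show "AE \<omega> in lborel. norm (kappa \<omega> * (cmod (fourier \<phi> \<omega>))\<^sup>2) \<le> norm (kappa \<omega> * ?N\<^sup>2)"
    using kappa_nonneg by (intro AE_I2) (auto simp: abs_mult intro!: mult_left_mono power_mono norm_fourier_le)
  show "(\<lambda>\<omega>. kappa \<omega> * (cmod (fourier \<phi> \<omega>))\<^sup>2) \<in> borel_measurable lborel" by measurable
qed

text \<open>The square of the symbol cancels against the density and leaves
  \<open>kappa * (cmod (fourier \<phi>))\<^sup>2\<close>. The comparison is an inequality because
  the symbol is zero at the origin.\<close>

lemma adjoint_drift_dom:
  assumes a: "0 < a" and \<phi>: "\<phi> \<in> schwartz_space"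
  shows "adjoint_drift K a \<phi> \<in> op_dom (nuK a l)"
proof -
  have i\<phi>: "integrable lborel \<phi>" by (rule schwartz_integrable[OF \<phi>])
  have [measurable]: "fourier \<phi> \<in> borel_measurable borel"
    using borel_measurable_integrable[OF i\<phi>] by (intro fourier_measurable) simp
  have "integrable (nuK a l) (\<lambda>\<omega>. (cmod (cnj (msym a \<omega>) * fourier \<phi> \<omega>))\<^sup>2)"
  proof (subst integrable_nuK)
    show "integrable lborel (\<lambda>\<omega>. (l\<^sup>2 * (kappa \<omega> / (cmod (msym a \<omega>))\<^sup>2)) *\<^sub>R (cmod (cnj (msym a \<omega>) * fourier \<phi> \<omega>))\<^sup>2)"
    proof (rule Bochner_Integration.integrable_bound)
      show "integrable lborel (\<lambda>\<omega>. l\<^sup>2 * (kappa \<omega> * (cmod (fourier \<phi> \<omega>))\<^sup>2))" using integrable_kappa_fourier[OF i\<phi>] by simp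
      show "AE \<omega> in lborel. norm ((l\<^sup>2 * (kappa \<omega> / (cmod (msym a \<omega>))\<^sup>2)) *\<^sub>R (cmod (cnj (msym a \<omega>) * fourier \<phi> \<omega>))\<^sup>2) \<le> norm (l\<^sup>2 * (kappa \<omega> * (cmod (fourier \<phi> \<omega>))\<^sup>2))"
      proof (rule AE_I2)
        fix \<omega>
        have "(l\<^sup>2 * (kappa \<omega> / (cmod (msym a \<omega>))\<^sup>2)) * (cmod (cnj (msym a \<omega>) * fourier \<phi> \<omega>))\<^sup>2 \<le> l\<^sup>2 * (kappa \<omega> * (cmod (fourier \<phi> \<omega>))\<^sup>2)"
          using kappa_nonneg[of \<omega>] by (cases "msym a \<omega> = 0") (auto simp: norm_mult power_mult_distrib)
        then show "norm ((l\<^sup>2 * (kappa \<omega> / (cmod (msym a \<omega>))\<^sup>2)) *\<^sub>R (cmod (cnj (msym a \<omega>) * fourier \<phi> \<omega>))\<^sup>2) \<le> norm (l\<^sup>2 * (kappa \<omega> * (cmod (fourier \<phi> \<omega>))\<^sup>2))"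
          using kappa_nonneg[of \<omega>] by (simp add: abs_mult)
      qed
    qed measurable
  qed measurable
  then show ?thesis using tempered_adjoint_drift[OF \<phi>] is_function_adjoint_drift[OF \<phi>] unfolding op_dom_def by blast
qed

text \<open>The transform is unbounded near the origin in general, so it is rewritten as \<open>a *
  k * fourier \<phi> = msym * fourier \<phi> - fourier (vderiv \<phi>)\<close>. The first term is
  handled by the cancellation above, the second is bounded and the measure is finite.\<close>

lemma convolution_dom:
  assumes a: "0 < a" and \<phi>: "\<phi> \<in> schwartz_space"
  shows "function_distribution (convolution (kernel_plus K) \<phi>) \<in> op_dom (nuK a l)"
proof -
  have i\<phi>: "integrable lborel \<phi>" by (rule schwartz_integrable[OF \<phi>])
  have i\<phi>': "integrable lborel (vderiv \<phi>)" by (rule schwartz_integrable[OF schwartz_vderiv[OF \<phi>]])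
  have [measurable]: "fourier \<phi> \<in> borel_measurable borel"
    using borel_measurable_integrable[OF i\<phi>] by (intro fourier_measurable) simp
  let ?N = "\<integral>t. cmod (vderiv \<phi> t) \<partial>lborel"
  let ?R = "\<lambda>\<omega>. kappa \<omega> / (cmod (msym a \<omega>))\<^sup>2"
  have "integrable (nuK a l) (\<lambda>\<omega>. (cmod (k (\<i> * of_real \<omega>) * fourier \<phi> \<omega>))\<^sup>2)"
  proof (subst integrable_nuK)
    show "integrable lborel (\<lambda>\<omega>. (l\<^sup>2 * ?R \<omega>) *\<^sub>R (cmod (k (\<i> * of_real \<omega>) * fourier \<phi> \<omega>))\<^sup>2)"
    proof (rule Bochner_Integration.integrable_bound)
      show "integrable lborel (\<lambda>\<omega>. 2 / a\<^sup>2 * (l\<^sup>2 * (kappa \<omega> * (cmod (fourier \<phi> \<omega>))\<^sup>2)) + 2 / a\<^sup>2 * (l\<^sup>2 * ?N\<^sup>2 * ?R \<omega>))"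
        using integrable_kappa_fourier[OF i\<phi>] has_bochner_integral_spectral_density[OF a]
        by (intro Bochner_Integration.integrable_add integrable_mult_right) (auto simp: has_bochner_integral_iff)
      show "AE \<omega> in lborel. norm ((l\<^sup>2 * ?R \<omega>) *\<^sub>R (cmod (k (\<i> * of_real \<omega>) * fourier \<phi> \<omega>))\<^sup>2) \<le> norm (2 / a\<^sup>2 * (l\<^sup>2 * (kappa \<omega> * (cmod (fourier \<phi> \<omega>))\<^sup>2)) + 2 / a\<^sup>2 * (l\<^sup>2 * ?N\<^sup>2 * ?R \<omega>))"
      proof (rule AE_I2)
        fix \<omega>
        let ?m = "msym a \<omega>" and ?k = "k (\<i> * of_real \<omega>)" and ?f = "fourier \<phi> \<omega>"
        have R0: "0 \<le> ?R \<omega>" using kappa_nonneg by simp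
        have "of_real a * ?k * ?f = ?m * ?f + - fourier (vderiv \<phi>) \<omega>"
          by (simp add: msym_def fourier_vderiv[OF \<phi>] algebra_simps)
        then have "(cmod (of_real a * ?k * ?f))\<^sup>2 \<le> 2 * (cmod (?m * ?f))\<^sup>2 + 2 * (cmod (- fourier (vderiv \<phi>) \<omega>))\<^sup>2"
          by (simp only: cmod_add_sq_le)
        also have "\<dots> \<le> 2 * (cmod (?m * ?f))\<^sup>2 + 2 * ?N\<^sup>2"
          using norm_fourier_le[of "vderiv \<phi>" \<omega>] by (auto intro!: power_mono)
        finally have "a\<^sup>2 * (cmod (?k * ?f))\<^sup>2 \<le> 2 * (cmod (?m * ?f))\<^sup>2 + 2 * ?N\<^sup>2"
          by (simp add: norm_mult power_mult_distrib mult.assoc)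
        then have "(cmod (?k * ?f))\<^sup>2 \<le> 2 / a\<^sup>2 * ((cmod (?m * ?f))\<^sup>2 + ?N\<^sup>2)"
          using a by (simp add: field_simps)
        then have "(l\<^sup>2 * ?R \<omega>) * (cmod (?k * ?f))\<^sup>2 \<le> (l\<^sup>2 * ?R \<omega>) * (2 / a\<^sup>2 * ((cmod (?m * ?f))\<^sup>2 + ?N\<^sup>2))"
          by (rule mult_left_mono) (rule mult_nonneg_nonneg[OF zero_le_power2 R0])
        also have "\<dots> = 2 / a\<^sup>2 * (l\<^sup>2 * (?R \<omega> * (cmod (?m * ?f))\<^sup>2)) + 2 / a\<^sup>2 * (l\<^sup>2 * ?N\<^sup>2 * ?R \<omega>)"
          by (simp only: distrib_left mult_ac)
        also have "\<dots> \<le> 2 / a\<^sup>2 * (l\<^sup>2 * (kappa \<omega> * (cmod ?f)\<^sup>2)) + 2 / a\<^sup>2 * (l\<^sup>2 * ?N\<^sup>2 * ?R \<omega>)"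
        proof -
          have "?R \<omega> * (cmod (?m * ?f))\<^sup>2 \<le> kappa \<omega> * (cmod ?f)\<^sup>2"
            using kappa_nonneg[of \<omega>] by (cases "?m = 0") (auto simp: norm_mult power_mult_distrib)
          then show ?thesis by (intro add_right_mono mult_left_mono) auto
        qed
        finally have "(l\<^sup>2 * ?R \<omega>) * (cmod (?k * ?f))\<^sup>2 \<le> 2 / a\<^sup>2 * (l\<^sup>2 * (kappa \<omega> * (cmod ?f)\<^sup>2)) + 2 / a\<^sup>2 * (l\<^sup>2 * ?N\<^sup>2 * ?R \<omega>)" .
        moreover have "0 \<le> (l\<^sup>2 * ?R \<omega>) * (cmod (?k * ?f))\<^sup>2" by (rule mult_nonneg_nonneg[OF mult_nonneg_nonneg[OF zero_le_power2 R0] zero_le_power2])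
        ultimately show "norm ((l\<^sup>2 * ?R \<omega>) *\<^sub>R (cmod (?k * ?f))\<^sup>2) \<le> norm (2 / a\<^sup>2 * (l\<^sup>2 * (kappa \<omega> * (cmod ?f)\<^sup>2)) + 2 / a\<^sup>2 * (l\<^sup>2 * ?N\<^sup>2 * ?R \<omega>))"
          unfolding real_norm_def real_scaleR_def by linarith
      qed
    qed measurable
  qed measurable
  then show ?thesis using tempered_kernel_convolution[OF \<phi>] is_function_kernel_convolution[OF \<phi>] unfolding op_dom_def by blast
qed

lemma nuK_noise:
  assumes a: "0 < a" and \<phi>: "\<phi> \<in> schwartz_space" and \<psi>: "\<psi> \<in> schwartz_space"
  shows "(\<integral>y. (cnj (msym a y) * fourier \<phi> y) * cnj (cnj (msym a y) * fourier \<psi> y) \<partial>nuK a l) = of_real (l\<^sup>2) * noise_covariance K \<phi> \<psi>"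
proof -
  have [measurable]: "fourier \<phi> \<in> borel_measurable borel" "fourier \<psi> \<in> borel_measurable borel"
    using schwartz_measurable \<phi> \<psi> by (auto intro!: fourier_measurable)
  have m: "(\<lambda>y. (cnj (msym a y) * fourier \<phi> y) * cnj (cnj (msym a y) * fourier \<psi> y)) \<in> borel_measurable borel" by measurable
  have "(\<integral>y. (cnj (msym a y) * fourier \<phi> y) * cnj (cnj (msym a y) * fourier \<psi> y) \<partial>nuK a l)
    = (\<integral>y. of_real (l\<^sup>2) * (of_real (kappa y) * (fourier \<phi> y * cnj (fourier \<psi> y))) \<partial>lborel)"
  proof (subst integrable_nuK(2)[OF m], rule integral_cong_AE)
    have "AE y in lborel. y \<noteq> (0::real)" by (rule AE_lborel_singleton)
    then show "AE y in lborel. (l\<^sup>2 * (kappa y / (cmod (msym a y))\<^sup>2)) *\<^sub>R ((cnj (msym a y) * fourier \<phi> y) * cnj (cnj (msym a y) * fourier \<psi> y))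
       = of_real (l\<^sup>2) * (of_real (kappa y) * (fourier \<phi> y * cnj (fourier \<psi> y)))"
    proof eventually_elim
      case (elim y)
      have m: "msym a y \<noteq> 0" by (rule msym_nonzero[OF a elim])
      have "(cnj (msym a y) * fourier \<phi> y) * cnj (cnj (msym a y) * fourier \<psi> y) = of_real ((cmod (msym a y))\<^sup>2) * (fourier \<phi> y * cnj (fourier \<psi> y))"
        unfolding complex_norm_square by (simp add: mult_ac)
      then have "(l\<^sup>2 * (kappa y / (cmod (msym a y))\<^sup>2)) *\<^sub>R ((cnj (msym a y) * fourier \<phi> y) * cnj (cnj (msym a y) * fourier \<psi> y))
          = of_real (l\<^sup>2 * (kappa y / (cmod (msym a y))\<^sup>2) * (cmod (msym a y))\<^sup>2) * (fourier \<phi> y * cnj (fourier \<psi> y))"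
        by (simp only: scaleR_conv_of_real of_real_mult mult.assoc)
      moreover have "l\<^sup>2 * (kappa y / (cmod (msym a y))\<^sup>2) * (cmod (msym a y))\<^sup>2 = l\<^sup>2 * kappa y" using m by simp
      ultimately have "(l\<^sup>2 * (kappa y / (cmod (msym a y))\<^sup>2)) *\<^sub>R ((cnj (msym a y) * fourier \<phi> y) * cnj (cnj (msym a y) * fourier \<psi> y))
          = of_real (l\<^sup>2 * kappa y) * (fourier \<phi> y * cnj (fourier \<psi> y))" by (simp only:)
      then show ?case by (simp only: of_real_mult mult.assoc)
    qed
  qed measurable
  also have "\<dots> = of_real (l\<^sup>2) * noise_covariance K \<phi> \<psi>"
    unfolding noise_covariance_eq[OF \<phi> \<psi>] by (rule integral_mult_right_zero)
  finally show ?thesis .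
qed

text \<open>The operator is spelled out as \<open>phi\<close> of fixed coefficients and of the path
  of \<open>\<xi>\<close>, because independence of the modes is read off from this form.\<close>

theorem weak_solution_exists:
  assumes a: "0 < a" and n: "iid_normals M \<xi>"
  shows "weak_stationary_solution M K a l (nuK a l) (\<lambda>f w. phi (symmetric_borel_measure.coef (nuK a l) (rep (nuK a l) f)) (\<lambda>j. \<xi> j w))"
proof -
  interpret S: symmetric_borel_measure "nuK a l" by (rule symmetric_nuK[OF a])
  interpret N: iid_normals M \<xi> by (rule n)
  interpret gaussian_model "nuK a l" M \<xi> by unfold_locales (rule ac_nuK)
  have V: "V = (\<lambda>f w. phi (S.coef (rep (nuK a l) f)) (\<lambda>j. \<xi> j w))" by (simp add: V_def N.W_def fun_eq_iff)
  have "weak_stationary_solution M K a l (nuK a l) V"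
    unfolding weak_stationary_solution_def
  proof (intro conjI ballI)
    show ao: "associated_operator M (nuK a l) V" by (rule associated_operator_V)
    fix \<phi> assume \<phi>: "\<phi> \<in> schwartz_space"
    show "function_distribution (convolution (kernel_plus K) \<phi>) \<in> op_dom (nuK a l)" by (rule convolution_dom[OF a \<phi>])
    show "adjoint_drift K a \<phi> \<in> op_dom (nuK a l)" by (rule adjoint_drift_dom[OF a \<phi>])
    fix \<psi> assume \<psi>: "\<psi> \<in> schwartz_space"
    have "(\<integral>w. V (adjoint_drift K a \<phi>) w * cnj (V (adjoint_drift K a \<psi>) w) \<partial>M)
      = (\<integral>y. (cnj (msym a y) * fourier \<phi> y) * cnj (cnj (msym a y) * fourier \<psi> y) \<partial>nuK a l)"
      using ao adjoint_drift_dom[OF a \<phi>, of l] adjoint_drift_dom[OF a \<psi>, of l] is_function_adjoint_drift[OF \<phi>, of a] is_function_adjoint_drift[OF \<psi>, of a]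
      unfolding associated_operator_def by blast
    then show "(\<integral>w. V (adjoint_drift K a \<phi>) w * cnj (V (adjoint_drift K a \<psi>) w) \<partial>M) = of_real (l\<^sup>2) * noise_covariance K \<phi> \<psi>"
      unfolding nuK_noise[OF a \<phi> \<psi>] .
  qed
  then show ?thesis unfolding V .
qed

end

section \<open>Recovering the mass of a spectral measure from the weak equation\<close>

lemma fourier_gauss:
  "fourier (\<lambda>t. complex_of_real (exp (- (t\<^sup>2 / 2)))) \<omega> = of_real (sqrt (2 * pi) * exp (- (\<omega>\<^sup>2 / 2)))"
proof -
  have "of_real (exp (- ((- \<omega>)\<^sup>2 / 2))) = char std_normal_distribution (- \<omega>)" by (simp add: char_std_normal_distribution)
  also have "\<dots> = (\<integral>x. std_normal_density x *\<^sub>R iexp (- \<omega> * x) \<partial>lborel)"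
    unfolding char_def by (subst integral_density) (auto simp: normal_density_nonneg)
  also have "\<dots> = (\<integral>x. of_real (1 / sqrt (2 * pi)) * (of_real (exp (- (x\<^sup>2 / 2))) * four_exp (x * \<omega>)) \<partial>lborel)"
    by (intro Bochner_Integration.integral_cong refl) (simp add: std_normal_density_def scaleR_conv_of_real mult_ac)
  also have "\<dots> = of_real (1 / sqrt (2 * pi)) * fourier (\<lambda>t. complex_of_real (exp (- (t\<^sup>2 / 2)))) \<omega>"
    by (simp only: integral_mult_right_zero fourier_def)
  finally show ?thesis by (simp add: field_simps)
qed

context convex_kernel
begin

text \<open>The noise identity for a Gaussian centred at \<open>\<tau>\<close> against one centred
  at 0. The product of their transforms is \<open>2 * pi * exp (- y\<^sup>2)\<close> times the
  character of \<open>\<tau>\<close>, so the equation compares two Fourier transforms at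
  \<open>\<tau>\<close>; the Gaussian weight has no zeros and can be divided out later.\<close>

lemma gauss_moments:
  assumes ws: "weak_stationary_solution M K a l \<nu> V"
  shows "(\<integral>y. of_real ((cmod (msym a y))\<^sup>2 * (2 * pi * exp (- y\<^sup>2))) * four_exp (\<tau> * y) \<partial>\<nu>)
     = (\<integral>y. of_real (l\<^sup>2 * kappa y * (2 * pi * exp (- y\<^sup>2))) * four_exp (\<tau> * y) \<partial>lborel)"
proof -
  let ?p = "\<lambda>\<tau> t. complex_of_real (exp (- ((t - \<tau>)\<^sup>2 / 2)))"
  let ?G = "\<lambda>y. 2 * pi * exp (- y\<^sup>2)"
  have f: "fourier (?p \<tau>) y = four_exp (\<tau> * y) * of_real (sqrt (2 * pi) * exp (- (y\<^sup>2 / 2)))" for \<tau> y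
    by (subst fourier_translate) (simp only: fourier_gauss)
  have ff: "fourier (?p \<tau>) y * cnj (fourier (?p 0) y) = of_real (?G y) * four_exp (\<tau> * y)" for y
  proof -
    have "(sqrt (2 * pi) * exp (- (y\<^sup>2 / 2))) * (sqrt (2 * pi) * exp (- (y\<^sup>2 / 2)))
        = (sqrt (2 * pi) * sqrt (2 * pi)) * exp (- (y\<^sup>2 / 2) + - (y\<^sup>2 / 2))" unfolding exp_add by (simp only: mult_ac)
    also have "\<dots> = ?G y" by simp
    finally have "complex_of_real (sqrt (2 * pi) * exp (- (y\<^sup>2 / 2))) * complex_of_real (sqrt (2 * pi) * exp (- (y\<^sup>2 / 2))) = of_real (?G y)"
      by (simp only: of_real_mult[symmetric])
    moreover have "four_exp (0 * y) = 1" by simp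
    ultimately show ?thesis unfolding f complex_cnj_mult complex_cnj_complex_of_real by (simp add: mult_ac)
  qed
  have "(\<integral>w. V (adjoint_drift K a (?p \<tau>)) w * cnj (V (adjoint_drift K a (?p 0)) w) \<partial>M)
      = (\<integral>y. (cnj (msym a y) * fourier (?p \<tau>) y) * cnj (cnj (msym a y) * fourier (?p 0) y) \<partial>\<nu>)"
    using ws schwartz_gauss[of \<tau>] schwartz_gauss[of 0]
      is_function_adjoint_drift[OF schwartz_gauss[of \<tau>], of a] is_function_adjoint_drift[OF schwartz_gauss[of 0], of a]
    unfolding weak_stationary_solution_def associated_operator_def by blast
  also have "\<dots> = (\<integral>y. of_real ((cmod (msym a y))\<^sup>2 * ?G y) * four_exp (\<tau> * y) \<partial>\<nu>)"
  proof (intro Bochner_Integration.integral_cong refl)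
    fix y
    have "(cnj (msym a y) * fourier (?p \<tau>) y) * cnj (cnj (msym a y) * fourier (?p 0) y)
      = of_real ((cmod (msym a y))\<^sup>2) * (fourier (?p \<tau>) y * cnj (fourier (?p 0) y))"
      unfolding complex_norm_square by (simp add: mult_ac)
    then show "(cnj (msym a y) * fourier (?p \<tau>) y) * cnj (cnj (msym a y) * fourier (?p 0) y)
      = of_real ((cmod (msym a y))\<^sup>2 * ?G y) * four_exp (\<tau> * y)"
      unfolding ff by (simp only: of_real_mult mult.assoc)
  qed
  finally have 1: "(\<integral>w. V (adjoint_drift K a (?p \<tau>)) w * cnj (V (adjoint_drift K a (?p 0)) w) \<partial>M)
     = (\<integral>y. of_real ((cmod (msym a y))\<^sup>2 * ?G y) * four_exp (\<tau> * y) \<partial>\<nu>)" .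
  have "(\<integral>w. V (adjoint_drift K a (?p \<tau>)) w * cnj (V (adjoint_drift K a (?p 0)) w) \<partial>M)
     = of_real (l\<^sup>2) * noise_covariance K (?p \<tau>) (?p 0)"
    using ws schwartz_gauss[of \<tau>] schwartz_gauss[of 0] unfolding weak_stationary_solution_def by blast
  also have "\<dots> = (\<integral>y. of_real (l\<^sup>2) * (of_real (kappa y) * (of_real (?G y) * four_exp (\<tau> * y))) \<partial>lborel)"
    unfolding noise_covariance_eq[OF schwartz_gauss schwartz_gauss] ff by (rule integral_mult_right_zero[symmetric])
  also have "\<dots> = (\<integral>y. of_real (l\<^sup>2 * kappa y * ?G y) * four_exp (\<tau> * y) \<partial>lborel)"
    by (intro Bochner_Integration.integral_cong refl) (simp only: of_real_mult mult.assoc)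
  finally show ?thesis unfolding 1 .
qed

text \<open>Testing against translated Gaussians determines the characteristic function of
  \<open>\<bar>m\<bar>\<^sup>2 exp (- y\<^sup>2) d\<nu>\<close>, so by Levy's theorem \<open>\<nu>\<close> has the expected mass.\<close>
lemma spectral_mass:
  assumes a: "0 < a" and l: "0 < l" and ws: "weak_stationary_solution M K a l \<nu> V"
  shows "emeasure \<nu> UNIV = ennreal (l\<^sup>2 / a)"
proof -
  let ?G = "\<lambda>y::real. 2 * pi * exp (- y\<^sup>2)"
  let ?f = "\<lambda>y. (cmod (msym a y))\<^sup>2 * ?G y" and ?h = "\<lambda>y. l\<^sup>2 * kappa y * ?G y"
  have sm: "spectral_measure \<nu>" using ws by (simp add: weak_stationary_solution_def associated_operator_def)
  then have S[measurable_cong]: "sets \<nu> = sets borel" and ac: "absolutely_continuous lborel \<nu>" by (auto simp: spectral_measure_def)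
  have sp: "space \<nu> = UNIV" using sets_eq_imp_space_eq[OF S] by simp
  have f0: "0 \<le> ?f y" for y by simp
  have h0: "0 \<le> ?h y" for y using kappa_nonneg[of y] by simp
  have ih: "integrable lborel ?h"
  proof (rule Bochner_Integration.integrable_bound)
    show "integrable lborel (\<lambda>y. 2 * pi * (l\<^sup>2 * kappa y))" using integrable_kappa by simp
    show "AE y in lborel. norm (?h y) \<le> norm (2 * pi * (l\<^sup>2 * kappa y))"
    proof (rule AE_I2)
      fix y
      have "?h y = (2 * pi * (l\<^sup>2 * kappa y)) * exp (- y\<^sup>2)" by simp
      also have "\<dots> \<le> 2 * pi * (l\<^sup>2 * kappa y)" using kappa_nonneg[of y] by (intro mult_left_le) auto
      finally show "norm (?h y) \<le> norm (2 * pi * (l\<^sup>2 * kappa y))" using h0[of y] kappa_nonneg[of y] by simp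
    qed
  qed measurable
  define c where "c = (\<integral>y. ?h y \<partial>lborel)"
  have c: "0 < c"
  proof -
    have "c \<noteq> 0"
    proof
      assume "c = 0"
      then have "AE y in lborel. ?h y = 0" unfolding c_def using ih h0 integral_nonneg_eq_0_iff_AE[of lborel ?h] by simp
      moreover have "AE y in lborel. y \<noteq> (0::real)" by (rule AE_lborel_singleton)
      ultimately have "AE y in (lborel :: real measure). False"
      proof eventually_elim
        case (elim y)
        then show ?case using kappa_pos[of y] l by simp
      qed
      then show False by (simp add: AE_iff_null null_sets_def)
    qed
    moreover have "0 \<le> c" unfolding c_def using h0 by (intro integral_nonneg_AE) auto
    ultimately show ?thesis by simp
  qed
  have mom: "(\<integral>y. of_real (?f y) * four_exp (\<tau> * y) \<partial>\<nu>) = (\<integral>y. of_real (?h y) * four_exp (\<tau> * y) \<partial>lborel)" for \<tau>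
    by (rule gauss_moments[OF ws])
  have cc: "(\<integral>y. complex_of_real (?f y) \<partial>\<nu>) = of_real c"
    using mom[of 0] integral_complex_of_real[of lborel ?h] by (simp add: c_def del: of_real_mult of_real_power)
  \<comment> \<open>A Bochner integral without integrability is zero by convention; the nonzero
    value \<open>c\<close> therefore certifies integrability.\<close>
  then have "integrable \<nu> (\<lambda>y. complex_of_real (?f y))"
    using c not_integrable_integral_eq[of \<nu> "\<lambda>y. complex_of_real (?f y)"] by fastforce
  then have jf: "integrable \<nu> ?f" by (simp only: complex_of_real_integrable_eq)
  have intf: "(\<integral>y. ?f y \<partial>\<nu>) = c" using cc by (simp only: integral_complex_of_real of_real_eq_iff)
  define N1 where "N1 = density \<nu> (\<lambda>y. ennreal (?f y / c))"
  define N2 where "N2 = density lborel (\<lambda>y. ennreal (?h y / c))"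
  have mf[measurable]: "?f \<in> borel_measurable borel" and mh[measurable]: "?h \<in> borel_measurable borel" by measurable
  have fc: "0 \<le> ?f y / c" "0 \<le> ?h y / c" for y using f0[of y] h0[of y] c by auto
  have r1: "real_distribution N1"
  proof (intro real_distribution.intro real_distribution_axioms.intro prob_spaceI)
    show "sets N1 = sets borel" by (simp add: N1_def S)
    have "emeasure N1 (space N1) = (\<integral>\<^sup>+y. ennreal (?f y / c) \<partial>\<nu>)" unfolding N1_def by (simp add: emeasure_density cong: nn_integral_cong)
    also have "\<dots> = ennreal (\<integral>y. ?f y / c \<partial>\<nu>)" using jf fc by (intro nn_integral_eq_integral) auto
    finally show "emeasure N1 (space N1) = 1" using intf c by simp
  qed
  have r2: "real_distribution N2"
  proof (intro real_distribution.intro real_distribution_axioms.intro prob_spaceI)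
    show "sets N2 = sets borel" by (simp add: N2_def)
    have "emeasure N2 (space N2) = (\<integral>\<^sup>+y. ennreal (?h y / c) \<partial>lborel)" unfolding N2_def by (simp add: emeasure_density cong: nn_integral_cong)
    also have "\<dots> = ennreal (\<integral>y. ?h y / c \<partial>lborel)" using ih fc by (intro nn_integral_eq_integral) auto
    finally show "emeasure N2 (space N2) = 1" using c by (simp add: c_def)
  qed
  have eq: "N1 = N2"
  proof (rule Levy_uniqueness[OF r1 r2], rule ext)
    fix t
    have e: "iexp (t * y) = four_exp (- t * y)" for y by simp
    have "char N1 t = (\<integral>y. (?f y / c) *\<^sub>R iexp (t * y) \<partial>\<nu>)"
      unfolding char_def N1_def by (rule integral_density) (use fc in auto)
    also have "\<dots> = (\<integral>y. of_real (?f y) * four_exp (- t * y) \<partial>\<nu>) / of_real c"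
      unfolding integral_divide_zero[symmetric] e by (intro Bochner_Integration.integral_cong refl) (simp add: scaleR_conv_of_real)
    also have "\<dots> = (\<integral>y. of_real (?h y) * four_exp (- t * y) \<partial>lborel) / of_real c" unfolding mom ..
    also have "\<dots> = (\<integral>y. (?h y / c) *\<^sub>R iexp (t * y) \<partial>lborel)"
      unfolding integral_divide_zero[symmetric] e by (intro Bochner_Integration.integral_cong refl) (simp add: scaleR_conv_of_real)
    also have "\<dots> = char N2 t"
      unfolding char_def N2_def by (rule integral_density[symmetric]) (use fc in auto)
    finally show "char N1 t = char N2 t" .
  qed
  have ne: "AE y in lborel. y \<noteq> (0::real)" by (rule AE_lborel_singleton)
  \<comment> \<open>Absolute continuity excludes mass at the origin, the one point where the weight
    vanishes and cannot be inverted.\<close>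
  then have ne': "AE y in \<nu>. y \<noteq> 0" by (rule absolutely_continuous_AE[rotated 2]) (use ac S in auto)
  have pos: "0 < ?f y" if "y \<noteq> 0" for y using msym_nonzero[OF a that] by simp
  have "emeasure \<nu> UNIV = (\<integral>\<^sup>+y. 1 \<partial>\<nu>)" using sp by simp
  \<comment> \<open>The mass is recovered by integrating the reciprocal weight \<open>c / ?f\<close>
    against \<open>N1\<close>, which may now be exchanged for \<open>N2\<close>.\<close>
  also have "\<dots> = (\<integral>\<^sup>+y. ennreal (?f y / c) * ennreal (c / ?f y) \<partial>\<nu>)"
  proof (rule nn_integral_cong_AE)
    show "AE y in \<nu>. 1 = ennreal (?f y / c) * ennreal (c / ?f y)" using ne'
    proof eventually_elim
      case (elim y)
      have "ennreal (?f y / c) * ennreal (c / ?f y) = ennreal (?f y / c * (c / ?f y))" using fc(1)[of y] by (intro ennreal_mult'[symmetric])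
      also have "?f y / c * (c / ?f y) = 1"
      proof -
        have "u / c * (c / u) = 1" if "u > 0" for u using that c by simp
        from this[OF pos[OF elim]] show ?thesis .
      qed
      finally show ?case by simp
    qed
  qed
  also have "\<dots> = (\<integral>\<^sup>+y. ennreal (c / ?f y) \<partial>N1)" unfolding N1_def by (rule nn_integral_density[symmetric]) auto
  also have "\<dots> = (\<integral>\<^sup>+y. ennreal (c / ?f y) \<partial>N2)" by (simp only: eq)
  also have "\<dots> = (\<integral>\<^sup>+y. ennreal (?h y / c) * ennreal (c / ?f y) \<partial>lborel)" unfolding N2_def by (rule nn_integral_density) auto
  also have "\<dots> = (\<integral>\<^sup>+y. ennreal (l\<^sup>2) * ennreal (kappa y / (cmod (msym a y))\<^sup>2) \<partial>lborel)"
  proof (rule nn_integral_cong_AE)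
    show "AE y in lborel. ennreal (?h y / c) * ennreal (c / ?f y) = ennreal (l\<^sup>2) * ennreal (kappa y / (cmod (msym a y))\<^sup>2)" using ne
    proof eventually_elim
      case (elim y)
      have "ennreal (?h y / c) * ennreal (c / ?f y) = ennreal (?h y / c * (c / ?f y))" using fc(2)[of y] by (intro ennreal_mult'[symmetric])
      also have "?h y / c * (c / ?f y) = l\<^sup>2 * (kappa y / (cmod (msym a y))\<^sup>2)" using msym_nonzero[OF a elim] c by (simp add: field_simps)
      also have "ennreal \<dots> = ennreal (l\<^sup>2) * ennreal (kappa y / (cmod (msym a y))\<^sup>2)" by (rule ennreal_mult') simp
      finally show ?case .
    qed
  qed
  also have "\<dots> = ennreal (l\<^sup>2) * ennreal (1 / a)"
    by (subst nn_integral_cmult) (simp_all add: nn_integral_spectral_density[OF a])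
  also have "\<dots> = ennreal (l\<^sup>2 / a)" using a by (simp add: ennreal_mult'[symmetric])
  finally show ?thesis .
qed

text \<open>The transform of a point evaluation has modulus 1, so the variance is the total mass of
  the spectral measure, at every time.\<close>

lemma dirac_variance:
  assumes a: "0 < a" and l: "0 < l" and ws: "weak_stationary_solution M K a l \<nu> V" and d: "dirac t \<in> op_dom \<nu>"
  shows "has_bochner_integral M (\<lambda>w. (cmod (V (dirac t) w))\<^sup>2) (l\<^sup>2 / a)"
proof -
  have i: "integrable M (\<lambda>w. (cmod (V (dirac t) w))\<^sup>2)"
    using ws d unfolding weak_stationary_solution_def associated_operator_def by blast
  have "complex_of_real (\<integral>w. (cmod (V (dirac t) w))\<^sup>2 \<partial>M) = (\<integral>w. V (dirac t) w * cnj (V (dirac t) w) \<partial>M)"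
    unfolding complex_norm_square[symmetric] by (rule integral_of_real[OF i, symmetric])
  also have "\<dots> = (\<integral>y. four_exp (t * y) * cnj (four_exp (t * y)) \<partial>\<nu>)"
    using ws d is_function_dirac[of t] unfolding weak_stationary_solution_def associated_operator_def by blast
  also have "\<dots> = (\<integral>y. 1 \<partial>\<nu>)" by (simp only: complex_norm_square[symmetric] norm_four_exp) simp
  also have "\<dots> = of_real (measure \<nu> (space \<nu>))" by (simp add: scaleR_conv_of_real)
  also have "space \<nu> = UNIV"
    using ws sets_eq_imp_space_eq[of \<nu> borel] by (simp add: weak_stationary_solution_def associated_operator_def spectral_measure_def)
  also have "measure \<nu> UNIV = l\<^sup>2 / a" using spectral_mass[OF a l ws] a by (simp add: measure_def)
  finally show ?thesis using i by (simp add: has_bochner_integral_iff del: of_real_power of_real_divide)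
qed

end

section \<open>The kernel and the noise of the theorem\<close>

lemma completely_monotone_has_derivative:
  assumes "completely_monotone K" "0 < t"
  shows "((vderiv ^^ n) K has_real_derivative (vderiv ^^ Suc n) K t) (at t)"
  using assms unfolding completely_monotone_def smooth_on_def has_real_derivative_iff_has_vector_derivative
  by (auto simp: vderiv_def vector_derivative_works[symmetric])

text \<open>The lower bound of \<open>K''\<close> near the origin is the point with content. If
  \<open>K''\<close> vanished, \<open>K\<close> would be affine on the positive half line,
  nonnegative and with limit zero, hence zero everywhere. So \<open>K''\<close> is positive
  somewhere, and it is nonincreasing because the third derivative is nonpositive.\<close>

lemma convex_kernel_of_completely_monotone:
  assumes nonneg: "\<And>t. 0 \<le> K t" and cont: "continuous_on UNIV K" and nz: "\<exists>t. K t \<noteq> 0"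
    and sym: "\<And>t. K (- t) = K t" and lim: "(K \<longlongrightarrow> 0) at_top" and cm: "completely_monotone K"
  shows "convex_kernel K (vderiv K) (vderiv (vderiv K))"
proof
  note d = completely_monotone_has_derivative[OF cm]
  have s: "0 < t \<Longrightarrow> 0 \<le> (-1) ^ n * (vderiv ^^ n) K t" for n t using cm by (simp add: completely_monotone_def)
  show d1: "(K has_real_derivative vderiv K t) (at t)" if "0 < t" for t using d[OF that, of 0] by simp
  show d2: "(vderiv K has_real_derivative vderiv (vderiv K) t) (at t)" if "0 < t" for t using d[OF that, of 1] by simp
  have d3: "(vderiv (vderiv K) has_real_derivative vderiv (vderiv (vderiv K)) t) (at t)" if "0 < t" for t
    using d[OF that, of 2] by (simp add: numeral_2_eq_2)
  show "continuous_on {0<..} (vderiv (vderiv K))"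
    by (rule continuous_at_imp_continuous_on) (use d3 DERIV_isCont in auto)
  show K1: "vderiv K t \<le> 0" if "0 < t" for t using s[OF that, of 1] by simp
  show K2: "0 \<le> vderiv (vderiv K) t" if "0 < t" for t using s[OF that, of 2] by (simp add: numeral_2_eq_2)
  have K3: "vderiv (vderiv (vderiv K)) t \<le> 0" if "0 < t" for t using s[OF that, of 3] by (simp add: numeral_3_eq_3)
  have "\<exists>s>0. 0 < vderiv (vderiv K) s"
  proof (rule ccontr)
    assume "\<not> ?thesis"
    then have z: "vderiv (vderiv K) t = 0" if "0 < t" for t using K2[OF that] that by force
    have "\<exists>b. \<forall>t\<in>{0<..}. vderiv K t = b"
      by (rule has_field_derivative_zero_constant) (use d2 z in \<open>auto intro: has_field_derivative_at_within\<close>)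
    then obtain b where b: "\<And>t. 0 < t \<Longrightarrow> vderiv K t = b" by auto
    have "\<exists>c. \<forall>t\<in>{0<..}. K t - b * t = c"
    proof (rule has_field_derivative_zero_constant)
      fix t :: real assume t: "t \<in> {0<..}"
      have "((\<lambda>t. K t - b * t) has_real_derivative vderiv K t - b * 1) (at t)"
        using t d1 by (auto intro!: derivative_intros)
      then show "((\<lambda>t. K t - b * t) has_real_derivative 0) (at t within {0<..})"
        using b t by (auto intro: has_field_derivative_at_within)
    qed simp
    then obtain c where c: "\<And>t. 0 < t \<Longrightarrow> K t = b * t + c" by (force simp: algebra_simps)
    \<comment> \<open>This combination cancels the linear part \<open>b * t\<close> and isolates the
      constant \<open>c\<close>, which must then be the limit zero.\<close>
    have "((\<lambda>t. 2 * K t - K (2 * t)) \<longlongrightarrow> 2 * 0 - 0) at_top"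
      by (intro tendsto_diff tendsto_mult tendsto_const lim filterlim_compose[OF lim] filterlim_tendsto_pos_mult_at_top[OF tendsto_const] filterlim_ident) auto
    moreover have "\<forall>\<^sub>F t in at_top. 2 * K t - K (2 * t) = c"
      using eventually_gt_at_top[of 0] by eventually_elim (simp add: c)
    ultimately have "((\<lambda>t::real. c) \<longlongrightarrow> 0) at_top" by (simp add: tendsto_cong)
    then have "c = 0" by (simp add: tendsto_const_iff)
    moreover have "b \<le> 0" using b[of 1] K1[of 1] by simp
    ultimately have pos: "K t = 0" if "0 < t" for t
      using c[OF that] nonneg[of t] mult_nonpos_nonneg[of b t] that by simp
    have "isCont K 0" using cont by (simp add: continuous_on_eq_continuous_at)
    then have "(\<lambda>n. K (1 / real (Suc n))) \<longlonglongrightarrow> K 0" using LIMSEQ_Suc[OF lim_1_over_n] by (rule isCont_tendsto_compose)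
    then have "K 0 = 0" using pos by (simp add: LIMSEQ_const_iff)
    then have "K t = 0" for t using pos[of t] pos[of "- t"] sym[of t] by (cases t "0::real" rule: linorder_cases) auto
    then show False using nz by simp
  qed
  then obtain s0 where s0: "0 < s0" "0 < vderiv (vderiv K) s0" by blast
  have "vderiv (vderiv K) s0 \<le> vderiv (vderiv K) s" if "s \<in> {0<..s0}" for s
  proof (rule DERIV_nonpos_imp_nonincreasing[where f="vderiv (vderiv K)"])
    show "s \<le> s0" using that by simp
    show "\<exists>y. (vderiv (vderiv K) has_real_derivative y) (at x) \<and> y \<le> 0" if "s \<le> x" for x
      using that \<open>s \<in> {0<..s0}\<close> by (intro exI[of _ "vderiv (vderiv (vderiv K)) x"] conjI d3 K3) auto
  qed
  then show "\<exists>s0>0. \<exists>c>0. \<forall>s\<in>{0<..s0}. c \<le> vderiv (vderiv K) s" using s0 by blast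
qed (use nonneg cont sym lim in auto)

lemma iid_normals_inj:
  assumes "iid_normals M \<xi>" "inj h"
  shows "iid_normals M (\<lambda>j. \<xi> (h j))"
proof -
  interpret iid_normals M \<xi> by fact
  show ?thesis
  proof
    have "indep_vars (\<lambda>j. Pi\<^sub>M {h j} (\<lambda>_. borel)) (\<lambda>j w. restrict (\<lambda>i. \<xi> i w) {h j}) UNIV"
      by (rule indep_vars_restrict[OF indep]) (use assms(2) in \<open>auto simp: disjoint_family_on_def inj_def\<close>)
    then have "indep_vars (\<lambda>_. borel) (\<lambda>j w. (\<lambda>f. f (h j)) (restrict (\<lambda>i. \<xi> i w) {h j})) UNIV"
      by (rule indep_vars_compose2) (rule measurable_component_singleton, simp)
    then show "indep_vars (\<lambda>_. borel) (\<lambda>j. \<xi> (h j)) UNIV" by simp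
    show "distributed M lborel (\<xi> (h j)) std_normal_density" for j by (rule normal)
  qed
qed

text \<open>The variance at time 0 is \<open>K 0 > 0\<close>, which rules out the degenerate
  alternative of \<open>centered_normal\<close>; dividing by the standard deviation yields standard
  normal variables.\<close>

lemma (in prob_space) iid_normals_of_noise:
  assumes F: "iid_gaussian_noise M K F" and K0: "0 < K 0"
  obtains \<xi> where "iid_normals M \<xi>"
proof -
  have n: "\<exists>s>0. distributed M lborel (F k 0) (normal_density 0 s)" for k
  proof -
    have g: "centered_gaussian M UNIV (\<lambda>t w. complex_of_real (F k t w))" using F by (simp add: iid_gaussian_noise_def)
    have c: "centered_normal M (F k 0)"
      using g[unfolded centered_gaussian_def, rule_format, of "{0}" "\<lambda>_. 1"] by simp
    have "\<not> (AE w in M. F k 0 w = 0)"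
    proof
      assume z: "AE w in M. F k 0 w = 0"
      have "expectation (\<lambda>w. F k 0 w * F k 0 w) = K \<bar>0 - 0\<bar>" using F unfolding iid_gaussian_noise_def by blast
      moreover have "expectation (\<lambda>w. F k 0 w * F k 0 w) = 0"
        by (rule integral_eq_zero_AE) (use z in \<open>auto elim: eventually_mono\<close>)
      ultimately show False using K0 by simp
    qed
    then show ?thesis using c by (auto simp: centered_normal_def)
  qed
  then obtain s where s: "\<And>k. 0 < s k" "\<And>k. distributed M lborel (F k 0) (normal_density 0 (s k))" by metis
  have "iid_normals M (\<lambda>k w. F k 0 w / s k)"
  proof
    have "indep_vars (\<lambda>_. Pi\<^sub>M UNIV (\<lambda>_. borel)) (\<lambda>k w t. F k t w) UNIV" using F by (simp add: iid_gaussian_noise_def)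
    then have "indep_vars (\<lambda>_. borel) (\<lambda>k w. (\<lambda>f. f 0 / s k) (\<lambda>t. F k t w)) UNIV" by (rule indep_vars_compose2) measurable
    then show "indep_vars (\<lambda>_. borel) (\<lambda>k w. F k 0 w / s k) UNIV" by simp
    show "distributed M lborel (\<lambda>w. F k 0 w / s k) std_normal_density" for k
      using normal_standard_normal_convert[OF s(1)[of k], of "F k 0" 0] s(2)[of k] by (simp add: prob_space_axioms)
  qed
  then show thesis ..
qed

section \<open>Random orthonormal series\<close>

lemma nn_integral_cmod_add_sq_le:
  assumes [measurable]: "f \<in> borel_measurable N" "g \<in> borel_measurable N"
  shows "(\<integral>\<^sup>+x. ennreal ((cmod (f x + g x))\<^sup>2) \<partial>N)
     \<le> 2 * (\<integral>\<^sup>+x. ennreal ((cmod (f x))\<^sup>2) \<partial>N) + 2 * (\<integral>\<^sup>+x. ennreal ((cmod (g x))\<^sup>2) \<partial>N)"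
proof -
  have "ennreal ((cmod (f x + g x))\<^sup>2) \<le> 2 * ennreal ((cmod (f x))\<^sup>2) + 2 * ennreal ((cmod (g x))\<^sup>2)" for x
  proof -
    have "ennreal ((cmod (f x + g x))\<^sup>2) \<le> ennreal (2 * (cmod (f x))\<^sup>2 + 2 * (cmod (g x))\<^sup>2)" by (intro ennreal_leI cmod_add_sq_le)
    also have "\<dots> = 2 * ennreal ((cmod (f x))\<^sup>2) + 2 * ennreal ((cmod (g x))\<^sup>2)" by (simp add: ennreal_plus ennreal_mult del: ennreal_power)
    finally show ?thesis .
  qed
  then have "(\<integral>\<^sup>+x. ennreal ((cmod (f x + g x))\<^sup>2) \<partial>N) \<le> (\<integral>\<^sup>+x. 2 * ennreal ((cmod (f x))\<^sup>2) + 2 * ennreal ((cmod (g x))\<^sup>2) \<partial>N)"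
    by (intro nn_integral_mono)
  also have "\<dots> = 2 * (\<integral>\<^sup>+x. ennreal ((cmod (f x))\<^sup>2) \<partial>N) + 2 * (\<integral>\<^sup>+x. ennreal ((cmod (g x))\<^sup>2) \<partial>N)"
    by (simp add: nn_integral_add nn_integral_cmult)
  finally show ?thesis .
qed

locale orthonormal_system = finite_measure Q for Q :: "'x measure" +
  fixes b :: "nat \<Rightarrow> 'x \<Rightarrow> complex"
  assumes b [measurable]: "b k \<in> borel_measurable Q"
    and sq: "integrable Q (\<lambda>x. (cmod (b k x))\<^sup>2)"
    and orthonormal: "(\<integral>x. b j x * cnj (b k x) \<partial>Q) = (if j = k then 1 else 0)"
begin

lemma pythagoras:
  assumes J: "finite J"
  shows "(\<integral>\<^sup>+x. ennreal ((cmod (\<Sum>k\<in>J. c k * b k x))\<^sup>2) \<partial>Q) = ennreal (\<Sum>k\<in>J. (cmod (c k))\<^sup>2)"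
proof -
  let ?p = "\<lambda>j k x. b j x * cnj (b k x)"
  have ip: "integrable Q (?p j k)" for j k
  proof (rule Bochner_Integration.integrable_bound)
    show "integrable Q (\<lambda>x. (cmod (b j x))\<^sup>2 + (cmod (b k x))\<^sup>2)" using sq by simp
    have "u * v \<le> u\<^sup>2 + v\<^sup>2" if "0 \<le> u" "0 \<le> v" for u v :: real
      using sum_squares_bound[of u v] mult_nonneg_nonneg[OF that] by linarith
    then show "AE x in Q. norm (?p j k x) \<le> norm ((cmod (b j x))\<^sup>2 + (cmod (b k x))\<^sup>2)" by (simp add: norm_mult)
  qed measurable
  have e: "complex_of_real ((cmod (\<Sum>k\<in>J. c k * b k x))\<^sup>2) = (\<Sum>j\<in>J. \<Sum>k\<in>J. (c j * cnj (c k)) * ?p j k x)" for x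
    unfolding complex_norm_square by (simp add: sum_product mult_ac)
  have i: "integrable Q (\<lambda>x. \<Sum>j\<in>J. \<Sum>k\<in>J. (c j * cnj (c k)) * ?p j k x)"
    by (intro Bochner_Integration.integrable_sum integrable_mult_right ip)
  have ir: "integrable Q (\<lambda>x. (cmod (\<Sum>k\<in>J. c k * b k x))\<^sup>2)"
    using i unfolding e[symmetric] by (simp only: complex_of_real_integrable_eq)
  have "complex_of_real (\<integral>x. (cmod (\<Sum>k\<in>J. c k * b k x))\<^sup>2 \<partial>Q) = (\<integral>x. (\<Sum>j\<in>J. \<Sum>k\<in>J. (c j * cnj (c k)) * ?p j k x) \<partial>Q)"
    unfolding e[symmetric] by (rule integral_complex_of_real[symmetric])
  also have "\<dots> = (\<Sum>j\<in>J. \<integral>x. (\<Sum>k\<in>J. (c j * cnj (c k)) * ?p j k x) \<partial>Q)"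
    by (intro Bochner_Integration.integral_sum Bochner_Integration.integrable_sum integrable_mult_right ip)
  also have "\<dots> = (\<Sum>j\<in>J. \<Sum>k\<in>J. \<integral>x. (c j * cnj (c k)) * ?p j k x \<partial>Q)"
    by (intro sum.cong refl Bochner_Integration.integral_sum integrable_mult_right ip)
  also have "\<dots> = (\<Sum>j\<in>J. \<Sum>k\<in>J. (c j * cnj (c k)) * (if j = k then 1 else 0))"
    by (simp only: integral_mult_right_zero orthonormal)
  also have "\<dots> = (\<Sum>j\<in>J. c j * cnj (c j))" using J by (intro sum.cong refl) (simp add: if_distrib sum.delta cong: if_cong)
  also have "\<dots> = of_real (\<Sum>j\<in>J. (cmod (c j))\<^sup>2)" by (simp only: of_real_sum complex_norm_square)
  finally have "(\<integral>x. (cmod (\<Sum>k\<in>J. c k * b k x))\<^sup>2 \<partial>Q) = (\<Sum>j\<in>J. (cmod (c j))\<^sup>2)" by (simp only: of_real_eq_iff)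
  then show ?thesis using nn_integral_eq_integral[OF ir] by simp
qed

text \<open>The factor \<open>2\<close> saves identifying \<open>c k\<close> with the Fourier coefficients of \<open>u\<close>.\<close>
lemma partial_sum_le:
  fixes c :: "nat \<Rightarrow> complex"
  assumes u [measurable]: "u \<in> borel_measurable Q"
    and lim: "(\<lambda>n. \<integral>\<^sup>+x. ennreal ((cmod (u x - (\<Sum>k<n. c k * b k x)))\<^sup>2) \<partial>Q) \<longlonglongrightarrow> 0"
  shows "ennreal (\<Sum>k<n. (cmod (c k))\<^sup>2) \<le> 2 * (\<integral>\<^sup>+x. ennreal ((cmod (u x))\<^sup>2) \<partial>Q)"
proof -
  let ?U = "\<integral>\<^sup>+x. ennreal ((cmod (u x))\<^sup>2) \<partial>Q"
  let ?g = "\<lambda>n. \<integral>\<^sup>+x. ennreal ((cmod (u x - (\<Sum>k<n. c k * b k x)))\<^sup>2) \<partial>Q"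
  have le: "ennreal (\<Sum>k<n. (cmod (c k))\<^sup>2) \<le> 2 * ?U + 2 * ?g N" if "n \<le> N" for N
  proof -
    have "ennreal (\<Sum>k<n. (cmod (c k))\<^sup>2) \<le> ennreal (\<Sum>k<N. (cmod (c k))\<^sup>2)"
      using that by (intro ennreal_leI sum_mono2) auto
    also have "\<dots> = (\<integral>\<^sup>+x. ennreal ((cmod (u x + - (u x - (\<Sum>k<N. c k * b k x))))\<^sup>2) \<partial>Q)"
      by (subst pythagoras[symmetric]) auto
    also have "\<dots> \<le> 2 * ?U + 2 * (\<integral>\<^sup>+x. ennreal ((cmod (- (u x - (\<Sum>k<N. c k * b k x))))\<^sup>2) \<partial>Q)"
      by (rule nn_integral_cmod_add_sq_le) measurable
    finally show ?thesis by (simp only: norm_minus_cancel)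
  qed
  have "(\<lambda>N. 2 * ?U + 2 * ?g N) \<longlonglongrightarrow> 2 * ?U + 2 * 0"
    by (intro tendsto_add tendsto_const ennreal_tendsto_cmult lim) simp
  then have "(\<lambda>N. 2 * ?U + 2 * ?g N) \<longlonglongrightarrow> 2 * ?U" by simp
  then show ?thesis using le by (intro LIMSEQ_le_const[OF _ exI[of _ n]]) auto
qed

text \<open>A limit along a subsequence on the product space gives a jointly measurable
  \<open>u\<close>. For fixed \<open>w\<close> the whole sequence has to converge: along the
  subsequence the mean errors are summable, so the errors tend to zero almost surely, and between
  its indices orthonormality bounds the gap by the tail of the squared coefficients.\<close>

theorem random_series:
  fixes X :: "nat \<Rightarrow> 'w \<Rightarrow> complex"
  assumes M: "prob_space M" and X [measurable]: "\<And>k. X k \<in> borel_measurable M"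
    and v: "\<And>k. (\<integral>\<^sup>+w. ennreal ((cmod (X k w))\<^sup>2) \<partial>M) = ennreal (v k)" "\<And>k. 0 \<le> v k" "summable v"
  shows "\<exists>u. (\<lambda>(w, x). u w x) \<in> borel_measurable (M \<Otimes>\<^sub>M Q) \<and>
     (\<integral>\<^sup>+w. \<integral>\<^sup>+x. ennreal ((cmod (u w x))\<^sup>2) \<partial>Q \<partial>M) < \<infinity> \<and>
     (AE w in M. (\<integral>\<^sup>+x. ennreal ((cmod (u w x))\<^sup>2) \<partial>Q) < \<infinity> \<and>
        (\<lambda>n. \<integral>\<^sup>+x. ennreal ((cmod (u w x - (\<Sum>k<n. X k w * b k x)))\<^sup>2) \<partial>Q) \<longlonglongrightarrow> 0)"
proof -
  interpret M: prob_space M by fact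
  interpret P: pair_sigma_finite M Q ..
  interpret P: finite_measure "M \<Otimes>\<^sub>M Q"
    by (rule finite_measure_pair_measure) unfold_locales
  define S where "S n = (\<lambda>(w, x). \<Sum>k<n. X k w * b k x)" for n :: nat
  define \<rho> where "\<rho> n = (\<Sum>k. v k) - (\<Sum>k<n. v k)" for n
  have S[measurable]: "S n \<in> borel_measurable (M \<Otimes>\<^sub>M Q)" for n unfolding S_def by measurable
  have "\<rho> \<longlonglongrightarrow> (\<Sum>k. v k) - (\<Sum>k. v k)" unfolding \<rho>_def[abs_def] by (intro tendsto_diff tendsto_const summable_LIMSEQ v)
  then obtain r where r: "strict_mono r" "\<And>k. \<rho> (r k) \<le> (1/8) ^ k" using fast_subsequence[of \<rho>] by auto
  have rest: "(\<Sum>k=m..<n. v k) \<le> \<rho> m" if "m \<le> n" for m n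
  proof -
    have "(\<Sum>k<n. v k) = (\<Sum>k<m. v k) + (\<Sum>k=m..<n. v k)"
      using sum.atLeastLessThan_concat[of 0 m n v] that by (simp add: lessThan_atLeast0)
    then show ?thesis using sum_le_suminf[OF v(3), of "{..<n}"] v(2) by (simp add: \<rho>_def)
  qed
  have Sdiff: "S n (w, x) - S m (w, x) = (\<Sum>k=m..<n. X k w * b k x)" if "m \<le> n" for m n w x
    using sum.atLeastLessThan_concat[of 0 m n "\<lambda>k. X k w * b k x"] that by (simp add: S_def lessThan_atLeast0 algebra_simps)
  have Sinner: "(\<integral>\<^sup>+x. ennreal ((cmod (S n (w, x) - S m (w, x)))\<^sup>2) \<partial>Q) = ennreal (\<Sum>k=m..<n. (cmod (X k w))\<^sup>2)" if "m \<le> n" for m n w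
    unfolding Sdiff[OF that] by (rule pythagoras) simp
  have bound: "(\<integral>\<^sup>+z. ennreal ((cmod (S n z - S m z))\<^sup>2) \<partial>(M \<Otimes>\<^sub>M Q)) \<le> ennreal (\<rho> m)" if "m \<le> n" for m n
  proof -
    have "(\<integral>\<^sup>+z. ennreal ((cmod (S n z - S m z))\<^sup>2) \<partial>(M \<Otimes>\<^sub>M Q)) = (\<integral>\<^sup>+w. \<integral>\<^sup>+x. ennreal ((cmod (S n (w, x) - S m (w, x)))\<^sup>2) \<partial>Q \<partial>M)"
      by (rule nn_integral_fst[symmetric]) measurable
    also have "\<dots> = (\<integral>\<^sup>+w. (\<Sum>k=m..<n. ennreal ((cmod (X k w))\<^sup>2)) \<partial>M)" unfolding Sinner[OF that] by (simp add: sum_ennreal del: ennreal_power)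
    also have "\<dots> = (\<Sum>k=m..<n. ennreal (v k))" by (subst nn_integral_sum) (simp_all only: v, measurable)
    also have "\<dots> = ennreal (\<Sum>k=m..<n. v k)" using v(2) by simp
    also have "\<dots> \<le> ennreal (\<rho> m)" by (intro ennreal_leI rest that)
    finally show ?thesis .
  qed
  define u where "u w x = lim (\<lambda>k. S (r k) (w, x))" for w x
  have u[measurable]: "(\<lambda>(w, x). u w x) \<in> borel_measurable (M \<Otimes>\<^sub>M Q)"
  proof -
    have "(\<lambda>(w, x). u w x) = (\<lambda>z. lim (\<lambda>k. S (r k) z))" by (simp add: u_def fun_eq_iff)
    then show ?thesis by (simp only:) (rule borel_measurable_lim_metric[OF S])
  qed
  let ?g = "\<lambda>n w. \<integral>\<^sup>+x. ennreal ((cmod (u w x - S n (w, x)))\<^sup>2) \<partial>Q"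
  have gm[measurable]: "?g n \<in> borel_measurable M" for n by measurable
  have g: "(\<integral>\<^sup>+w. ?g n w \<partial>M) \<le> ennreal (\<rho> n)" for n
  proof -
    have [measurable]: "(\<lambda>z. u (fst z) (snd z)) \<in> borel_measurable (M \<Otimes>\<^sub>M Q)" using u by (simp add: case_prod_beta')
    have m: "(\<lambda>z. ennreal ((cmod (u (fst z) (snd z) - S n z))\<^sup>2)) \<in> borel_measurable (M \<Otimes>\<^sub>M Q)" by measurable
    have "(\<integral>\<^sup>+w. ?g n w \<partial>M) = (\<integral>\<^sup>+z. ennreal ((cmod (u (fst z) (snd z) - S n z))\<^sup>2) \<partial>(M \<Otimes>\<^sub>M Q))"
      by (subst nn_integral_fst[OF m, symmetric]) simp
    also have "\<dots> = (\<integral>\<^sup>+z. ennreal ((cmod (lim (\<lambda>k. S (r k) z) - S n z))\<^sup>2) \<partial>(M \<Otimes>\<^sub>M Q))"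
      by (intro nn_integral_cong) (simp add: u_def case_prod_beta)
    also have "\<dots> \<le> ennreal (\<rho> n)" by (rule P.L2_limit(2)[OF S r bound])
    finally show ?thesis .
  qed
  have g0: "(\<integral>\<^sup>+x. ennreal ((cmod (u w x))\<^sup>2) \<partial>Q) = ?g 0 w" for w by (simp add: S_def)
  have fin: "(\<integral>\<^sup>+w. ?g 0 w \<partial>M) < \<infinity>" using g[of 0] by (rule order_le_less_trans) simp
  have a1: "AE w in M. ?g 0 w \<noteq> \<infinity>" by (rule nn_integral_PInf_AE) (use fin in auto)
  have "(\<integral>\<^sup>+w. (\<Sum>k. ?g (r k) w) \<partial>M) = (\<Sum>k. \<integral>\<^sup>+w. ?g (r k) w \<partial>M)" by (rule nn_integral_suminf) measurable
  also have "\<dots> \<le> (\<Sum>k. ennreal ((1/8) ^ k))" by (intro suminf_le order_trans[OF g] ennreal_leI r) auto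
  also have "\<dots> = ennreal (\<Sum>k. (1/8) ^ k)" by (rule suminf_ennreal2) (auto intro: summable_geometric)
  finally have a2: "AE w in M. (\<Sum>k. ?g (r k) w) \<noteq> \<infinity>" by (intro nn_integral_PInf_AE) (auto simp: top_unique)
  have "(\<integral>\<^sup>+w. (\<Sum>k. ennreal ((cmod (X k w))\<^sup>2)) \<partial>M) = (\<Sum>k. ennreal (v k))"
    by (subst nn_integral_suminf) (simp_all only: v, measurable)
  also have "\<dots> = ennreal (\<Sum>k. v k)" by (rule suminf_ennreal2) (use v in auto)
  finally have a3: "AE w in M. (\<Sum>k. ennreal ((cmod (X k w))\<^sup>2)) \<noteq> \<infinity>" by (intro nn_integral_PInf_AE) auto
  have lim: "(\<lambda>n. ?g n w) \<longlonglongrightarrow> 0"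
    if w: "w \<in> space M" and s1: "(\<Sum>k. ?g (r k) w) \<noteq> \<infinity>" and s2: "(\<Sum>k. ennreal ((cmod (X k w))\<^sup>2)) \<noteq> \<infinity>" for w
  proof -
    let ?a = "\<lambda>k. X k w"
    have mu: "u w \<in> borel_measurable Q" and mS: "(\<lambda>x. S n (w, x)) \<in> borel_measurable Q" for n
      using measurable_compose[OF measurable_Pair1'[OF w] u] measurable_compose[OF measurable_Pair1'[OF w] S] by (simp_all)
    have e: "ell2 ?a" unfolding ell2_def using s2 by (intro summable_suminf_not_top) auto
    have fg: "ennreal (enn2real (?g (r k) w)) = ?g (r k) w" for k
      using s1 ennreal_suminf_lessD[of "\<lambda>k. ?g (r k) w" top k] by (simp add: less_top)
    have "summable (\<lambda>k. enn2real (?g (r k) w))"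
      by (rule summable_suminf_not_top) (use s1 fg in auto)
    then have "(\<lambda>k. ennreal (enn2real (?g (r k) w))) \<longlonglongrightarrow> ennreal 0" by (intro tendsto_ennrealI summable_LIMSEQ_zero)
    then have l1: "(\<lambda>k. ?g (r k) w) \<longlonglongrightarrow> 0" unfolding fg by simp
    have l2: "(\<lambda>k. ennreal (tail ?a (r k))) \<longlonglongrightarrow> ennreal 0"
      using LIMSEQ_subseq_LIMSEQ[OF tail_lim[OF e] r(1)] by (intro tendsto_ennrealI) (simp add: comp_def)
    have "(\<lambda>k. 2 * ?g (r k) w + 2 * ennreal (tail ?a (r k))) \<longlonglongrightarrow> 2 * 0 + 2 * ennreal 0"
      by (intro tendsto_add ennreal_tendsto_cmult l1 l2) auto
    then have l: "(\<lambda>k. 2 * ?g (r k) w + 2 * ennreal (tail ?a (r k))) \<longlonglongrightarrow> 0" by simp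
    \<comment> \<open>From index \<open>r k\<close> to \<open>n\<close> the partial sums differ by
      one orthonormal block, whose square norm is at most the tail from \<open>r k\<close>
      on.\<close>
    have le: "?g n w \<le> 2 * ?g (r k) w + 2 * ennreal (tail ?a (r k))" if "r k \<le> n" for n k
    proof -
      have "?g n w = (\<integral>\<^sup>+x. ennreal ((cmod ((u w x - S (r k) (w, x)) + - (S n (w, x) - S (r k) (w, x))))\<^sup>2) \<partial>Q)" by simp
      also have "\<dots> \<le> 2 * ?g (r k) w + 2 * (\<integral>\<^sup>+x. ennreal ((cmod (- (S n (w, x) - S (r k) (w, x))))\<^sup>2) \<partial>Q)"
        by (rule nn_integral_cmod_add_sq_le) (use mu mS in measurable)
      also have "(\<integral>\<^sup>+x. ennreal ((cmod (- (S n (w, x) - S (r k) (w, x))))\<^sup>2) \<partial>Q) = ennreal (\<Sum>j=r k..<n. (cmod (X j w))\<^sup>2)"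
        using Sinner[OF that, of w] by (simp only: norm_minus_cancel)
      also have "\<dots> \<le> ennreal (tail ?a (r k))" by (intro ennreal_leI sum_le_tail[OF e that])
      finally show ?thesis by (simp add: add_left_mono mult_left_mono)
    qed
    show ?thesis
    proof (rule order_tendstoI)
      fix \<epsilon> :: ennreal assume "0 < \<epsilon>"
      then obtain k where k: "2 * ?g (r k) w + 2 * ennreal (tail ?a (r k)) < \<epsilon>"
        using order_tendstoD(2)[OF l] by (auto simp: eventually_sequentially)
      show "\<forall>\<^sub>F n in sequentially. ?g n w < \<epsilon>"
        using eventually_ge_at_top[of "r k"] by eventually_elim (rule order_le_less_trans[OF le k])
    qed simp
  qed
  show ?thesis
  proof (intro exI[of _ u] conjI)
    show "(\<lambda>(w, x). u w x) \<in> borel_measurable (M \<Otimes>\<^sub>M Q)" by (rule u)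
    show "(\<integral>\<^sup>+w. \<integral>\<^sup>+x. ennreal ((cmod (u w x))\<^sup>2) \<partial>Q \<partial>M) < \<infinity>" unfolding g0 by (rule fin)
    show "AE w in M. (\<integral>\<^sup>+x. ennreal ((cmod (u w x))\<^sup>2) \<partial>Q) < \<infinity> \<and>
        (\<lambda>n. \<integral>\<^sup>+x. ennreal ((cmod (u w x - (\<Sum>k<n. X k w * b k x)))\<^sup>2) \<partial>Q) \<longlonglongrightarrow> 0"
      using a1 a2 a3 AE_space
    proof eventually_elim
      case (elim w)
      show ?case unfolding g0 using lim[OF elim(4) elim(2) elim(3)] elim(1) by (simp add: S_def less_top)
    qed
  qed
qed

end

text \<open>\<open>prod_encode\<close> cuts one independent sequence into disjoint rows, one for
  each mode. Independence of the rows passes to the whole families because \<open>phi\<close> is a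
  measurable function of its row.\<close>

lemma (in prob_space) indep_vars_operators:
  fixes \<xi> :: "nat \<Rightarrow> 'a \<Rightarrow> real" and a :: "nat \<Rightarrow> 'f \<Rightarrow> nat \<Rightarrow> complex"
  assumes "indep_vars (\<lambda>_. borel) \<xi> UNIV"
  shows "indep_vars (\<lambda>k. Pi\<^sub>M (D k) (\<lambda>_. borel)) (\<lambda>k w. \<lambda>f\<in>D k. phi (a k f) (\<lambda>j. \<xi> (prod_encode (k, j)) w)) UNIV"
proof -
  let ?R = "\<lambda>k. range (\<lambda>j. prod_encode (k, j))"
  have "indep_vars (\<lambda>k. Pi\<^sub>M (?R k) (\<lambda>_. borel)) (\<lambda>k w. restrict (\<lambda>i. \<xi> i w) (?R k)) UNIV"
    by (rule indep_vars_restrict[OF assms]) (auto simp: disjoint_family_on_def)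
  then have "indep_vars (\<lambda>k. Pi\<^sub>M (D k) (\<lambda>_. borel))
    (\<lambda>k w. (\<lambda>x. \<lambda>f\<in>D k. phi (a k f) (\<lambda>j. x (prod_encode (k, j)))) (restrict (\<lambda>i. \<xi> i w) (?R k))) UNIV"
  proof (rule indep_vars_compose2)
    fix k
    have "(\<lambda>x j. x (prod_encode (k, j))) \<in> Pi\<^sub>M (?R k) (\<lambda>_. borel :: real measure) \<rightarrow>\<^sub>M Pi\<^sub>M UNIV (\<lambda>_. borel)"
      by (rule measurable_PiM_single') (auto intro: measurable_component_singleton)
    then show "(\<lambda>x. \<lambda>f\<in>D k. phi (a k f) (\<lambda>j. x (prod_encode (k, j)))) \<in> Pi\<^sub>M (?R k) (\<lambda>_. borel) \<rightarrow>\<^sub>M Pi\<^sub>M (D k) (\<lambda>_. borel)"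
      by (intro measurable_restrict measurable_compose[OF _ phi_measurable])
  qed
  then show ?thesis by simp
qed

section \<open>Translation to the norms of the statement, and the equivalence\<close>

lemma L2_norm_eq:
  assumes [measurable]: "f \<in> borel_measurable (lebesgue_on \<O>)"
  shows "L2_norm \<O> f = sqrt (enn2real (\<integral>\<^sup>+x. ennreal ((cmod (f x))\<^sup>2) \<partial>lebesgue_on \<O>))"
  unfolding L2_norm_def by (subst integral_eq_nn_integral) auto

lemma L2_iff:
  "f \<in> L2 \<O> \<longleftrightarrow> f \<in> borel_measurable (lebesgue_on \<O>) \<and> (\<integral>\<^sup>+x. ennreal ((cmod (f x))\<^sup>2) \<partial>lebesgue_on \<O>) < \<infinity>"
  unfolding L2_def by (auto simp: integrable_iff_bounded)

lemma orthonormal_system_lebesgue_on: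
  assumes "open \<O>" "bounded \<O>" and b: "L2_orthonormal_basis \<O> b"
  shows "orthonormal_system (lebesgue_on \<O>) b"
proof -
  interpret finite_measure "lebesgue_on \<O>" by (intro finite_measure_lebesgue_on lmeasurable_open assms)
  show ?thesis
    by unfold_locales (use b in \<open>auto simp: L2_orthonormal_basis_def L2_def L2_inner_def\<close>)
qed

text \<open>Integrating \<open>partial_sum_le\<close> over the probability space bounds every
  partial sum of the variances by twice the second moment of \<open>u\<close>.\<close>

lemma (in orthonormal_system) summable_coefficients:
  fixes X :: "nat \<Rightarrow> 'w \<Rightarrow> complex"
  assumes M: "prob_space M"
    and X: "\<And>k. has_bochner_integral M (\<lambda>w. (cmod (X k w))\<^sup>2) (v k)" and Xm [measurable]: "\<And>k. X k \<in> borel_measurable M"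
    and u [measurable]: "(\<lambda>(w, x). u w x) \<in> borel_measurable (M \<Otimes>\<^sub>M Q)"
    and fin: "(\<integral>\<^sup>+w. \<integral>\<^sup>+x. ennreal ((cmod (u w x))\<^sup>2) \<partial>Q \<partial>M) < \<infinity>"
    and lim: "AE w in M. (\<lambda>n. \<integral>\<^sup>+x. ennreal ((cmod (u w x - (\<Sum>k<n. X k w * b k x)))\<^sup>2) \<partial>Q) \<longlonglongrightarrow> 0"
  shows "summable v"
proof -
  interpret M: prob_space M by fact
  let ?B = "\<integral>\<^sup>+w. \<integral>\<^sup>+x. ennreal ((cmod (u w x))\<^sup>2) \<partial>Q \<partial>M"
  have v0: "0 \<le> v k" for k unfolding has_bochner_integral_integral_eq[OF X, symmetric] by simp
  have nn: "(\<integral>\<^sup>+w. ennreal ((cmod (X k w))\<^sup>2) \<partial>M) = ennreal (v k)" for k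
    using X[of k] nn_integral_eq_integral[of M "\<lambda>w. (cmod (X k w))\<^sup>2"] by (auto simp: has_bochner_integral_iff)
  have "(\<Sum>k<n. v k) \<le> enn2real (2 * ?B)" for n
  proof -
    have "AE w in M. ennreal (\<Sum>k<n. (cmod (X k w))\<^sup>2) \<le> 2 * (\<integral>\<^sup>+x. ennreal ((cmod (u w x))\<^sup>2) \<partial>Q)"
      using lim AE_space
    proof eventually_elim
      case (elim w)
      have "u w \<in> borel_measurable Q" using measurable_compose[OF measurable_Pair1'[OF elim(2)] u] by simp
      then show ?case by (rule partial_sum_le[OF _ elim(1)])
    qed
    then have "(\<integral>\<^sup>+w. ennreal (\<Sum>k<n. (cmod (X k w))\<^sup>2) \<partial>M) \<le> (\<integral>\<^sup>+w. 2 * (\<integral>\<^sup>+x. ennreal ((cmod (u w x))\<^sup>2) \<partial>Q) \<partial>M)"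
      by (rule nn_integral_mono_AE)
    also have "\<dots> = 2 * ?B" by (rule nn_integral_cmult) measurable
    also have "(\<integral>\<^sup>+w. ennreal (\<Sum>k<n. (cmod (X k w))\<^sup>2) \<partial>M) = (\<integral>\<^sup>+w. (\<Sum>k<n. ennreal ((cmod (X k w))\<^sup>2)) \<partial>M)"
      by (simp add: sum_ennreal del: ennreal_power)
    also have "\<dots> = (\<Sum>k<n. ennreal (v k))" by (subst nn_integral_sum) (simp_all only: nn, measurable)
    also have "\<dots> = ennreal (\<Sum>k<n. v k)" using v0 by simp
    finally have "ennreal (\<Sum>k<n. v k) \<le> 2 * ?B" .
    moreover have "2 * ?B < top" using fin by (simp add: ennreal_mult_less_top)
    ultimately show ?thesis using enn2real_mono[of "ennreal (\<Sum>k<n. v k)" "2 * ?B"] v0 by (simp add: sum_nonneg)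
  qed
  then show ?thesis by (intro summableI_nonneg_bounded v0)
qed

theorem theorem2p8:
  fixes \<O> :: "(real ^ 'd) set"
    and D :: "(real ^ 'd \<Rightarrow> complex) set"
    and A :: "(real ^ 'd \<Rightarrow> complex) \<Rightarrow> real ^ 'd \<Rightarrow> complex"
    and e :: "nat \<Rightarrow> real ^ 'd \<Rightarrow> real"
    and \<alpha> c lam :: "nat \<Rightarrow> real"
    and C :: real
    and K :: "real \<Rightarrow> real"
    and M :: "'w measure"
    and F :: "nat \<Rightarrow> real \<Rightarrow> 'w \<Rightarrow> real"
  assumes domain: "open \<O>" "connected \<O>" "\<O> \<noteq> {}" "bounded \<O>"
    and A: "L2_self_adjoint \<O> D A" "L2_negative \<O> D A"
    and basis: "L2_orthonormal_basis \<O> (\<lambda>k x. complex_of_real (e k x))"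
    and eigen: "\<And>k. (\<lambda>x. complex_of_real (e k x)) \<in> D"
      "\<And>k. AE x in lebesgue_on \<O>. A (\<lambda>x. complex_of_real (e k x)) x
              = - complex_of_real (\<alpha> k) * complex_of_real (e k x)"
    and alpha: "0 < \<alpha> 0" "incseq \<alpha>" "filterlim \<alpha> at_top sequentially"
    and C: "0 < C"
    and c: "\<And>k. 0 < c k" "incseq c"
    and e_bound: "\<And>k \<xi>. \<xi> \<in> \<O> \<Longrightarrow> \<bar>e k \<xi>\<bar> \<le> C * c k"
    and grad_bound: "\<And>k \<xi>. \<xi> \<in> \<O> \<Longrightarrow>
          \<exists>g. (GDERIV (e k) \<xi> :> g) \<and> norm g \<le> C * sqrt (\<alpha> k) * c k"
    and lam: "\<And>k. 0 < lam k"
    and K: "\<And>t. 0 \<le> K t" "continuous_on UNIV K" "\<exists>t. K t \<noteq> 0" "\<And>t. K (- t) = K t"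
    and K_decreasing: "\<exists>T. antimono_on {T..} K" "(K \<longlongrightarrow> 0) at_top"
    and K_cm: "completely_monotone K"
    and M: "prob_space M"
    and F: "iid_gaussian_noise M K F"
  shows "(\<exists>u. stationary_solution M \<O> K \<alpha> lam e u)
           \<longleftrightarrow> summable (\<lambda>k. (lam k)\<^sup>2 / \<alpha> k)"
  proof -
  let ?b = "\<lambda>k x. complex_of_real (e k x)" and ?Q = "lebesgue_on \<O>" and ?v = "\<lambda>k. (lam k)\<^sup>2 / \<alpha> k"
  interpret M: prob_space M by (rule M)
  interpret K: convex_kernel K "vderiv K" "vderiv (vderiv K)"
    by (rule convex_kernel_of_completely_monotone) (use K K_decreasing(2) K_cm in auto)
  interpret Q: orthonormal_system ?Q ?b by (rule orthonormal_system_lebesgue_on[OF domain(1,4) basis])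
  have \<alpha>: "0 < \<alpha> k" for k using alpha(1) incseqD[OF alpha(2), of 0 k] by simp
  have K0: "0 < K 0"
  proof -
    obtain t where "K t \<noteq> 0" using K(3) by blast
    then show ?thesis using K(1)[of t] K.K_le[of t] by simp
  qed
  show ?thesis
  proof
    assume "\<exists>u. stationary_solution M \<O> K \<alpha> lam e u"
    then obtain u \<nu> V where ws: "\<And>k. weak_stationary_solution M K (\<alpha> k) (lam k) (\<nu> k) (V k)"
      and d: "\<And>k t. dirac t \<in> op_dom (\<nu> k)"
      and ae: "\<And>t. AE w in M. u t w \<in> L2 \<O> \<and>
           (\<lambda>n. L2_norm \<O> (\<lambda>x. u t w x - (\<Sum>k<n. V k (dirac t) w * complex_of_real (e k x)))) \<longlonglongrightarrow> 0"
      and um: "\<And>t. (\<lambda>(w, x). u t w x) \<in> borel_measurable (M \<Otimes>\<^sub>M ?Q)"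
      and fin: "\<And>t. (\<integral>\<^sup>+w. \<integral>\<^sup>+x. ennreal ((cmod (u t w x))\<^sup>2) \<partial>?Q \<partial>M) < \<infinity>"
      unfolding stationary_solution_def by blast
    show "summable ?v"
    \<comment> \<open>The single time 0 suffices, since the variance of each mode is the same at all
      times.\<close>
    proof (rule Q.summable_coefficients[OF M _ _ um[of 0] fin[of 0], where X = "\<lambda>k. V k (dirac 0)"])
      show "has_bochner_integral M (\<lambda>w. (cmod (V k (dirac 0) w))\<^sup>2) (?v k)" for k by (rule K.dirac_variance[OF \<alpha> lam ws d])
      show "V k (dirac 0) \<in> borel_measurable M" for k
        using ws[of k] d[of 0 k] unfolding weak_stationary_solution_def associated_operator_def by blast
      show "AE w in M. (\<lambda>n. \<integral>\<^sup>+x. ennreal ((cmod (u 0 w x - (\<Sum>k<n. V k (dirac 0) w * ?b k x)))\<^sup>2) \<partial>?Q) \<longlonglongrightarrow> 0"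
        using ae[of 0]
      proof eventually_elim
        case (elim w)
        let ?S = "\<lambda>n x. \<Sum>k<n. V k (dirac 0) w * ?b k x"
        let ?g = "\<lambda>n. \<integral>\<^sup>+x. ennreal ((cmod (u 0 w x - ?S n x))\<^sup>2) \<partial>?Q"
        have [measurable]: "u 0 w \<in> borel_measurable ?Q" and fu: "(\<integral>\<^sup>+x. ennreal ((cmod (u 0 w x))\<^sup>2) \<partial>?Q) < \<infinity>"
          using elim by (auto simp: L2_iff)
        have [measurable]: "?S n \<in> borel_measurable ?Q" for n by measurable
        \<comment> \<open>Finiteness has to be established because \<open>L2_norm\<close> reads an
          infinite integral as zero, so it determines \<open>?g n\<close> only when that is
          finite.\<close>
        have "?g n < top" for n
        proof -
          have "?g n \<le> 2 * (\<integral>\<^sup>+x. ennreal ((cmod (u 0 w x))\<^sup>2) \<partial>?Q) + 2 * (\<integral>\<^sup>+x. ennreal ((cmod (- ?S n x))\<^sup>2) \<partial>?Q)"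
            using nn_integral_cmod_add_sq_le[of "u 0 w" ?Q "\<lambda>x. - ?S n x"] by simp
          also have "\<dots> < top" using fu by (simp only: norm_minus_cancel Q.pythagoras finite_lessThan) (simp add: ennreal_mult_less_top)
          finally show ?thesis .
        qed
        then have g: "?g n = ennreal ((L2_norm \<O> (\<lambda>x. u 0 w x - ?S n x))\<^sup>2)" for n
          by (subst L2_norm_eq) (simp_all del: ennreal_power)
        have "(\<lambda>n. ennreal ((L2_norm \<O> (\<lambda>x. u 0 w x - ?S n x))\<^sup>2)) \<longlonglongrightarrow> ennreal (0\<^sup>2)"
          using elim by (intro tendsto_ennrealI tendsto_power) simp
        then show ?case unfolding g by simp
      qed
    qed
  next
    assume s: "summable ?v"
    obtain \<xi> where \<xi>: "iid_normals M \<xi>" by (rule M.iid_normals_of_noise[OF F K0])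
    let ?\<nu> = "\<lambda>k. K.nuK (\<alpha> k) (lam k)"
    let ?a = "\<lambda>k f. symmetric_borel_measure.coef (?\<nu> k) (rep (?\<nu> k) f)"
    \<comment> \<open>Mode \<open>k\<close> is driven by row \<open>k\<close> of the doubly indexed
      array of normal variables.\<close>
    define V where "V k f w = phi (?a k f) (\<lambda>j. \<xi> (prod_encode (k, j)) w)" for k f w
    have ws: "weak_stationary_solution M K (\<alpha> k) (lam k) (?\<nu> k) (V k)" for k
      unfolding V_def[abs_def]
      by (rule K.weak_solution_exists[OF \<alpha> iid_normals_inj[OF \<xi>]]) (simp add: inj_def)
    have ind: "M.indep_vars (\<lambda>k. Pi\<^sub>M (op_dom (?\<nu> k)) (\<lambda>_. borel)) (\<lambda>k w. \<lambda>f\<in>op_dom (?\<nu> k). V k f w) UNIV"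
      unfolding V_def using iid_normals.indep[OF \<xi>] by (rule M.indep_vars_operators)
    have d: "dirac t \<in> op_dom (?\<nu> k)" for k t by (rule K.dirac_dom[OF \<alpha>])
    have Vm: "V k (dirac t) \<in> borel_measurable M" for k t
      using ws[of k] d[of t k] unfolding weak_stationary_solution_def associated_operator_def by blast
    have nn: "(\<integral>\<^sup>+w. ennreal ((cmod (V k (dirac t) w))\<^sup>2) \<partial>M) = ennreal (?v k)" for k t
      using K.dirac_variance[OF \<alpha> lam ws d, of k t] nn_integral_eq_integral[of M "\<lambda>w. (cmod (V k (dirac t) w))\<^sup>2"]
      by (auto simp: has_bochner_integral_iff)
    have v0: "0 \<le> ?v k" for k using \<alpha>[of k] by simp
    \<comment> \<open>Measurability and convergence are required for each \<open>t\<close>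
      separately, so a field is chosen for each time; the operators \<open>V k\<close> link the
      times.\<close>
    have "\<forall>t. \<exists>u. (\<lambda>(w, x). u w x) \<in> borel_measurable (M \<Otimes>\<^sub>M ?Q) \<and>
     (\<integral>\<^sup>+w. \<integral>\<^sup>+x. ennreal ((cmod (u w x))\<^sup>2) \<partial>?Q \<partial>M) < \<infinity> \<and>
     (AE w in M. (\<integral>\<^sup>+x. ennreal ((cmod (u w x))\<^sup>2) \<partial>?Q) < \<infinity> \<and>
        (\<lambda>n. \<integral>\<^sup>+x. ennreal ((cmod (u w x - (\<Sum>k<n. V k (dirac t) w * ?b k x)))\<^sup>2) \<partial>?Q) \<longlonglongrightarrow> 0)"
      by (intro allI Q.random_series[OF M Vm nn v0 s])
    then obtain u where um: "\<And>t. (\<lambda>(w, x). u t w x) \<in> borel_measurable (M \<Otimes>\<^sub>M ?Q)"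
      and fin: "\<And>t. (\<integral>\<^sup>+w. \<integral>\<^sup>+x. ennreal ((cmod (u t w x))\<^sup>2) \<partial>?Q \<partial>M) < \<infinity>"
      and ae: "\<And>t. AE w in M. (\<integral>\<^sup>+x. ennreal ((cmod (u t w x))\<^sup>2) \<partial>?Q) < \<infinity> \<and>
        (\<lambda>n. \<integral>\<^sup>+x. ennreal ((cmod (u t w x - (\<Sum>k<n. V k (dirac t) w * ?b k x)))\<^sup>2) \<partial>?Q) \<longlonglongrightarrow> 0"
      by (subst (asm) choice_iff) blast
    have "AE w in M. u t w \<in> L2 \<O> \<and> (\<lambda>n. L2_norm \<O> (\<lambda>x. u t w x - (\<Sum>k<n. V k (dirac t) w * ?b k x))) \<longlonglongrightarrow> 0" for t
      using ae[of t] AE_space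
    proof eventually_elim
      case (elim w)
      have um': "u t w \<in> borel_measurable ?Q" using measurable_compose[OF measurable_Pair1'[OF elim(2)] um[of t]] by simp
      have m: "(\<lambda>x. u t w x - (\<Sum>k<n. V k (dirac t) w * ?b k x)) \<in> borel_measurable ?Q" for n using um' by measurable
      have "(\<lambda>n. sqrt (enn2real (\<integral>\<^sup>+x. ennreal ((cmod (u t w x - (\<Sum>k<n. V k (dirac t) w * ?b k x)))\<^sup>2) \<partial>?Q))) \<longlonglongrightarrow> sqrt 0"
        using elim(1) by (intro tendsto_real_sqrt tendsto_enn2real) simp_all
      then show ?case using elim(1) um' by (simp add: L2_norm_eq[OF m] L2_iff)
    qed
    then have "stationary_solution M \<O> K \<alpha> lam e u"
      unfolding stationary_solution_def using ws ind d um fin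
      by (intro conjI exI[of _ ?\<nu>] exI[of _ V] allI)
    then show "\<exists>u. stationary_solution M \<O> K \<alpha> lam e u" by (rule exI[of _ u])
  qed
qed

end
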